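(* Let $\Omega\subset\mathbb R^n$ and $\phi$ satisfy (A1), (A2), (A3) of the context with constants $\rho>0$ and $0<\lambda\le\Lambda$. Let $u\in C(\overline\Omega)\cap W^{2,n}_{loc}(\Omega)$ be a solution to $$\Phi^{ij}u_{ij}=f\ \text{ in }\Omega,\qquad u=\varphi\ \text{ on }\partial\Omega ,$$ where $\varphi\in C^\alpha(\partial\Omega)$ for some $\alpha\in(0,1)$. Then there exist constants $\beta,C>0$ depending only on $\lambda,\Lambda,n,\alpha$ and $\rho$ such that $$|u(x)-u(y)|\le C|x-y|^\beta\Big(\|u\|_{L^\infty(\Omega)}+\|\varphi\|_{C^\alpha(\partial\Omega)}+\|f\|_{L^n(\Omega)}\Big)\quad\forall x,y\in\Omega .$$
   Context: $\Omega$ is a bounded convex domain; $B_r(z)$ is the ball of radius $r$ and center $z$, $B_r=B_r(0)$. $\Phi=(\Phi^{ij})=(\det D^2\phi)(D^2\phi)^{-1}$ is the cofactor matrix of $D^2\phi$; repeated indices are summed; $f\in L^n(\Omega)$. (A1) $\Omega\subset B_{1/\rho}$, and for each $y\in\partial\Omega$ there is a ball $B_\rho(z)\subset\Omega$ that is tangent to $\partial\Omega$ at $y$. (A2) $\phi\in C^{0,1}(\overline\Omega)\cap C^2(\Omega)$ is convex and $\lambda\le\det D^2\phi\le\Lambda$ in $\Omega$. (A3) For all $x,x_0\in\partial\Omega$: $\rho|x-x_0|^2\le\phi(x)-\phi(x_0)-\nabla\phi(x_0)\cdot(x-x_0)\le\rho^{-1}|x-x_0|^2$. For $x_0\in\partial\Omega$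 with inner unit normal $\nu$, $\nabla\phi(x_0)$ denotes the slope of the tangent plane at $x_0$: $\phi(x)\ge\phi(x_0)+\nabla\phi(x_0)\cdot(x-x_0)$ on $\overline\Omega$, and this fails if $\nabla\phi(x_0)$ is replaced by $\nabla\phi(x_0)+\varepsilon\nu$ for any $\varepsilon>0$ (the usual gradient if $\phi$ is differentiable up to the boundary). *)

theory Defs
  imports "HOL-Analysis.Analysis" "HOL-Probability.Essential_Supremum"
begin

definition pderiv_dir :: "'n \<Rightarrow> (real^'n \<Rightarrow> real) \<Rightarrow> real^'n::finite \<Rightarrow> real" where
  "pderiv_dir i f x = frechet_derivative f (at x) (axis i 1)"

definition iter_pderiv :: "'n list \<Rightarrow> (real^'n \<Rightarrow> real) \<Rightarrow> real^'n::finite \<Rightarrow> real" where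
  "iter_pderiv is f = foldr pderiv_dir is f"

text \<open>\<open>Ck_on k S f\<close> is meant for open \<open>S\<close>; the values of \<open>f\<close> outside \<open>S\<close> are then irrelevant.\<close>

primrec Ck_on :: "nat \<Rightarrow> (real^'n::finite) set \<Rightarrow> (real^'n \<Rightarrow> real) \<Rightarrow> bool" where
  "Ck_on 0 S f \<longleftrightarrow> continuous_on S f"
| "Ck_on (Suc k) S f \<longleftrightarrow>
     (\<forall>x\<in>S. f differentiable (at x)) \<and> (\<forall>i. Ck_on k S (pderiv_dir i f))"

definition hessian :: "(real^'n::finite \<Rightarrow> real) \<Rightarrow> real^'n \<Rightarrow> real^'n^'n" where
  "hessian f x = (\<chi> i j. iter_pderiv [i, j] f x)"

definition hessian_cofactor :: "(real^'n::finite \<Rightarrow> real) \<Rightarrow> real^'n \<Rightarrow> real^'n^'n" where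
  "hessian_cofactor f x = det (hessian f x) *\<^sub>R matrix_inv (hessian f x)"

definition test_function :: "(real^'n::finite) set \<Rightarrow> (real^'n \<Rightarrow> real) \<Rightarrow> bool" where
  "test_function \<Omega> \<psi> \<longleftrightarrow>
     (\<forall>k. Ck_on k UNIV \<psi>) \<and>
     compact (closure {x. \<psi> x \<noteq> 0}) \<and> closure {x. \<psi> x \<noteq> 0} \<subseteq> \<Omega>"

definition Lp_space :: "nat \<Rightarrow> (real^'n::finite) set \<Rightarrow> (real^'n \<Rightarrow> real) \<Rightarrow> bool" where
  "Lp_space p \<Omega> g \<longleftrightarrow>
     g \<in> borel_measurable (lebesgue_on \<Omega>) \<and> integrable (lebesgue_on \<Omega>) (\<lambda>x. \<bar>g x\<bar> ^ p)"

definition Lp_loc :: "nat \<Rightarrow> (real^'n::finite) set \<Rightarrow> (real^'n \<Rightarrow> real) \<Rightarrow> bool" where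
  "Lp_loc p \<Omega> g \<longleftrightarrow> (\<forall>K. compact K \<and> K \<subseteq> \<Omega> \<longrightarrow> Lp_space p K g)"

definition Lp_norm :: "nat \<Rightarrow> (real^'n::finite) set \<Rightarrow> (real^'n \<Rightarrow> real) \<Rightarrow> real" where
  "Lp_norm p \<Omega> g = root p (integral\<^sup>L (lebesgue_on \<Omega>) (\<lambda>x. \<bar>g x\<bar> ^ p))"

definition Linf_norm :: "(real^'n::finite) set \<Rightarrow> (real^'n \<Rightarrow> real) \<Rightarrow> real" where
  "Linf_norm \<Omega> g = real_of_ereal (esssup (lebesgue_on \<Omega>) (\<lambda>x. ereal \<bar>g x\<bar>))"

text \<open>A list of coordinate directions plays the role of a multi-index; its length is the order.\<close>

definition weak_deriv ::
  "(real^'n::finite) set \<Rightarrow> 'n list \<Rightarrow> (real^'n \<Rightarrow> real) \<Rightarrow> (real^'n \<Rightarrow> real) \<Rightarrow> bool" where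
  "weak_deriv \<Omega> is u v \<longleftrightarrow>
     Lp_loc 1 \<Omega> u \<and> Lp_loc 1 \<Omega> v \<and>
     (\<forall>\<psi>. test_function \<Omega> \<psi> \<longrightarrow>
        integral\<^sup>L (lebesgue_on \<Omega>) (\<lambda>x. u x * iter_pderiv is \<psi> x) =
        (-1) ^ length is * integral\<^sup>L (lebesgue_on \<Omega>) (\<lambda>x. v x * \<psi> x))"

definition sobolev_loc ::
  "nat \<Rightarrow> nat \<Rightarrow> (real^'n::finite) set \<Rightarrow> (real^'n \<Rightarrow> real) \<Rightarrow> bool" where
  "sobolev_loc k p \<Omega> u \<longleftrightarrow>
     (\<forall>is. length is \<le> k \<longrightarrow> (\<exists>v. weak_deriv \<Omega> is u v \<and> Lp_loc p \<Omega> v))"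

definition holder_on :: "real \<Rightarrow> (real^'n::finite) set \<Rightarrow> (real^'n \<Rightarrow> real) \<Rightarrow> bool" where
  "holder_on \<alpha> S g \<longleftrightarrow>
     bounded (g ` S) \<and> (\<exists>M. \<forall>x\<in>S. \<forall>y\<in>S. \<bar>g x - g y\<bar> \<le> M * dist x y powr \<alpha>)"

definition holder_norm :: "real \<Rightarrow> (real^'n::finite) set \<Rightarrow> (real^'n \<Rightarrow> real) \<Rightarrow> real" where
  "holder_norm \<alpha> S g =
     (SUP x\<in>S. \<bar>g x\<bar>) +
     (SUP (x, y)\<in>{(x, y). x \<in> S \<and> y \<in> S \<and> x \<noteq> y}. \<bar>g x - g y\<bar> / dist x y powr \<alpha>)"

text \<open>The inner unit normal of a convex set at a boundary point, through its supporting
  hyperplane. It is unique wherever an interior ball touches the boundary.\<close>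

definition inner_unit_normal :: "(real^'n::finite) set \<Rightarrow> real^'n \<Rightarrow> real^'n \<Rightarrow> bool" where
  "inner_unit_normal \<Omega> x0 \<nu> \<longleftrightarrow> norm \<nu> = 1 \<and> (\<forall>x\<in>\<Omega>. 0 \<le> \<nu> \<bullet> (x - x0))"

definition supporting_slope ::
  "(real^'n::finite) set \<Rightarrow> (real^'n \<Rightarrow> real) \<Rightarrow> real^'n \<Rightarrow> real^'n \<Rightarrow> bool" where
  "supporting_slope \<Omega> \<phi> x0 p \<longleftrightarrow> (\<forall>x\<in>closure \<Omega>. \<phi> x0 + p \<bullet> (x - x0) \<le> \<phi> x)"

definition boundary_gradient ::
  "(real^'n::finite) set \<Rightarrow> (real^'n \<Rightarrow> real) \<Rightarrow> real^'n \<Rightarrow> real^'n \<Rightarrow> bool" where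
  "boundary_gradient \<Omega> \<phi> x0 p \<longleftrightarrow>
     supporting_slope \<Omega> \<phi> x0 p \<and>
     (\<forall>\<nu> \<epsilon>. inner_unit_normal \<Omega> x0 \<nu> \<and> 0 < \<epsilon> \<longrightarrow>
        \<not> supporting_slope \<Omega> \<phi> x0 (p + \<epsilon> *\<^sub>R \<nu>))"

definition bounded_convex_domain :: "(real^'n::finite) set \<Rightarrow> bool" where
  "bounded_convex_domain \<Omega> \<longleftrightarrow> open \<Omega> \<and> convex \<Omega> \<and> bounded \<Omega> \<and> \<Omega> \<noteq> {}"

definition domain_condition :: "real \<Rightarrow> (real^'n::finite) set \<Rightarrow> bool" where
  "domain_condition \<rho> \<Omega> \<longleftrightarrow>
     \<Omega> \<subseteq> ball 0 (1 / \<rho>) \<and>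
     (\<forall>y\<in>frontier \<Omega>. \<exists>z. ball z \<rho> \<subseteq> \<Omega> \<and> y \<in> sphere z \<rho>)"

definition potential_condition ::
  "real \<Rightarrow> real \<Rightarrow> (real^'n::finite) set \<Rightarrow> (real^'n \<Rightarrow> real) \<Rightarrow> bool" where
  "potential_condition l L \<Omega> \<phi> \<longleftrightarrow>
     (\<exists>M. M-lipschitz_on (closure \<Omega>) \<phi>) \<and> Ck_on 2 \<Omega> \<phi> \<and> convex_on (closure \<Omega>) \<phi> \<and>
     (\<forall>x\<in>\<Omega>. l \<le> det (hessian \<phi> x) \<and> det (hessian \<phi> x) \<le> L)"

text \<open>The boundary gradient enters as a relation. For a Lipschitz convex function on a domain with
  interior touching balls some boundary gradient always exists, and the two-sided bound below makes
  it unique, so the existential quantifier may equivalently be read as a universal one.\<close>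

definition quadratic_separation ::
  "real \<Rightarrow> (real^'n::finite) set \<Rightarrow> (real^'n \<Rightarrow> real) \<Rightarrow> bool" where
  "quadratic_separation \<rho> \<Omega> \<phi> \<longleftrightarrow>
     (\<forall>x0\<in>frontier \<Omega>. \<exists>p. boundary_gradient \<Omega> \<phi> x0 p \<and>
        (\<forall>x\<in>frontier \<Omega>.
           \<rho> * (norm (x - x0))\<^sup>2 \<le> \<phi> x - \<phi> x0 - p \<bullet> (x - x0) \<and>
           \<phi> x - \<phi> x0 - p \<bullet> (x - x0) \<le> inverse \<rho> * (norm (x - x0))\<^sup>2))"

text \<open>Strong solutions: the equation holds almost everywhere, with \<open>H\<close> the matrix of weak second
  derivatives of \<open>u\<close> (unique up to null sets).\<close>

definition lma_solution ::
  "(real^'n::finite) set \<Rightarrow> (real^'n \<Rightarrow> real) \<Rightarrow> (real^'n \<Rightarrow> real) \<Rightarrow> (real^'n \<Rightarrow> real) \<Rightarrow> bool" where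
  "lma_solution \<Omega> \<phi> f u \<longleftrightarrow>
     (\<exists>H :: real^'n \<Rightarrow> real^'n^'n.
        (\<forall>i j. weak_deriv \<Omega> [i, j] u (\<lambda>x. H x $ i $ j)) \<and>
        (AE x in lebesgue_on \<Omega>.
           (\<Sum>i\<in>UNIV. \<Sum>j\<in>UNIV. hessian_cofactor \<phi> x $ i $ j * H x $ i $ j) = f x))"

end

(* As in the theory of Caffarelli and Gutierrez, sections of the potential play the role of balls.
   Touching a power of a nonnegative supersolution from below by tangent planes of the potential, the
   area formula gives a critical density estimate; a Vitali covering turns it into decay of the
   oscillation on sections, first for C^2 functions and then, by mollification, for strong solutions.
   At the boundary, the potential minus its tangent plane and a quadratic polynomial is a supersolution
   that controls the solution up to an Aleksandrov-Bakelman-Pucci term. The same barriers show that at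
   a point at distance d from the boundary the section of height c d^(2n+4) is compactly contained in
   the domain. Interior and boundary estimates then combine, because all losses are powers of d. *)

theory Submission
  imports Defs "HOL-Probability.Probability"
begin

text \<open>The Jacobian of the touching map contains the contribution \<open>n det D^2 phi\<close>
  of the potential itself, which the source term does not control. Inside the section whose low set
  is to be measured this is harmless. At contact points farther out it has to be absorbed by the
  second derivative of the power of \<open>u\<close>, through a Cauchy-Schwarz inequality in the
  radial direction. That works only where the radial second derivative of \<open>phi\<close> is
  moderate, and no pointwise bound for it is at hand. But the set where it exceeds
  \<open>k*r\<close> has measure \<open>O(1/k)\<close> relative to the section, since a radial
  stretching built from the gradient is injective with bounded image. A power with exponent
  \<open>-1/m\<close>, whose convexity relative to its slope grows with \<open>m\<close>, admits
  large \<open>k\<close>. Sections are never normalized by affine maps; a simplex of maximal volume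
  supplies coordinates instead. One volume count serves twice: near a supporting plane the
  admissible slopes extend far in the normal direction, and this gives both Aleksandrov's estimate
  for sections and the maximum principle at the boundary.\<close>

abbreviation vol :: "'a::euclidean_space set => real" where
 "vol == measure lebesgue"

section \<open>Positive semidefinite matrices and their cofactors\<close>

lemma prod_le_mean_power:
 fixes x :: "'i => real"
 assumes "finite I" "I ~= {}" "!!i. i \<in> I ==> 0 <= x i"
 shows "(\<Prod>i\<in>I. x i) <= ((\<Sum>i\<in>I. x i)/card I) ^ card I"
proof -
 have c: "0 < card I" using assms by (simp add: card_gt_0_iff)
 have "((\<Prod>i\<in>I. x i) powr (1/card I)) ^ card I <= ((\<Sum>i\<in>I. x i)/card I) ^ card I"
  using arith_geom_mean[OF assms] by (intro power_mono) (auto simp: sum_divide_distrib)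
 also have "((\<Prod>i\<in>I. x i) powr (1/card I)) ^ card I = (\<Prod>i\<in>I. x i)"
  using c assms(3) by (cases "(\<Prod>i\<in>I. x i) = 0") (auto simp: powr_power prod_nonneg)
 finally show ?thesis .
qed

definition psd :: "real^'n^'n::finite => bool" where
 "psd A \<longleftrightarrow> transpose A = A & (ALL x. 0 <= x \<bullet> (A *v x))"

text \<open>This is the Frobenius pairing, so \<open>mdot (cofac (A x)) (H x)\<close> is the
  linearized Monge-Ampere operator applied to a function with Hessian \<open>H\<close>.\<close>

definition mdot :: "real^'n^'n::finite => real^'n^'n => real" where
 "mdot A B = (\<Sum>i\<in>UNIV. \<Sum>j\<in>UNIV. A $ i $ j*B $ i $ j)"

definition cofac :: "real^'n^'n::finite => real^'n^'n" where
 "cofac A = det A *\<^sub>R matrix_inv A"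

definition outer :: "real^'n => real^'n::finite => real^'n^'n" where
 "outer p q = (\<chi> i j. p $ i*q $ j)"

lemma mdot_trace: "mdot A B = trace (transpose A ** B)" unfolding mdot_def trace_def matrix_matrix_mult_def transpose_def by (subst sum.swap) simp

lemma mdot_add: "mdot A (B + C) = mdot A B + mdot A C" by (simp add: mdot_def algebra_simps sum.distrib)

lemma mdot_diff: "mdot A (B - C) = mdot A B - mdot A C" by (simp add: mdot_def algebra_simps sum_subtractf)

lemma mdot_scale: "mdot A (c *\<^sub>R B) = c*mdot A B" by (simp add: mdot_def algebra_simps sum_distrib_left)

lemma mdot_outer: "mdot A (outer p q) = p \<bullet> (A *v q)"
 by (simp add: mdot_def outer_def inner_vec_def matrix_vector_mult_def sum_distrib_left algebra_simps)

lemma outer_mult_vec: "outer p q *v x = (q \<bullet> x) *\<^sub>R p"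
 by (simp add: vec_eq_iff outer_def matrix_vector_mult_def inner_vec_def sum_distrib_left algebra_simps)

lemma transpose_outer: "transpose (outer p q) = outer q p" by (simp add: vec_eq_iff transpose_def outer_def mult.commute)

lemma transpose_add: "transpose (A + B) = transpose A + transpose (B :: real^'n^'m)" by (simp add: vec_eq_iff transpose_def)

lemma transpose_diff: "transpose (A - B) = transpose A - transpose (B :: real^'n^'m)" by (simp add: vec_eq_iff transpose_def)

lemma transpose_scale: "transpose (c *\<^sub>R A) = c *\<^sub>R transpose (A :: real^'n^'m)" by (simp add: vec_eq_iff transpose_def)

lemma matrix_vector_scaleR: "(c *\<^sub>R A) *v x = c *\<^sub>R (A *v (x :: real^'n))" for A :: "real^'n^'m"
 by (simp add: vec_eq_iff matrix_vector_mult_def sum_distrib_left algebra_simps)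

lemma inner_transpose: "x \<bullet> (A *v y) = (transpose A *v x) \<bullet> (y :: real^'n)" for A :: "real^'n^'m"
 by (simp add: dot_lmul_matrix[symmetric])

lemma det_scaleR: "det (c *\<^sub>R (A :: real^'n^'n)) = c^CARD('n)*det A"
proof -
 have "c *\<^sub>R A = (\<chi> i. c *s A $ i)" by (simp add: vec_eq_iff)
 thus ?thesis using det_rows_mul[of "%_. c" "%i. A $ i"] by simp
qed

text \<open>The quadratic form attains its maximum on the unit sphere of the invariant subspace, and
  the first-order condition there is the eigenvector equation.\<close>

lemma self_adjoint_eigenvector:
 fixes f :: "'a::euclidean_space => 'a"
 assumes lin: "linear f" and sa: "!!x y. f x \<bullet> y = x \<bullet> f y"
  and S: "subspace S" and inv: "f ` S \<subseteq> S" and ne: "S ~= {0}"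
 obtains x c where "x \<in> S" "norm x = 1" "f x = c *\<^sub>R x"
proof -
 let ?K = "S \<inter> sphere 0 1"
 obtain z where z: "z \<in> S" "z ~= 0" using ne S subspace_0 by blast
 have "(1/norm z) *\<^sub>R z \<in> ?K" using z S by (simp add: subspace_scale)
 hence Kne: "?K ~= {}" by blast
 have comp: "compact ?K" using closed_subspace[OF S] by (simp add: closed_Int_compact)
 have cont: "continuous_on ?K (%x. x \<bullet> f x)"
  using lin by (intro continuous_on_inner continuous_on_id linear_continuous_on) (simp add: linear_linear)
 obtain x where x: "x \<in> ?K" and xmax: "!!y. y \<in> ?K ==> y \<bullet> f y <= x \<bullet> f x"
  using continuous_attains_sup[OF comp Kne cont] by blast
 define c where "c = x \<bullet> f x"
 have quad: "y \<bullet> f y <= c*(norm y)^2" if "y \<in> S" for y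
 proof (cases "y = 0")
  case True thus ?thesis using lin by (simp add: linear_0)
 next
  case False
  hence "(1/norm y) *\<^sub>R y \<in> ?K" using that S by (simp add: subspace_scale)
  from xmax[OF this] have "(y \<bullet> f y)/(norm y)^2 <= c" using lin by (simp add: linear_scale c_def power2_eq_square)
  thus ?thesis using False by (simp add: field_simps)
 qed
 have orth: "y \<bullet> (f x - c *\<^sub>R x) = 0" if y: "y \<in> S" for y
 proof -
  define b where "b = y \<bullet> (f x - c *\<^sub>R x)"
  define a where "a = y \<bullet> f y - c*(norm y)^2"
  have x1: "x \<bullet> x = 1" using x by (simp add: dot_square_norm)
  have key: "2*t*b + t^2*a <= 0" for t :: real
  proof -
   have "x + t *\<^sub>R y \<in> S" using x y S by (simp add: subspace_add subspace_scale)
   from quad[OF this] have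
    "(x + t *\<^sub>R y) \<bullet> (f x + t *\<^sub>R f y) <= c*((x + t *\<^sub>R y) \<bullet> (x + t *\<^sub>R y))"
    using lin by (simp add: linear_add linear_scale dot_square_norm)
   moreover have "x \<bullet> f y = y \<bullet> f x" using sa[of x y] by (simp add: inner_commute)
   ultimately show ?thesis using x1 by (simp add: inner_add_left inner_add_right a_def b_def c_def inner_diff_right
      power2_norm_eq_inner inner_commute)
     (simp add: power2_eq_square algebra_simps)
  qed
  show ?thesis
  proof (rule ccontr)
   assume "~ ?thesis"
   hence b0: "b ~= 0" by (simp add: b_def)
   \<comment> \<open>The sign of \<open>t\<close> is that of \<open>b\<close>, and the denominator
     makes the linear term \<open>2*t*b\<close> outweigh \<open>t^2*a\<close>, so \<open>key\<close>
     fails unless \<open>b = 0\<close>.\<close>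
   define t where "t = b/(\<bar>a\<bar> + 1)"
   have p: "0 < \<bar>a\<bar> + 1" by simp
   have alg: "2*(b/k)*b + (b/k)^2*a = b^2*(2*k + a)/k^2" if "0 < k" for k :: real using that by (simp add: field_simps power2_eq_square)
   have "2*t*b + t^2*a = b^2*(2*(\<bar>a\<bar> + 1) + a)/(\<bar>a\<bar> + 1)^2" unfolding t_def by (rule alg[OF p])
   also have "... > 0"
   proof -
    have "0 < 2*(\<bar>a\<bar> + 1) + a" by (cases "0 <= a") auto
    thus ?thesis using b0 p by (intro divide_pos_pos mult_pos_pos) auto
   qed
   finally show False using key[of t] by simp
  qed
 qed
 have "f x - c *\<^sub>R x \<in> S" using x inv S by (auto intro!: subspace_diff subspace_scale)
 from orth[OF this] have "f x = c *\<^sub>R x" by simp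
 thus thesis using that x by auto
qed

text \<open>Induction on the dimension: an eigenvector is split off, and self-adjointness keeps its
  orthogonal complement in \<open>S\<close> invariant.\<close>

lemma self_adjoint_eigenbasis:
 fixes f :: "'a::euclidean_space => 'a"
 assumes lin: "linear f" and sa: "!!x y. f x \<bullet> y = x \<bullet> f y"
  and S: "subspace S" and inv: "f ` S \<subseteq> S"
 shows "EX B. B \<subseteq> S & pairwise orthogonal B & (ALL b:B. norm b = 1 & (EX c. f b = c *\<^sub>R b))
   & finite B & card B = dim S" using S inv
proof (induction "dim S" arbitrary: S rule: less_induct)
 case less
 show ?case
 proof (cases "S = {0}")
  case True
  thus ?thesis by (intro exI[of _ "{}"]) auto
 next
  case False
  obtain x c where x: "x \<in> S" "norm x = 1" "f x = c *\<^sub>R x" using self_adjoint_eigenvector[OF lin sa less.prems False] by blast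
  define T where "T = {y \<in> S. x \<bullet> y = 0}"
  have T: "subspace T" using less.prems(1) unfolding T_def subspace_def by (auto simp: inner_add_right)
  have "x \<notin> T" using x by (auto simp: T_def dot_square_norm)
  have dimS: "dim S = Suc (dim T)"
  proof -
   have "S = {a + b |a b. a \<in> span {x} & b \<in> T}"
   proof (intro set_eqI iffI)
    fix y assume "y \<in> S"
    have "y - (x \<bullet> y) *\<^sub>R x \<in> T" using \<open>y \<in> S\<close> x less.prems(1)
     by (auto simp: T_def subspace_diff subspace_scale inner_diff_right dot_square_norm)
    moreover have "(x \<bullet> y) *\<^sub>R x \<in> span {x}" by (simp add: span_base span_scale)
    moreover have "y = (x \<bullet> y) *\<^sub>R x + (y - (x \<bullet> y) *\<^sub>R x)" by simp
    ultimately show "y \<in> {a + b |a b. a \<in> span {x} & b \<in> T}" by blast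
   next
    fix y assume "y \<in> {a + b |a b. a \<in> span {x} & b \<in> T}"
    then obtain a b where ab: "y = a + b" "a \<in> span {x}" "b \<in> T" by blast
    have "a \<in> S" using ab(2) x(1) less.prems(1) span_minimal[of "{x}" S] by auto
    thus "y \<in> S" using ab less.prems(1) by (auto simp: T_def subspace_add)
   qed
   hence "dim S = dim {a + b |a b. a \<in> span {x} & b \<in> T}" by simp
   also have "... = dim (span {x}) + dim T"
   proof -
    have int: "span {x} \<inter> T = {0}"
    proof (intro equalityI subsetI)
     fix y assume "y \<in> span {x} \<inter> T"
     then obtain k where "y = k *\<^sub>R x" "x \<bullet> y = 0" by (auto simp: span_singleton T_def)
     thus "y \<in> {0}" using x(2) by (simp add: dot_square_norm)
    qed (use T in \<open>auto simp: subspace_0 span_zero\<close>)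
    have "dim {a + b |a b. a \<in> span {x} & b \<in> T} + dim (span {x} \<inter> T) = dim (span {x}) + dim T"
     using dim_sums_Int[OF subspace_span T, of "{x}"] by (simp add: conj_ac)
    thus ?thesis using int by simp
   qed
   also have "dim (span {x}) = 1" using x by (auto simp: dim_span)
   finally show ?thesis by simp
  qed
  have "f ` T \<subseteq> T"
  proof
   fix y assume "y \<in> f ` T"
   then obtain z where z: "y = f z" "z \<in> T" by blast
   have "x \<bullet> f z = f x \<bullet> z" by (simp add: sa)
   hence "x \<bullet> f z = 0" using z x by (simp add: T_def)
   thus "y \<in> T" using z less.prems(2) by (auto simp: T_def)
  qed
  from less.hyps[OF _ T this] dimS obtain B where B: "B \<subseteq> T" "pairwise orthogonal B"
   "ALL b:B. norm b = 1 & (EX c. f b = c *\<^sub>R b)" "finite B" "card B = dim T" by auto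
  have "x \<notin> B" using B(1) \<open>x \<notin> T\<close> by blast
  have "pairwise orthogonal (insert x B)" using B(1,2) by (auto simp: pairwise_insert orthogonal_def T_def inner_commute)
  thus ?thesis using B x dimS \<open>x \<notin> B\<close> by (intro exI[of _ "insert x B"]) (auto simp: T_def)
 qed
qed

lemma symmetric_matrix_diagonalizable:
 fixes A :: "real^'n^'n::finite"
 assumes sym: "transpose A = A"
 obtains Q :: "real^'n^'n" and d :: "'n => real" where "orthogonal_matrix Q" "transpose Q ** A ** Q = (\<chi> i j. if i = j then d i else 0)"
proof -
 have sa: "(A *v x) \<bullet> y = x \<bullet> (A *v y)" for x y by (simp add: inner_transpose sym)
 obtain B where B: "pairwise orthogonal B" "ALL b:B. norm b = 1 & (EX c. A *v b = c *\<^sub>R b)"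
   "finite B" "card B = CARD('n)" using self_adjoint_eigenbasis[of "(*v) A" UNIV, OF matrix_vector_mul_linear sa subspace_UNIV]
  unfolding dim_UNIV DIM_cart by auto
 obtain b where b: "bij_betw b (UNIV::'n set) B" using B finite_same_card_bij[of "UNIV :: 'n set" B] by auto
 have bB: "b i \<in> B" for i using b by (auto simp: bij_betw_def)
 have "ALL i. EX c. A *v b i = c *\<^sub>R b i" using B(2) bB by blast
 then obtain d where d: "!!i. A *v b i = d i *\<^sub>R b i" by metis
 have orth: "b i \<bullet> b j = (if i = j then 1 else 0)" for i j
 proof (cases "i = j")
  case True
  thus ?thesis using B(2) bB[of i] by (simp add: dot_square_norm)
 next
  case False
  hence "b i ~= b j" using b by (auto simp: bij_betw_def dest: injD)
  hence "orthogonal (b i) (b j)" using B(1) bB[of i] bB[of j] by (blast dest: pairwiseD)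
  thus ?thesis using False by (simp add: orthogonal_def)
 qed
 define Q :: "real^'n^'n" where "Q = (\<chi> i j. b j $ i)"
 have TQ: "(transpose Q ** N) $ i $ j = b i \<bullet> column j N" for N :: "real^'n^'n" and i j
  by (simp add: Q_def matrix_matrix_mult_def transpose_def inner_vec_def column_def)
 have cQ: "column j Q = b j" for j by (simp add: Q_def column_def vec_eq_iff)
 have cAQ: "column j (A ** Q) = d j *\<^sub>R b j" for j
 proof -
  have "column j (A ** Q) = A *v b j" by (simp add: Q_def vec_eq_iff column_def matrix_matrix_mult_def matrix_vector_mult_def)
  thus ?thesis by (simp add: d)
 qed
 have "orthogonal_matrix Q" unfolding orthogonal_matrix by (simp add: vec_eq_iff TQ cQ orth mat_def)
 moreover have "transpose Q ** A ** Q = (\<chi> i j. if i = j then d i else 0)" by (simp add: matrix_mul_assoc[symmetric] vec_eq_iff TQ cAQ orth)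
 ultimately show thesis using that by blast
qed

lemma psd_congruence: "psd A ==> psd (transpose R ** A ** R)" for A R :: "real^'n^'n::finite" unfolding psd_def
proof (intro conjI allI)
 assume A: "transpose A = A & (ALL x. 0 <= x \<bullet> (A *v x))"
 show "transpose (transpose R ** A ** R) = transpose R ** A ** R" using A by (simp add: matrix_transpose_mul matrix_mul_assoc)
 fix x
 have "x \<bullet> ((transpose R ** A ** R) *v x) = (R *v x) \<bullet> (A *v (R *v x))"
  by (simp only: matrix_vector_mul_assoc[symmetric] inner_transpose transpose_transpose)
 thus "0 <= x \<bullet> ((transpose R ** A ** R) *v x)" using A by simp
qed

lemma psd_diag_entry: "psd A ==> 0 <= A $ i $ i" for A :: "real^'n^'n::finite"
proof -
 assume "psd A"
 hence "0 <= axis i 1 \<bullet> (A *v axis i 1)" by (simp add: psd_def)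
 also have "axis i 1 \<bullet> (A *v axis i 1) = A $ i $ i" by (simp add: inner_axis' matrix_vector_mult_basis column_def)
 finally show ?thesis .
qed

lemma det_diag: "det ((\<chi> i j. if i = j then d i else 0) :: real^'n^'n::finite) = (\<Prod>i\<in>UNIV. d i)" by (subst det_diagonal) auto

text \<open>After diagonalization, determinant and trace are product and sum of nonnegative
  eigenvalues, so the third claim is the arithmetic-geometric mean inequality.\<close>

lemma psd_det_trace:
 fixes A :: "real^'n^'n::finite"
 assumes "psd A"
 shows "0 <= det A" "0 <= trace A" "det A <= (trace A/CARD('n))^CARD('n)"
proof -
 obtain Q d where Q: "orthogonal_matrix Q"
  and D: "transpose Q ** A ** Q = (\<chi> i j. if i = j then d i else 0)" using symmetric_matrix_diagonalizable[of A] assms unfolding psd_def by blast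
 have QQ: "Q ** transpose Q = mat 1" using Q by (simp add: orthogonal_matrix_def)
 have "psd (transpose Q ** A ** Q)" using assms by (rule psd_congruence)
 hence "0 <= (transpose Q ** A ** Q) $ i $ i" for i by (rule psd_diag_entry)
 hence dnn: "0 <= d i" for i by (simp add: D)
 have dQ: "det Q*det Q = 1" using det_orthogonal_matrix[OF Q] by auto
 have "det Q*det A*det Q = (\<Prod>i\<in>UNIV. d i)" using arg_cong[OF D, of det] by (simp add: det_mul det_diag)
 moreover have "det Q*det A*det Q = det A*(det Q*det Q)" by (simp only: ac_simps)
 ultimately have det: "det A = (\<Prod>i\<in>UNIV. d i)" by (simp only: dQ mult_1_right)
 have "trace (transpose Q ** A ** Q) = trace (Q ** transpose Q ** A)" using trace_mul_sym[of "transpose Q ** A" Q] by (simp only: matrix_mul_assoc)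
 hence tr: "trace A = (\<Sum>i\<in>UNIV. d i)" using arg_cong[OF D, of trace] QQ by (simp add: trace_def)
 show "0 <= det A" unfolding det by (simp add: dnn prod_nonneg)
 show "0 <= trace A" unfolding tr by (simp add: dnn sum_nonneg)
 show "det A <= (trace A/CARD('n))^CARD('n)" unfolding det tr using prod_le_mean_power[of UNIV d] dnn by simp
qed

text \<open>A square root \<open>A = R R^T\<close> turns the pairing into a trace:
  \<open>R^T B R\<close> is again positive semidefinite, with trace \<open>mdot A B\<close> and
  determinant \<open>det A * det B\<close>, and \<open>psd_det_trace\<close> applies to it.\<close>

lemma psd_mdot:
 fixes A B :: "real^'n^'n::finite"
 assumes A: "psd A" and B: "psd B"
 shows "0 <= mdot A B" "det A*det B <= (mdot A B/CARD('n))^CARD('n)"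
proof -
 obtain Q d where Q: "orthogonal_matrix Q"
  and D: "transpose Q ** A ** Q = (\<chi> i j. if i = j then d i else 0)" using symmetric_matrix_diagonalizable[of A] A unfolding psd_def by blast
 have QQ: "Q ** transpose Q = mat 1" using Q by (simp add: orthogonal_matrix_def)
 have "psd (transpose Q ** A ** Q)" using A by (rule psd_congruence)
 hence "0 <= (transpose Q ** A ** Q) $ i $ i" for i by (rule psd_diag_entry)
 hence dnn: "0 <= d i" for i by (simp add: D)
 define E :: "real^'n^'n" where "E = (\<chi> i j. if i = j then sqrt (d i) else 0)"
 have EE: "E ** E = transpose Q ** A ** Q" unfolding D by (auto simp: E_def vec_eq_iff matrix_matrix_mult_def dnn if_distrib[where f="%x. x*_"]
    cong: if_cong)
 have tE: "transpose E = E" by (auto simp: E_def transpose_def vec_eq_iff)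
 define R where "R = Q ** E"
 have RR: "R ** transpose R = A"
 proof -
  have "R ** transpose R = Q ** (E ** E) ** transpose Q" by (simp add: R_def matrix_transpose_mul tE matrix_mul_assoc)
  also have "... = (Q ** transpose Q) ** A ** (Q ** transpose Q)" unfolding EE by (simp add: matrix_mul_assoc)
  finally show ?thesis by (simp add: QQ)
 qed
 have P: "psd (transpose R ** B ** R)" using B by (rule psd_congruence)
 have t: "trace (transpose R ** B ** R) = mdot A B"
 proof -
  have "trace (transpose R ** B ** R) = trace (R ** (transpose R ** B))" by (rule trace_mul_sym)
  also have "... = trace (A ** B)" by (simp add: matrix_mul_assoc RR)
  finally show ?thesis using A by (simp add: mdot_trace psd_def)
 qed
 have d: "det (transpose R ** B ** R) = det A*det B" unfolding RR[symmetric] by (simp add: det_mul)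
 show "0 <= mdot A B" using psd_det_trace(2)[OF P] by (simp add: t)
 show "det A*det B <= (mdot A B/CARD('n))^CARD('n)" using psd_det_trace(3)[OF P] by (simp add: t d)
qed

text \<open>The form may be degenerate, hence the case distinction: if the form vanishes at
  \<open>y\<close>, the quadratic polynomial in \<open>t\<close> is affine and bounded below, so its
  slope is zero.\<close>

lemma psd_cauchy_schwarz:
 assumes A: "psd A"
 shows "(x \<bullet> (A *v y))^2 <= (x \<bullet> (A *v x))*(y \<bullet> (A *v y))"
proof -
 let ?a = "y \<bullet> (A *v y)" and ?b = "x \<bullet> (A *v y)" and ?c = "x \<bullet> (A *v x)"
 have sym: "y \<bullet> (A *v x) = ?b" using A inner_transpose[of y A x] inner_commute[of x "A *v y"] by (simp only: psd_def)
 have q: "0 <= ?c + 2*t*?b + t^2*?a" for t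
 proof -
  have "0 <= (x + t *\<^sub>R y) \<bullet> (A *v (x + t *\<^sub>R y))" using A by (simp add: psd_def)
  thus ?thesis using sym by (simp add: matrix_vector_right_distrib matrix_vector_mult_scaleR inner_add_left inner_add_right
    power2_eq_square algebra_simps)
 qed
 have a: "0 <= ?a" using A by (simp add: psd_def)
 show ?thesis
 proof (cases "?a = 0")
  case True
  have "?b = 0"
  proof (rule ccontr)
   assume "?b ~= 0"
   thus False using q[of "- (?c + 1)/(2*?b)"] True by (simp add: field_simps)
  qed
  thus ?thesis using True by simp
 next
  case False
  thus ?thesis using q[of "- ?b/?a"] a by (simp add: power2_eq_square field_simps)
 qed
qed

text \<open>The last inequality is Cauchy-Schwarz for the form of \<open>A\<close>, applied to
  \<open>e\<close> and \<open>A^-1 q\<close>. Through it a bound on the second derivative of the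
  potential in a single direction \<open>e\<close> bounds the quadratic form of the cofactor matrix
  from below.\<close>

lemma cofac_props:
 fixes A :: "real^'n^'n::finite"
 assumes A: "psd A" and d: "0 < det A"
 shows "psd (cofac A)" "mdot (cofac A) A = CARD('n)*det A"
  "det (cofac A) = det A^(CARD('n) - 1)"
  "(q \<bullet> e)^2*det A <= (q \<bullet> (cofac A *v q))*(e \<bullet> (A *v e))"
proof -
 have inv: "invertible A" using d by (simp add: invertible_det_nz)
 have AI: "A ** matrix_inv A = mat 1" "matrix_inv A ** A = mat 1" using someI_ex[OF inv[unfolded invertible_def]] by (simp_all add: matrix_inv_def)
 have sA: "transpose A = A" using A by (simp add: psd_def)
 have sI: "transpose (matrix_inv A) = matrix_inv A"
 proof -
  have "transpose (matrix_inv A) ** A = mat 1" using arg_cong[OF AI(1), of transpose] by (simp add: matrix_transpose_mul sA transpose_mat)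
  hence "transpose (matrix_inv A) ** (A ** matrix_inv A) = matrix_inv A" by (simp add: matrix_mul_assoc)
  thus ?thesis by (simp add: AI)
 qed
 have w: "A *v (matrix_inv A *v x) = x" for x by (simp add: matrix_vector_mul_assoc AI)
 have quad: "x \<bullet> (matrix_inv A *v x) = (matrix_inv A *v x) \<bullet> (A *v (matrix_inv A *v x))" for x by (simp add: w inner_commute)
 have nn: "0 <= x \<bullet> (matrix_inv A *v x)" for x unfolding quad using A by (simp add: psd_def)
 show "psd (cofac A)" using d nn by (simp add: psd_def cofac_def transpose_scale sI matrix_vector_scaleR)
 show "mdot (cofac A) A = CARD('n)*det A"
 proof -
  have "mdot (cofac A) A = trace (det A *\<^sub>R (matrix_inv A ** A))"
   by (simp add: mdot_trace cofac_def transpose_scale sI scalar_matrix_assoc[symmetric])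
  thus ?thesis by (simp add: AI trace_def mat_def)
 qed
 have "det (matrix_inv A)*det A = 1" using arg_cong[OF AI(2), of det] by (simp add: det_mul)
 hence "det (matrix_inv A) = 1/det A" using d by (simp add: field_simps)
 thus "det (cofac A) = det A^(CARD('n) - 1)" using d by (simp add: cofac_def det_scaleR power_eq_if[of _ "CARD('n)"])
 have "(q \<bullet> e)^2 = (e \<bullet> (A *v (matrix_inv A *v q)))^2" by (simp add: w inner_commute)
 also have "... <= (e \<bullet> (A *v e))*((matrix_inv A *v q) \<bullet> (A *v (matrix_inv A *v q)))" by (rule psd_cauchy_schwarz[OF A])
 also have "... = (e \<bullet> (A *v e))*(q \<bullet> (matrix_inv A *v q))" by (simp add: quad)
 finally have "(q \<bullet> e)^2 <= (e \<bullet> (A *v e))*(q \<bullet> (matrix_inv A *v q))" .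
 hence "(q \<bullet> e)^2*det A <= (e \<bullet> (A *v e))*(q \<bullet> (matrix_inv A *v q))*det A" using d by (intro mult_right_mono) auto
 thus "(q \<bullet> e)^2*det A <= (q \<bullet> (cofac A *v q))*(e \<bullet> (A *v e))" by (simp add: cofac_def matrix_vector_scaleR algebra_simps)
qed

text \<open>The form of the arithmetic-geometric mean inequality that turns a bound on the linearized
 operator into a bound on a Jacobian.\<close>

lemma det_le_mdot_cofac:
 fixes A M :: "real^'n^'n::finite"
 assumes A: "psd A" and d: "0 < det A" and M: "psd M"
 shows "det M <= det A*(mdot (cofac A) M/(CARD('n)*det A))^CARD('n)"
proof -
 have "det (cofac A)*det M <= (mdot (cofac A) M/CARD('n))^CARD('n)" by (rule psd_mdot(2)[OF cofac_props(1)[OF A d] M])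
 hence "det A^(CARD('n) - 1)*det M <= (mdot (cofac A) M/CARD('n))^CARD('n)" by (simp add: cofac_props(3)[OF A d])
 hence "det M <= (mdot (cofac A) M/CARD('n))^CARD('n)/det A^(CARD('n) - 1)" using d by (simp add: field_simps)
 also have "... = det A*(mdot (cofac A) M/(CARD('n)*det A))^CARD('n)"
  using d by (simp add: power_divide power_mult_distrib power_eq_if[of "det A" "CARD('n)"])
 finally show ?thesis .
qed

text \<open>Pairing the cofactor matrix of \<open>A\<close> with \<open>A - B\<close> gives
  \<open>mdot (cofac A) B <= n det A\<close>, and \<open>det_le_mdot_cofac\<close> converts this
  into the claim.\<close>

lemma psd_det_mono:
 fixes A B :: "real^'n^'n::finite"
 assumes A: "psd A" "0 < det A" and B: "psd B" and BA: "psd (A - B)"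
 shows "det B <= det A"
proof -
 have "0 <= mdot (cofac A) (A - B)" by (rule psd_mdot(1)[OF cofac_props(1)[OF A] BA])
 hence le: "mdot (cofac A) B <= CARD('n)*det A" by (simp add: mdot_diff cofac_props(2)[OF A])
 have nn: "0 <= mdot (cofac A) B" by (rule psd_mdot(1)[OF cofac_props(1)[OF A] B])
 have "det B <= det A*(mdot (cofac A) B/(CARD('n)*det A))^CARD('n)" by (rule det_le_mdot_cofac[OF A B])
 also have "... <= det A*1" using A(2) le nn by (intro mult_left_mono power_le_one) (auto simp: divide_le_eq)
 finally show ?thesis by simp
qed

lemma quad_id_outer:
 "x \<bullet> ((a *\<^sub>R mat 1 + b *\<^sub>R outer nu nu) *v x) = a*(x \<bullet> x) + b*(nu \<bullet> x)^2"
 by (simp add: matrix_vector_mult_add_rdistrib matrix_vector_scaleR outer_mult_vec inner_add_right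
   inner_commute[of x nu] power2_eq_square)

lemma psd_id_outer:
 assumes "0 <= a" "0 <= b"
 shows "psd (a *\<^sub>R mat 1 + b *\<^sub>R outer nu nu)" unfolding psd_def quad_id_outer using assms
 by (simp add: transpose_add transpose_scale transpose_outer transpose_mat)

section \<open>The area formula over arbitrary finite index types\<close>

text \<open>The change of variables theorems of the library are restricted to index types that are
 well-ordered. A copy of an arbitrary finite index type carrying such an order, with the induced
 permutation of coordinates, removes this restriction.\<close>

typedef ('a::finite) ranked = "{..<CARD('a::finite)}" by (rule exI[of _ 0]) simp

setup_lifting type_definition_ranked

instantiation ranked :: (finite) linorder
begin
lift_definition less_eq_ranked :: "'a ranked => 'a ranked => bool" is "(<=)" .
lift_definition less_ranked :: "'a ranked => 'a ranked => bool" is "(<)" .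
instance by standard (transfer; auto)+
end

instance ranked :: (finite) finite
proof
 show "finite (UNIV :: 'a ranked set)" using type_definition.Abs_image[OF type_definition_ranked] by (metis finite_imageI finite_lessThan)
qed

instance ranked :: (finite) wellorder
proof
 fix P :: "'a ranked => bool" and a
 assume step: "!!x. (!!y. y < x ==> P y) ==> P x"
 show "P a"
 proof (induction "Rep_ranked a" arbitrary: a rule: less_induct)
  case less
  show ?case
  proof (rule step)
   fix y assume "y < a"
   thus "P y" by (intro less) (simp add: less_ranked.rep_eq)
  qed
 qed
qed

lemma card_ranked: "CARD('a ranked) = CARD('a::finite)" using type_definition.card[OF type_definition_ranked] by simp

definition rank_idx :: "'a::finite ranked => 'a" where
 "rank_idx = (SOME f. bij f)"

lemma bij_rank_idx: "bij (rank_idx :: 'a::finite ranked => 'a)"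
proof -
 have "EX f :: 'a ranked => 'a. bij f" using finite_same_card_bij[of "UNIV :: 'a ranked set" "UNIV :: 'a set"] by (simp add: card_ranked)
 thus ?thesis unfolding rank_idx_def by (rule someI_ex)
qed

lemma rank_idx_inv: "rank_idx (inv rank_idx i) = i" "inv rank_idx (rank_idx j) = j"
 by (rule surj_f_inv_f[OF bij_is_surj[OF bij_rank_idx]]) (rule inv_f_f[OF bij_is_inj[OF bij_rank_idx]])

definition ranked_vec :: "real^'n::finite => real^'n ranked" where
 "ranked_vec x = (\<chi> i. x $ rank_idx i)"

definition unranked_vec :: "real^'n::finite ranked => real^'n" where
 "unranked_vec y = (\<chi> i. y $ inv rank_idx i)"

lemma ranked_unranked [simp]: "unranked_vec (ranked_vec x) = x" "ranked_vec (unranked_vec y) = y"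
 by (simp_all add: ranked_vec_def unranked_vec_def vec_eq_iff rank_idx_inv)

lemma linear_ranked: "linear ranked_vec" "linear unranked_vec" by (auto intro!: linearI simp: ranked_vec_def unranked_vec_def vec_eq_iff)

lemma bounded_linear_ranked: "bounded_linear ranked_vec" "bounded_linear unranked_vec" using linear_ranked by (simp_all add: linear_linear)

lemma ranked_image_eq: "ranked_vec ` S = unranked_vec -` S" by (auto intro: image_eqI[where x="unranked_vec _"])

text \<open>Boxes correspond to boxes with the same side lengths, and Lebesgue measure is determined
  by its values on boxes.\<close>

lemma distr_unranked: "distr lborel borel unranked_vec = (lborel :: (real^'n::finite) measure)"
proof (rule lborel_eqI[symmetric])
 fix l u :: "real^'n"
 assume le: "!!b. b \<in> Basis ==> l \<bullet> b <= u \<bullet> b"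
 have lei: "l $ i <= u $ i" for i using le[of "axis i 1"] by (simp add: inner_axis axis_in_Basis_iff)
 have "unranked_vec -` box l u = box (ranked_vec l) (ranked_vec u)"
 proof -
  have "(ALL i. l $ i < y $ inv rank_idx i & y $ inv rank_idx i < u $ i) \<longleftrightarrow>
    (ALL j. l $ rank_idx j < y $ j & y $ j < u $ rank_idx j)" for y :: "real^'n ranked" using bij_rank_idx by (metis bij_inv_eq_iff)
  thus ?thesis by (auto simp: mem_box_cart ranked_vec_def unranked_vec_def)
 qed
 hence "emeasure (distr lborel borel unranked_vec) (box l u) = emeasure lborel (box (ranked_vec l) (ranked_vec u))"
  by (subst emeasure_distr) (auto intro!: borel_measurable_continuous_onI linear_continuous_on bounded_linear_ranked)
 also have "... = (\<Prod>b\<in>Basis. (ranked_vec u - ranked_vec l) \<bullet> b)"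
  by (rule emeasure_lborel_box) (auto simp: Basis_vec_def inner_axis ranked_vec_def lei)
 also have "(\<Prod>b\<in>Basis. (ranked_vec u - ranked_vec l) \<bullet> b) = (\<Prod>j\<in>UNIV. u $ rank_idx j - l $ rank_idx j)"
 proof -
  have E: "(Basis :: (real^'n ranked) set) = range (%j. axis j 1)" by (auto simp: Basis_vec_def)
  show ?thesis unfolding E by (subst prod.reindex) (auto simp: inj_on_def axis_eq_axis inner_axis ranked_vec_def)
 qed
 also have "... = (\<Prod>i\<in>UNIV. u $ i - l $ i)" by (rule prod.reindex_bij_betw[OF bij_rank_idx, of "%i. u $ i - l $ i"])
 also have "... = (\<Prod>b\<in>Basis. (u - l) \<bullet> b)"
 proof -
  have E: "(Basis :: (real^'n) set) = range (%j. axis j 1)" by (auto simp: Basis_vec_def)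
  show ?thesis unfolding E by (subst prod.reindex) (auto simp: inj_on_def axis_eq_axis inner_axis)
 qed
 finally show "emeasure (distr lborel borel unranked_vec) (box l u) = (\<Prod>b\<in>Basis. (u - l) \<bullet> b)" .
qed simp

lemma ranked_lebesgue:
 fixes S :: "(real^'n::finite) set"
 assumes S: "S \<in> sets lebesgue"
 shows "ranked_vec ` S \<in> sets lebesgue" "emeasure lebesgue (ranked_vec ` S) = emeasure lebesgue S"
proof -
 have um: "unranked_vec \<in> borel_measurable (lborel :: (real^'n ranked) measure)"
  by (auto intro!: borel_measurable_continuous_onI linear_continuous_on bounded_linear_ranked)
 obtain B N N' where B: "S = B \<union> N" "N \<subseteq> N'" "N' \<in> null_sets lborel" "B \<in> sets lborel" using S by (rule sets_completionE)
 have bor: "ranked_vec ` A \<in> sets lborel" "emeasure lborel (ranked_vec ` A) = emeasure lborel A" if "A \<in> sets lborel" for A :: "(real^'n) set"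
 proof -
  show 1: "ranked_vec ` A \<in> sets lborel" unfolding ranked_image_eq using measurable_sets[OF um, of A] that by simp
  have "emeasure lborel A = emeasure (distr lborel borel unranked_vec) A" by (simp add: distr_unranked)
  also have "... = emeasure lborel (ranked_vec ` A)" using um that by (subst emeasure_distr) (auto simp: ranked_image_eq)
  finally show "emeasure lborel (ranked_vec ` A) = emeasure lborel A" by simp
 qed
 have N': "ranked_vec ` N' \<in> null_sets lborel" using B(3) bor[of N'] by (auto simp: null_sets_def)
 have eq: "ranked_vec ` S = ranked_vec ` B \<union> ranked_vec ` N" using B(1) by auto
 have "ranked_vec ` N \<subseteq> ranked_vec ` N'" using B(2) by blast
 thus m: "ranked_vec ` S \<in> sets lebesgue" unfolding eq using bor(1)[OF B(4)] N' by (intro sets_completionI) auto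
 have NS: "N \<in> null_sets lebesgue" by (rule null_sets_completion_subset[OF B(2) null_sets_completionI[OF B(3)]])
 have NR: "ranked_vec ` N \<in> null_sets lebesgue"
  by (rule null_sets_completion_subset[OF \<open>ranked_vec ` N \<subseteq> ranked_vec ` N'\<close> null_sets_completionI[OF N']])
 have BB: "B \<in> sets lebesgue" "ranked_vec ` B \<in> sets lebesgue" using B(4) bor(1)[OF B(4)] by auto
 have "emeasure lebesgue (ranked_vec ` S) = emeasure lebesgue (ranked_vec ` B)" unfolding eq using emeasure_Un_null_set[OF BB(2) NR] .
 also have "... = emeasure lebesgue B" using bor[OF B(4)] B(4) by (simp add: emeasure_completion)
 also have "... = emeasure lebesgue S" unfolding B(1) using emeasure_Un_null_set[OF BB(1) NS] by simp
 finally show "emeasure lebesgue (ranked_vec ` S) = emeasure lebesgue S" .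
qed

text \<open>The equivalence serves the transfer of the area formula, which yields measurability of
  the permuted image; that of the image itself has to be recovered from it.\<close>

lemma ranked_lmeasurable:
 fixes S :: "(real^'n::finite) set"
 shows "ranked_vec ` S \<in> lmeasurable \<longleftrightarrow> S \<in> lmeasurable"
  "S \<in> sets lebesgue ==> vol (ranked_vec ` S) = vol S"
proof -
 show "vol (ranked_vec ` S) = vol S" if "S \<in> sets lebesgue" using ranked_lebesgue[OF that] by (simp add: measure_def)
 have bck: "S \<in> sets lebesgue" if R: "ranked_vec ` S \<in> sets lebesgue"
 proof -
  obtain B N N' where B: "ranked_vec ` S = B \<union> N" "N \<subseteq> N'" "N' \<in> null_sets lborel" "B \<in> sets lborel"
   using R by (rule sets_completionE)
  have rm: "ranked_vec \<in> borel_measurable (lborel :: (real^'n) measure)"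
   by (auto intro!: borel_measurable_continuous_onI linear_continuous_on bounded_linear_ranked)
  have im: "unranked_vec ` A = ranked_vec -` A" for A :: "(real^'n ranked) set" by (auto intro: image_eqI[where x="ranked_vec _"])
  have bor: "unranked_vec ` A \<in> sets lborel" if "A \<in> sets lborel" for A :: "(real^'n ranked) set"
   unfolding im using measurable_sets[OF rm, of A] that by simp
  have "emeasure lborel (unranked_vec ` N') = emeasure (distr lborel borel unranked_vec) (unranked_vec ` N')" by (simp add: distr_unranked)
  also have "... = emeasure lborel (unranked_vec -` (unranked_vec ` N'))" using bor[of N'] B(3)
   by (subst emeasure_distr) (auto intro!: borel_measurable_continuous_onI linear_continuous_on bounded_linear_ranked)
  also have "unranked_vec -` (unranked_vec ` N') = N'" by (rule inj_vimage_image_eq, rule inj_on_inverseI[where g=ranked_vec]) simp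
  finally have nul: "unranked_vec ` N' \<in> null_sets lborel" using B(3) bor[of N'] by (auto simp: null_sets_def)
  have "S = unranked_vec ` (ranked_vec ` S)" by (simp add: image_image)
  also have "... = unranked_vec ` B \<union> unranked_vec ` N" unfolding B(1) by auto
  finally show ?thesis by (rule sets_completionI[OF _ image_mono[OF B(2)] nul bor[OF B(4)]])
 qed
 have em: "emeasure lebesgue (ranked_vec ` S) = emeasure lebesgue S" if "S \<in> sets lebesgue" by (rule ranked_lebesgue(2)[OF that])
 show "ranked_vec ` S \<in> lmeasurable \<longleftrightarrow> S \<in> lmeasurable"
 proof
  assume R: "ranked_vec ` S \<in> lmeasurable"
  hence S: "S \<in> sets lebesgue" by (intro bck fmeasurableD)
  show "S \<in> lmeasurable" using fmeasurableD2[OF R] unfolding em[OF S] by (intro fmeasurableI[OF S]) (simp add: top.not_eq_extremum)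
 next
  assume S: "S \<in> lmeasurable"
  show "ranked_vec ` S \<in> lmeasurable" using fmeasurableD2[OF S] unfolding em[OF fmeasurableD[OF S], symmetric]
   by (intro fmeasurableI ranked_lebesgue(1) fmeasurableD[OF S]) (simp add: top.not_eq_extremum)
 qed
qed

lemma det_reindex:
 fixes A :: "real^'a^'a::finite" and r :: "'b::finite => 'a"
 assumes r: "bij r"
 shows "det (\<chi> i j. A $ r i $ r j) = det A"
proof -
 have r': "inj r" "surj r" using r by (auto simp: bij_def)
 have bb: "bij_betw (%p. r \<circ> p \<circ> inv r) {p. p permutes UNIV} {p. p permutes UNIV}"
  using bij_betw_permutations[OF r] by (simp add: comp_def)
 have s: "sign (r \<circ> p \<circ> inv r) = sign p" if "p permutes UNIV" for p
  using sign_map_permutation[of r UNIV p] r' that by (simp add: map_permutation_def restrict_id_def comp_def)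
 have "det A = (\<Sum>p | p permutes UNIV. of_int (sign (r \<circ> p \<circ> inv r))*(\<Prod>i\<in>UNIV. A $ i $ ((r \<circ> p \<circ> inv r) i)))"
  unfolding det_def by (rule sum.reindex_bij_betw[OF bb, symmetric])
 also have "... = (\<Sum>p | p permutes UNIV. of_int (sign p)*(\<Prod>i\<in>UNIV. A $ r i $ r (p i)))"
  using prod.reindex_bij_betw[OF r, of "%i. A $ i $ (r \<circ> p \<circ> inv r) i" for p] r' by (intro sum.cong refl) (simp add: s)
 finally show ?thesis by (simp add: det_def)
qed

text \<open>Conjugation by the coordinate permutation reorders rows and columns simultaneously, so
  Jacobian determinants survive the transfer.\<close>

lemma det_matrix_ranked:
 fixes f :: "real^'n::finite => real^'n"
 shows "det (matrix (%h. ranked_vec (f (unranked_vec h)))) = det (matrix f)"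
proof -
 have ax: "unranked_vec (axis j 1) = axis (rank_idx j) 1" for j :: "'n ranked" by (auto simp: unranked_vec_def axis_def vec_eq_iff rank_idx_inv)
 have "matrix (%h. ranked_vec (f (unranked_vec h))) = (\<chi> i j. matrix f $ rank_idx i $ rank_idx j)"
  by (simp add: matrix_def ax) (simp add: ranked_vec_def vec_eq_iff)
 thus ?thesis by (simp add: det_reindex[OF bij_rank_idx])
qed

lemma integral_ranked:
 fixes f :: "real^'n::finite => real"
 assumes S: "S \<in> sets lebesgue" and f: "f absolutely_integrable_on S"
 shows "(%y. f (unranked_vec y)) absolutely_integrable_on (ranked_vec ` S)"
  "integral (ranked_vec ` S) (%y. f (unranked_vec y)) = integral S f"
proof -
 have dl: "distr lebesgue lebesgue unranked_vec = (lebesgue :: (real^'n) measure)"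
  and ml: "unranked_vec \<in> measurable lebesgue (lebesgue :: (real^'n) measure)"
 proof -
  show ml: "unranked_vec \<in> measurable lebesgue (lebesgue :: (real^'n) measure)"
   by (rule measurableI) (auto simp: ranked_image_eq[symmetric] ranked_lebesgue)
  show "distr lebesgue lebesgue unranked_vec = (lebesgue :: (real^'n) measure)"
  proof (rule measure_eqI)
   fix A assume "A \<in> sets (distr lebesgue lebesgue (unranked_vec :: _ => real^'n))"
   hence A: "A \<in> sets lebesgue" by simp
   have "emeasure (distr lebesgue lebesgue unranked_vec) A = emeasure lebesgue (unranked_vec -` A \<inter> space lebesgue)"
    by (rule emeasure_distr[OF ml A])
   also have "... = emeasure lebesgue (ranked_vec ` A)" by (simp only: ranked_image_eq space_completion space_lborel space_borel Int_UNIV_right)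
   also have "... = emeasure lebesgue A" by (rule ranked_lebesgue(2)[OF A])
   finally show "emeasure (distr lebesgue lebesgue unranked_vec) A = emeasure lebesgue A" .
  qed simp
 qed
 have ind: "indicat_real (ranked_vec ` S) y = indicat_real S (unranked_vec y)" for y by (auto simp: indicator_def ranked_image_eq)
 have i: "integrable lebesgue (%x. indicat_real S x *\<^sub>R f x)" using f by (simp add: set_integrable_def)
 have i': "integrable (distr lebesgue lebesgue unranked_vec) (%x. indicat_real S x *\<^sub>R f x)" unfolding dl by (rule i)
 show a: "(%y. f (unranked_vec y)) absolutely_integrable_on (ranked_vec ` S)" unfolding set_integrable_def ind by (rule integrable_distr[OF ml i'])
 have "integral (ranked_vec ` S) (%y. f (unranked_vec y)) = (LINT y|lebesgue. indicat_real S (unranked_vec y) *\<^sub>R f (unranked_vec y))"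
  using set_lebesgue_integral_eq_integral(2)[OF a] by (simp add: set_lebesgue_integral_def ind)
 also have "... = (LINT x|distr lebesgue lebesgue unranked_vec. indicat_real S x *\<^sub>R f x)"
  by (rule integral_distr[symmetric, OF ml]) (use i in \<open>auto dest: borel_measurable_integrable\<close>)
 also have "... = integral S f" unfolding dl using set_lebesgue_integral_eq_integral(2)[OF f] by (simp add: set_lebesgue_integral_def)
 finally show "integral (ranked_vec ` S) (%y. f (unranked_vec y)) = integral S f" .
qed

text \<open>Conjugation with \<open>ranked_vec\<close> changes neither measures nor integrals nor
  Jacobian determinants, so the area formula carries over from the ordered index type.\<close>

lemma differentiable_image_vec:
 fixes f :: "real^'n::finite => real^'n"
 assumes S: "S \<in> sets lebesgue"
  and df: "!!x. x \<in> S ==> (f has_derivative f' x) (at x within S)"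
  and int: "(%x. \<bar>det (matrix (f' x))\<bar>) absolutely_integrable_on S"
 shows "f ` S \<in> lmeasurable"
  "vol (f ` S) <= integral S (%x. \<bar>det (matrix (f' x))\<bar>)"
  "inj_on f S ==> vol (f ` S) = integral S (%x. \<bar>det (matrix (f' x))\<bar>)"
proof -
 define F where "F y = ranked_vec (f (unranked_vec y))" for y
 define F' where "F' y = (%h. ranked_vec (f' (unranked_vec y) (unranked_vec h)))" for y
 have dF: "(F has_derivative F' y) (at y within ranked_vec ` S)" if y: "y \<in> ranked_vec ` S" for y
 proof -
  have 1: "(unranked_vec has_derivative unranked_vec) (at y within ranked_vec ` S)"
   by (rule bounded_linear_imp_has_derivative[OF bounded_linear_ranked(2)])
  have "unranked_vec y \<in> S" using y by auto
  from df[OF this] have "(f has_derivative f' (unranked_vec y)) (at (unranked_vec y) within unranked_vec ` (ranked_vec ` S))"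
   by (simp add: image_image)
  from has_derivative_in_compose[OF 1 this] have
   "((%y. f (unranked_vec y)) has_derivative (%h. f' (unranked_vec y) (unranked_vec h))) (at y within ranked_vec ` S)" .
  from bounded_linear.has_derivative[OF bounded_linear_ranked(1) this] show ?thesis by (simp add: F_def[abs_def] F'_def)
 qed
 have dd: "det (matrix (F' y)) = det (matrix (f' (unranked_vec y)))" for y unfolding F'_def by (rule det_matrix_ranked)
 have im: "F ` (ranked_vec ` S) = ranked_vec ` (f ` S)" by (auto simp: F_def image_image)
 note ri = integral_ranked[OF S int]
 have int': "(%y. \<bar>det (matrix (F' y))\<bar>) integrable_on ranked_vec ` S" unfolding dd using set_lebesgue_integral_eq_integral(1)[OF ri(1)] .
 note RS = ranked_lebesgue(1)[OF S]
 show L: "f ` S \<in> lmeasurable" using measurable_differentiable_image[OF RS dF int'] unfolding im ranked_lmeasurable(1) .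
 hence m: "vol (F ` ranked_vec ` S) = vol (f ` S)" unfolding im using ranked_lmeasurable(2)[of "f ` S"] by auto
 show "vol (f ` S) <= integral S (%x. \<bar>det (matrix (f' x))\<bar>)" using measure_differentiable_image[OF RS dF int'] unfolding m dd ri(2) .
 assume inj: "inj_on f S"
 have "inj_on F (ranked_vec ` S)"
 proof (rule inj_onI)
  fix y z assume yz: "y \<in> ranked_vec ` S" "z \<in> ranked_vec ` S" "F y = F z"
  have "unranked_vec (F y) = unranked_vec (F z)" using yz(3) by simp
  hence "f (unranked_vec y) = f (unranked_vec z)" by (simp add: F_def)
  moreover have "unranked_vec y \<in> S" "unranked_vec z \<in> S" using yz(1,2) by auto
  ultimately have "unranked_vec y = unranked_vec z" by (rule inj_onD[OF inj])
  hence "ranked_vec (unranked_vec y) = ranked_vec (unranked_vec z)" by simp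
  thus "y = z" by (simp only: ranked_unranked)
 qed
 from measure_differentiable_image_eq[OF RS dF this int']
 show "vol (f ` S) = integral S (%x. \<bar>det (matrix (f' x))\<bar>)" unfolding m dd ri(2) .
qed

lemma measure_linear_image_vec:
 fixes A :: "real^'n^'n::finite"
 assumes "S \<in> lmeasurable"
 shows "(%x. A *v x) ` S \<in> lmeasurable"
  "det A ~= 0 ==> vol ((%x. A *v x) ` S) = \<bar>det A\<bar> * vol S"
proof -
 have SL: "S \<in> sets lebesgue" using assms by auto
 have d: "((%x. A *v x) has_derivative (%h. A *v h)) (at x within S)" for x
  by (rule bounded_linear_imp_has_derivative[OF matrix_vector_mul_bounded_linear])
 have i: "(%x::real^'n. \<bar>det (matrix (%h. A *v h))\<bar>) absolutely_integrable_on S" using assms by (simp add: absolutely_integrable_on_const)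
 note D = differentiable_image_vec[OF SL d i]
 show "(%x. A *v x) ` S \<in> lmeasurable" by (rule D(1))
 assume "det A ~= 0"
 hence "inj_on (%x. A *v x) S" using inj_matrix_vector_mult[of A] by (auto simp: invertible_det_nz inj_on_def inj_def)
 from D(3)[OF this] have "vol ((%x. A *v x) ` S) = integral S (%x. \<bar>det A\<bar>*1)" by simp
 thus "vol ((%x. A *v x) ` S) = \<bar>det A\<bar> * vol S" unfolding integral_mult_right lmeasure_integral[OF assms] .
qed

section \<open>Twice differentiable functions and touching arguments\<close>

definition c2_on ::
 "(real^'n::finite) set => (real^'n => real) => (real^'n => real^'n) => (real^'n => real^'n^'n) => bool" where
 "c2_on S u g H \<longleftrightarrow> open S &
  (ALL x:S. (u has_derivative (%h. g x \<bullet> h)) (at x) &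
      (g has_derivative (%h. H x *v h)) (at x) & transpose (H x) = H x) &
  continuous_on S H"

lemma c2_onD:
 assumes "c2_on S u g H"
 shows "open S" "continuous_on S H"
  "!!x. x \<in> S ==> (u has_derivative (%h. g x \<bullet> h)) (at x)"
  "!!x. x \<in> S ==> (g has_derivative (%h. H x *v h)) (at x)"
  "!!x. x \<in> S ==> transpose (H x) = H x" using assms unfolding c2_on_def by blast+

lemma c2_on_subset: "c2_on S u g H ==> open T ==> T \<subseteq> S ==> c2_on T u g H" unfolding c2_on_def using continuous_on_subset by blast

lemma c2_on_continuous:
 assumes "c2_on S u g H"
 shows "continuous_on S u" "continuous_on S g" using c2_onD[OF assms] by (meson has_derivative_continuous continuous_at_imp_continuous_on)+

lemma c2_on_line:
 assumes c: "c2_on S u g H" and x: "x + s *\<^sub>R h \<in> S"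
 shows "((%s. u (x + s *\<^sub>R h)) has_real_derivative (g (x + s *\<^sub>R h) \<bullet> h)) (at s)"
  "((%s. g (x + s *\<^sub>R h) \<bullet> k) has_real_derivative (k \<bullet> (H (x + s *\<^sub>R h) *v h))) (at s)"
proof -
 have a: "((%s. x + s *\<^sub>R h) has_derivative (%r. r *\<^sub>R h)) (at s)" by (auto intro!: derivative_eq_intros)
 show "((%s. u (x + s *\<^sub>R h)) has_real_derivative (g (x + s *\<^sub>R h) \<bullet> h)) (at s)" unfolding has_field_derivative_def
  by (rule has_derivative_eq_rhs[OF has_derivative_compose[OF a c2_onD(3)[OF c x]]])
   (simp add: fun_eq_iff mult.commute)
 have b: "((%s. g (x + s *\<^sub>R h)) has_derivative (%r. H (x + s *\<^sub>R h) *v (r *\<^sub>R h))) (at s)"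
  using has_derivative_compose[OF a c2_onD(4)[OF c x]] .
 show "((%s. g (x + s *\<^sub>R h) \<bullet> k) has_real_derivative (k \<bullet> (H (x + s *\<^sub>R h) *v h))) (at s)"
  unfolding has_field_derivative_def by (rule has_derivative_eq_rhs[OF has_derivative_inner_left[OF b, of k]])
   (simp add: fun_eq_iff matrix_vector_mult_scaleR inner_commute[of "_ *v _" k] mult.commute)
qed

text \<open>The mean value theorem acts in direction \<open>a\<close> only; the unknown intermediate
  point is then absorbed by the first-order expansion of \<open>g\<close> at \<open>x\<close>, the
  one point where \<open>g\<close> is differentiated.\<close>

lemma mixed_difference:
 fixes u :: "real^'n::finite => real"
 assumes S: "open S" "x \<in> S" and du: "!!y. y \<in> S ==> (u has_derivative (%h. g y \<bullet> h)) (at y)"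
  and dg: "(g has_derivative (%h. G *v h)) (at x)" and e: "0 < e"
 shows "EX d>0. ALL s. 0 < s & s < d --> \<bar>u (x + s *\<^sub>R a + s *\<^sub>R b) - u (x + s *\<^sub>R a) - u (x + s *\<^sub>R b) + u x - s^2*(a \<bullet> (G *v b))\<bar>
  <= s^2*(2*e*(norm a + norm b)*norm a)"
proof -
 define c where "c = norm a + norm b"
 obtain r where r: "0 < r" "ball x r \<subseteq> S" using S openE by blast
 obtain k where k: "0 < k" "!!y. norm (y - x) < k ==> norm (g y - g x - G *v (y - x)) <= e*norm (y - x)"
  using dg e unfolding has_derivative_at_alt by blast
 have c0: "0 <= c" by (simp add: c_def)
 show ?thesis
 proof (intro exI[of _ "min r k/(c + 1)"] conjI allI impI)
  show "0 < min r k/(c + 1)" using r k c0 by simp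
  fix s assume s: "0 < s & s < min r k/(c + 1)"
  have "s*(c + 1) < min r k" using s c0 by (simp add: pos_less_divide_eq)
  hence sc: "s * c < r" "s * c < k" using s by (auto simp: algebra_simps)
  have n: "norm (t *\<^sub>R a + v *\<^sub>R b) <= s * c" if "0 <= t" "t <= s" "0 <= v" "v <= s" for t v
  proof -
   have "norm (t *\<^sub>R a + v *\<^sub>R b) <= t*norm a + v * norm b" using norm_triangle_ineq[of "t *\<^sub>R a" "v *\<^sub>R b"] that by simp
   also have "... <= s*norm a + s*norm b" using that by (intro add_mono mult_right_mono) auto
   finally show ?thesis by (simp add: c_def algebra_simps)
  qed
  have inS: "x + (t *\<^sub>R a + v *\<^sub>R b) \<in> S" if "0 <= t" "t <= s" "0 <= v" "v <= s" for t v
   by (rule subsetD[OF r(2)]) (use n[OF that] sc dist_norm[of "x + _" x] in \<open>simp add: dist_commute\<close>)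
  define F where "F t = u (x + (t *\<^sub>R a + s *\<^sub>R b)) - u (x + (t *\<^sub>R a + 0 *\<^sub>R b))" for t
  have "(F has_real_derivative (g (x + (t *\<^sub>R a + s *\<^sub>R b)) - g (x + (t *\<^sub>R a + 0 *\<^sub>R b))) \<bullet> a) (at t)" if t: "0 <= t" "t <= s" for t
  proof -
   have da: "((%t. x + (t *\<^sub>R a + w)) has_derivative (%r. r *\<^sub>R a)) (at t)" for w by (auto intro!: derivative_eq_intros)
   have D: "((%t. u (x + (t *\<^sub>R a + v *\<^sub>R b))) has_derivative (%r. g (x + (t *\<^sub>R a + v *\<^sub>R b)) \<bullet> (r *\<^sub>R a))) (at t)" if "0 <= v" "v <= s" for v
    by (rule has_derivative_compose[OF da du[OF inS[OF t that]]])
   show ?thesis unfolding has_field_derivative_def F_def[abs_def]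
    by (rule has_derivative_eq_rhs[OF has_derivative_diff[OF D D]]) (use s in \<open>auto simp: fun_eq_iff inner_diff_left algebra_simps\<close>)
  qed
  from MVT2[of 0 s F, OF _ this] s obtain t where t: "0 < t" "t < s"
   "F s - F 0 = s*((g (x + (t *\<^sub>R a + s *\<^sub>R b)) - g (x + (t *\<^sub>R a + 0 *\<^sub>R b))) \<bullet> a)" by auto
  define R where "R v = g (x + (t *\<^sub>R a + v *\<^sub>R b)) - g x - G *v (t *\<^sub>R a + v *\<^sub>R b)" for v
  have R: "\<bar>R v \<bullet> a\<bar> <= e*(s * c)*norm a" if "0 <= v" "v <= s" for v
  proof -
   have "norm (R v) <= e*norm (t *\<^sub>R a + v *\<^sub>R b)" using k(2)[of "x + (t *\<^sub>R a + v *\<^sub>R b)"] n[of t v] t that sc by (simp add: R_def)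
   also have "... <= e*(s * c)" using n[of t v] t that e by (intro mult_left_mono) auto
   finally have "norm (R v)*norm a <= e*(s * c)*norm a" by (rule mult_right_mono) simp
   thus ?thesis using Cauchy_Schwarz_ineq2[of "R v" a] by linarith
  qed
  have ge: "g (x + (t *\<^sub>R a + s *\<^sub>R b)) - g (x + (t *\<^sub>R a + 0 *\<^sub>R b)) = s *\<^sub>R (G *v b) + (R s - R 0)"
   by (simp add: R_def matrix_vector_right_distrib matrix_vector_mult_scaleR)
  have "F s - F 0 = s*(s*(a \<bullet> (G *v b)) + (R s \<bullet> a - R 0 \<bullet> a))"
   using t(3) unfolding ge by (simp add: inner_add_left inner_diff_left inner_commute[of a])
  hence "u (x + s *\<^sub>R a + s *\<^sub>R b) - u (x + s *\<^sub>R a) - u (x + s *\<^sub>R b) + u x - s^2*(a \<bullet> (G *v b)) = s*(R s \<bullet> a - R 0 \<bullet> a)"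
   by (simp add: F_def add.assoc power2_eq_square algebra_simps)
  moreover have "\<bar>R s \<bullet> a - R 0 \<bullet> a\<bar> <= s*(2*e * c*norm a)" using R[of s] R[of 0] s by (simp add: mult_ac)
  hence "s*\<bar>R s \<bullet> a - R 0 \<bullet> a\<bar> <= s*(s*(2*e * c*norm a))" using s by (intro mult_left_mono) auto
  ultimately show "\<bar>u (x + s *\<^sub>R a + s *\<^sub>R b) - u (x + s *\<^sub>R a) - u (x + s *\<^sub>R b) + u x - s^2*(a \<bullet> (G *v b))\<bar>
   <= s^2*(2*e*(norm a + norm b)*norm a)" using s unfolding c_def by (simp add: abs_mult power2_eq_square mult.assoc)
 qed
qed

text \<open>The second difference of \<open>mixed_difference\<close> is symmetric in
  \<open>a\<close> and \<open>b\<close>, hence so is its limit. This supplies, for the given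
  potential, the symmetry built into \<open>c2_on\<close>.\<close>

lemma second_derivative_symmetric:
 fixes u :: "real^'n::finite => real"
 assumes "open S" "x \<in> S" "!!y. y \<in> S ==> (u has_derivative (%h. g y \<bullet> h)) (at y)"
  and "(g has_derivative (%h. G *v h)) (at x)"
 shows "transpose G = G"
proof -
 have "\<bar>a \<bullet> (G *v b) - b \<bullet> (G *v a)\<bar> <= 0 + e" if a: "norm a = 1" "norm b = 1" and e: "0 < e" for a b e
 proof -
  obtain d d' where d: "0 < d" "0 < d'"
   "ALL s. 0 < s & s < d --> \<bar>u (x + s *\<^sub>R a + s *\<^sub>R b) - u (x + s *\<^sub>R a) - u (x + s *\<^sub>R b) + u x - s^2*(a \<bullet> (G *v b))\<bar> <= s^2*(2*(e/8)*(norm a + norm b)*norm a)"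
   "ALL s. 0 < s & s < d' --> \<bar>u (x + s *\<^sub>R b + s *\<^sub>R a) - u (x + s *\<^sub>R b) - u (x + s *\<^sub>R a) + u x - s^2*(b \<bullet> (G *v a))\<bar> <= s^2*(2*(e/8)*(norm b + norm a)*norm b)"
   using mixed_difference[OF assms, of "e/8" a b] mixed_difference[OF assms, of "e/8" b a] e by auto
  define s where "s = min d d'/2"
  have s: "0 < s" "s < d" "s < d'" using d by (auto simp: s_def)
  have "x + s *\<^sub>R b + s *\<^sub>R a = x + s *\<^sub>R a + s *\<^sub>R b" by (simp add: add_ac)
  note D = d(3)[rule_format, OF conjI, OF s(1,2)] d(4)[rule_format, OF conjI, OF s(1,3), unfolded this]
  have "\<bar>s^2*(a \<bullet> (G *v b)) - s^2*(b \<bullet> (G *v a))\<bar> <= s^2*e" proof -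
   have "s^2*(2*(e/8)*(1 + 1)*1) = s^2*e/2" by simp
   note D = D[unfolded a this]
   show ?thesis using D[THEN abs_le_D1] D[THEN abs_le_D2] by (intro abs_leI) linarith+
  qed
  moreover have "\<bar>s^2*(a \<bullet> (G *v b)) - s^2*(b \<bullet> (G *v a))\<bar> = s^2*\<bar>a \<bullet> (G *v b) - b \<bullet> (G *v a)\<bar>"
   unfolding right_diff_distrib[symmetric] abs_mult by simp
  ultimately have "s^2*\<bar>a \<bullet> (G *v b) - b \<bullet> (G *v a)\<bar> <= s^2*e" by simp
  thus ?thesis using s by simp
 qed
 from field_le_epsilon[OF this, of "axis i 1" "axis j 1" for i j]
 show ?thesis by (simp add: vec_eq_iff transpose_def norm_axis_1 inner_axis' matrix_vector_mult_basis column_def)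
qed

text \<open>If the second derivative along \<open>h\<close> were positive, the directional
  derivative would become positive and nearby values would exceed \<open>u x\<close>. The open set
  \<open>T\<close> allows maximality to be known only near \<open>x\<close>, as at a contact point
  inside a larger domain.\<close>

lemma local_max_test:
 assumes c: "c2_on S u g H" and x: "x \<in> S" and T: "open T" "x \<in> T"
  and mx: "!!y. y \<in> T \<inter> S ==> u y <= u x"
 shows "g x = 0" "h \<bullet> (H x *v h) <= 0"
proof -
 have op: "open (T \<inter> S)" using T c2_onD(1)[OF c] by (simp add: open_Int)
 obtain r where r: "0 < r" "ball x r \<subseteq> T \<inter> S" using op T x by (meson IntI openE)
 have "g x \<bullet> (g x) = 0" using differential_zero_maxmin[OF _ op c2_onD(3)[OF c x]] mx T x by (metis IntI)
 thus g0: "g x = 0" by simp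
 show "h \<bullet> (H x *v h) <= 0"
 proof (rule ccontr)
  assume "~ ?thesis"
  hence pos: "0 < h \<bullet> (H x *v h)" by simp
  have h0: "h ~= 0" using pos by auto
  define d where "d = r/norm h"
  have d0: "0 < d" using r h0 by (simp add: d_def)
  have mem: "x + s *\<^sub>R h \<in> T \<inter> S" if "\<bar>s\<bar> < d" for s
  proof -
   have "\<bar>s\<bar>*norm h < r" using that h0 by (simp add: d_def field_simps)
   thus ?thesis using r(2) by (auto simp: dist_norm)
  qed
  have D0: "((%s. g (x + s *\<^sub>R h) \<bullet> h) has_real_derivative (h \<bullet> (H x *v h))) (at 0)"
   using c2_on_line(2)[OF c, of x 0 h h] x by simp
  obtain e where e: "0 < e" "!!s. 0 < s ==> s < e ==> g (x + 0 *\<^sub>R h) \<bullet> h < g (x + (0 + s) *\<^sub>R h) \<bullet> h"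
   using DERIV_pos_inc_right[OF D0 pos] by blast
  define s where "s = min d e/2"
  have s: "0 < s" "s < d" "s < e" using d0 e by (auto simp: s_def)
  have "EX z>0. z < s & u (x + s *\<^sub>R h) - u (x + 0 *\<^sub>R h) = (s - 0)*(g (x + z *\<^sub>R h) \<bullet> h)"
   using s by (intro MVT2 c2_on_line(1)[OF c]) (use mem in auto)
  then obtain z where z: "0 < z" "z < s" "u (x + s *\<^sub>R h) - u x = s*(g (x + z *\<^sub>R h) \<bullet> h)" by auto
  have "0 < g (x + z *\<^sub>R h) \<bullet> h" using e(2)[of z] z s g0 by simp
  hence "u x < u (x + s *\<^sub>R h)" using z(3) s mult_pos_pos[of s "g (x + z *\<^sub>R h) \<bullet> h"] by linarith
  moreover have "u (x + s *\<^sub>R h) <= u x" using s by (intro mx mem) auto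
  ultimately show False by simp
 qed
qed

lemma c2_on_add:
 assumes "c2_on S u g H" "c2_on S v k M"
 shows "c2_on S (%x. u x + v x) (%x. g x + k x) (%x. H x + M x)" using assms unfolding c2_on_def
 by (auto intro!: continuous_intros derivative_eq_intros simp: transpose_add inner_add_left matrix_vector_mult_add_rdistrib)

lemma c2_on_scale:
 assumes "c2_on S u g H"
 shows "c2_on S (%x. c*u x) (%x. c *\<^sub>R g x) (%x. c *\<^sub>R H x)" using assms unfolding c2_on_def
 by (auto intro!: continuous_intros derivative_eq_intros simp: transpose_scale matrix_vector_scaleR)

lemma c2_on_diff:
 assumes "c2_on S u g H" "c2_on S v k M"
 shows "c2_on S (%x. u x - v x) (%x. g x - k x) (%x. H x - M x)" using c2_on_add[OF assms(1) c2_on_scale[OF assms(2), of "-1"]] by simp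

lemma c2_on_affine:
 assumes "open S"
 shows "c2_on S (%x. a + b \<bullet> x) (%x. b) (%x. 0)" using assms unfolding c2_on_def
 by (auto intro!: continuous_intros derivative_eq_intros simp: transpose_def vec_eq_iff matrix_vector_mult_def)

lemma c2_on_quadratic:
 assumes "open S" "transpose M = M"
 shows "c2_on S (%x. (x - c) \<bullet> (M *v (x - c))) (%x. 2 *\<^sub>R (M *v (x - c))) (%x. 2 *\<^sub>R M)"
proof -
 have bl: "bounded_linear (%h. M *v h)" by (rule matrix_vector_mul_bounded_linear)
 have d: "((%x. M *v (x - c)) has_derivative (%h. M *v h)) (at x)" for x
  by (rule bounded_linear.has_derivative[OF bl]) (auto intro!: derivative_eq_intros)
 have sym: "x \<bullet> (M *v y) = y \<bullet> (M *v x)" for x y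
  using inner_transpose[where x=x and A=M and y=y] assms(2) inner_commute[of "M *v x" y] by simp
 have "((%x. (x - c) \<bullet> (M *v (x - c))) has_derivative (%h. (2 *\<^sub>R (M *v (x - c))) \<bullet> h)) (at x)" for x
  by (rule has_derivative_eq_rhs, rule has_derivative_inner[OF _ d])
   (auto intro!: derivative_eq_intros simp: fun_eq_iff sym[of "x - c"] inner_commute[of "M *v _"])
 moreover have "((%x. 2 *\<^sub>R (M *v (x - c))) has_derivative (%h. (2 *\<^sub>R M) *v h)) (at x)" for x
  by (rule has_derivative_eq_rhs[OF has_derivative_scaleR_right[OF d]])
   (simp add: fun_eq_iff matrix_vector_scaleR)
 ultimately show ?thesis unfolding c2_on_def by (intro conjI ballI) (simp_all only: assms transpose_scale continuous_on_const)
qed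

lemma c2_on_compose:
 fixes psi psi' psi'' :: "real => real"
 assumes c: "c2_on S u g H"
  and d1: "!!x. x \<in> S ==> (psi has_real_derivative psi' (u x)) (at (u x))"
  and d2: "!!x. x \<in> S ==> (psi' has_real_derivative psi'' (u x)) (at (u x))"
  and ct: "continuous_on (u ` S) psi''"
 shows "c2_on S (%x. psi (u x)) (%x. psi' (u x) *\<^sub>R g x)
  (%x. psi' (u x) *\<^sub>R H x + psi'' (u x) *\<^sub>R outer (g x) (g x))" unfolding c2_on_def
proof (intro conjI ballI)
 show "open S" by (rule c2_onD(1)[OF c])
 fix x assume x: "x \<in> S"
 note du = c2_onD(3)[OF c x] and dg = c2_onD(4)[OF c x]
 have a: "((%x. psi (u x)) has_derivative (%h. psi' (u x)*(g x \<bullet> h))) (at x)"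
  using has_derivative_compose[OF du d1[OF x, unfolded has_field_derivative_def]] .
 thus "((%x. psi (u x)) has_derivative (%h. (psi' (u x) *\<^sub>R g x) \<bullet> h)) (at x)" by simp
 have b: "((%x. psi' (u x)) has_derivative (%h. psi'' (u x)*(g x \<bullet> h))) (at x)"
  using has_derivative_compose[OF du d2[OF x, unfolded has_field_derivative_def]] .
 show "((%x. psi' (u x) *\<^sub>R g x) has_derivative
   (%h. (psi' (u x) *\<^sub>R H x + psi'' (u x) *\<^sub>R outer (g x) (g x)) *v h)) (at x)"
  by (rule has_derivative_eq_rhs[OF has_derivative_scaleR[OF b dg]])
   (simp add: fun_eq_iff matrix_vector_mult_add_rdistrib matrix_vector_scaleR outer_mult_vec)
 show "transpose (psi' (u x) *\<^sub>R H x + psi'' (u x) *\<^sub>R outer (g x) (g x))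
   = psi' (u x) *\<^sub>R H x + psi'' (u x) *\<^sub>R outer (g x) (g x)"
  using c2_onD(5)[OF c x] by (simp add: transpose_add transpose_scale transpose_outer)
next
 have cu: "continuous_on S u" and cg: "continuous_on S g" using c2_on_continuous[OF c] by auto
 have "continuous_on (u ` S) psi'"
 proof (rule continuous_at_imp_continuous_on, rule ballI)
  fix y assume "y \<in> u ` S" thus "isCont psi' y" using d2 DERIV_isCont by blast
 qed
 hence 1: "continuous_on S (%x. psi' (u x))" using cu by (rule continuous_on_compose2) auto
 have 2: "continuous_on S (%x. psi'' (u x))" using ct cu by (rule continuous_on_compose2) auto
 have 3: "continuous_on S (%x. outer (g x) (g x))" unfolding outer_def using cg by (intro continuous_intros)
 show "continuous_on S (%x. psi' (u x) *\<^sub>R H x + psi'' (u x) *\<^sub>R outer (g x) (g x))"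
  using 1 2 3 c2_onD(2)[OF c] by (intro continuous_intros)
qed

lemma integrable_on_compact_subset:
 fixes f :: "'a::euclidean_space => real"
 assumes K: "compact K" and f: "continuous_on K f" and B: "B \<in> sets lebesgue" "B \<subseteq> K"
 shows "f absolutely_integrable_on B" "f integrable_on B"
proof -
 have "integrable lborel (%x. indicat_real K x *\<^sub>R f x)" by (rule borel_integrable_compact[OF K f])
 hence "f absolutely_integrable_on K" unfolding set_integrable_def by (simp add: integrable_completion)
 thus a: "f absolutely_integrable_on B" using B by (rule set_integrable_subset)
 thus "f integrable_on B" by (rule set_lebesgue_integral_eq_integral(1))
qed

text \<open>The contact set is split because two kinds of Jacobian bound occur: a constant on
  \<open>B1\<close>, whose volume is then the quantity of interest, and a function of the source on
  \<open>B2\<close>.\<close>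

lemma gradient_image_measure:
 assumes c: "c2_on S w g H" and K: "compact K" "K \<subseteq> S"
  and B: "B1 \<in> sets lebesgue" "B1 \<subseteq> K" "B2 \<in> sets lebesgue" "B2 \<subseteq> K"
  and P: "P \<in> lmeasurable" "P \<subseteq> g ` (B1 \<union> B2)"
  and b1: "!!x. x \<in> B1 ==> \<bar>det (H x)\<bar> <= C"
  and b2: "!!x. x \<in> B2 ==> \<bar>det (H x)\<bar> <= F x"
  and F: "continuous_on K F" "!!x. x \<in> K ==> 0 <= F x"
 shows "vol P <= C * vol B1 + integral K F"
proof -
 have KL: "K \<in> lmeasurable" using K(1) by (rule lmeasurable_compact)
 have KK: "K \<in> sets lebesgue" using KL by (rule fmeasurableD)
 have BL: "B1 \<in> lmeasurable" using bounded_set_imp_lmeasurable[OF bounded_subset[OF compact_imp_bounded[OF K(1)] B(2)] B(1)] .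
 have dg: "(g has_derivative (%h. H x *v h)) (at x within B)" if "x \<in> B" "B \<subseteq> K" for x B
  using c2_onD(4)[OF c] that K(2) by (meson has_derivative_at_withinI subsetD)
 have "continuous_on K (%x. \<bar>det (H x)\<bar>)" unfolding det_def using continuous_on_subset[OF c2_onD(2)[OF c] K(2)] by (intro continuous_intros)
 hence int: "(%x. \<bar>det (matrix (%h. H x *v h))\<bar>) absolutely_integrable_on B" if "B \<in> sets lebesgue" "B \<subseteq> K" for B
  using integrable_on_compact_subset(1)[OF K(1) _ that] by simp
 note int' = set_lebesgue_integral_eq_integral(1)[OF int]
 have intF: "F integrable_on B" if "B \<in> sets lebesgue" "B \<subseteq> K" for B using integrable_on_compact_subset(2)[OF K(1) F(1) that] .
 note d1 = differentiable_image_vec[OF B(1) dg[OF _ B(2)] int[OF B(1,2)]]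
 note d2 = differentiable_image_vec[OF B(3) dg[OF _ B(4)] int[OF B(3,4)]]
 have ic: "(%x. C*1) integrable_on B1" using integrable_on_const[OF BL] by simp
 have "integral B1 (%x. \<bar>det (matrix (%h. H x *v h))\<bar>) <= integral B1 (%x. C*1)" using b1 by (intro integral_le int'[OF B(1,2)] ic) auto
 also have "... = C * vol B1" unfolding integral_mult_right lmeasure_integral[OF BL] ..
 finally have m1: "vol (g ` B1) <= C * vol B1" using d1(2) by linarith
 have "integral B2 (%x. \<bar>det (matrix (%h. H x *v h))\<bar>) <= integral B2 F"
  using b2 by (intro integral_le int'[OF B(3,4)] intF[OF B(3,4)]) auto
 also have "... <= integral K F" using F(2) by (intro integral_subset_le B intF KK) auto
 finally have m2: "vol (g ` B2) <= integral K F" using d2(2) by linarith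
 have "vol P <= vol (g ` B1 \<union> g ` B2)" using P d1(1) d2(1) by (intro measure_mono_fmeasurable) (auto simp: image_Un)
 also have "... <= vol (g ` B1) + vol (g ` B2)" using d1(1) d2(1) by (intro measure_Un_le) auto
 finally show ?thesis using m1 m2 by linarith
qed

section \<open>Volume and shape of the sections of the potential\<close>

definition MA ::
 "real => real => (real^'n::finite) set => (real^'n => real) => (real^'n => real^'n) => (real^'n => real^'n^'n) => bool" where
 "MA l L S phi g A \<longleftrightarrow> convex S & convex_on S phi & c2_on S phi g A & 0 < l &
  (ALL x:S. l <= det (A x) & det (A x) <= L)"

text \<open>This is the Bregman distance of \<open>phi\<close>; its sublevel sets in the last
  argument are the sections centred at \<open>y\<close>.\<close>

definition excess :: "(real^'n::finite => real) => (real^'n => real^'n) => real^'n => real^'n => real" where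
 "excess phi g y x = phi x - phi y - g y \<bullet> (x - y)"

lemma segment_scale_mem:
 assumes "convex S" "x \<in> S" "y \<in> S" "0 <= s" "s <= 1"
 shows "x + s *\<^sub>R (y - x) \<in> S"
proof -
 have "(1 - s) *\<^sub>R x + s *\<^sub>R y \<in> S" using assms by (simp add: convex_alt)
 thus ?thesis by (simp add: algebra_simps)
qed

lemma convex_c2_above_tangent:
 assumes c: "c2_on S u g H" and cv: "convex S" "convex_on S u" and x: "x \<in> S" and y: "y \<in> S"
 shows "g x \<bullet> (y - x) <= u y - u x"
proof (rule field_le_epsilon)
 fix e :: real assume e: "0 < e"
 have D: "((%s. u (x + s *\<^sub>R (y - x)) - s*(u y - u x)) has_real_derivative
   (g (x + 0 *\<^sub>R (y - x)) \<bullet> (y - x) - (u y - u x))) (at 0)" using x by (auto intro!: derivative_eq_intros c2_on_line(1)[OF c])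
 show "g x \<bullet> (y - x) <= u y - u x + e"
 proof (rule ccontr)
  assume "~ ?thesis"
  hence "0 < g (x + 0 *\<^sub>R (y - x)) \<bullet> (y - x) - (u y - u x)" using e by simp
  from DERIV_pos_inc_right[OF D this] obtain d where d: "0 < d"
   "!!h. 0 < h ==> h < d ==> u (x + 0 *\<^sub>R (y - x)) - 0*(u y - u x) < u (x + (0 + h) *\<^sub>R (y - x)) - (0 + h)*(u y - u x)" by blast
  define h where "h = min d 1/2"
  have h: "0 < h" "h < d" "h < 1" using d by (auto simp: h_def)
  have "u ((1 - h) *\<^sub>R x + h *\<^sub>R y) <= (1 - h)*u x + h*u y" using h x y cv(2) by (intro convex_onD) auto
  moreover have "x + h *\<^sub>R (y - x) = (1 - h) *\<^sub>R x + h *\<^sub>R y" by (simp add: algebra_simps)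
  ultimately show False using d(2)[OF h(1,2)] by (simp add: algebra_simps)
 qed
qed

lemma convex_c2_psd:
 assumes c: "c2_on S u g H" and cv: "convex S" "convex_on S u" and x: "x \<in> S"
 shows "psd (H x)" unfolding psd_def
proof (intro conjI allI)
 show "transpose (H x) = H x" by (rule c2_onD(5)[OF c x])
 fix h
 have c': "c2_on S (%y. ((u x - g x \<bullet> x) + g x \<bullet> y) - u y) (%y. g x - g y) (%y. 0 - H y)"
  by (rule c2_on_diff[OF c2_on_affine[OF c2_onD(1)[OF c]] c])
 have "h \<bullet> ((0 - H x) *v h) <= 0" by (rule local_max_test(2)[OF c' x open_UNIV])
   (use convex_c2_above_tangent[OF c cv x] in \<open>auto simp: inner_diff_right algebra_simps\<close>)
 thus "0 <= h \<bullet> (H x *v h)" unfolding matrix_vector_mult_diff_rdistrib by simp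
qed

lemma MA_D:
 assumes M: "MA l L S phi g A"
 shows "open S" "convex S" "convex_on S phi" "c2_on S phi g A" "0 < l"
  "!!x. x \<in> S ==> l <= det (A x)" "!!x. x \<in> S ==> det (A x) <= L"
  "!!x. x \<in> S ==> 0 < det (A x)" "!!x. x \<in> S ==> psd (A x)"
  "!!x y. x \<in> S ==> y \<in> S ==> 0 <= excess phi g y x"
proof -
 show c: "c2_on S phi g A" and cv: "convex S" "convex_on S phi" and l: "0 < l" using M by (auto simp: MA_def)
 show "open S" by (rule c2_onD(1)[OF c])
 show ll: "!!x. x \<in> S ==> l <= det (A x)" "!!x. x \<in> S ==> det (A x) <= L" using M by (auto simp: MA_def)
 show "!!x. x \<in> S ==> 0 < det (A x)" using ll(1) l by (meson less_le_trans)
 show "!!x. x \<in> S ==> psd (A x)" by (rule convex_c2_psd[OF c cv])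
 show "!!x y. x \<in> S ==> y \<in> S ==> 0 <= excess phi g y x" using convex_c2_above_tangent[OF c cv] by (auto simp: excess_def)
qed

lemma psd_pos_def:
 assumes A: "psd A" and d: "0 < det A" and h: "h ~= 0"
 shows "0 < h \<bullet> (A *v h)"
proof (rule ccontr)
 assume "~ ?thesis"
 hence 0: "h \<bullet> (A *v h) = 0" using A by (auto simp: psd_def intro: antisym)
 have "((A *v h) \<bullet> (A *v h))^2 <= ((A *v h) \<bullet> (A *v (A *v h)))*(h \<bullet> (A *v h))" by (rule psd_cauchy_schwarz[OF A])
 hence "A *v h = 0" unfolding 0 by simp
 moreover have "inj ((*v) A)" using d inj_matrix_vector_mult[of A] by (simp add: invertible_det_nz)
 ultimately show False using h by (metis injD matrix_vector_mult_0_right)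
qed

lemma MA_grad_mono:
 assumes M: "MA l L S phi g A" and x: "x \<in> S" and y: "y \<in> S" and ne: "x ~= y"
 shows "0 < (g x - g y) \<bullet> (x - y)"
proof -
 have seg: "y + s *\<^sub>R (x - y) \<in> S" if "0 <= s" "s <= 1" for s by (rule segment_scale_mem[OF MA_D(2)[OF M] y x that])
 have "EX z>0. z < 1 & g (y + 1 *\<^sub>R (x - y)) \<bullet> (x - y) - g (y + 0 *\<^sub>R (x - y)) \<bullet> (x - y)
   = (1 - 0)*((x - y) \<bullet> (A (y + z *\<^sub>R (x - y)) *v (x - y)))" by (intro MVT2 c2_on_line(2)[OF MA_D(4)[OF M]] seg) auto
 then obtain z where z: "0 < z" "z < 1"
  "g x \<bullet> (x - y) - g y \<bullet> (x - y) = (x - y) \<bullet> (A (y + z *\<^sub>R (x - y)) *v (x - y))" by auto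
 have mem: "y + z *\<^sub>R (x - y) \<in> S" using seg z by simp
 have "0 < (x - y) \<bullet> (A (y + z *\<^sub>R (x - y)) *v (x - y))"
  using psd_pos_def[OF MA_D(9,8)[OF M mem]] mem M ne by (auto intro!: psd_pos_def MA_D)
 thus ?thesis using z(3) by (simp add: inner_diff_left)
qed

lemma MA_grad_inj:
 assumes M: "MA l L S phi g A"
 shows "inj_on g S"
proof (rule inj_onI)
 fix x y assume "x \<in> S" "y \<in> S" "g x = g y"
 thus "x = y" using MA_grad_mono[OF M, of x y] by (cases "x = y") auto
qed

text \<open>Strict monotonicity makes the gradient map injective, so the area formula is an equality
  and the lower determinant bound passes to the image.\<close>

lemma MA_gradient_image_lower:
 assumes M: "MA l L S phi g A" and K: "compact K" "K \<subseteq> S"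
 shows "g ` K \<in> lmeasurable" "l * vol K <= vol (g ` K)"
proof -
 note c = MA_D(4)[OF M]
 have KL: "K \<in> lmeasurable" using K(1) by (rule lmeasurable_compact)
 have KK: "K \<in> sets lebesgue" using KL by (rule fmeasurableD)
 have dg: "(g has_derivative (%h. A x *v h)) (at x within K)" if "x \<in> K" for x
  using c2_onD(4)[OF c] that K(2) by (meson has_derivative_at_withinI subsetD)
 have "continuous_on K (%x. \<bar>det (A x)\<bar>)" unfolding det_def using continuous_on_subset[OF c2_onD(2)[OF c] K(2)] by (intro continuous_intros)
 hence int: "(%x. \<bar>det (matrix (%h. A x *v h))\<bar>) absolutely_integrable_on K" using integrable_on_compact_subset(1)[OF K(1) _ KK] by simp
 note d = differentiable_image_vec[OF KK dg int]
 show "g ` K \<in> lmeasurable" by (rule d(1))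
 have "l * vol K = integral K (%x. l*1)" unfolding integral_mult_right lmeasure_integral[OF KL] ..
 also have "... <= integral K (%x. \<bar>det (matrix (%h. A x *v h))\<bar>)"
 proof (rule integral_le)
  show "(%x. l*1) integrable_on K" using integrable_on_const[OF KL] by simp
  show "(%x. \<bar>det (matrix (%h. A x *v h))\<bar>) integrable_on K" by (rule set_lebesgue_integral_eq_integral(1)[OF int])
  fix x assume "x \<in> K"
  hence "x \<in> S" using K by blast
  from MA_D(6)[OF M this] show "l*1 <= \<bar>det (matrix (%h. A x *v h))\<bar>" by simp
 qed
 also have "... = vol (g ` K)" using d(3)[OF _ inj_on_subset[OF MA_grad_inj[OF M] K(2)]] by simp
 finally show "l * vol K <= vol (g ` K)" .
qed

text \<open>A simplex of maximal volume inside a compact set replaces the ellipsoid of John's lemma.\<close>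

lemma maximal_simplex:
 fixes D :: "(real^'n::finite) set"
 assumes D: "compact D" and ball: "ball c r \<subseteq> D" "0 < r"
 obtains v :: "real^'n" and E :: "real^'n^'n" where "det E ~= 0" "v \<in> D" "!!i. v + column i E \<in> D"
  "!!x. x \<in> D ==> EX e. x = v + E *v e & (ALL i. \<bar>e $ i\<bar> <= 1)"
proof -
 define X :: "(real^'n^'n) set" where "X = {W. ALL i. W $ i \<in> D}"
 have "closed X"
 proof -
  have "X = (\<Inter>i. (%W. W $ i) -` D)" by (auto simp: X_def)
  moreover have "closed ((%W :: real^'n^'n. W $ i) -` D)" for i by (intro continuous_closed_vimage compact_imp_closed D continuous_intros)
  ultimately show ?thesis by (simp add: closed_INT)
 qed
 moreover have "bounded X"
 proof -
  obtain B where B: "!!x. x \<in> D ==> norm x <= B" using D by (meson bounded_iff compact_imp_bounded)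
  have "norm W <= CARD('n)*B" if "W \<in> X" for W
  proof -
   have "norm W <= (\<Sum>i\<in>UNIV. norm (W $ i))" unfolding norm_vec_def by (rule L2_set_le_sum) simp
   also have "... <= (\<Sum>i\<in>(UNIV::'n set). B)" using that B by (intro sum_mono) (auto simp: X_def)
   finally show ?thesis by simp
  qed
  thus ?thesis by (auto simp: bounded_iff)
 qed
 ultimately have cX: "compact (D \<times> X)" using D by (intro compact_Times) (auto simp: compact_eq_bounded_closed)
 define M where "M q = (\<chi> i. snd q $ i - fst q)" for q :: "(real^'n) \<times> (real^'n^'n)"
 have contM: "continuous_on (D \<times> X) (%q. \<bar>det (M q)\<bar>)" unfolding det_def M_def by (simp, intro continuous_intros)
 have q0: "(c, \<chi> i. c + (r/2) *\<^sub>R axis i 1) \<in> D \<times> X"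
 proof -
  have "c \<in> ball c r" using ball by simp
  moreover have "c + (r/2) *\<^sub>R axis i 1 \<in> ball c r" for i :: 'n using ball by (simp add: dist_norm)
  ultimately show ?thesis using ball unfolding X_def by auto
 qed
 obtain q where q: "q \<in> D \<times> X" and qmax: "!!q'. q' \<in> D \<times> X ==> \<bar>det (M q')\<bar> <= \<bar>det (M q)\<bar>"
  using continuous_attains_sup[OF cX _ contM] q0 by blast
 have "M (c, \<chi> i. c + (r/2) *\<^sub>R axis i 1) = (r/2) *\<^sub>R mat 1" by (simp add: M_def vec_eq_iff mat_def axis_def)
 hence "det (M (c, \<chi> i. c + (r/2) *\<^sub>R axis i 1)) = (r/2)^CARD('n)" by (simp add: det_scaleR)
 with qmax[OF q0] have dpos: "0 < \<bar>det (M q)\<bar>" using ball(2) zero_less_power[of "r/2" "CARD('n)"] by linarith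
 obtain v W where vW: "q = (v, W)" by (cases q)
 define E where "E = transpose (M q)"
 have Mi: "M q $ i = W $ i - v" for i by (simp add: M_def vW)
 have colE: "column i E = W $ i - v" for i by (simp add: E_def column_def transpose_def vec_eq_iff Mi)
 have detE: "det E = det (M q)" by (simp add: E_def)
 show thesis
 proof (rule that)
  show "det E ~= 0" using dpos detE by auto
  show "v \<in> D" using q vW by auto
  show "v + column i E \<in> D" for i using q vW by (auto simp: colE X_def)
  fix x assume x: "x \<in> D"
  have invE: "invertible E" using dpos detE by (auto simp: invertible_det_nz)
  define e where "e = matrix_inv E *v (x - v)"
  have "E ** matrix_inv E = mat 1" using someI_ex[OF invE[unfolded invertible_def]] by (simp add: matrix_inv_def)
  hence Ee: "E *v e = x - v" by (simp add: e_def matrix_vector_mul_assoc)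
  have "\<bar>e $ k\<bar> <= 1" for k
  proof -
   \<comment> \<open>Replacing vertex \<open>k\<close> by \<open>x\<close> multiplies the
     determinant by the coordinate \<open>e $ k\<close>, by Cramer's rule; maximality bounds this
     factor by one.\<close>
   define W' where "W' = (\<chi> i. if i = k then x else W $ i)"
   have "(v, W') \<in> D \<times> X" using q vW x by (auto simp: X_def W'_def)
   hence le: "\<bar>det (M (v, W'))\<bar> <= \<bar>det (M q)\<bar>" by (rule qmax)
   have xs: "x - v = (\<Sum>i\<in>UNIV. e $ i *s row i (M q))" unfolding Ee[symmetric] matrix_mult_sum by (simp add: E_def)
   have "M (v, W') = (\<chi> i. if i = k then (\<Sum>i\<in>UNIV. e $ i *s row i (M q)) else row i (M q))"
    unfolding xs[symmetric] by (simp add: vec_eq_iff M_def W'_def vW row_def)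
   hence "det (M (v, W')) = e $ k*det (M q)" by (simp only: cramer_lemma_transpose)
   with le have "\<bar>e $ k\<bar>*\<bar>det (M q)\<bar> <= 1*\<bar>det (M q)\<bar>" by (simp add: abs_mult)
   thus ?thesis using dpos by (simp only: mult_le_cancel_right_pos)
  qed
  thus "EX e. x = v + E *v e & (ALL i. \<bar>e $ i\<bar> <= 1)" using Ee by (intro exI[of _ e]) auto
 qed
qed

lemma simplex_coordinates_mem:
 fixes E :: "real^'n^'n::finite"
 assumes D: "convex D" "v \<in> D" "!!i. v + column i E \<in> D"
  and e: "!!i. 0 <= e $ i" "(\<Sum>i\<in>UNIV. e $ i) <= 1"
 shows "v + E *v e \<in> D"
proof -
 let ?s = "\<Sum>i\<in>UNIV. e $ i"
 define f where "f o' = (case o' of None => v | Some i => v + column i E)" for o'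
 define a where "a o' = (case o' of None => 1 - ?s | Some i => e $ i)" for o'
 have un: "(UNIV :: 'n option set) = insert None (range Some)" by (rule UNIV_option_conv)
 have "(\<Sum>o'\<in>UNIV. a o' *\<^sub>R f o') \<in> D"
 proof (rule convex_sum[OF _ D(1)])
  show "(\<Sum>o'\<in>UNIV. a o') = 1" unfolding un by (simp add: a_def sum.reindex)
  show "0 <= a o'" for o' using e by (auto simp: a_def split: option.splits)
  show "f o' \<in> D" for o' using D by (auto simp: f_def split: option.splits)
 qed simp
 also have "(\<Sum>o'\<in>UNIV. a o' *\<^sub>R f o') = (1 - ?s) *\<^sub>R v + (\<Sum>i\<in>UNIV. e $ i *\<^sub>R (v + column i E))"
  unfolding un by (simp add: a_def f_def sum.reindex)
 also have "... = v + (\<Sum>i\<in>UNIV. e $ i *\<^sub>R column i E)"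
  by (simp add: scaleR_add_right sum.distrib scaleR_sum_left[symmetric] algebra_simps)
 also have "(\<Sum>i\<in>UNIV. e $ i *\<^sub>R column i E) = E *v e" by (simp add: matrix_mult_sum scalar_mult_eq_scaleR)
 finally show ?thesis .
qed

text \<open>Comparison with a quadratic polynomial whose sublevel set is an
 ellipsoid inscribed in the simplex.\<close>

lemma simplex_volume_upper:
 fixes E :: "real^'n^'n::finite"
 assumes M: "MA l L S phi g A" and dE: "det E ~= 0"
  and D: "convex D" "D \<subseteq> S" "v \<in> D" "!!i. v + column i E \<in> D"
  and h: "0 < h" "!!x. x \<in> D ==> 0 <= phi x - (a + b \<bullet> x) & phi x - (a + b \<bullet> x) <= h"
 shows "l*(det E)^2 <= (16*(real CARD('n))^2*h)^CARD('n)"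
proof -
 let ?n = "real CARD('n)"
 have n1: "1 <= ?n" by simp
 \<comment> \<open>This makes \<open>h/\<beta> = 1/(8*n^2)\<close>, less than the squared radius
   \<open>1/(4*n^2)\<close> of the inscribed ball in simplex coordinates, so the maximum of
   \<open>w\<close> lies in the interior of the ellipsoid.\<close>
 define \<beta> where "\<beta> = 8*?n^2*h"
 have \<beta>: "0 < \<beta>" using h n1 by (simp add: \<beta>_def)
 have invE: "invertible E" using dE by (simp add: invertible_det_nz)
 define I where "I = matrix_inv E"
 have EI: "E ** I = mat 1" "I ** E = mat 1" using someI_ex[OF invE[unfolded invertible_def]] by (simp_all add: I_def matrix_inv_def)
 \<comment> \<open>In simplex coordinates the ball of radius \<open>1/(2*n)\<close> about
   \<open>ec\<close> stays in the cube with sides from 0 to \<open>1/n\<close>, hence in the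
   simplex.\<close>
 define ec :: "real^'n" where "ec = (\<chi> i. 1/(2*?n))"
 define xc where "xc = v + E *v ec"
 have mem: "v + E *v e \<in> D" if "norm (e - ec) <= 1/(2*?n)" for e
 proof (rule simplex_coordinates_mem[OF D(1,3,4)])
  have ci: "\<bar>e $ i - 1/(2*?n)\<bar> <= 1/(2*?n)" for i using component_le_norm_cart[of "e - ec" i] that by (simp add: ec_def)
  have ei: "0 <= e $ i & e $ i <= 1/?n" for i
  proof -
   have "1/?n = 1/(2*?n) + 1/(2*?n)" by simp
   thus ?thesis using ci[of i] by linarith
  qed
  thus "0 <= e $ i" for i by blast
  have "(\<Sum>i\<in>UNIV. e $ i) <= (\<Sum>i\<in>(UNIV::'n set). 1/?n)" using ei by (intro sum_mono) blast
  thus "(\<Sum>i\<in>UNIV. e $ i) <= 1" by simp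
 qed
 define N where "N = transpose I ** I"
 have tN: "transpose N = N" by (simp add: N_def matrix_transpose_mul)
 define Q where "Q x = (x - xc) \<bullet> (N *v (x - xc))" for x
 have Qn: "Q x = (norm (I *v (x - xc)))^2" for x
  by (simp only: Q_def N_def matrix_vector_mul_assoc[symmetric] inner_transpose transpose_transpose power2_norm_eq_inner)
 have xI: "x = v + E *v (ec + I *v (x - xc))" for x
  by (simp add: xc_def matrix_vector_right_distrib matrix_vector_mul_assoc EI matrix_vector_mult_diff_distrib)
 define K where "K = (%e. v + E *v e) ` cball ec (1/(2*?n))"
 have cK: "compact K" unfolding K_def
  by (intro compact_continuous_image continuous_intros linear_continuous_on matrix_vector_mul_bounded_linear compact_cball)
 have KD: "K \<subseteq> D" using mem by (auto simp: K_def dist_norm norm_minus_commute)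
 have KI: "x \<in> K" if "norm (I *v (x - xc)) <= 1/(2*?n)" for x
  unfolding K_def by (rule image_eqI[where x="ec + I *v (x - xc)"]) (rule xI, use that in \<open>simp add: dist_norm\<close>)
 define w where "w x = phi x - (a + b \<bullet> x) - \<beta>*Q x" for x
 note c = MA_D(4)[OF M] and op = MA_D(1)[OF M]
 have cw: "c2_on S w (%x. g x - b - \<beta> *\<^sub>R (2 *\<^sub>R (N *v (x - xc)))) (%x. A x - 0 - \<beta> *\<^sub>R (2 *\<^sub>R N))"
  unfolding w_def[abs_def] Q_def[abs_def] by (intro c2_on_diff c2_on_scale c c2_on_affine[OF op] c2_on_quadratic[OF op tN])
 have "continuous_on K w" using c2_on_continuous(1)[OF cw] KD D(2) by (meson continuous_on_subset subset_trans)
 moreover have xcK: "xc \<in> K" using KI[of xc] by simp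
 ultimately obtain x where x: "x \<in> K" and xm: "!!y. y \<in> K ==> w y <= w x" using continuous_attains_sup[OF cK] by blast
 have "0 <= w xc" using h(2)[of xc] xcK KD by (auto simp: w_def Q_def)
 hence wx: "0 <= w x" using xm[OF xcK] by linarith
 have "\<beta>*Q x <= h" using wx h(2)[of x] x KD by (auto simp: w_def)
 hence "Q x <= h/\<beta>" using \<beta> by (simp add: field_simps)
 also have "h/\<beta> = 1/(8*?n^2)" using h by (simp add: \<beta>_def)
 also have "... < (1/(2*?n))^2" using n1 by (simp add: power2_eq_square field_simps)
 finally have Ilt: "norm (I *v (x - xc)) < 1/(2*?n)" unfolding Qn using power2_less_imp_less[of _ "1/(2*?n)"] by simp
 define T where "T = {y. norm (I *v (y - xc)) < 1/(2*?n)}"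
 have T: "open T" unfolding T_def by (intro open_Collect_less continuous_on_norm continuous_on_const
   continuous_on_compose2[OF linear_continuous_on[OF matrix_vector_mul_bounded_linear, of UNIV]]
   continuous_intros) auto
 have xS: "x \<in> S" using x KD D(2) by blast
 have "z \<bullet> ((A x - 0 - \<beta> *\<^sub>R (2 *\<^sub>R N)) *v z) <= 0" for z
  by (rule local_max_test(2)[OF cw xS T]) (use Ilt xm KI in \<open>auto simp: T_def less_imp_le\<close>)
 hence le: "z \<bullet> (A x *v z) <= 2*\<beta>*(z \<bullet> (N *v z))" for z
  by (simp add: matrix_vector_mult_diff_rdistrib matrix_vector_scaleR inner_diff_right algebra_simps)
 have dI: "det I = 1/det E" using arg_cong[OF EI(1), of det] dE by (simp add: det_mul field_simps)
 define B where "B = (2*\<beta>) *\<^sub>R N"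
 have zN: "z \<bullet> (N *v z) = (norm (I *v z))^2" for z
  by (simp only: N_def matrix_vector_mul_assoc[symmetric] inner_transpose transpose_transpose power2_norm_eq_inner)
 have pB: "psd B" using \<beta> by (simp add: psd_def B_def transpose_scale tN matrix_vector_scaleR zN)
 have dB: "det B = (2*\<beta>)^CARD('n)/(det E)^2" by (simp add: B_def N_def det_scaleR det_mul dI power2_eq_square)
 have "0 < det B" unfolding dB using \<beta> dE by simp
 moreover have "psd (B - A x)" using le MA_D(9)[OF M xS] pB by (simp add: psd_def transpose_diff matrix_vector_mult_diff_rdistrib inner_diff_right)
   (simp add: B_def matrix_vector_scaleR)
 ultimately have "det (A x) <= det B" using psd_det_mono[OF pB _ MA_D(9)[OF M xS]] by blast
 hence "l <= (2*\<beta>)^CARD('n)/(det E)^2" using MA_D(6)[OF M xS] dB by linarith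
 thus ?thesis using dE by (simp add: \<beta>_def field_simps)
qed

lemma measure_cbox_cart:
 fixes lo hi :: "real^'n::finite"
 assumes "!!i. lo $ i <= hi $ i"
 shows "vol (cbox lo hi) = (\<Prod>i\<in>UNIV. hi $ i - lo $ i)"
proof -
 have E: "(Basis :: (real^'n) set) = range (%j. axis j 1)" by (auto simp: Basis_vec_def)
 have "vol (cbox lo hi) = (\<Prod>b\<in>Basis. (hi - lo) \<bullet> b)"
  using assms by (subst measure_completion) (auto simp: measure_lborel_cbox_eq E inner_axis)
 also have "... = (\<Prod>i\<in>UNIV. hi $ i - lo $ i)" unfolding E by (subst prod.reindex) (auto simp: inj_on_def axis_eq_axis inner_axis)
 finally show ?thesis .
qed

text \<open>A lower bound for the volume of a polar body that improves when the base point is close to the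
 boundary in the direction \<open>xi\<close>.\<close>

lemma slope_set_measure:
 fixes E :: "real^'n^'n::finite"
 assumes dE: "det E ~= 0"
  and D: "!!x. x \<in> D ==> EX e. x - p = E *v e & (ALL i. \<bar>e $ i\<bar> <= 2)"
  and r: "0 <= r" "!!x. x \<in> D ==> xi \<bullet> p - xi \<bullet> x <= r"
  and R: "0 <= R" "R*r <= m/2" and m: "0 < m"
  and k: "(transpose E *v xi) $ k ~= 0"
 obtains P where "P \<in> lmeasurable" "!!\<pi> x. \<pi> \<in> P ==> x \<in> D ==> \<pi> \<bullet> (x - p) < m"
  "vol P = \<bar>(transpose E *v xi) $ k\<bar>*R*(m/(4*real CARD('n)))^(CARD('n) - 1)/\<bar>det E\<bar>"
proof -
 let ?n = "real CARD('n)"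
 define eta where "eta = transpose E *v xi"
 define d where "d = m/(8*?n)"
 have d: "0 < d" using m by (simp add: d_def)
 \<comment> \<open>Slopes are parametrized by a box, thin in all directions but \<open>k\<close> and
   of length \<open>R\<close> on the negative side in direction \<open>k\<close>, whose basis vector
   is replaced by \<open>eta\<close>. Negative multiples of \<open>xi\<close> are cheap, since on
   \<open>D\<close> the value of \<open>xi\<close> drops by at most \<open>r\<close> below that at
   \<open>p\<close>.\<close>
 define lo :: "real^'n" where "lo = (\<chi> j. if j = k then - R else - d)"
 define hi :: "real^'n" where "hi = (\<chi> j. if j = k then 0 else d)"
 define T :: "real^'n^'n" where "T = (\<chi> i j. if j = k then eta $ i else (mat 1 :: real^'n^'n) $ i $ j)"
 define J where "J = transpose (matrix_inv E)"
 have invE: "invertible E" using dE by (simp add: invertible_det_nz)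
 have EI: "E ** matrix_inv E = mat 1" "matrix_inv E ** E = mat 1" using someI_ex[OF invE[unfolded invertible_def]] by (simp_all add: matrix_inv_def)
 have dT: "det T = eta $ k" using cramer_lemma[of k "mat 1 :: real^'n^'n" eta] by (simp only: T_def matrix_vector_mul_lid det_I mult_1_right)
 have "det (matrix_inv E)*det E = 1" using arg_cong[OF EI(2), of det] by (simp add: det_mul)
 hence dJ: "det J = 1/det E" using dE by (simp add: J_def field_simps)
 have dJT: "det (J ** T) = eta $ k/det E" by (simp add: det_mul dT dJ)
 have dnz: "det (J ** T) ~= 0" unfolding dJT using k dE by (simp add: eta_def)
 define P where "P = (%x. (J ** T) *v x) ` cbox lo hi"
 have Pm: "vol P = \<bar>det (J ** T)\<bar> * vol (cbox lo hi)" and PL: "P \<in> lmeasurable"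
  unfolding P_def using measure_linear_image_vec[of "cbox lo hi" "J ** T"] dnz by auto
 have le: "lo $ i <= hi $ i" for i using R d by (simp add: lo_def hi_def)
 have "(\<Prod>i\<in>UNIV. hi $ i - lo $ i) = (\<Prod>i\<in>UNIV. if i = k then R else 2*d)" by (rule prod.cong) (auto simp: lo_def hi_def)
 also have "... = R*(\<Prod>i\<in>UNIV - {k}. if i = k then R else 2*d)" by (subst prod.remove[of _ k]) auto
 also have "(\<Prod>i\<in>UNIV - {k}. if i = k then R else 2*d) = (\<Prod>i\<in>UNIV - {k}. 2*d)" by (rule prod.cong) auto
 finally have pr: "(\<Prod>i\<in>UNIV. hi $ i - lo $ i) = R*(2*d)^(CARD('n) - 1)" by (simp add: card_Diff_singleton)
 have "vol P = \<bar>eta $ k/det E\<bar>*(R*(2*d)^(CARD('n) - 1))" unfolding Pm dJT measure_cbox_cart[OF le] pr ..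
 hence meas: "vol P = \<bar>eta $ k\<bar>*R*(m/(4*?n))^(CARD('n) - 1)/\<bar>det E\<bar>" by (simp add: d_def)
 have bound: "\<pi> \<bullet> (x - p) < m" if "\<pi> \<in> P" "x \<in> D" for \<pi> x
 proof -
  obtain b where b: "b \<in> cbox lo hi" "\<pi> = J *v (T *v b)" using \<open>\<pi> \<in> P\<close> by (auto simp: P_def matrix_vector_mul_assoc)
  obtain e where e: "x - p = E *v e" "!!i. \<bar>e $ i\<bar> <= 2" using D[OF \<open>x \<in> D\<close>] by blast
  have "\<pi> \<bullet> (x - p) = (transpose E *v (J *v (T *v b))) \<bullet> e" unfolding b(2) e(1) by (rule inner_transpose)
  also have "transpose E *v (J *v (T *v b)) = T *v b"
  proof -
   have "transpose E ** J = mat 1" unfolding J_def matrix_transpose_mul[symmetric] EI(2) by (simp add: transpose_mat)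
   thus ?thesis by (simp only: matrix_vector_mul_assoc[of "transpose E" J] matrix_vector_mul_lid)
  qed
  also have "T *v b = (\<chi> i. if i = k then 0 else b $ i) + b $ k *\<^sub>R eta"
  proof -
   have "(T *v b) $ i = (if i = k then 0 else b $ i) + b $ k*eta $ i" for i
   proof -
    have "(T *v b) $ i = (\<Sum>j\<in>UNIV. (if j = k then b $ k*eta $ i else if j = i then b $ i else 0))"
     unfolding matrix_vector_mult_def by (simp, rule sum.cong) (auto simp: T_def mat_def)
    also have "... = b $ k*eta $ i + (\<Sum>j\<in>UNIV - {k}. if j = k then b $ k*eta $ i else if j = i then b $ i else 0)"
     by (subst sum.remove[of _ k]) auto
    also have "(\<Sum>j\<in>UNIV - {k}. if j = k then b $ k*eta $ i else if j = i then b $ i else 0)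
      = (\<Sum>j\<in>UNIV - {k}. if j = i then b $ i else 0)" by (rule sum.cong) auto
    finally show ?thesis by simp
   qed
   thus ?thesis by (simp add: vec_eq_iff)
  qed
  also have "((\<chi> i. if i = k then 0 else b $ i) + b $ k *\<^sub>R eta) \<bullet> e
    = (\<Sum>i\<in>UNIV. (if i = k then 0 else b $ i)*e $ i) + b $ k*(eta \<bullet> e)"
   by (simp only: inner_add_left inner_scaleR_left) (simp add: inner_vec_def)
  also have "(\<Sum>i\<in>UNIV. (if i = k then 0 else b $ i)*e $ i) <= (\<Sum>i\<in>(UNIV::'n set). 2*d)"
  proof (rule sum_mono)
   fix i
   have "(if i = k then 0 else b $ i)*e $ i <= \<bar>if i = k then 0 else b $ i\<bar>*\<bar>e $ i\<bar>"
    using abs_ge_self[of "(if i = k then 0 else b $ i)*e $ i"] by (simp add: abs_mult)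
   also have "... <= d*2"
   proof (rule mult_mono[OF _ e(2)])
    show "\<bar>if i = k then 0 else b $ i\<bar> <= d"
    proof (cases "i = k")
     case False
     have "lo $ i <= b $ i & b $ i <= hi $ i" using b(1) by (simp add: mem_box_cart)
     thus ?thesis using False by (simp add: lo_def hi_def abs_le_iff)
    qed (use d in simp)
   qed (use d in auto)
   finally show "(if i = k then 0 else b $ i)*e $ i <= 2*d" by simp
  qed
  also have "(\<Sum>i\<in>(UNIV::'n set). 2*d) = m/4" by (simp add: d_def)
  also have "b $ k*(eta \<bullet> e) <= m/2"
  proof -
   have "eta \<bullet> e = xi \<bullet> (E *v e)" by (simp add: eta_def inner_transpose)
   hence ee: "eta \<bullet> e = - (xi \<bullet> p - xi \<bullet> x)" by (simp add: e(1)[symmetric] inner_diff_right)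
   have "lo $ k <= b $ k & b $ k <= hi $ k" using b(1) by (simp add: mem_box_cart)
   hence bk: "0 <= - b $ k" "- b $ k <= R" by (auto simp: lo_def hi_def)
   have "b $ k*(eta \<bullet> e) = (- b $ k)*(xi \<bullet> p - xi \<bullet> x)" by (simp add: ee right_diff_distrib)
   also have "... <= (- b $ k)*r" using bk r(2)[OF \<open>x \<in> D\<close>] by (intro mult_left_mono) auto
   also have "... <= R*r" using bk r by (intro mult_right_mono) auto
   finally show ?thesis using R by linarith
  qed
  finally show ?thesis using m by simp
 qed
 show thesis by (rule that[OF PL bound meas[unfolded eta_def]])
qed

text \<open>The cutting plane is arbitrary rather than a raised tangent plane, because tilted planes
  occur in the proof of \<open>csec_strict_interior\<close>.\<close>

definition sublev :: "'a::real_inner set => ('a => real) => real => 'a => 'a set" where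
 "sublev S phi a b = {x \<in> S. phi x <= a + b \<bullet> x}"

lemma sublev_convex:
 assumes "convex S" "convex_on S phi"
 shows "convex (sublev S phi a b)"
proof (rule convexI)
 fix x y and u v :: real
 assume xy: "x \<in> sublev S phi a b" "y \<in> sublev S phi a b" and uv: "0 <= u" "0 <= v" "u + v = 1"
 have "phi (u *\<^sub>R x + v *\<^sub>R y) <= u*phi x + v * phi y" using xy uv assms(2) by (auto simp: sublev_def convex_on_def)
 also have "... <= u*(a + b \<bullet> x) + v * (a + b \<bullet> y)" using xy uv by (intro add_mono mult_left_mono) (auto simp: sublev_def)
 also have "... = (u + v)*a + b \<bullet> (u *\<^sub>R x + v *\<^sub>R y)" by (simp add: inner_add_right algebra_simps)
 finally show "u *\<^sub>R x + v *\<^sub>R y \<in> sublev S phi a b" using xy uv assms(1) by (simp add: sublev_def convexD)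
qed

lemma sublev_interior:
 assumes M: "MA l L S phi g A"
 shows "open {x \<in> S. phi x < a + b \<bullet> x}"
proof -
 have "continuous_on S (%x. phi x - (a + b \<bullet> x))" using c2_on_continuous(1)[OF MA_D(4)[OF M]] by (intro continuous_intros)
 hence "open (S \<inter> (%x. phi x - (a + b \<bullet> x)) -` {..<0})" using MA_D(1)[OF M] by (intro continuous_open_preimage) auto
 moreover have "S \<inter> (%x. phi x - (a + b \<bullet> x)) -` {..<0} = {x \<in> S. phi x < a + b \<bullet> x}" by auto
 ultimately show ?thesis by simp
qed

text \<open>Subtract from \<open>phi\<close> the cutting plane and the linear function of slope
  \<open>\<pi>\<close> vanishing at \<open>p\<close>. The result is at most \<open>-m\<close> at
  \<open>p\<close>, so at its minimum \<open>phi\<close> lies strictly below the cutting plane; the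
  minimum is interior and its gradient vanishes.\<close>

lemma slope_set_le:
 fixes S :: "(real^'n::finite) set"
 assumes M: "MA l L S phi g A" and D: "compact (sublev S phi a b)" "p \<in> sublev S phi a b"
  and m: "m <= a + b \<bullet> p - phi p"
  and P: "P \<in> lmeasurable" "!!\<pi> x. \<pi> \<in> P ==> x \<in> sublev S phi a b ==> \<pi> \<bullet> (x - p) < m"
 shows "vol P <= L * vol (sublev S phi a b)"
proof -
 let ?D = "sublev S phi a b"
 note c = MA_D(4)[OF M] and op = MA_D(1)[OF M]
 have DS: "?D \<subseteq> S" by (auto simp: sublev_def)
 define w where "w x = phi x - (a + b \<bullet> x)" for x
 have cw: "c2_on S w (%x. g x - b) (%x. A x - 0)" unfolding w_def[abs_def] by (intro c2_on_diff c c2_on_affine[OF op])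
 have im: "\<pi> \<in> (%x. g x - b) ` ?D" if \<pi>: "\<pi> \<in> P" for \<pi>
 proof -
  define f where "f x = w x - ((- (\<pi> \<bullet> p)) + \<pi> \<bullet> x)" for x
  have cf: "c2_on S f (%x. (g x - b) - \<pi>) (%x. A x - 0 - 0)" unfolding f_def[abs_def] by (intro c2_on_diff cw c2_on_affine[OF op])
  have "continuous_on ?D f" by (rule continuous_on_subset[OF c2_on_continuous(1)[OF cf] DS])
  then obtain x where x: "x \<in> ?D" and xm: "!!y. y \<in> ?D ==> f x <= f y" using continuous_attains_inf[OF D(1)] D(2) by blast
  have "f x <= - m" using xm[OF D(2)] m by (simp add: f_def w_def)
  hence "w x <= \<pi> \<bullet> (x - p) - m" by (simp add: f_def inner_diff_right)
  hence "w x < 0" using P(2)[OF \<pi> x] by linarith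
  hence xT: "x \<in> {x \<in> S. phi x < a + b \<bullet> x}" using x by (auto simp: w_def sublev_def)
  have "c2_on S (%x. (-1)*f x) (%x. (-1) *\<^sub>R ((g x - b) - \<pi>)) (%x. (-1) *\<^sub>R (A x - 0 - 0))" by (rule c2_on_scale[OF cf])
  from local_max_test(1)[OF this _ sublev_interior[OF M] xT] xT xm
  have "(-1) *\<^sub>R ((g x - b) - \<pi>) = 0" by (auto simp: sublev_def less_imp_le)
  thus ?thesis using x by (auto intro!: image_eqI[of _ _ x])
 qed
 have DL: "?D \<in> sets lebesgue" using lmeasurable_compact[OF D(1)] by (rule fmeasurableD)
 have "vol P <= L * vol ?D + integral ?D (%x. 0)"
 proof (rule gradient_image_measure[OF cw D(1) DS DL subset_refl, where ?B2.0="{}"])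
  show "P \<subseteq> (%x. g x - b) ` (?D \<union> {})" using im by auto
  show "\<bar>det (A x - 0)\<bar> <= L" if "x \<in> ?D" for x using MA_D(7,8)[OF M, of x] that DS by (auto simp: abs_of_pos)
 qed (use P in auto)
 thus ?thesis by simp
qed

lemma unit_box_image_measure:
 fixes E :: "real^'n^'n::finite"
 assumes dE: "det E ~= 0" and s: "0 <= s"
 shows "(%e. v + E *v e) ` cbox (\<chi> i. c) (\<chi> i. c + s) \<in> lmeasurable"
  "vol ((%e. v + E *v e) ` cbox (\<chi> i. c) (\<chi> i. c + s)) = \<bar>det E\<bar> * s^CARD('n)"
proof -
 have L: "(%e. E *v e) ` cbox (\<chi> i. c) (\<chi> i. c + s) \<in> lmeasurable" by (rule measure_linear_image_vec(1)) auto
 have eq: "(%e. v + E *v e) ` cbox (\<chi> i. c) (\<chi> i. c + s) = (+) v ` ((%e. E *v e) ` cbox (\<chi> i. c) (\<chi> i. c + s))"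
  by (simp add: image_image)
 show "(%e. v + E *v e) ` cbox (\<chi> i. c) (\<chi> i. c + s) \<in> lmeasurable" unfolding eq by (rule measurable_translation[OF L])
 show "vol ((%e. v + E *v e) ` cbox (\<chi> i. c) (\<chi> i. c + s)) = \<bar>det E\<bar> * s^CARD('n)" unfolding eq measure_translation
  using measure_linear_image_vec(2)[OF _ dE, of "cbox (\<chi> i. c) (\<chi> i. c + s)"] s
   measure_cbox_cart[of "\<chi> i. c" "(\<chi> i. c + s) :: real^'n"] by simp
qed

text \<open>The section contains a cube of the simplex coordinates and lies in a larger one, so its
  volume is comparable to \<open>det E\<close>, which \<open>simplex_volume_upper\<close> bounds in
  terms of the height.\<close>

lemma sublev_simplex:
 fixes S :: "(real^'n::finite) set"
 assumes M: "MA l L S phi g A" and D: "compact (sublev S phi a b)" "p \<in> sublev S phi a b"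
  and m: "0 < a + b \<bullet> p - phi p" and H: "!!x. x \<in> sublev S phi a b ==> a + b \<bullet> x - phi x <= H"
 obtains E :: "real^'n^'n"
 where "det E ~= 0" "!!x y. x \<in> sublev S phi a b ==> y \<in> sublev S phi a b ==> EX e. x - y = E *v e & (ALL i. \<bar>e $ i\<bar> <= 2)"
  "l*(det E)^2 <= (16*(real CARD('n))^2*H)^CARD('n)"
  "vol (sublev S phi a b) <= 2^CARD('n)*\<bar>det E\<bar>"
  "\<bar>det E\<bar>*(1/real CARD('n))^CARD('n) <= vol (sublev S phi a b)"
proof -
 let ?D = "sublev S phi a b" and ?n = "real CARD('n)"
 have DS: "?D \<subseteq> S" by (auto simp: sublev_def)
 have cv: "convex ?D" by (rule sublev_convex[OF MA_D(2,3)[OF M]])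
 have pT: "p \<in> {x \<in> S. phi x < a + b \<bullet> x}" using D(2) m by (auto simp: sublev_def)
 then obtain r where r: "0 < r" "ball p r \<subseteq> {x \<in> S. phi x < a + b \<bullet> x}" using sublev_interior[OF M] openE by blast
 hence bp: "ball p r \<subseteq> ?D" by (auto simp: sublev_def)
 obtain v E where E: "det E ~= 0" "v \<in> ?D" "!!i. v + column i E \<in> ?D"
  "!!x. x \<in> ?D ==> EX e. x = v + E *v e & (ALL i. \<bar>e $ i\<bar> <= 1)" by (rule maximal_simplex[OF D(1) bp r(1)]) (rule that; assumption)
 have DL: "?D \<in> lmeasurable" by (rule lmeasurable_compact[OF D(1)])
 show thesis
 proof (rule that[OF E(1)])
  fix x y assume "x \<in> ?D" "y \<in> ?D"
  from E(4)[OF this(1)] E(4)[OF this(2)] obtain e f where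
   ef: "x = v + E *v e" "!!i. \<bar>e $ i\<bar> <= 1" "y = v + E *v f" "!!i. \<bar>f $ i\<bar> <= 1" by blast
  have "x - y = E *v (e - f)" by (simp add: ef matrix_vector_mult_diff_distrib)
  moreover have "\<bar>(e - f) $ i\<bar> <= 2" for i using ef(2)[of i] ef(4)[of i] abs_triangle_ineq4[of "e $ i" "f $ i"] by simp
  ultimately show "EX e. x - y = E *v e & (ALL i. \<bar>e $ i\<bar> <= 2)" by blast
 next
  have Hp: "0 < H" using H[OF D(2)] m by linarith
  have "l*(det E)^2 <= (16*?n^2*H)^CARD('n)"
  proof (rule simplex_volume_upper[OF M E(1) cv DS E(2,3) Hp])
   fix x assume "x \<in> ?D"
   thus "0 <= phi x - ((a - H) + b \<bullet> x) & phi x - ((a - H) + b \<bullet> x) <= H" using H[of x] by (auto simp: sublev_def)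
  qed
  thus "l*(det E)^2 <= (16*?n^2*H)^CARD('n)" .
  have "?D \<subseteq> (%e. v + E *v e) ` cbox (\<chi> i. - 1) (\<chi> i. - 1 + 2)"
  proof
   fix x assume "x \<in> ?D"
   from E(4)[OF this] obtain e where "x = v + E *v e" "!!i. \<bar>e $ i\<bar> <= 1" by blast
   thus "x \<in> (%e. v + E *v e) ` cbox (\<chi> i. - 1) (\<chi> i. - 1 + 2)"
    by (intro image_eqI[of _ _ e]) (auto simp: mem_box_cart abs_le_iff minus_le_iff)
  qed
  from measure_mono_fmeasurable[OF this fmeasurableD[OF DL] unit_box_image_measure(1)[OF E(1)]]
  show "vol ?D <= 2^CARD('n)*\<bar>det E\<bar>" unfolding unit_box_image_measure(2)[OF E(1), of 2, simplified] by (simp add: mult.commute)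
  have "(%e. v + E *v e) ` cbox (\<chi> i. 0) (\<chi> i. 0 + 1/?n) \<subseteq> ?D"
  proof
   fix x assume "x \<in> (%e. v + E *v e) ` cbox (\<chi> i. 0) (\<chi> i. 0 + 1/?n)"
   then obtain e :: "real^'n" where e: "x = v + E *v e" "!!i. 0 <= e $ i" "!!i. e $ i <= 1/?n" by (auto simp: mem_box_cart)
   have "(\<Sum>i\<in>UNIV. e $ i) <= (\<Sum>i\<in>(UNIV::'n set). 1/?n)" using e by (intro sum_mono) blast
   hence "(\<Sum>i\<in>UNIV. e $ i) <= 1" by simp
   thus "x \<in> ?D" unfolding e(1) by (intro simplex_coordinates_mem[OF cv E(2,3)] e)
  qed
  from measure_mono_fmeasurable[OF this fmeasurableD[OF unit_box_image_measure(1)[OF E(1)]] DL]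
  show "\<bar>det E\<bar>*(1/?n)^CARD('n) <= vol ?D" unfolding unit_box_image_measure(2)[OF E(1), of "1/?n", simplified] by simp
 qed
qed

text \<open>An affinely invariant form of Aleksandrov's maximum principle: relative depth
  \<open>m/H\<close> guarantees a definite fraction of the width of the section in every direction.
  If \<open>p\<close> were closer to a supporting plane, long slopes normal to that plane would make
  the slope set larger than \<open>slope_set_le\<close> allows.\<close>

lemma aleksandrov_estimate:
 fixes l L :: real
 assumes l: "0 < l" "l <= L"
 shows "EX c>0. c <= 1 & (ALL (S :: (real^'n::finite) set) phi g A a b p m H ka xi z.
  MA l L S phi g A & compact (sublev S phi a b) & p \<in> sublev S phi a b & 0 < m &
  m <= a + b \<bullet> p - phi p & (ALL x:sublev S phi a b. a + b \<bullet> x - phi x <= H) &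
  (ALL x:sublev S phi a b. ka <= xi \<bullet> x) & z \<in> sublev S phi a b -->
  c*(m/H)^CARD('n)*(xi \<bullet> z - ka) <= xi \<bullet> p - ka)"
proof -
 let ?n = "real CARD('n)" and ?N = "CARD('n)"
 define C where "C = 2*L*2^?N*(16*?n^2)^?N*(4*?n)^(?N - 1)/l"
 have C: "0 < C" using l by (simp add: C_def)
 define c where "c = 1/(1 + 2*?n*C)"
 have den: "0 < 1 + 2*?n*C" using C by (simp add: add_pos_pos)
 have c: "0 < c" "c <= 1" using C by (simp_all add: c_def add_pos_pos)
 have main: "c*(m/H)^?N*(xi \<bullet> z - ka) <= xi \<bullet> p - ka"
  if M: "MA l L S phi g A" and D: "compact (sublev S phi a b)" "p \<in> sublev S phi a b" and m: "0 < m"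
   "m <= a + b \<bullet> p - phi p" and H: "!!x. x \<in> sublev S phi a b ==> a + b \<bullet> x - phi x <= H"
   and k: "!!x. x \<in> sublev S phi a b ==> ka <= xi \<bullet> x" and z: "z \<in> sublev S phi a b"
  for S :: "(real^'n) set" and phi g A a b p m H ka xi z
 proof -
  let ?D = "sublev S phi a b"
  have mH: "m <= H" using H[OF D(2)] m by linarith
  have m0: "0 < a + b \<bullet> p - phi p" using m by linarith
  obtain E :: "real^'n^'n" where E: "det E ~= 0"
   "!!x y. x \<in> ?D ==> y \<in> ?D ==> EX e. x - y = E *v e & (ALL i. \<bar>e $ i\<bar> <= 2)"
   "l*(det E)^2 <= (16*?n^2*H)^?N"
   "vol ?D <= 2^?N*\<bar>det E\<bar>" by (rule sublev_simplex[OF M D(1,2) m0 H]) ((rule that)?; assumption)+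
  define eta where "eta = transpose E *v xi"
  \<comment> \<open>The largest component of \<open>E^T xi\<close> measures the width of the section
    in direction \<open>xi\<close> up to a factor of the dimension, and it is the factor that
    appears in the volume of the slope set.\<close>
  obtain i where i: "!!j. \<bar>eta $ j\<bar> <= \<bar>eta $ i\<bar>"
  proof -
   have "Max (range (%j. \<bar>eta $ j\<bar>)) \<in> range (%j. \<bar>eta $ j\<bar>)" by (rule Max_in) auto
   then obtain i where "Max (range (%j. \<bar>eta $ j\<bar>)) = \<bar>eta $ i\<bar>" by blast
   moreover have "\<bar>eta $ j\<bar> <= Max (range (%j. \<bar>eta $ j\<bar>))" for j by (rule Max_ge) auto
   ultimately show thesis by (intro that) simp
  qed
  define w where "w = \<bar>eta $ i\<bar>"
  have zw: "xi \<bullet> z - xi \<bullet> p <= 2*?n*w"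
  proof -
   obtain e where e: "z - p = E *v e" "!!i. \<bar>e $ i\<bar> <= 2" using E(2)[OF z D(2)] by blast
   have "xi \<bullet> z - xi \<bullet> p = eta \<bullet> e" by (simp add: inner_diff_right[symmetric] e(1) inner_transpose eta_def)
   also have "... <= (\<Sum>j\<in>(UNIV::'n set). w*2)" unfolding inner_vec_def
   proof (rule sum_mono)
    fix j
    have "eta $ j \<bullet> e $ j <= \<bar>eta $ j\<bar>*\<bar>e $ j\<bar>" using abs_ge_self[of "eta $ j*e $ j"] by (simp add: abs_mult)
    also have "... <= w*2" using i e(2) by (intro mult_mono) (auto simp: w_def)
    finally show "eta $ j \<bullet> e $ j <= w*2" .
   qed
   finally show ?thesis by simp
  qed
  have mh: "0 < m/H" "m/H <= 1" using m mH by auto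
  have p1: "0 < (m/H)^?N" "(m/H)^?N <= 1" using mh by (auto intro: power_le_one)
  \<comment> \<open>Every positive \<open>r\<close> above \<open>xi \<bullet> p - ka\<close> is
    allowed, since this distance may a priori vanish; the limit is taken at the end.\<close>
  have wr: "w*(m/H)^?N <= C*r" if r: "xi \<bullet> p - ka <= r" "0 < r" for r
  proof (cases "w = 0")
   case True thus ?thesis using r C by simp
  next
   case False
   define R where "R = m/(2*r)"
   have R: "0 <= R" "R*r <= m/2" using r m by (auto simp: R_def)
   have nz: "(transpose E *v xi) $ i ~= 0" using False by (simp add: w_def eta_def)
   have rr: "xi \<bullet> p - xi \<bullet> x <= r" if "x \<in> ?D" for x using k[OF that] r by linarith
   obtain P where P: "P \<in> lmeasurable" "!!\<pi> x. \<pi> \<in> P ==> x \<in> ?D ==> \<pi> \<bullet> (x - p) < m"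
    "vol P = \<bar>(transpose E *v xi) $ i\<bar>*R*(m/(4*?n))^(?N - 1)/\<bar>det E\<bar>"
    by (rule slope_set_measure[OF E(1) E(2)[OF _ D(2)] less_imp_le[OF r(2)] rr R m(1) nz])
     ((rule that)?; assumption)+
   have "w*R*(m/(4*?n))^(?N - 1)/\<bar>det E\<bar> <= L * vol ?D" using slope_set_le[OF M D m(2) P(1,2)] P(3) by (simp add: w_def eta_def)
   also have "... <= L*(2^?N*\<bar>det E\<bar>)" using E(4) l by (intro mult_left_mono) auto
   finally have "w*R*(m/(4*?n))^(?N - 1) <= L*2^?N*(det E)^2" using E(1) by (simp add: field_simps power2_eq_square abs_mult_self_eq)
   also have "... <= L*2^?N*((16*?n^2*H)^?N/l)" using E(3) l by (intro mult_left_mono) (auto simp: field_simps)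
   finally have a1: "w*R*(m/(4*?n))^(?N - 1) <= L*2^?N*((16*?n^2*H)^?N/l)" .
   have "m^?N = m*m^(?N - 1)" by (simp add: power_eq_if)
   hence "w*m^?N = (w*R*(m/(4*?n))^(?N - 1))*(2*r*(4*?n)^(?N - 1))" using r by (simp add: R_def power_divide)
   also have "... <= (L*2^?N*((16*?n^2*H)^?N/l))*(2*r*(4*?n)^(?N - 1))" using a1 r by (intro mult_right_mono) auto
   also have "... = C*r*H^?N" by (simp add: C_def power_mult_distrib)
   finally show ?thesis using mH m by (simp add: power_divide field_simps)
  qed
  have "(m/H)^?N*(xi \<bullet> z - ka) <= (1 + 2*?n*C)*r" if r: "xi \<bullet> p - ka <= r" "0 < r" for r
  proof -
   have "(m/H)^?N*(xi \<bullet> z - ka) <= (m/H)^?N*(r + 2*?n*w)" using zw r p1 by (intro mult_left_mono) auto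
   also have "... = (m/H)^?N*r + 2*?n*(w*(m/H)^?N)" by (simp add: algebra_simps)
   also have "... <= 1*r + 2*?n*(C*r)" using p1 r wr[OF r] by (intro add_mono mult_right_mono mult_left_mono) auto
   finally show ?thesis by (simp add: algebra_simps)
  qed
  note bd = this
  have "c*(m/H)^?N*(xi \<bullet> z - ka) <= (xi \<bullet> p - ka) + e" if e: "0 < e" for e
  proof -
   have "0 < xi \<bullet> p - ka + e" using k[OF D(2)] e by linarith
   from bd[OF _ this] e have "(m/H)^?N*(xi \<bullet> z - ka) <= (1 + 2*?n*C)*(xi \<bullet> p - ka + e)" by simp
   hence "c*((m/H)^?N*(xi \<bullet> z - ka)) <= c*((1 + 2*?n*C)*(xi \<bullet> p - ka + e))" using c by (intro mult_left_mono) auto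
   also have "... = xi \<bullet> p - ka + e" using den by (simp add: c_def)
   finally show ?thesis by (simp add: mult.assoc)
  qed
  thus ?thesis by (rule field_le_epsilon)
 qed
 show ?thesis by (rule exI[of _ c]) (use c main in blast)
qed

text \<open>The upper bound is that of the maximal simplex. For the lower bound the slope set is a
  parallelepiped dual to the simplex, of volume about \<open>m^n/det E\<close>, which cannot exceed
  \<open>L\<close> times the volume of the section.\<close>

lemma sublev_volume:
 fixes l L :: real
 assumes l: "0 < l" "l <= L"
 shows "EX c C. 0 < c & 0 < C & (ALL (S :: (real^'n::finite) set) phi g A a b p m H.
  MA l L S phi g A & compact (sublev S phi a b) & p \<in> sublev S phi a b & 0 < m &
  m <= a + b \<bullet> p - phi p & (ALL x:sublev S phi a b. a + b \<bullet> x - phi x <= H) -->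
  c * sqrt m^CARD('n) <= vol (sublev S phi a b) &
  vol (sublev S phi a b) <= C * sqrt H^CARD('n))"
proof -
 let ?n = "real CARD('n)" and ?N = "CARD('n)"
 define c where "c = sqrt (1/((4*?n)^?N*L*2^?N))*(1/?n)^?N"
 define C where "C = 2^?N * sqrt ((16*?n^2)^?N/l)"
 have cC: "0 < c" "0 < C" using l by (auto simp: c_def C_def)
 have main: "c * sqrt m^?N <= vol (sublev S phi a b) &
  vol (sublev S phi a b) <= C * sqrt H^?N" if M: "MA l L S phi g A" and D: "compact (sublev S phi a b)" "p \<in> sublev S phi a b" and m: "0 < m"
   "m <= a + b \<bullet> p - phi p" and H: "!!x. x \<in> sublev S phi a b ==> a + b \<bullet> x - phi x <= H"
  for S :: "(real^'n) set" and phi g A a b p m H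
 proof -
  let ?D = "sublev S phi a b"
  have mH: "m <= H" using H[OF D(2)] m by linarith
  have m0: "0 < a + b \<bullet> p - phi p" using m by linarith
  obtain E :: "real^'n^'n" where E: "det E ~= 0"
   "!!x y. x \<in> ?D ==> y \<in> ?D ==> EX e. x - y = E *v e & (ALL i. \<bar>e $ i\<bar> <= 2)"
   "l*(det E)^2 <= (16*?n^2*H)^?N"
   "vol ?D <= 2^?N*\<bar>det E\<bar>"
   "\<bar>det E\<bar>*(1/?n)^?N <= vol ?D" by (rule sublev_simplex[OF M D(1,2) m0 H]) ((rule that)?; assumption)+
  fix k :: 'n
  \<comment> \<open>In simplex coordinates \<open>xi\<close> is a coordinate functional, so it
    varies by at most 2 on the section and the length \<open>R = m/4\<close> is admissible.\<close>
  define xi where "xi = transpose (matrix_inv E) *v axis k 1"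
  have invE: "invertible E" using E(1) by (simp add: invertible_det_nz)
  have "matrix_inv E ** E = mat 1" using someI_ex[OF invE[unfolded invertible_def]] by (simp add: matrix_inv_def)
  hence "transpose E ** transpose (matrix_inv E) = mat 1" by (simp add: matrix_transpose_mul[symmetric] transpose_mat)
  hence xe: "transpose E *v xi = axis k 1" by (simp only: xi_def matrix_vector_mul_assoc matrix_vector_mul_lid)
  have rr: "xi \<bullet> p - xi \<bullet> x <= 2" if xD: "x \<in> ?D" for x
  proof -
   obtain e where e: "p - x = E *v e" "!!i. \<bar>e $ i\<bar> <= 2" using E(2)[OF D(2) xD] by blast
   have "xi \<bullet> p - xi \<bullet> x = (transpose E *v xi) \<bullet> e" by (simp add: inner_diff_right[symmetric] e(1) inner_transpose)
   also have "... = e $ k" unfolding xe by (simp add: inner_axis')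
   finally show ?thesis using e(2)[of k] by linarith
  qed
  have nz: "(transpose E *v xi) $ k ~= 0" and one: "\<bar>(transpose E *v xi) $ k\<bar> = 1" unfolding xe by auto
  obtain P where P: "P \<in> lmeasurable" "!!\<pi> x. \<pi> \<in> P ==> x \<in> ?D ==> \<pi> \<bullet> (x - p) < m"
   "vol P = \<bar>(transpose E *v xi) $ k\<bar>*(m/4)*(m/(4*?n))^(?N - 1)/\<bar>det E\<bar>"
   by (rule slope_set_measure[OF E(1) E(2)[OF _ D(2)] _ rr, where R="m/4" and m=m and k=k])
    (assumption | rule nz | (rule that; assumption) | (use m in simp))+
  have "(m/4)*(m/(4*?n))^(?N - 1)/\<bar>det E\<bar> <= L * vol ?D" using slope_set_le[OF M D m(2) P(1,2)] P(3) unfolding one by simp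
  also have "... <= L*(2^?N*\<bar>det E\<bar>)" using E(4) l by (intro mult_left_mono) auto
  finally have a1: "(m/4)*(m/(4*?n))^(?N - 1) <= L*2^?N*(det E)^2" using E(1) by (simp add: field_simps power2_eq_square abs_mult_self_eq)
  have "(m/(4*?n))^?N = m/(4*?n)*(m/(4*?n))^(?N - 1)" by (simp add: power_eq_if[of _ ?N])
  also have "... <= (m/4)*(m/(4*?n))^(?N - 1)" using m by (intro mult_right_mono) (auto simp: field_simps)
  finally have "(m/(4*?n))^?N <= L*2^?N*(det E)^2" using a1 by linarith
  hence "m^?N*(1/((4*?n)^?N*L*2^?N)) <= (det E)^2" using l by (simp add: power_divide field_simps)
  hence "sqrt (m^?N*(1/((4*?n)^?N*L*2^?N))) <= \<bar>det E\<bar>" using real_sqrt_le_mono by fastforce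
  hence "sqrt m^?N * sqrt (1/((4*?n)^?N*L*2^?N)) <= \<bar>det E\<bar>" by (simp only: real_sqrt_mult real_sqrt_power)
  hence "sqrt m^?N * sqrt (1/((4*?n)^?N*L*2^?N))*(1/?n)^?N <= \<bar>det E\<bar>*(1/?n)^?N" by (rule mult_right_mono) simp
  moreover have "c * sqrt m^?N = sqrt m^?N * sqrt (1/((4*?n)^?N*L*2^?N))*(1/?n)^?N" by (simp only: c_def mult_ac)
  ultimately have lo: "c * sqrt m^?N <= vol ?D" using E(5) by linarith
  have "(det E)^2 <= H^?N*((16*?n^2)^?N/l)" using E(3) l by (simp add: power_mult_distrib field_simps)
  hence "\<bar>det E\<bar> <= sqrt (H^?N*((16*?n^2)^?N/l))" using real_sqrt_le_mono by fastforce
  hence "\<bar>det E\<bar> <= sqrt H^?N * sqrt ((16*?n^2)^?N/l)" by (simp only: real_sqrt_mult real_sqrt_power)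
  hence "2^?N*\<bar>det E\<bar> <= 2^?N*(sqrt H^?N * sqrt ((16*?n^2)^?N/l))" by (rule mult_left_mono) simp
  moreover have "C * sqrt H^?N = 2^?N*(sqrt H^?N * sqrt ((16*?n^2)^?N/l))" by (simp only: C_def mult_ac)
  ultimately have "vol ?D <= C * sqrt H^?N" using E(4) by linarith
  with lo show ?thesis by blast
 qed
 show ?thesis by (rule exI[of _ c], rule exI[of _ C]) (use cC main in blast)
qed

definition csec :: "(real^'n::finite) set => (real^'n => real) => (real^'n => real^'n) => real^'n => real => (real^'n) set" where
 "csec S phi g y h = {x \<in> S. excess phi g y x <= h}"

lemma csec_eq_sublev: "csec S phi g y h = sublev S phi (phi y - g y \<bullet> y + h) (g y)"
 by (auto simp: csec_def sublev_def excess_def inner_diff_right algebra_simps)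

lemma csec_mono: "h <= k ==> csec S phi g y h \<subseteq> csec S phi g y k" by (auto simp: csec_def)

lemma excess_self [simp]: "excess phi g y y = 0" by (simp add: excess_def)

lemma excess_three_points:
 "excess phi g y z = excess phi g y x + (g x - g y) \<bullet> (z - x) + excess phi g x z" by (simp add: excess_def inner_diff_left inner_diff_right)

lemma csec_volume:
 fixes l L :: real
 assumes l: "0 < l" "l <= L"
 shows "EX c C. 0 < c & 0 < C & (ALL (S :: (real^'n::finite) set) phi g A y h.
  MA l L S phi g A & compact (csec S phi g y h) & y \<in> S & 0 < h -->
  c * sqrt h^CARD('n) <= vol (csec S phi g y h) &
  vol (csec S phi g y h) <= C * sqrt h^CARD('n))"
proof -
 obtain c C where cC: "0 < c" "0 < C" and V: "!!(S :: (real^'n) set) phi g A a b p m H.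
  MA l L S phi g A & compact (sublev S phi a b) & p \<in> sublev S phi a b & 0 < m &
  m <= a + b \<bullet> p - phi p & (ALL x:sublev S phi a b. a + b \<bullet> x - phi x <= H) ==>
  c * sqrt m^CARD('n) <= vol (sublev S phi a b) &
  vol (sublev S phi a b) <= C * sqrt H^CARD('n)" using sublev_volume[OF l, where 'n='n] by blast
 have "c * sqrt h^CARD('n) <= vol (csec S phi g y h) &
  vol (csec S phi g y h) <= C * sqrt h^CARD('n)" if M: "MA l L S phi g A" and "compact (csec S phi g y h)" "y \<in> S" "0 < h"
  for S :: "(real^'n) set" and phi g A y h unfolding csec_eq_sublev
 proof (rule V, intro conjI ballI)
  show "y \<in> sublev S phi (phi y - g y \<bullet> y + h) (g y)" using that by (auto simp: sublev_def)
  fix x assume "x \<in> sublev S phi (phi y - g y \<bullet> y + h) (g y)"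
  hence "x \<in> S" by (simp add: sublev_def)
  from MA_D(10)[OF M this \<open>y \<in> S\<close>] show "phi y - g y \<bullet> y + h + g y \<bullet> x - phi x <= h"
   by (simp add: excess_def inner_diff_right)
 qed (use that in \<open>auto simp: csec_eq_sublev\<close>)
 thus ?thesis using cC by blast
qed

text \<open>Compactness encodes that the section stays away from the frontier: \<open>csec\<close>
  is cut out of the open set \<open>S\<close>, so it is not compact if points of the frontier adhere
  to it.\<close>

definition msec where
 "msec l L S phi g A y h \<longleftrightarrow> MA l L S phi g A & y \<in> S & 0 < h & compact (csec S phi g y h)"

lemma msecD:
 assumes "msec l L S phi g A y h"
 shows "MA l L S phi g A" "y \<in> S" "0 < h" "compact (csec S phi g y h)" using assms by (auto simp: msec_def)

lemma excess_continuous: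
 assumes "MA l L S phi g A"
 shows "continuous_on S (excess phi g y)" unfolding excess_def[abs_def] using c2_on_continuous(1)[OF MA_D(4)[OF assms]] by (intro continuous_intros)

lemma msec_smaller:
 assumes M: "msec l L S phi g A y h" and k: "0 < k" "k <= h"
 shows "msec l L S phi g A y k"
proof -
 have "csec S phi g y k = csec S phi g y h \<inter> excess phi g y -` {..k}" using k by (auto simp: csec_def)
 moreover have "continuous_on (csec S phi g y h) (excess phi g y)"
  by (rule continuous_on_subset[OF excess_continuous[OF msecD(1)[OF M]]]) (auto simp: csec_def)
 hence "closed (csec S phi g y h \<inter> excess phi g y -` {..k})"
  by (rule continuous_closed_preimage) (auto intro: compact_imp_closed msecD(4)[OF M])
 ultimately have "compact (csec S phi g y k)" using compact_Int_closed[OF msecD(4)[OF M]] by (metis Int_absorb1 csec_mono k(2))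
 thus ?thesis using M k by (simp add: msec_def)
qed

lemma csec_convex: "MA l L S phi g A ==> convex (csec S phi g y h)" unfolding csec_eq_sublev by (rule sublev_convex[OF MA_D(2,3)])

lemma excess_segment:
 assumes M: "MA l L S phi g A" and x: "x \<in> S" and z: "z \<in> S" and s: "0 <= s" "s <= 1"
 shows "excess phi g x (x + s *\<^sub>R (z - x)) <= s*excess phi g x z"
proof -
 have "phi ((1 - s) *\<^sub>R x + s *\<^sub>R z) <= (1 - s)*phi x + s*phi z" using M s x z by (intro convex_onD[OF MA_D(3)[OF M]]) auto
 moreover have "x + s *\<^sub>R (z - x) = (1 - s) *\<^sub>R x + s *\<^sub>R z" by (simp add: algebra_simps)
 ultimately show ?thesis by (simp add: excess_def algebra_simps)
qed

lemma csec_aleksandrov: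
 fixes l L :: real
 assumes l: "0 < l" "l <= L"
 shows "EX c>0. c <= 1 & (ALL (S :: (real^'n::finite) set) phi g A y h x m ka xi z.
  msec l L S phi g A y h & 0 < m & x \<in> S & excess phi g y x <= h - m &
  (ALL w:csec S phi g y h. ka <= xi \<bullet> w) & z \<in> csec S phi g y h -->
  c*(m/h)^CARD('n)*(xi \<bullet> z - ka) <= xi \<bullet> x - ka)"
proof -
 obtain c where c: "0 < c" "c <= 1" and V: "!!(S :: (real^'n) set) phi g A a b p m H ka xi z.
  MA l L S phi g A & compact (sublev S phi a b) & p \<in> sublev S phi a b & 0 < m &
  m <= a + b \<bullet> p - phi p & (ALL x:sublev S phi a b. a + b \<bullet> x - phi x <= H) &
  (ALL x:sublev S phi a b. ka <= xi \<bullet> x) & z \<in> sublev S phi a b ==>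
  c*(m/H)^CARD('n)*(xi \<bullet> z - ka) <= xi \<bullet> p - ka" using aleksandrov_estimate[OF l, where 'n='n] by blast
 have "c*(m/h)^CARD('n)*(xi \<bullet> z - ka) <= xi \<bullet> x - ka"
  if M: "msec l L S phi g A y h" and m: "0 < m" and x: "x \<in> S" "excess phi g y x <= h - m"
   and k: "ALL w:csec S phi g y h. ka <= xi \<bullet> w" and z: "z \<in> csec S phi g y h" for S :: "(real^'n) set" and phi g A y h x m ka xi z
 proof (rule V[of S phi g A "phi y - g y \<bullet> y + h" "g y"], intro conjI ballI)
  note MM = msecD[OF M]
  show "MA l L S phi g A" "0 < m" by fact+
  show "compact (sublev S phi (phi y - g y \<bullet> y + h) (g y))" using MM(4) by (simp add: csec_eq_sublev)
  show "x \<in> sublev S phi (phi y - g y \<bullet> y + h) (g y)" using x m by (simp add: csec_eq_sublev[symmetric] csec_def)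
  show "m <= phi y - g y \<bullet> y + h + g y \<bullet> x - phi x" using x by (simp add: excess_def inner_diff_right)
  show "z \<in> sublev S phi (phi y - g y \<bullet> y + h) (g y)" using z by (simp add: csec_eq_sublev)
  fix w assume w: "w \<in> sublev S phi (phi y - g y \<bullet> y + h) (g y)"
  thus "ka <= xi \<bullet> w" using k by (simp add: csec_eq_sublev)
  have "w \<in> S" using w by (simp add: sublev_def)
  from MA_D(10)[OF MM(1) this MM(2)] show "phi y - g y \<bullet> y + h + g y \<bullet> w - phi w <= h" by (simp add: excess_def inner_diff_right)
 qed
 thus ?thesis using c by blast
qed

text \<open>The linear function with slope \<open>g x - g y\<close> is bounded above on the doubled
  section by the three-point identity. Since \<open>x\<close> has depth at least \<open>h\<close>
  there, Aleksandrov's estimate for its negative gives the bound from below. The bound on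
  \<open>excess\<close> says that \<open>x\<close> may replace \<open>y\<close> as centre at the
  cost of a constant.\<close>

lemma csec_gradient_bound:
 fixes l L :: real
 assumes l: "0 < l" "l <= L"
 shows "EX C>=2. ALL (S :: (real^'n::finite) set) phi g A y h x z.
  msec l L S phi g A y (2*h) & x \<in> csec S phi g y h & z \<in> csec S phi g y (2*h) -->
  \<bar>(g x - g y) \<bullet> (z - x)\<bar> <= C*h & excess phi g x z <= C*h"
proof -
 obtain c where c: "0 < c" "c <= 1" and V: "!!(S :: (real^'n) set) phi g A y h x m ka xi z.
  msec l L S phi g A y h & 0 < m & x \<in> S & excess phi g y x <= h - m &
  (ALL w:csec S phi g y h. ka <= xi \<bullet> w) & z \<in> csec S phi g y h ==>
  c*(m/h)^CARD('n)*(xi \<bullet> z - ka) <= xi \<bullet> x - ka" using csec_aleksandrov[OF l, where 'n='n] by blast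
 define C where "C = 2 + 2*2^CARD('n)/c"
 have C: "2 <= C" using c by (simp add: C_def)
 have "\<bar>(g x - g y) \<bullet> (z - x)\<bar> <= C*h & excess phi g x z <= C*h"
  if M: "msec l L S phi g A y (2*h)" and x: "x \<in> csec S phi g y h" and z: "z \<in> csec S phi g y (2*h)"
  for S :: "(real^'n) set" and phi g A y h x z
 proof -
  let ?ex = "excess phi g"
  note MM = msecD[OF M]
  have h: "0 < h" using MM(3) by simp
  have xS: "x \<in> S" and xh: "?ex y x <= h" using x by (auto simp: csec_def)
  have up: "(g x - g y) \<bullet> (w - x) <= 2*h" if "w \<in> csec S phi g y (2*h)" for w
  proof -
   have "w \<in> S" "?ex y w <= 2*h" using that by (auto simp: csec_def)
   moreover have "0 <= ?ex x w" "0 <= ?ex y x" using MA_D(10)[OF MM(1)] xS \<open>w \<in> S\<close> MM(2) by auto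
   ultimately show ?thesis using excess_three_points[of phi g y w x] by linarith
  qed
  define xi where "xi = - (g x - g y)"
  define ka where "ka = xi \<bullet> x - 2*h"
  have k: "ALL w:csec S phi g y (2*h). ka <= xi \<bullet> w"
  proof
   fix w assume "w \<in> csec S phi g y (2*h)"
   from up[OF this] show "ka <= xi \<bullet> w" by (simp add: ka_def xi_def inner_diff_right inner_diff_left)
  qed
  have "c*(h/(2*h))^CARD('n)*(xi \<bullet> z - ka) <= xi \<bullet> x - ka" using xS xh M h k z by (intro V) auto
  hence "c/2^CARD('n)*(xi \<bullet> z - ka) <= 2*h" using h by (simp add: ka_def power_divide)
  hence "xi \<bullet> z - ka <= 2*2^CARD('n)/c*h" using c by (simp add: field_simps)
  hence lo: "- (2*2^CARD('n)/c*h) <= (g x - g y) \<bullet> (z - x)" using h by (simp add: ka_def xi_def inner_diff_right inner_diff_left)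
  have p: "0 <= 2*2^CARD('n)/c*h" using c h by simp
  have Ch: "C*h = 2*h + 2*2^CARD('n)/c*h" by (simp add: C_def algebra_simps)
  have zS: "z \<in> S" "?ex y z <= 2*h" using z by (auto simp: csec_def)
  have "0 <= ?ex y x" using MA_D(10)[OF MM(1) xS MM(2)] .
  hence "?ex x z <= C*h" using excess_three_points[of phi g y z x] zS lo Ch by linarith
  moreover have "\<bar>(g x - g y) \<bullet> (z - x)\<bar> <= C*h" using up[OF z] lo Ch p h by linarith
  ultimately show ?thesis by blast
 qed
 thus ?thesis using C by blast
qed

text \<open>Sections with centre well inside a section are small compared with it when their height is.
 The lowest value of the supporting function at \<open>x\<close> over its approximate contact set \<open>{excess <= s}\<close>
 is monotone in \<open>s\<close> and bounded, so it must be almost stationary on some scale; tilting the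
 supporting plane there cuts off a section that is deep next to its boundary, against
 Aleksandrov's estimate.\<close>

lemma csec_strict_interior:
 fixes l L eta :: real
 assumes l: "0 < l" "l <= L" and eta: "0 < eta" "eta <= 1"
 shows "EX eps>0. eps <= 1 & (ALL (S :: (real^'n::finite) set) phi g A y h x z.
  msec l L S phi g A y ((1 + eta)*h) & x \<in> csec S phi g y h & z \<in> csec S phi g x (eps*h) -->
  excess phi g y z < (1 + eta)*h)"
proof -
 obtain c where c: "0 < c" "c <= 1" and V: "!!(S :: (real^'n) set) phi g A a b p m H ka xi z.
  MA l L S phi g A & compact (sublev S phi a b) & p \<in> sublev S phi a b & 0 < m &
  m <= a + b \<bullet> p - phi p & (ALL x:sublev S phi a b. a + b \<bullet> x - phi x <= H) &
  (ALL x:sublev S phi a b. ka <= xi \<bullet> x) & z \<in> sublev S phi a b ==>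
  c*(m/H)^CARD('n)*(xi \<bullet> z - ka) <= xi \<bullet> p - ka" using aleksandrov_estimate[OF l, where 'n='n] by blast
 \<comment> \<open>The ratio of successive scales: it makes the excess at \<open>P (s/M)\<close> at
   most half of what the tilted plane gains there.\<close>
 define M where "M = 12/eta"
 have M: "12 <= M" using eta by (simp add: M_def field_simps)
 define de where "de = c*(eta/12)^CARD('n)*(eta/4)"
 have de: "0 < de" using c eta by (simp add: de_def)
 \<comment> \<open>Each scale raises the minimum by \<open>de*h\<close>; after \<open>N\<close>
   scales the total exceeds \<open>2*h\<close>, although all these minima lie between
   \<open>-h\<close> and \<open>h\<close>.\<close>
 obtain N' where N': "2/de < real N'" using reals_Archimedean2 by blast
 define N where "N = Suc N'"
 have N: "2 < de*real N" using N' de by (simp add: N_def field_simps)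
 define eps where "eps = 1/M^N"
 have eps: "0 < eps" using M by (simp add: eps_def)
 have eN: "eps <= eta/12"
 proof -
  have "M^1 <= M^N" using M by (intro power_increasing) (auto simp: N_def)
  hence "1/M^N <= 1/M" using M by (intro divide_left_mono) auto
  thus ?thesis by (simp add: eps_def M_def)
 qed
 have e1: "eps <= 1" using eN eta by linarith
 have "excess phi g y zz < (1 + eta)*h"
  if Ms: "msec l L S phi g A y ((1 + eta)*h)" and x: "x \<in> csec S phi g y h" and zz: "zz \<in> csec S phi g x (eps*h)"
  for S :: "(real^'n) set" and phi g A y h x zz
 proof (rule ccontr)
  assume not: "~ excess phi g y zz < (1 + eta)*h"
  note MM = msecD[OF Ms]
  have h: "0 < h" using MM(3) eta by (simp add: zero_less_mult_iff)
  let ?D = "csec S phi g y ((1 + eta)*h)"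
  have xS: "x \<in> S" and xh: "excess phi g y x <= h" using x by (auto simp: csec_def)
  have zzS: "zz \<in> S" and zze: "excess phi g x zz <= eps*h" using zz by (auto simp: csec_def)
  have pos: "0 <= excess phi g x w" "0 <= excess phi g y w" if "w \<in> S" for w using MA_D(10)[OF MM(1) that] xS MM(2) by auto
  define q where "q = g x - g y"
  \<comment> \<open>The supporting plane at \<open>x\<close> measured from the one at
    \<open>y\<close>; by \<open>split\<close> the excess from \<open>y\<close> is \<open>ell\<close>
    plus the excess from \<open>x\<close>.\<close>
  define ell where "ell w = excess phi g y x + q \<bullet> (w - x)" for w
  have split: "excess phi g y w = ell w + excess phi g x w" for w using excess_three_points[of phi g y w x] by (simp add: ell_def q_def)
  have segS: "x + s *\<^sub>R (zz - x) \<in> S" if "0 <= s" "s <= 1" for s by (rule segment_scale_mem[OF MA_D(2)[OF MM(1)] xS zzS that])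
  have "continuous_on {0..1} (%s. excess phi g y (x + s *\<^sub>R (zz - x)))"
   by (intro continuous_on_compose2[OF excess_continuous[OF MM(1)]] continuous_intros) (use segS in auto)
  then obtain s0 where s0: "0 <= s0" "s0 <= 1" "excess phi g y (x + s0 *\<^sub>R (zz - x)) = (1 + eta)*h"
   using IVT'[of "%s. excess phi g y (x + s *\<^sub>R (zz - x))" 0 "(1 + eta)*h" 1] xh not eta h
    mult_right_mono[of 1 "1 + eta" h] by fastforce
  \<comment> \<open>Here the segment towards \<open>zz\<close> has reached the level
    \<open>(1 + eta)*h\<close> exactly, and \<open>ell\<close> is still large because the excess
    from \<open>x\<close> is tiny.\<close>
  define z0 where "z0 = x + s0 *\<^sub>R (zz - x)"
  have z0S: "z0 \<in> S" using segS s0 by (simp add: z0_def)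
  have z0e: "excess phi g x z0 <= eps*h"
  proof -
   have "excess phi g x z0 <= s0*excess phi g x zz" unfolding z0_def by (rule excess_segment[OF MM(1) xS zzS s0(1,2)])
   also have "... <= 1*excess phi g x zz" using s0 pos[OF zzS] by (intro mult_right_mono) auto
   finally show ?thesis using zze by simp
  qed
  have z0l: "(1 + eta/2)*h <= ell z0"
  proof -
   have "ell z0 = (1 + eta)*h - excess phi g x z0" using split[of z0] s0 by (simp add: z0_def)
   also have "... >= (1 + eta)*h - eta/12*h" using z0e mult_right_mono[OF eN, of h] h by linarith
   finally show ?thesis using mult_pos_pos[OF eta(1) h] by (simp add: algebra_simps)
  qed
  have xD: "x \<in> ?D" using xS xh mult_pos_pos[OF eta(1) h] by (simp add: csec_def algebra_simps)
  define G where "G s = {w \<in> ?D. excess phi g x w <= s}" for s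
  have "EX p. p \<in> G s & (ALL w:G s. ell p <= ell w)" if "0 <= s" for s
  proof -
   have "continuous_on ?D (excess phi g x)" by (rule continuous_on_subset[OF excess_continuous[OF MM(1)]]) (auto simp: csec_def)
   hence "closed (?D \<inter> excess phi g x -` {..s})" by (rule continuous_closed_preimage) (auto intro: compact_imp_closed MM(4))
   moreover have "G s = ?D \<inter> (?D \<inter> excess phi g x -` {..s})" by (auto simp: G_def)
   ultimately have cG: "compact (G s)" using compact_Int_closed[OF MM(4)] by metis
   have "x \<in> G s" using xD that by (simp add: G_def)
   moreover have "continuous_on (G s) ell" unfolding ell_def[abs_def] by (intro continuous_intros)
   ultimately show ?thesis using continuous_attains_inf[OF cG] by blast
  qed
  then obtain P where P: "!!s. 0 <= s ==> P s \<in> G s" "!!s w. 0 <= s ==> w \<in> G s ==> ell (P s) <= ell w" by metis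
  have xG: "x \<in> G s" if "0 <= s" for s using xD that by (simp add: G_def)
  have Pup: "ell (P s) <= h" if "0 <= s" for s using P(2)[OF that xG[OF that]] xh by (simp add: ell_def)
  have Plo: "- s <= ell (P s)" if "0 <= s" for s
  proof -
   have "P s \<in> S" "excess phi g x (P s) <= s" using P(1)[OF that] by (auto simp: G_def csec_def)
   thus ?thesis using split[of "P s"] pos(2)[of "P s"] by linarith
  qed
  have step: "ell (P s) + de*h <= ell (P (s/M))" if s: "0 < s" "s <= h" "eps*h <= s/M" for s
  proof -
   define p where "p = P (s/M)"
   define th where "th = s/(3*h)"
   have th: "0 < th" "th <= 1/3" "s = 3*th*h" using s h by (auto simp: th_def field_simps)
   have sM: "0 <= s/M" using s M by simp
   have sM': "s/M = th*h*eta/4" using th(3) eta by (simp add: M_def)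
   define b where "b = 1 + eta/2"
   \<comment> \<open>The plane \<open>ell\<close> is rotated slightly about its level set at height
     \<open>b*h\<close>, which separates the minima from \<open>z0\<close>; on the side of the
     minima the tilted plane lies above \<open>ell\<close>.\<close>
   define new where "new w = ell w + th*(b*h - ell w)" for w
   define bb where "bb = g y + (1 - th) *\<^sub>R q"
   define aa where "aa = phi y - g y \<bullet> y + (1 - th)*(excess phi g y x - q \<bullet> x) + th*b*h"
   have aff: "aa + bb \<bullet> w - phi w = new w - excess phi g y w" for w
    by (simp add: aa_def bb_def new_def ell_def excess_def inner_add_left inner_diff_right algebra_simps)
   let ?E = "sublev S phi aa bb"
   have E: "w \<in> ?E \<longleftrightarrow> w \<in> S & excess phi g y w <= new w" for w using aff[of w] by (auto simp: sublev_def)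
   have newE: "new w - excess phi g y w = th*(b*h - ell w) - excess phi g x w" for w by (simp add: new_def split)
   have Eb: "ell w <= b*h" if "w \<in> ?E" for w
   proof (rule ccontr)
    assume "~ ?thesis"
    hence "th*(b*h - ell w) < 0" using th by (intro mult_pos_neg) auto
    moreover have "w \<in> S" "excess phi g y w <= new w" using that E by auto
    ultimately show False using newE[of w] pos(1)[of w] by linarith
   qed
   have ED: "w \<in> csec S phi g y (b*h)" if "w \<in> ?E" for w
   proof -
    have "new w <= b*h"
    proof -
     have "b*h - new w = (1 - th)*(b*h - ell w)" by (simp add: new_def algebra_simps)
     also have "... >= 0" using th Eb[OF that] by (intro mult_nonneg_nonneg) auto
     finally show ?thesis by simp
    qed
    thus ?thesis using that E[of w] by (auto simp: csec_def)
   qed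
   have bD: "csec S phi g y (b*h) \<subseteq> ?D" using h eta by (intro csec_mono) (simp add: b_def)
   have cE: "compact ?E"
   proof -
    have "continuous_on ?D (%w. excess phi g y w - new w)" unfolding new_def ell_def
     by (intro continuous_intros continuous_on_subset[OF excess_continuous[OF MM(1)]]) (auto simp: csec_def)
    hence "closed (?D \<inter> (%w. excess phi g y w - new w) -` {..0})" by (rule continuous_closed_preimage) (auto intro: compact_imp_closed MM(4))
    moreover have "?E = ?D \<inter> (?D \<inter> (%w. excess phi g y w - new w) -` {..0})" using ED bD E by (auto simp: csec_def)
    ultimately show ?thesis using compact_Int_closed[OF MM(4)] by metis
   qed
   have EG: "w \<in> G s" if "w \<in> ?E" for w
   proof -
    have wD: "w \<in> ?D" and wS: "w \<in> S" using ED[OF that] bD that E by auto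
    have e1: "excess phi g x w <= th*(b*h - ell w)" using newE[of w] that E[of w] by linarith
    have "- ell w <= excess phi g x w" using split[of w] pos(2)[OF wS] by linarith
    hence "- ell w <= th*(b*h) + th*(- ell w)" using e1 by (simp add: algebra_simps)
    hence "(1 - th)*(- ell w) <= th*(b*h)" by (simp add: algebra_simps)
    moreover have bh: "b*h <= 3/2*h" using eta h by (simp add: b_def)
    moreover have "th*(b*h) <= 1/3*(3/2*h)" using th bh h eta by (intro mult_mono) (auto simp: b_def)
    ultimately have r: "(1 - th)*(- ell w) <= h/2" by linarith
    have "- ell w <= h"
    proof (cases "0 <= - ell w")
     case True
     have "(2/3)*(- ell w) <= (1 - th)*(- ell w)" using th True by (intro mult_right_mono) auto
     thus ?thesis using r True by linarith
    qed (use h in linarith)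
    hence "b*h - ell w <= 3*h" using bh h by linarith
    hence "th*(b*h - ell w) <= th*(3*h)" using th by (intro mult_left_mono) auto
    hence "excess phi g x w <= s" using e1 th(3) by linarith
    thus ?thesis using wD by (simp add: G_def)
   qed
   have lo: "ell (P s) <= ell w" if "w \<in> ?E" for w using P(2)[OF less_imp_le[OF s(1)] EG[OF that]] .
   have Hb: "aa + bb \<bullet> w - phi w <= 3*th*h" if "w \<in> ?E" for w
   proof -
    have "- h <= ell w" using lo[OF that] Plo[of s] s by linarith
    moreover have "b*h <= 2*h" using eta h by (simp add: b_def)
    ultimately have "th*(b*h - ell w) <= th*(3*h)" using th by (intro mult_left_mono) auto
    thus ?thesis using newE[of w] aff[of w] pos(1)[of w] that E[of w] by linarith
   qed
   have pG: "p \<in> G (s/M)" using P(1)[OF sM] by (simp add: p_def)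
   have pS: "p \<in> S" and pe: "excess phi g x p <= s/M" using pG by (auto simp: G_def csec_def)
   have ph: "ell p <= h" using Pup[OF sM] by (simp add: p_def)
   have pm: "th*h*eta/4 <= aa + bb \<bullet> p - phi p"
   proof -
    have "eta/2*h <= b*h - ell p" using ph by (simp add: b_def algebra_simps)
    hence "th*(eta/2*h) <= th*(b*h - ell p)" using th by (intro mult_left_mono) auto
    thus ?thesis using newE[of p] aff[of p] pe sM' by (simp add: algebra_simps)
   qed
   have mpos: "0 < th*h*eta/4" using th h eta by simp
   have pE: "p \<in> ?E" using pm mpos pS by (simp add: sublev_def)
   have dz: "0 < ell z0 - ell p" using z0l ph h eta mult_pos_pos[OF eta(1) h] unfolding ring_distribs by linarith
   \<comment> \<open>\<open>z1\<close> is the point between \<open>p\<close> and \<open>z0\<close>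
     with \<open>ell z1 = (1 + eta/4)*h\<close>: low enough to belong to the tilted section, yet at
     least \<open>eta*h/4\<close> above the minimum of \<open>ell\<close>.\<close>
   define tau where "tau = ((1 + eta/4)*h - ell p)/(ell z0 - ell p)"
   have tau: "0 <= tau" "tau <= 1"
   proof -
    have "ell p <= (1 + eta/4)*h" using ph h eta mult_pos_pos[OF eta(1) h] unfolding ring_distribs by linarith
    thus "0 <= tau" using dz by (simp add: tau_def)
    have "(1 + eta/4)*h <= ell z0" using z0l h eta mult_pos_pos[OF eta(1) h] unfolding ring_distribs by linarith
    thus "tau <= 1" using dz by (simp add: tau_def)
   qed
   define z1 where "z1 = p + tau *\<^sub>R (z0 - p)"
   have z1S: "z1 \<in> S" unfolding z1_def by (rule segment_scale_mem[OF MA_D(2)[OF MM(1)] pS z0S tau])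
   have "ell z1 = ell p + tau*(ell z0 - ell p)" by (simp add: z1_def ell_def inner_add_right inner_diff_right algebra_simps)
   hence z1l: "ell z1 = (1 + eta/4)*h" using dz by (simp add: tau_def)
   have z1e: "excess phi g x z1 <= s/M"
   proof -
    have "p \<in> csec S phi g x (s/M)" "z0 \<in> csec S phi g x (s/M)" using pS pe z0S z0e s(3) by (auto simp: csec_def)
    from segment_scale_mem[OF csec_convex[OF MM(1)] this tau] show ?thesis by (simp add: csec_def z1_def)
   qed
   have z1E: "z1 \<in> ?E"
   proof -
    have "b*h - ell z1 = eta/4*h" by (simp add: z1l b_def algebra_simps)
    hence "th*(b*h - ell z1) = th*(eta/4*h)" by (rule arg_cong)
    also have "... = s/M" unfolding sM' by simp
    finally have "th*(b*h - ell z1) = s/M" .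
    thus ?thesis using newE[of z1] z1e E[of z1] z1S by linarith
   qed
   define ka where "ka = ell (P s) - excess phi g y x + q \<bullet> x"
   have ql: "q \<bullet> w = ell w - excess phi g y x + q \<bullet> x" for w by (simp add: ell_def inner_diff_right)
   \<comment> \<open>Depth at least \<open>th*h*eta/4\<close> against height at most
     \<open>3*th*h\<close>: the ratio \<open>eta/12\<close> does not depend on the scale, so neither
     does the gain \<open>de\<close>.\<close>
   have al0: "c*((th*h*eta/4)/(3*th*h))^CARD('n)*(q \<bullet> z1 - ka) <= q \<bullet> p - ka"
   proof (rule V[of S phi g A aa bb], intro conjI ballI)
    show "MA l L S phi g A" by (rule MM(1))
    show "ka <= q \<bullet> w" if "w \<in> ?E" for w using lo[OF that] by (simp add: ka_def ql[of w])
   qed (use cE pE mpos pm Hb z1E in auto)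
   have e12: "(th*h*eta/4)/(3*th*h) = eta/12" using th h by (simp del: times_divide_eq_left)
   have al: "c*(eta/12)^CARD('n)*(ell z1 - ell (P s)) <= ell p - ell (P s)" using al0 unfolding e12 by (simp add: ka_def ql[of z1] ql[of p])
   have "eta/4*h <= ell z1 - ell (P s)" using Pup[of s] s z1l by (simp add: algebra_simps)
   hence "c*(eta/12)^CARD('n)*(eta/4*h) <= c*(eta/12)^CARD('n)*(ell z1 - ell (P s))" using c eta by (intro mult_left_mono) auto
   moreover have "de*h = c*(eta/12)^CARD('n)*(eta/4*h)" by (simp add: de_def)
   ultimately show ?thesis using al unfolding p_def by linarith
  qed
  have it: "ell (P h) + real k*(de*h) <= ell (P (h/M^k))" if "k <= N" for k using that
  proof (induction k)
   case (Suc k)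
   have M1: "1 <= M^k" using M by (simp add: one_le_power)
   have "M^Suc k <= M^N" using M Suc.prems by (intro power_increasing) auto
   hence "1/M^N <= 1/M^Suc k" using M by (intro divide_left_mono) auto
   hence "eps*h <= 1/M^Suc k*h" unfolding eps_def using h by (intro mult_right_mono) auto
   hence "eps*h <= h/M^k/M" by (simp add: mult.commute)
   moreover have "h/M^k <= h" using h M1 M by (simp add: field_simps)
   moreover have "0 < h/M^k" using h M by simp
   ultimately have "ell (P (h/M^k)) + de*h <= ell (P (h/M^k/M))" by (intro step)
   thus ?case using Suc by (simp add: algebra_simps)
  qed simp
  have "ell (P h) + real N*(de*h) <= h" using it[of N] Pup[of "h/M^N"] h M by simp
  moreover have "- h <= ell (P h)" using Plo[of h] h by simp
  moreover have "2*h < real N*(de*h)" using mult_strict_right_mono[OF N h] by (simp add: mult_ac)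
  ultimately show False by linarith
 qed
 thus ?thesis using eps e1 by (intro exI[of _ eps]) auto
qed

lemma compact_sublevel:
 fixes f :: "'a::t2_space => real"
 assumes K: "compact K" and f: "continuous_on K f"
 shows "compact {x \<in> K. f x <= c}"
proof -
 have "closed (K \<inter> f -` {..c})" using f by (rule continuous_closed_preimage) (auto intro: compact_imp_closed K)
 from compact_Int_closed[OF K this] show ?thesis by (simp add: Int_def vimage_def)
qed

lemma compact_superlevel:
 fixes f :: "'a::t2_space => real"
 assumes K: "compact K" and f: "continuous_on K f"
 shows "compact {x \<in> K. c <= f x}" using compact_sublevel[OF K continuous_on_minus[OF f], of "- c"] by simp

text \<open>The case \<open>eta = 1\<close> of the strict interior estimate; being contained in a
  compact section of another centre also gives compactness.\<close>

lemma csec_engulf: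
 fixes l L :: real
 assumes l: "0 < l" "l <= L"
 shows "EX eps>0. eps <= 1 & (ALL (S :: (real^'n::finite) set) phi g A y h x.
  msec l L S phi g A y (2*h) & x \<in> csec S phi g y h -->
  msec l L S phi g A x (eps*h) & csec S phi g x (eps*h) \<subseteq> {z \<in> S. excess phi g y z < 2*h})"
proof -
 obtain eps where eps: "0 < eps" "eps <= 1" and V: "!!(S :: (real^'n) set) phi g A y h x z.
  msec l L S phi g A y ((1 + 1)*h) & x \<in> csec S phi g y h & z \<in> csec S phi g x (eps*h) ==>
  excess phi g y z < (1 + 1)*h" using csec_strict_interior[OF l, of 1, where 'n='n] by auto
 have "msec l L S phi g A x (eps*h) & csec S phi g x (eps*h) \<subseteq> {z \<in> S. excess phi g y z < 2*h}"
  if M: "msec l L S phi g A y (2*h)" and x: "x \<in> csec S phi g y h" for S :: "(real^'n) set" and phi g A y h x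
 proof -
  note MM = msecD[OF M]
  have sub: "csec S phi g x (eps*h) \<subseteq> {z \<in> S. excess phi g y z < 2*h}" using V[of S phi g A y h x] M x by (auto simp: csec_def)
  have "continuous_on (csec S phi g y (2*h)) (excess phi g x)" by (rule continuous_on_subset[OF excess_continuous[OF MM(1)]]) (auto simp: csec_def)
  from compact_sublevel[OF MM(4) this, of "eps*h"] have "compact (csec S phi g x (eps*h))"
   by (rule back_subst[of compact]) (use sub in \<open>auto simp: csec_def\<close>)
  thus ?thesis using sub MM eps x by (auto simp: msec_def csec_def)
 qed
 thus ?thesis using eps by blast
qed

section \<open>The critical density estimate\<close>

lemma det_id_plus_outer:
 fixes u v :: "real^'n::finite"
 assumes a: "a ~= 0"
 shows "det (a *\<^sub>R mat 1 + outer u v) = a^(CARD('n) - 1)*(a + v \<bullet> u)"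
proof (cases "u = 0")
 case True
 hence "a *\<^sub>R mat 1 + outer u v = a *\<^sub>R mat 1" by (simp add: outer_def vec_eq_iff)
 thus ?thesis using True by (simp add: det_scaleR power_eq_if[of _ "CARD('n)"])
next
 case False
 fix k :: 'n
 \<comment> \<open>Rotating \<open>u\<close> onto a coordinate axis leaves a matrix that differs
   from \<open>a\<close> times the identity in row \<open>k\<close> only, to which Cramer's formula
   applies.\<close>
 define nu where "nu = (1/norm u) *\<^sub>R u"
 have n1: "norm nu = 1" using False by (simp add: nu_def)
 obtain Q where Q: "orthogonal_matrix Q" "Q *v axis k 1 = nu" using orthogonal_matrix_exists_basis[OF n1] by metis
 have QQ: "Q ** transpose Q = mat 1" "transpose Q ** Q = mat 1" using Q by (auto simp: orthogonal_matrix_def)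
 define w where "w = transpose Q *v v"
 define B where "B = a *\<^sub>R mat 1 + outer (norm u *\<^sub>R axis k 1) w"
 have uQ: "u = norm u *\<^sub>R (Q *v axis k 1)" using False by (simp add: Q(2) nu_def)
 have "transpose Q ** (a *\<^sub>R mat 1 + outer u v) ** Q = B"
 proof -
  have "(transpose Q ** (a *\<^sub>R mat 1 + outer u v) ** Q) *v x = B *v x" for x
  proof -
   have "transpose Q *v u = norm u *\<^sub>R axis k 1"
    by (subst uQ) (simp only: matrix_vector_mult_scaleR matrix_vector_mul_assoc QQ matrix_vector_mul_lid)
   moreover have "v \<bullet> (Q *v x) = w \<bullet> x" by (simp add: w_def inner_transpose)
   moreover have "transpose Q *v (Q *v x) = x" by (simp add: matrix_vector_mul_assoc QQ)
   ultimately show ?thesis by (simp add: matrix_vector_mul_assoc[symmetric] B_def matrix_vector_mult_add_rdistrib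
      matrix_vector_scaleR outer_mult_vec matrix_vector_right_distrib matrix_vector_mult_scaleR)
  qed
  thus ?thesis by (simp add: matrix_eq)
 qed
 hence "det B = det (a *\<^sub>R mat 1 + outer u v)*(det Q*det Q)" by (metis (no_types, lifting) det_mul det_transpose mult.assoc mult.commute)
 also have "det Q*det Q = 1" using det_orthogonal_matrix[OF Q(1)] by auto
 finally have dB: "det (a *\<^sub>R mat 1 + outer u v) = det B" by simp
 define x where "x = axis k 1 + (norm u/a) *\<^sub>R w"
 have "B = (\<chi> i. if i = k then sum (%i. x $ i *s row i (a *\<^sub>R mat 1)) UNIV else row i (a *\<^sub>R mat 1))"
 proof -
  have s: "(\<Sum>i\<in>UNIV. x $ i *s row i (a *\<^sub>R mat 1)) = a *\<^sub>R x"
   by (simp add: vec_eq_iff row_def mat_def if_distrib[where f="%t. _*t"] cong: if_cong)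
  show ?thesis unfolding s using a by (auto simp: vec_eq_iff B_def row_def x_def outer_def mat_def axis_def algebra_simps)
 qed
 hence "det B = x $ k*a^CARD('n)" by (simp only: cramer_lemma_transpose) (simp add: det_scaleR)
 also have "x $ k = 1 + norm u*w $ k/a" by (simp add: x_def)
 also have "norm u*w $ k = v \<bullet> u"
 proof -
  have "v \<bullet> u = norm u*(w \<bullet> axis k 1)" by (subst uQ) (simp add: w_def inner_transpose[symmetric] inner_transpose[of v Q])
  thus ?thesis by (simp add: inner_axis)
 qed
 finally have "det B = (1 + v \<bullet> u/a)*(a*a^(CARD('n) - 1))" by (simp add: power_eq_if[of a "CARD('n)"])
 also have "... = a^(CARD('n) - 1)*(a + v \<bullet> u)" using a by (simp add: field_simps)
 finally show ?thesis by (simp add: dB)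
qed

text \<open>The radial second derivative bounds from below the Jacobian of a radial stretching with bounded
 image.\<close>

lemma radial_hessian_measure:
 fixes D :: "(real^'n::finite) set"
 assumes M: "MA l L S phi g A" and D: "compact D" "convex D" "D \<subseteq> S" "y \<in> D"
  and r: "0 < r" "0 < k" and C: "!!x. x \<in> D ==> (g x - g y) \<bullet> (x - y) <= C*r"
 shows "compact {x \<in> D. k*r <= (x - y) \<bullet> (A x *v (x - y))}"
  "k * vol {x \<in> D. k*r <= (x - y) \<bullet> (A x *v (x - y))} <= (1 + C)^CARD('n) * vol D"
proof -
 define B where "B = {x \<in> D. k*r <= (x - y) \<bullet> (A x *v (x - y))}"
 note c = MA_D(4)[OF M]
 have yS: "y \<in> S" using D by blast
 have C0: "0 <= C" using C[OF D(4)] r by (simp add: zero_le_mult_iff)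
 have cA: "continuous_on D A" using c2_onD(2)[OF c] D(3) continuous_on_subset by blast
 have cq: "continuous_on D (%x. (x - y) \<bullet> (A x *v (x - y)))"
  unfolding matrix_vector_mult_def inner_vec_def using cA by (intro continuous_intros)
 have cB: "compact B" unfolding B_def by (rule compact_superlevel[OF D(1) cq])
 have BL: "B \<in> lmeasurable" by (rule lmeasurable_compact[OF cB])
 have BD: "B \<subseteq> D" by (auto simp: B_def)
 define w where "w x = (g x - g y) \<bullet> (x - y)" for x
 have w0: "0 <= w x" if "x \<in> S" for x using MA_grad_mono[OF M that yS] by (cases "x = y") (auto simp: w_def)
 \<comment> \<open>The stretching factor grows with \<open>w\<close>, so the radial derivative of
   \<open>F\<close> carries the second derivative of \<open>phi\<close>, while the bound on
   \<open>w\<close> keeps the image inside a dilated copy of \<open>D\<close>.\<close>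
 define F where "F x = y + (1 + w x/r) *\<^sub>R (x - y)" for x
 define G where "G x = (1 + w x/r) *\<^sub>R mat 1 + outer (x - y) ((1/r) *\<^sub>R (A x *v (x - y) + (g x - g y)))" for x
 have dF: "(F has_derivative (%h. G x *v h)) (at x)" if x: "x \<in> S" for x
 proof -
  have sym: "(A x *v h) \<bullet> e = (A x *v e) \<bullet> h" for h e
   using inner_transpose[of e "A x" h] c2_onD(5)[OF c x] by (simp add: inner_commute)
  have "(w has_derivative (%h. (A x *v (x - y) + (g x - g y)) \<bullet> h)) (at x)" unfolding w_def[abs_def]
   by (rule has_derivative_eq_rhs, (rule derivative_intros c2_onD(4)[OF c x])+)
    (simp add: fun_eq_iff sym inner_add_left)
  note dw = this
  show ?thesis unfolding F_def[abs_def] divide_inverse by (rule has_derivative_eq_rhs, (rule derivative_intros dw)+)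
    (simp add: fun_eq_iff G_def matrix_vector_mult_add_rdistrib matrix_vector_scaleR outer_mult_vec divide_inverse)
 qed
 \<comment> \<open>The other \<open>n - 1\<close> directions are stretched by a factor of at least
   one, so the radial factor alone bounds the Jacobian from below.\<close>
 have detG: "(x - y) \<bullet> (A x *v (x - y))/r <= det (G x)" if x: "x \<in> S" for x
 proof -
  let ?a = "1 + w x/r" and ?q = "(x - y) \<bullet> (A x *v (x - y))"
  have a: "1 <= ?a" using w0[OF x] r by simp
  have q: "0 <= ?q" using MA_D(9)[OF M x] by (simp add: psd_def)
  have "det (G x) = ?a^(CARD('n) - 1)*(?a + ((1/r) *\<^sub>R (A x *v (x - y) + (g x - g y))) \<bullet> (x - y))"
   unfolding G_def using a by (intro det_id_plus_outer) linarith
  also have "((1/r) *\<^sub>R (A x *v (x - y) + (g x - g y))) \<bullet> (x - y) = ?q/r + w x/r"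
   by (simp add: w_def inner_commute[of _ "x - y"] inner_add_right add_divide_distrib)
  also have "?a^(CARD('n) - 1)*(?a + (?q/r + w x/r)) >= 1*(?q/r)" using a q r w0[OF x] by (intro mult_mono one_le_power) auto
  finally show ?thesis by simp
 qed
 have inj: "inj_on F S"
 proof (rule inj_onI)
  \<comment> \<open>By monotonicity of the gradient \<open>w\<close> does not decrease along a ray
    from \<open>y\<close>, so the stretching is strictly increasing on each ray.\<close>
  have aux: "t <= s" if x: "x \<in> S" and x': "x' \<in> S" and e: "x - y = s *\<^sub>R d" "x' - y = t *\<^sub>R d"
   and st: "0 <= s" and eq: "(1 + w x/r) * s = (1 + w x'/r)*t" for x x' s t d
  proof (rule ccontr)
   assume "~ t <= s"
   hence ts: "s < t" "0 < t" using st by auto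
   have "x' - x = (t - s) *\<^sub>R d" unfolding scaleR_diff_left e[symmetric] by simp
   hence "0 <= (t - s)*((g x' - g x) \<bullet> d)" using MA_grad_mono[OF M x' x] by (cases "x = x'") auto
   hence m: "0 <= (g x' - g x) \<bullet> d" using ts by (simp add: zero_le_mult_iff)
   have "0 <= w x'" using w0[OF x'] .
   hence w'd: "0 <= (g x' - g y) \<bullet> d" using ts by (simp add: w_def e zero_le_mult_iff)
   have "w x = s*((g x - g y) \<bullet> d)" by (simp add: w_def e)
   also have "... <= s*((g x' - g y) \<bullet> d)" using m st by (intro mult_left_mono) (simp add: inner_diff_left, simp)
   also have "... <= t*((g x' - g y) \<bullet> d)" using ts w'd by (intro mult_right_mono) auto
   also have "... = w x'" by (simp add: w_def e)
   finally have "w x <= w x'" .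
   hence "(1 + w x/r) * s <= (1 + w x'/r) * s" using st r by (intro mult_right_mono) (auto simp: divide_right_mono)
   also have "... < (1 + w x'/r)*t" using ts w0[OF x'] r by (intro mult_strict_left_mono) (auto simp: add_pos_nonneg)
   finally show False using eq by simp
  qed
  fix x x' assume x: "x \<in> S" and x': "x' \<in> S" and eq: "F x = F x'"
  have p: "0 < 1 + w x/r" "0 < 1 + w x'/r" using w0[OF x] w0[OF x'] r by (auto simp: add_pos_nonneg)
  have e: "(1 + w x/r) *\<^sub>R (x - y) = (1 + w x'/r) *\<^sub>R (x' - y)" using eq by (simp add: F_def)
  define t where "t = (1 + w x/r)/(1 + w x'/r)"
  have t0: "0 < t" using p by (simp add: t_def)
  have "(1 + w x'/r) *\<^sub>R (t *\<^sub>R (x - y)) = (1 + w x'/r) *\<^sub>R (x' - y)"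
   unfolding e[symmetric] scaleR_scaleR using p by (simp add: t_def)
  hence xt: "x' - y = t *\<^sub>R (x - y)" using scaleR_left_imp_eq[of "1 + w x'/r"] p(2) by (metis less_irrefl)
  have eqt: "(1 + w x/r)*1 = (1 + w x'/r)*t" using p by (simp add: t_def)
  have "t <= 1" by (rule aux[OF x x' _ xt _ eqt]) auto
  moreover have "1 <= t" by (rule aux[OF x' x xt _ _ eqt[symmetric]]) (use t0 in auto)
  ultimately have "t = 1" by simp
  thus "x = x'" using xt by simp
 qed
 have FD: "F ` B \<subseteq> (+) (- C *\<^sub>R y) ` (%x. ((1 + C) *\<^sub>R mat 1) *v x) ` D"
 proof
  fix z assume "z \<in> F ` B"
  then obtain x where x: "x \<in> D" "z = F x" using BD by blast
  have w1: "w x/r <= C" "0 <= w x/r" using C[OF x(1)] w0[of x] x D(3) r by (auto simp: w_def field_simps)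
  define s where "s = (1 + w x/r)/(1 + C)"
  have s: "0 <= s" "s <= 1" using w1 C0 by (auto simp: s_def)
  have "y + s *\<^sub>R (x - y) \<in> D" by (rule segment_scale_mem[OF D(2,4) x(1) s])
  moreover have "z = (- C *\<^sub>R y) + ((1 + C) *\<^sub>R mat 1) *v (y + s *\<^sub>R (x - y))"
  proof -
   have "(1 + C) * s = 1 + w x/r" using C0 by (simp add: s_def)
   hence "(1 + C) *\<^sub>R (s *\<^sub>R (x - y)) = (1 + w x/r) *\<^sub>R (x - y)" by (simp only: scaleR_scaleR)
   thus ?thesis unfolding x(2) F_def matrix_vector_scaleR matrix_vector_mul_lid scaleR_add_right by (simp add: scaleR_add_left)
  qed
  ultimately show "z \<in> (+) (- C *\<^sub>R y) ` (%x. ((1 + C) *\<^sub>R mat 1) *v x) ` D" by blast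
 qed
 have DL: "D \<in> lmeasurable" by (rule lmeasurable_compact[OF D(1)])
 have dc: "det ((1 + C) *\<^sub>R mat 1 :: real^'n^'n) = (1 + C)^CARD('n)" by (simp add: det_scaleR)
 have "vol (F ` B) <= vol ((+) (- C *\<^sub>R y) ` (%x. ((1 + C) *\<^sub>R mat 1) *v x) ` D)"
 proof (rule measure_mono_fmeasurable[OF FD])
  have "F ` B \<in> lmeasurable"
  proof -
   have "continuous_on B F" using dF BD D(3) by (meson continuous_at_imp_continuous_on has_derivative_continuous subsetD)
   thus ?thesis by (intro lmeasurable_compact compact_continuous_image cB)
  qed
  thus "F ` B \<in> sets lebesgue" by auto
  show "(+) (- C *\<^sub>R y) ` (%x. ((1 + C) *\<^sub>R mat 1) *v x) ` D \<in> lmeasurable"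
   by (intro measurable_translation measure_linear_image_vec(1) DL)
 qed
 also have "... = (1 + C)^CARD('n) * vol D"
  unfolding measure_translation using measure_linear_image_vec(2)[OF DL, of "(1 + C) *\<^sub>R mat 1"] C0 dc by auto
 finally have up: "vol (F ` B) <= (1 + C)^CARD('n) * vol D" .
 have BS: "B \<subseteq> S" using BD D(3) by blast
 have cG: "continuous_on B (%x. \<bar>det (G x)\<bar>)"
 proof -
  have cg: "continuous_on B g" using c2_on_continuous(2)[OF c] BS continuous_on_subset by blast
  have cA': "continuous_on B A" using cA BD continuous_on_subset by blast
  have "continuous_on B G" unfolding G_def w_def outer_def matrix_vector_mult_def using cg cA' r by (intro continuous_intros) auto
  thus ?thesis unfolding det_def by (intro continuous_intros)
 qed
 have int: "(%x. \<bar>det (matrix (%h. G x *v h))\<bar>) absolutely_integrable_on B"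
  using integrable_on_compact_subset(1)[OF cB _ fmeasurableD[OF BL] subset_refl] cG by simp
 have dFB: "(F has_derivative (%h. G x *v h)) (at x within B)" if "x \<in> B" for x using dF that BS by (meson has_derivative_at_withinI subsetD)
 have "k * vol B = integral B (%x. k*1)" unfolding integral_mult_right lmeasure_integral[OF BL] ..
 also have "... <= integral B (%x. \<bar>det (matrix (%h. G x *v h))\<bar>)"
 proof (rule integral_le)
  show "(%x. k*1) integrable_on B" using integrable_on_const[OF BL] by simp
  show "(%x. \<bar>det (matrix (%h. G x *v h))\<bar>) integrable_on B" by (rule set_lebesgue_integral_eq_integral(1)[OF int])
  fix x assume x: "x \<in> B"
  hence "k <= (x - y) \<bullet> (A x *v (x - y))/r" using r by (simp add: B_def pos_le_divide_eq)
  thus "k*1 <= \<bar>det (matrix (%h. G x *v h))\<bar>" using detG[of x] x BS by auto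
 qed
 also have "... = vol (F ` B)" using differentiable_image_vec(3)[OF fmeasurableD[OF BL] dFB int inj_on_subset[OF inj BS]] by simp
 finally show "k * vol {x \<in> D. k*r <= (x - y) \<bullet> (A x *v (x - y))} <= (1 + C)^CARD('n) * vol D" using up by (simp add: B_def)
 show "compact {x \<in> D. k*r <= (x - y) \<bullet> (A x *v (x - y))}" using cB by (simp add: B_def)
qed

text \<open>The function is \<open>(t + eps) powr (-1/m)\<close>. Its convexity grows with
  \<open>m\<close>, as the identity for \<open>psi''*psi\<close> records, while its size does not:
  \<open>eps = exp (- m)\<close> makes \<open>psi 0\<close> equal to Euler's number. The values 1/2
  and 1/4 separate arguments up to 1 from arguments beyond \<open>4^m\<close>.\<close>

lemma decreasing_profile:
 fixes m :: nat
 assumes m: "1 <= m"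
 shows "EX eps C psi psi' psi''. 0 < eps & 0 < C &
  (ALL t>-eps. (psi has_real_derivative psi' t) (at t) & (psi' has_real_derivative psi'' t) (at t)) &
  continuous_on {-eps<..} psi'' &
  (ALL t>=0. 0 < psi t & psi t <= 3 & - C <= psi' t & psi' t <= 0 & 0 <= psi'' t &
   psi'' t*psi t = (1 + real m)*(psi' t)^2) &
  (ALL t>=0. 1/4 <= psi t --> t <= 4^m) & (ALL t>=0. t <= 1 --> 1/2 <= psi t)"
proof -
 define eps where "eps = exp (- real m)"
 define a where "a = - 1/real m"
 have m0: "0 < real m" using m by simp
 have a0: "a < 0" "-1 <= a" using m by (auto simp: a_def)
 have e: "0 < eps" "eps <= 1" by (auto simp: eps_def)
 define psi where "psi t = (t + eps) powr a" for t
 define psi' where "psi' t = a*(t + eps) powr (a - 1)" for t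
 define psi'' where "psi'' t = a*((a - 1)*(t + eps) powr (a - 1 - 1))" for t
 have d: "((%t. (t + eps) powr b) has_real_derivative b*(t + eps) powr (b - 1)) (at t)" if "- eps < t" for t b
  using that by (auto intro!: derivative_eq_intros simp: field_simps powr_diff)
 have 1: "(psi has_real_derivative psi' t) (at t)" "(psi' has_real_derivative psi'' t) (at t)" if "- eps < t" for t
  unfolding psi_def[abs_def] psi'_def[abs_def] psi''_def by (rule d[OF that], intro DERIV_cmult d[OF that])
 have 2: "continuous_on {-eps<..} psi''" unfolding psi''_def[abs_def] by (intro continuous_intros) auto
 have le: "(t + eps) powr b <= eps powr b" if "0 <= t" "b <= 0" for t b using powr_mono2'[of b eps "t + eps"] that e by simp
 have 3: "0 < psi t" "psi t <= 3" if "0 <= t" for t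
 proof -
  show "0 < psi t" using that e by (simp add: psi_def)
  have "psi t <= eps powr a" unfolding psi_def using that a0 by (intro le) auto
  also have "... = exp 1" using m0 by (simp add: eps_def powr_def a_def)
  finally show "psi t <= 3" using exp_le by linarith
 qed
 define C where "C = (- a)*eps powr (a - 1)"
 have C: "0 < C" unfolding C_def using a0 e by (intro mult_pos_pos) auto
 have 4: "- C <= psi' t" "psi' t <= 0" if "0 <= t" for t
 proof -
  have "(- a)*(t + eps) powr (a - 1) <= C" unfolding C_def using le[OF that, of "a - 1"] a0 by (intro mult_left_mono) auto
  thus "- C <= psi' t" by (simp add: psi'_def)
  show "psi' t <= 0" using a0 by (simp add: psi'_def mult_nonpos_nonneg)
 qed
 have 5: "0 <= psi'' t" "psi'' t*psi t = (1 + real m)*(psi' t)^2" if "0 <= t" for t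
 proof -
  show "0 <= psi'' t" using a0 by (simp add: psi''_def mult_nonpos_nonpos mult_nonpos_nonneg)
  have "(t + eps) powr (a - 1 - 1)*(t + eps) powr a = (t + eps) powr (a - 1)*(t + eps) powr (a - 1)" by (simp add: powr_add[symmetric] algebra_simps)
  moreover have "a*(a - 1) = (1 + real m)*(a*a)" using m0 by (simp add: a_def field_simps)
  ultimately show "psi'' t*psi t = (1 + real m)*(psi' t)^2"
   unfolding psi_def psi'_def psi''_def power2_eq_square by (metis (no_types, opaque_lifting) mult.assoc mult.left_commute)
 qed
 have 6: "t <= 4^m" if "0 <= t" "1/4 <= psi t" for t
 proof (rule ccontr)
  assume "~ ?thesis"
  hence "4^m < t + eps" using e by linarith
  hence "(t + eps) powr a < (4^m) powr a" using a0 by (intro powr_less_mono2_neg) auto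
  also have "(4^m :: real) = 4 powr real m" by (simp add: powr_realpow)
  also have "(4 powr real m) powr a = 1/4" using m0 by (simp add: powr_powr a_def powr_minus_divide)
  finally show False using that by (simp add: psi_def)
 qed
 have 7: "1/2 <= psi t" if "0 <= t" "t <= 1" for t
 proof -
  have "1/2 = 2 powr (-1 :: real)" by (simp add: powr_minus_divide)
  also have "... <= 2 powr a" using a0 by (intro powr_mono) auto
  also have "... <= (t + eps) powr a" using that e a0 by (intro powr_mono2') auto
  finally show ?thesis by (simp add: psi_def)
 qed
 show ?thesis by (rule exI[of _ eps], rule exI[of _ C], rule exI[of _ psi], rule exI[of _ psi'], rule exI[of _ psi''])
   (use e C 1 2 3 4 5 6 7 in auto)
qed

text \<open>Pairing the cofactor matrix with \<open>M\<close> leaves \<open>n det A\<close>, a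
  source term and a negative term from \<open>psi''\<close>. A small source gives a constant bound.
  In the second claim the source alone bounds the Jacobian: either it dominates
  \<open>n det A\<close>, or the slope \<open>q\<close> in direction \<open>e\<close> is large
  against the second derivative of the potential there, and then by \<open>cofac_props\<close> the
  negative term cancels \<open>n det A\<close>.\<close>

lemma determinant_bound_at_contact:
 fixes A H M :: "real^'n^'n::finite" and p q e :: "real^'n"
 assumes A: "psd A" "l <= det A" "det A <= L" "0 < l"
  and M: "psd M" "M = A - c *\<^sub>R (psi' *\<^sub>R H + psi'' *\<^sub>R outer p p)"
  and c: "0 < c" "0 < psi" "psi <= 3" "- C <= psi'" "psi' <= 0" "0 <= psi''" "psi''*psi = (1 + m)*psi'^2" "0 <= m"
  and F: "mdot (cofac A) H <= F" "0 <= F" and C: "0 <= C" and q: "q = (c*psi') *\<^sub>R p"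
 shows "c*C*F <= real CARD('n)*l ==> det M <= L*2^CARD('n)"
  "real CARD('n)*l <= c*C*F | 3*real CARD('n) * c*(e \<bullet> (A *v e)) <= (1 + m)*(q \<bullet> e)^2 & e \<bullet> (A *v e) ~= 0 ==>
   det M <= L*((1 + L/l)*(c*C*F)/(real CARD('n)*l))^CARD('n)"
proof -
 let ?n = "real CARD('n)" and ?N = "CARD('n)" and ?T = "cofac A"
 have d: "0 < det A" using A by linarith
 have L: "0 < L" using A by linarith
 note cp = cofac_props[OF A(1) d]
 have pTp: "0 <= p \<bullet> (?T *v p)" using cp(1) by (simp add: psd_def)
 have mM: "mdot ?T M = ?n*det A - c*psi'*mdot ?T H - c*psi''*(p \<bullet> (?T *v p))"
  unfolding M(2) by (simp add: mdot_diff mdot_scale mdot_add mdot_outer cp(2) algebra_simps)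
 have FH: "- (c*psi'*mdot ?T H) <= c*C*F"
 proof -
  have "- (c*psi')*mdot ?T H <= - (c*psi')*F" using c F by (intro mult_left_mono) (auto simp: mult_nonneg_nonpos)
  also have "... = (c*F)*(- psi')" by simp
  also have "... <= (c*F)*C" using c F by (intro mult_left_mono) auto
  finally have "- (c*psi')*mdot ?T H <= c*C*F" by (simp add: mult_ac)
  thus ?thesis by simp
 qed
 have M0: "0 <= mdot ?T M" by (rule psd_mdot(1)[OF cp(1) M(1)])
 have dM: "det M <= det A*(mdot ?T M/(?n*det A))^?N" by (rule det_le_mdot_cofac[OF A(1) d M(1)])
 have up: "mdot ?T M <= ?n*det A + c*C*F" using mM FH mult_nonneg_nonneg[OF mult_nonneg_nonneg[OF less_imp_le[OF c(1)] c(6)] pTp] by linarith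
 show "det M <= L*2^?N" if "c*C*F <= ?n*l"
 proof -
  have "?n*l <= ?n*det A" using A by (intro mult_left_mono) auto
  hence "mdot ?T M <= 2*(?n*det A)" using up that by linarith
  hence "mdot ?T M/(?n*det A) <= 2" using d by (simp add: field_simps)
  hence "det A*(mdot ?T M/(?n*det A))^?N <= L*2^?N" using A d M0 L by (intro mult_mono power_mono) auto
  thus ?thesis using dM by linarith
 qed
 assume cs: "?n*l <= c*C*F | 3*?n * c*(e \<bullet> (A *v e)) <= (1 + m)*(q \<bullet> e)^2 & e \<bullet> (A *v e) ~= 0"
 have CF: "0 <= c*C*F" using c C F by simp
 have "mdot ?T M <= (1 + L/l)*(c*C*F)" using cs
 proof
  assume "?n*l <= c*C*F"
  hence "(L/l)*(?n*l) <= (L/l)*(c*C*F)" using A L by (intro mult_left_mono) auto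
  moreover have "(L/l)*(?n*l) = ?n*L" using A by simp
  ultimately have "?n*L <= (L/l)*(c*C*F)" by simp
  moreover have "?n*det A <= ?n*L" using A by (intro mult_left_mono) auto
  ultimately have "mdot ?T M <= c*C*F + (L/l)*(c*C*F)" using up by linarith
  thus ?thesis by (simp add: algebra_simps)
 next
  assume h: "3*?n * c*(e \<bullet> (A *v e)) <= (1 + m)*(q \<bullet> e)^2 & e \<bullet> (A *v e) ~= 0"
  let ?E = "e \<bullet> (A *v e)"
  have E0: "0 < ?E" using h A(1) unfolding psd_def by (metis order_le_less)
  have "3*?n * c*?E*det A <= (1 + m)*((q \<bullet> e)^2*det A)" using h d by (simp add: mult_right_mono flip: mult.assoc)
  also have "... <= (1 + m)*((q \<bullet> (?T *v q))*?E)" using cp(4)[of q e] c by (intro mult_left_mono) auto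
  finally have "?E*(3*?n * c*det A) <= ?E*((1 + m)*(q \<bullet> (?T *v q)))" by (simp add: mult_ac)
  hence "3*?n * c*det A <= (1 + m)*(q \<bullet> (?T *v q))" using E0 by simp
  also have "... = (1 + m)*((c*psi')^2*(p \<bullet> (?T *v p)))" by (simp add: q matrix_vector_mult_scaleR power2_eq_square)
  also have "... = c*psi*(c*psi''*(p \<bullet> (?T *v p)))"
  proof -
   have "(1 + m)*((c*psi')^2*(p \<bullet> (?T *v p))) = c^2*((1 + m)*psi'^2)*(p \<bullet> (?T *v p))" by (simp only: power_mult_distrib mult_ac)
   thus ?thesis unfolding c(7)[symmetric] by (simp only: power2_eq_square mult_ac)
  qed
  also have "... <= c*3*(c*psi''*(p \<bullet> (?T *v p)))" using c pTp by (intro mult_right_mono mult_left_mono) auto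
  finally have "(3 * c)*(?n*det A) <= (3 * c)*(c*psi''*(p \<bullet> (?T *v p)))" by (simp add: mult_ac)
  hence "?n*det A <= c*psi''*(p \<bullet> (?T *v p))" using c by simp
  hence "mdot ?T M <= c*C*F" using mM FH by linarith
  moreover have "0 <= L/l*(c*C*F)" using CF A L by simp
  ultimately show ?thesis by (simp add: algebra_simps)
 qed
 hence "mdot ?T M/(?n*det A) <= (1 + L/l)*(c*C*F)/(?n*l)" using A CF L M0 d by (intro frac_le mult_left_mono) auto
 hence "det A*(mdot ?T M/(?n*det A))^?N <= L*((1 + L/l)*(c*C*F)/(?n*l))^?N" using A d M0 L by (intro mult_mono power_mono) auto
 thus "det M <= L*((1 + L/l)*(c*C*F)/(?n*l))^?N" using dM by linarith
qed

text \<open>Planes with slopes \<open>g v\<close>, for \<open>v\<close> near \<open>y\<close>, touch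
  \<open>phi - cc*psi(u)\<close> from below. These slopes fill a volume of order
  \<open>sqrt r^n\<close>, and every contact point has \<open>u <= 4^m\<close>. Contact points
  outside the section of height \<open>r\<close> contribute little: those with large radial second
  derivative form a small set, and at the others the Jacobian is bounded by the source.\<close>

lemma critical_density:
 fixes l L :: real
 assumes l: "0 < l" "l <= L"
 shows "EX K Q c de. 4 <= K & 1 < Q & 0 < c & 0 < de &
  (ALL (S :: (real^'n::finite) set) phi g A y r T u p H F z.
   msec l L S phi g A y (K*r) & 0 < r & c2_on T u p H & csec S phi g y (K*r) \<subseteq> T &
   (ALL x:csec S phi g y (K*r). 0 <= u x & mdot (cofac (A x)) (H x) <= F x & 0 <= F x) &
   continuous_on (csec S phi g y (K*r)) F & z \<in> csec S phi g y (2*r) & u z <= 1 &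
   r^CARD('n)*integral (csec S phi g y (K*r)) (%x. F x^CARD('n)) <= de * sqrt r^CARD('n) -->
   c * sqrt r^CARD('n) <= vol {x \<in> csec S phi g y r. u x <= Q})"
proof -
 let ?n = "real CARD('n)" and ?N = "CARD('n)"
 obtain C1 where C1: "2 <= C1" and GB: "!!(S :: (real^'n) set) phi g A y h x z.
  msec l L S phi g A y (2*h) & x \<in> csec S phi g y h & z \<in> csec S phi g y (2*h) ==>
  \<bar>(g x - g y) \<bullet> (z - x)\<bar> <= C1*h & excess phi g x z <= C1*h" using csec_gradient_bound[OF l, where 'n='n] by blast
 obtain eps where eps: "0 < eps" "eps <= 1" and EN: "!!(S :: (real^'n) set) phi g A y h x.
  msec l L S phi g A y (2*h) & x \<in> csec S phi g y h ==>
  msec l L S phi g A x (eps*h) & csec S phi g x (eps*h) \<subseteq> {z \<in> S. excess phi g y z < 2*h}" using csec_engulf[OF l, where 'n='n] by blast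
 obtain cV CV where V: "0 < cV" "0 < CV" and VO: "!!(S :: (real^'n) set) phi g A y h.
  MA l L S phi g A & compact (csec S phi g y h) & y \<in> S & 0 < h ==>
  cV * sqrt h^?N <= vol (csec S phi g y h) &
  vol (csec S phi g y h) <= CV * sqrt h^?N" using csec_volume[OF l, where 'n='n] by blast
 \<comment> \<open>By two uses of the gradient bound, a contact point outside the section of height
   \<open>r\<close> has excess more than \<open>s*r\<close> from \<open>v\<close>, whereas
   \<open>y\<close> has at most \<open>s*r/2\<close>.\<close>
 define s where "s = 1/(2*C1)"
 define ka where "ka = s/(2*C1)"
 have s: "0 < s" "C1 * s = 1/2" using C1 by (auto simp: s_def)
 have ka: "0 < ka" "C1*ka = s/2" using C1 s by (auto simp: ka_def)
 have ka1: "ka <= 1"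
 proof -
  have "1*ka <= C1*ka" "1 * s <= C1 * s" using C1 ka s by (auto intro!: mult_right_mono)
  thus ?thesis using ka s by linarith
 qed
 \<comment> \<open>Amplitude of the perturbation: \<open>psi (u z) >= 1/2\<close> contributes
   \<open>4*C1*r\<close> at \<open>z\<close>, whose excess is at most \<open>2*C1*r\<close>, and
   what remains forces \<open>psi >= 1/4\<close> at the contact point.\<close>
 define Nc where "Nc = 8*C1"
 \<comment> \<open>Contact points have excess at most \<open>25*C1*r\<close> from \<open>v\<close>;
   engulfing at height \<open>K*r/2\<close> with this \<open>K\<close> keeps them in the interior of
   the section of height \<open>K*r\<close>.\<close>
 define K where "K = 50*C1/eps"
 have K: "100 <= K" using C1 eps by (simp add: K_def field_simps)
 have Kh: "eps*(K/2) = 25*C1" using eps by (simp add: K_def)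
 define Z where "Z = (1 + C1*K)^?N*(CV * sqrt K^?N)"
 define W where "W = l*(cV * sqrt ka^?N)"
 have W: "0 < W" using l V ka by (simp add: W_def)
 have Z: "0 < Z" using C1 K V by (simp add: Z_def add_pos_pos)
 \<comment> \<open>All constants so far are independent of the profile, so \<open>m\<close> can be
   taken so large that the set of large radial second derivative costs at most a quarter of
   \<open>W\<close>.\<close>
 obtain m' :: nat where m': "L*2^?N*Z*(12*?n*Nc)*4/(s^2*W) < real m'" using reals_Archimedean2 by blast
 define m where "m = Suc m'"
 have m1: "1 <= m" by (simp add: m_def)
 define k where "k = (1 + real m) * s^2/(12*?n*Nc)"
 have Nc: "0 < Nc" using C1 by (simp add: Nc_def)
 have k: "0 < k" using s Nc by (simp add: k_def)
 have kZ: "L*2^?N*(Z/k) <= W/4"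
 proof -
  have p: "0 < s^2*W" "0 < 12*?n*Nc" using s W Nc by auto
  have "L*2^?N*Z*(12*?n*Nc)*4 < real m'*(s^2*W)" using m' p by (simp add: pos_divide_less_eq)
  also have "... <= (1 + real m)*(s^2*W)" using p by (intro mult_right_mono) (auto simp: m_def)
  finally have "L*2^?N*Z*4*(12*?n*Nc) <= ((1 + real m) * s^2)*W" by (simp add: mult_ac)
  hence "L*2^?N*Z*4 <= ((1 + real m) * s^2)*W/(12*?n*Nc)" using p(2) by (simp add: pos_le_divide_eq)
  hence "L*2^?N*Z*4 <= k*W" by (simp add: k_def)
  thus ?thesis using k by (simp add: field_simps)
 qed
 obtain e0 C psi psi' psi'' where P: "0 < e0 & 0 < C &
  (ALL t>-e0. (psi has_real_derivative psi' t) (at t) & (psi' has_real_derivative psi'' t) (at t)) &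
  continuous_on {-e0<..} psi'' &
  (ALL t>=0. 0 < psi t & psi t <= 3 & - C <= psi' t & psi' t <= 0 & 0 <= psi'' t &
   psi'' t*psi t = (1 + real m)*(psi' t)^2) &
  (ALL t>=0. 1/4 <= psi t --> t <= 4^m) & (ALL t>=0. t <= 1 --> 1/2 <= psi t)" using decreasing_profile[OF m1] by (elim exE)
 hence e0: "0 < e0" and C: "0 < C" and psic: "continuous_on {-e0<..} psi''"
  and psid: "!!t. - e0 < t ==> (psi has_real_derivative psi' t) (at t)" "!!t. - e0 < t ==> (psi' has_real_derivative psi'' t) (at t)"
  and psib: "!!t. 0 <= t ==> 0 < psi t & psi t <= 3 & - C <= psi' t & psi' t <= 0 & 0 <= psi'' t &
   psi'' t*psi t = (1 + real m)*(psi' t)^2"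
  and psi4: "!!t. 0 <= t ==> 1/4 <= psi t ==> t <= 4^m" and psi1: "!!t. 0 <= t ==> t <= 1 ==> 1/2 <= psi t" by blast+
 define Km where "Km = L*((1 + L/l)*(Nc*C)/(?n*l))^?N"
 have Km: "0 < Km" using l Nc C by (simp add: Km_def add_pos_pos)
 define de where "de = W/(4*Km)"
 define c where "c = W/(2*(L*2^?N))"
 have dc: "0 < de" "0 < c" using W Km l by (auto simp: de_def c_def)
 have main: "c * sqrt r^?N <= vol {x \<in> csec S phi g y r. u x <= 4^m}"
  if Ms: "msec l L S phi g A y (2*K*r)" and r: "0 < r" and cu: "c2_on T u p H" and DT: "csec S phi g y (2*K*r) \<subseteq> T"
   and uF: "!!x. x \<in> csec S phi g y (2*K*r) ==> 0 <= u x & mdot (cofac (A x)) (H x) <= F x & 0 <= F x"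
   and cF: "continuous_on (csec S phi g y (2*K*r)) F" and z: "z \<in> csec S phi g y (2*r)" and uz: "u z <= 1"
   and Fs: "r^?N*integral (csec S phi g y (2*K*r)) (%x. F x^?N) <= de * sqrt r^?N" for S :: "(real^'n) set" and phi g A y r T u p H F z
 proof -
  let ?ms = "msec l L S phi g A" and ?cs = "csec S phi g" and ?ex = "excess phi g"
  note MM = msecD[OF Ms]
  note MA = MM(1) and yS = MM(2)
  have sm: "?ms y (t*r)" if "0 < t" "t <= 2*K" for t using that r by (intro msec_smaller[OF Ms]) auto
  define D where "D = ?cs y (K*r)"
  have DD: "D \<subseteq> ?cs y (2*K*r)" unfolding D_def using K r by (intro csec_mono) auto
  have DS: "D \<subseteq> S" by (auto simp: D_def csec_def)
  have msK: "?ms y (K*r)" using K by (intro sm) auto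
  have cD: "compact D" using msecD(4)[OF msK] by (simp add: D_def)
  define Q where "Q = {x \<in> S \<inter> T. - e0 < u x}"
  have oQ: "open Q"
  proof -
   have "continuous_on (S \<inter> T) u" using c2_on_continuous(1)[OF cu] continuous_on_subset by blast
   hence "open (S \<inter> T \<inter> u -` {- e0<..})" using MA_D(1)[OF MA] c2_onD(1)[OF cu] by (intro continuous_open_preimage) auto
   moreover have "Q = S \<inter> T \<inter> u -` {- e0<..}" by (auto simp: Q_def)
   ultimately show ?thesis by simp
  qed
  have DQ: "D \<subseteq> Q" using DD DS DT uF e0 unfolding Q_def by (fastforce dest: subsetD)
  have cuQ: "c2_on Q u p H" by (rule c2_on_subset[OF cu oQ]) (auto simp: Q_def)
  have cphi: "c2_on Q phi g A" by (rule c2_on_subset[OF MA_D(4)[OF MA] oQ]) (auto simp: Q_def)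
  have cU: "c2_on Q (%x. psi (u x)) (%x. psi' (u x) *\<^sub>R p x) (%x. psi' (u x) *\<^sub>R H x + psi'' (u x) *\<^sub>R outer (p x) (p x))"
   by (rule c2_on_compose[OF cuQ]) (auto simp: Q_def intro!: psid continuous_on_subset[OF psic])
  define cc where "cc = Nc*r"
  have cc: "0 < cc" using Nc r by (simp add: cc_def)
  define M where "M x = A x - cc *\<^sub>R (psi' (u x) *\<^sub>R H x + psi'' (u x) *\<^sub>R outer (p x) (p x))" for x
  define G where "G x = g x - cc *\<^sub>R (psi' (u x) *\<^sub>R p x)" for x
  have cw: "c2_on Q (%x. phi x - cc*psi (u x)) G M" unfolding M_def[abs_def] G_def[abs_def] by (intro c2_on_diff c2_on_scale cphi cU)
  have cM: "continuous_on D M" using c2_onD(2)[OF cw] DQ continuous_on_subset by blast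
  have cuD: "continuous_on D u" using c2_on_continuous(1)[OF cuQ] DQ continuous_on_subset by blast
  have cFD: "continuous_on D F" using cF DD continuous_on_subset by blast
  define E where "E = {x \<in> D. psd (M x)}"
  define Nr where "Nr = {x \<in> ?cs y r. u x <= 4^m}"
  define Bd where "Bd = {x \<in> D. k*r <= (x - y) \<bullet> (A x *v (x - y))}"
  define Sm where "Sm = {x \<in> D. cc*C*F x <= ?n*l}"
  have yD: "y \<in> D" using yS K r by (simp add: D_def csec_def)
  have rad: "(g x - g y) \<bullet> (x - y) <= C1*K*r" if "x \<in> D" for x
  proof -
   have "y \<in> ?cs y (2*(K*r))" using yS K r by (simp add: csec_def)
   hence "\<bar>(g x - g y) \<bullet> (y - x)\<bar> <= C1*(K*r)" using GB[of S phi g A y "K*r" x y] Ms that by (simp add: D_def mult.assoc)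
   thus ?thesis by (simp add: inner_diff_right abs_le_iff mult.assoc)
  qed
  have conv: "convex D" unfolding D_def by (rule csec_convex[OF MA])
  note RH = radial_hessian_measure[OF MA cD conv DS yD r k rad]
  have cBd: "compact Bd" using RH(1) by (simp add: Bd_def)
  have mBd: "vol Bd <= Z/k * sqrt r^?N"
  proof -
   have "k * vol Bd <= (1 + C1*K)^?N * vol D" using RH(2) by (simp add: Bd_def)
   also have "... <= (1 + C1*K)^?N*(CV * sqrt (K*r)^?N)" using VO[of S phi g A y "K*r"] MA cD yS K r C1 by (intro mult_left_mono) (auto simp: D_def)
   also have "... = Z * sqrt r^?N" by (simp add: Z_def real_sqrt_mult power_mult_distrib)
   finally show ?thesis using k by (simp add: field_simps)
  qed
  have rD: "?cs y r \<subseteq> D" unfolding D_def using K r by (intro csec_mono) auto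
  have cr: "compact (?cs y r)" using msecD(4)[OF sm[of 1]] K by simp
  have cNr: "compact Nr" unfolding Nr_def by (rule compact_sublevel[OF cr]) (rule continuous_on_subset[OF cuD rD])
  have cSm: "compact Sm" unfolding Sm_def by (rule compact_sublevel[OF cD]) (intro continuous_intros cFD)
  have cE: "compact E"
  proof -
   have "compact {x \<in> D. 0 <= h \<bullet> (M x *v h)}" for h
    using cM by (intro compact_superlevel[OF cD]) (auto simp: matrix_vector_mult_def inner_vec_def intro!: continuous_intros)
   hence "closed (\<Inter>h. {x \<in> D. 0 <= h \<bullet> (M x *v h)})" by (intro closed_INT ballI compact_imp_closed)
   from compact_Int_closed[OF cD this] show ?thesis
    by (rule back_subst[of compact]) (use c2_onD(5)[OF cw] DQ in \<open>auto simp: E_def psd_def\<close>)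
  qed
  \<comment> \<open>\<open>B1\<close> collects contact points with small source that lie in the set
    \<open>Nr\<close> to be measured or in the small set \<open>Bd\<close>. On the remaining contact
    points, \<open>B2\<close>, the Jacobian is bounded by the source.\<close>
  define B1 where "B1 = (E \<inter> Sm) \<inter> (Nr \<union> Bd)"
  define Fr where "Fr = {x \<in> D. s*r/2 <= (g x - G x) \<bullet> (x - y)}"
  have cFr: "compact Fr" unfolding Fr_def using c2_on_continuous(2)[OF cw] c2_on_continuous(2)[OF cphi] DQ
   by (intro compact_superlevel[OF cD] continuous_intros) (auto intro: continuous_on_subset)
  define B2 where "B2 = E \<inter> (Nr \<union> Fr) - B1"
  define X where "X v x \<longleftrightarrow> x \<in> D & (ALL w:D. cc*psi (u w) - ?ex v w <= cc*psi (u x) - ?ex v x)" for v x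
  have contact: "x \<in> E & G x = g v & (x \<in> ?cs y r --> x \<in> Nr) &
    (x \<notin> ?cs y r --> s*r/2 <= (g x - g v) \<bullet> (x - y))" if v: "v \<in> ?cs y (ka*r)" and x: "X v x" for v x
  proof -
   have xD: "x \<in> D" and xm: "!!w. w \<in> D ==> cc*psi (u w) - ?ex v w <= cc*psi (u x) - ?ex v x" using x by (auto simp: X_def)
   have xS: "x \<in> S" using xD DS by blast
   have vS: "v \<in> S" using v by (simp add: csec_def)
   have u0: "0 <= u x" using uF xD DD by blast
   have zD: "z \<in> D" unfolding D_def by (rule subsetD[OF csec_mono z]) (use K r in auto)
   have v2: "v \<in> ?cs y (2*r)" by (rule subsetD[OF csec_mono v]) (use ka1 r in auto)
   have z4: "z \<in> ?cs y (2*(2*r))" using z r by (auto simp: csec_def)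
   have "?ms y (2*(2*r))" using sm[of 4] K by simp
   hence tz: "?ex v z <= C1*(2*r)" using GB[of S phi g A y "2*r" v z] v2 z4 by blast
   have uz0: "0 <= u z" using uF zD DD by blast
   have "cc*(1/2) <= cc*psi (u z)" using psi1[OF uz0 uz] cc by (intro mult_left_mono) auto
   hence low: "2*C1*r <= cc*psi (u x) - ?ex v x" using xm[OF zD] tz by (simp add: cc_def Nc_def)
   have tv0: "0 <= ?ex v x" by (rule MA_D(10)[OF MA xS vS])
   have "cc*(1/4) <= cc*psi (u x)" using low tv0 by (simp add: cc_def Nc_def)
   hence "1/4 <= psi (u x)" using cc by (simp only: mult_le_cancel_left_pos)
   hence u4: "u x <= 4^m" using psi4[OF u0] by blast
   have "cc*psi (u x) <= cc*3" using psib[OF u0] cc by (intro mult_left_mono) auto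
   moreover have "0 < C1*r" "cc = 8*(C1*r)" using C1 r by (auto simp: cc_def Nc_def)
   ultimately have tvx: "?ex v x <= 25*C1*r" using low by linarith
   have vK: "v \<in> ?cs y (K/2*r)" by (rule subsetD[OF csec_mono v]) (use ka1 r K in auto)
   have "?ms y (2*(K/2*r))" using msK by simp
   from EN[of S phi g A y "K/2*r" v] this vK have
    ev: "?ms v (25*C1*r)" "?cs v (25*C1*r) \<subseteq> {z \<in> S. ?ex y z < K*r}" using Kh by (simp_all flip: mult.assoc)
   have xi: "x \<in> {z \<in> S. ?ex y z < K*r}" using ev(2) tvx xS by (auto simp: csec_def)
   have oI: "open {z \<in> S. ?ex y z < K*r}" using sublev_interior[OF MA, of "phi y - g y \<bullet> y + K*r" "g y"]
    by (rule back_subst[of "open"]) (auto simp: excess_def inner_diff_right)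
   have cW: "c2_on Q (%x. ((phi v - g v \<bullet> v) + g v \<bullet> x) - (phi x - cc*psi (u x))) (%x. g v - G x) (%x. 0 - M x)"
    by (intro c2_on_diff c2_on_affine oQ cw)
   have mx: "((phi v - g v \<bullet> v) + g v \<bullet> w) - (phi w - cc*psi (u w)) <= ((phi v - g v \<bullet> v) + g v \<bullet> x) - (phi x - cc*psi (u x))"
    if "w \<in> {z \<in> S. ?ex y z < K*r} \<inter> Q" for w
   proof -
    have "w \<in> D" using that by (auto simp: D_def csec_def)
    from xm[OF this] show ?thesis by (simp add: excess_def inner_diff_right)
   qed
   have xQ: "x \<in> Q" using xD DQ by blast
   note lm = local_max_test[OF cW xQ oI xi mx]
   have "0 <= h \<bullet> (M x *v h)" for h using lm(2)[of h] unfolding matrix_vector_mult_diff_rdistrib by simp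
   hence "psd (M x)" using c2_onD(5)[OF cw xQ] by (simp add: psd_def)
   hence "x \<in> E" using xD by (simp add: E_def)
   moreover have "G x = g v" using lm(1) by simp
   \<comment> \<open>The three-point identity gives the gradient difference a definite radial
     component, because \<open>x\<close> is far from \<open>v\<close> while \<open>y\<close> is
     near.\<close>
   moreover have "s*r/2 <= (g x - g v) \<bullet> (x - y)" if far: "x \<notin> ?cs y r"
   proof -
    have mska: "?ms y (2*(ka*r))" using sm[of "2*ka"] ka ka1 K by (simp add: mult.assoc)
    have "y \<in> ?cs y (2*(ka*r))" using yS ka r by (simp add: csec_def)
    hence "?ex v y <= C1*(ka*r)" using GB[of S phi g A y "ka*r" v y] mska v by blast
    hence vy: "?ex v y <= s/2*r" using ka by (simp flip: mult.assoc)
    have "s*r < ?ex v x"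
    proof (rule ccontr)
     assume "~ ?thesis"
     hence "?ex v x <= 2*(s*r)" using mult_pos_pos[OF s(1) r] by linarith
     hence xs: "x \<in> ?cs v (2*(s*r))" using xS by (simp add: csec_def)
     have "?ex v y <= s*r" using vy mult_pos_pos[OF s(1) r] by linarith
     hence ys: "y \<in> ?cs v (s*r)" using yS by (simp add: csec_def)
     have "2 * s <= 25*C1" using s C1 by (simp add: s_def field_simps) (use mult_mono[of 1 C1 1 C1] in simp)
     hence "2*(s*r) <= 25*C1*r" using r mult_right_mono[of "2 * s" "25*C1" r] by simp
     hence "?ms v (2*(s*r))" using s r by (intro msec_smaller[OF ev(1)]) auto
     hence "?ex y x <= C1*(s*r)" using GB[of S phi g A v "s*r" y x] ys xs by blast
     also have "C1*(s*r) = r/2" using s by (simp flip: mult.assoc)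
     finally show False using far xS r by (simp add: csec_def)
    qed
    moreover have "0 <= ?ex x y" by (rule MA_D(10)[OF MA yS xS])
    moreover have "?ex v y = ?ex v x + (g x - g v) \<bullet> (y - x) + ?ex x y" by (rule excess_three_points)
    moreover have "(g x - g v) \<bullet> (y - x) = - ((g x - g v) \<bullet> (x - y))" by (simp add: inner_diff_right)
    ultimately show ?thesis using vy by simp
   qed
   ultimately show ?thesis using u4 by (auto simp: Nr_def)
  qed
  have exX: "EX x. X v x" if v: "v \<in> ?cs y (ka*r)" for v
  proof -
   have "continuous_on D (%x. cc*psi (u x) - ?ex v x)" using c2_on_continuous(1)[OF cU] DQ DS
    by (intro continuous_intros continuous_on_subset[OF excess_continuous[OF MA]]) (auto intro: continuous_on_subset)
   from continuous_attains_sup[OF cD _ this] yD show ?thesis unfolding X_def by blast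
  qed
  have cK: "compact (?cs y (ka*r))" using msecD(4)[OF sm[of ka]] ka ka1 K by simp
  have KS: "?cs y (ka*r) \<subseteq> S" by (auto simp: csec_def)
  note gi = MA_gradient_image_lower[OF MA cK KS]
  have sub: "g ` ?cs y (ka*r) \<subseteq> G ` (B1 \<union> B2)"
  proof
   fix t assume "t \<in> g ` ?cs y (ka*r)"
   then obtain v where v: "v \<in> ?cs y (ka*r)" "t = g v" by blast
   obtain x where x: "X v x" using exX[OF v(1)] by blast
   have xD: "x \<in> D" using x by (simp add: X_def)
   from contact[OF v(1) x] xD have "x \<in> E \<inter> (Nr \<union> Fr)" "G x = t" unfolding v(2) by (auto simp: Fr_def)
   thus "t \<in> G ` (B1 \<union> B2)" by (auto simp: B2_def)
  qed
  have lB: "B1 \<in> lmeasurable" "B2 \<in> sets lebesgue" "B1 \<subseteq> D" "B2 \<subseteq> D"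
  proof -
   have "compact B1" unfolding B1_def by (intro compact_Int compact_Un cE cSm cNr cBd)
   thus 1: "B1 \<in> lmeasurable" by (rule lmeasurable_compact)
   have "compact (E \<inter> (Nr \<union> Fr))" by (intro compact_Int compact_Un cE cFr cNr)
   thus "B2 \<in> sets lebesgue" unfolding B2_def using fmeasurableD[OF 1] fmeasurableD[OF lmeasurable_compact] by (intro sets.Diff) auto
   show "B1 \<subseteq> D" "B2 \<subseteq> D" by (auto simp: B1_def B2_def E_def)
  qed
  note bnd = determinant_bound_at_contact[where l=l and L=L and c=cc and C=C and m="real m"]
  have hyp: "psd (A x)" "l <= det (A x)" "det (A x) <= L" "0 < l" "0 < cc" "0 < psi (u x)" "psi (u x) <= 3"
   "- C <= psi' (u x)" "psi' (u x) <= 0" "0 <= psi'' (u x)" "psi'' (u x)*psi (u x) = (1 + real m)*(psi' (u x))^2"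
   "0 <= real m" "mdot (cofac (A x)) (H x) <= F x" "0 <= F x" "0 <= C"
   "g x - G x = (cc*psi' (u x)) *\<^sub>R p x" if "x \<in> D" for x
  proof -
   have xS: "x \<in> S" and u0: "0 <= u x" using that DS uF DD by blast+
   show "psd (A x)" "l <= det (A x)" "det (A x) <= L" "0 < l" using MA_D(6,7,9)[OF MA xS] l by auto
   show "0 < psi (u x)" "psi (u x) <= 3"
   "- C <= psi' (u x)" "psi' (u x) <= 0" "0 <= psi'' (u x)" "psi'' (u x)*psi (u x) = (1 + real m)*(psi' (u x))^2" using psib[OF u0] by auto
   show "mdot (cofac (A x)) (H x) <= F x" "0 <= F x" using uF that DD by blast+
  qed (use cc C in \<open>auto simp: G_def\<close>)
  have ME: "psd (M x)" "M x = A x - cc *\<^sub>R (psi' (u x) *\<^sub>R H x + psi'' (u x) *\<^sub>R outer (p x) (p x))" "x \<in> D" if "x \<in> E" for x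
   using that by (auto simp: E_def M_def)
  have b1: "\<bar>det (M x)\<bar> <= L*2^?N" if "x \<in> B1" for x
  proof -
   have xE: "x \<in> E" "x \<in> Sm" using that by (auto simp: B1_def)
   note D = ME[OF xE(1)]
   have "det (M x) <= L*2^?N" by (rule bnd(1)[OF hyp(1-4)[OF D(3)] D(1,2) hyp(5-16)[OF D(3)]]) (use xE in \<open>simp add: Sm_def\<close>)
   thus ?thesis using psd_det_trace(1)[OF D(1)] by simp
  qed
  have b2: "\<bar>det (M x)\<bar> <= Km*(r*F x)^?N" if x: "x \<in> B2" for x
  proof -
   have xE: "x \<in> E" using x by (auto simp: B2_def)
   note D = ME[OF xE]
   have "?n*l <= cc*C*F x | 3*?n * cc*((x - y) \<bullet> (A x *v (x - y))) <= (1 + real m)*((g x - G x) \<bullet> (x - y))^2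
     & (x - y) \<bullet> (A x *v (x - y)) ~= 0"
   proof (cases "x \<in> Sm")
    case False
    thus ?thesis using D(3) by (auto simp: Sm_def)
   next
    case True
    hence far: "x \<in> Fr" "x \<notin> Bd" using x by (auto simp: B1_def B2_def)
    have q: "s*r/2 <= (g x - G x) \<bullet> (x - y)" using far by (simp add: Fr_def)
    have sr: "0 < s*r/2" using s r by simp
    have "x - y ~= 0" using q sr by auto
    hence ne: "(x - y) \<bullet> (A x *v (x - y)) ~= 0" using psd_pos_def[OF hyp(1)[OF D(3)]] hyp(2,4)[OF D(3)] by fastforce
    have "(x - y) \<bullet> (A x *v (x - y)) <= k*r" using far D(3) by (auto simp: Bd_def)
    hence "3*?n * cc*((x - y) \<bullet> (A x *v (x - y))) <= 3*?n * cc*(k*r)" using cc by (intro mult_left_mono) auto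
    also have "... = (1 + real m)*(s*r/2)^2" using Nc by (simp add: k_def cc_def power2_eq_square field_simps)
    also have "... <= (1 + real m)*((g x - G x) \<bullet> (x - y))^2" using q sr by (intro mult_left_mono power_mono) auto
    finally show ?thesis using ne by blast
   qed
   from bnd(2)[OF hyp(1-4)[OF D(3)] D(1,2) hyp(5-16)[OF D(3)] this]
   have "det (M x) <= L*((1 + L/l)*(cc*C*F x)/(?n*l))^?N" .
   also have "(1 + L/l)*(cc*C*F x)/(?n*l) = ((1 + L/l)*(Nc*C)/(?n*l))*(r*F x)" by (simp add: cc_def)
   also have "L*(((1 + L/l)*(Nc*C)/(?n*l))*(r*F x))^?N = Km*(r*F x)^?N" by (simp only: Km_def power_mult_distrib mult.assoc)
   finally have "det (M x) <= Km*(r*F x)^?N" .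
   thus ?thesis using psd_det_trace(1)[OF D(1)] by simp
  qed
  have "vol (g ` ?cs y (ka*r)) <= L*2^?N * vol B1 + integral D (%x. Km*(r*F x)^?N)"
  proof (rule gradient_image_measure[OF cw cD DQ _ lB(3) lB(2,4) gi(1) sub b1 b2])
   show "B1 \<in> sets lebesgue" using lB(1) by auto
   show "continuous_on D (%x. Km*(r*F x)^?N)" using cFD by (intro continuous_intros)
   show "0 <= Km*(r*F x)^?N" if "x \<in> D" for x using hyp(14)[OF that] Km r by simp
  qed
  moreover have "integral D (%x. Km*(r*F x)^?N) <= W/4 * sqrt r^?N"
  proof -
   have "integral D (%x. Km*(r*F x)^?N) = Km*(r^?N*integral D (%x. F x^?N))" by (simp add: power_mult_distrib)
   also have "integral D (%x. F x^?N) <= integral (?cs y (2*K*r)) (%x. F x^?N)"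
   proof (rule integral_subset_le[OF DD])
    have *: "continuous_on (?cs y (2*K*r)) (%x. F x^?N)" using cF by (intro continuous_intros)
    show "(%x. F x^?N) integrable_on ?cs y (2*K*r)"
     using integrable_on_compact_subset(2)[OF MM(4) * _ subset_refl] fmeasurableD[OF lmeasurable_compact[OF MM(4)]] by blast
    show "(%x. F x^?N) integrable_on D" using integrable_on_compact_subset(2)[OF MM(4) * _ DD] fmeasurableD[OF lmeasurable_compact[OF cD]] by blast
   qed (use uF in auto)
   also have "Km*(r^?N*integral (?cs y (2*K*r)) (%x. F x^?N)) <= Km*(de * sqrt r^?N)" using Fs Km by (intro mult_left_mono) auto
   also have "... = W/4 * sqrt r^?N" using Km by (simp add: de_def)
   finally show ?thesis using Km r by simp
  qed
  moreover have "W * sqrt r^?N <= vol (g ` ?cs y (ka*r))"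
  proof -
   have "W * sqrt r^?N = l*(cV * sqrt (ka*r)^?N)" by (simp add: W_def real_sqrt_mult power_mult_distrib)
   also have "... <= l * vol (?cs y (ka*r))" using VO[of S phi g A y "ka*r"] MA cK yS ka r l by (intro mult_left_mono) auto
   finally show ?thesis using gi(2) by linarith
  qed
  moreover have "L*2^?N * vol B1 <= L*2^?N * vol Nr + W/4 * sqrt r^?N"
  proof -
   have NL: "Nr \<in> lmeasurable" "Bd \<in> lmeasurable" using cNr cBd by (auto intro: lmeasurable_compact)
   have "vol B1 <= vol (Nr \<union> Bd)" using NL lB by (intro measure_mono_fmeasurable) (auto simp: B1_def)
   also have "... <= vol Nr + vol Bd" using NL by (intro measure_Un_le) auto
   also have "... <= vol Nr + Z/k * sqrt r^?N" using mBd by simp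
   finally have "L*2^?N * vol B1 <= L*2^?N*(vol Nr + Z/k * sqrt r^?N)" using l by (intro mult_left_mono) auto
   also have "... = L*2^?N * vol Nr + L*2^?N*(Z/k) * sqrt r^?N" by (simp add: algebra_simps)
   also have "L*2^?N*(Z/k) * sqrt r^?N <= W/4 * sqrt r^?N" using kZ r by (intro mult_right_mono) auto
   finally show ?thesis by simp
  qed
  \<comment> \<open>Of the image volume \<open>W * sqrt r^n\<close> one quarter is lost to the
    source and one to \<open>Bd\<close>; the rest must come from \<open>Nr\<close>.\<close>
  ultimately have "W/2 * sqrt r^?N <= L*2^?N * vol Nr" by simp
  thus ?thesis using l by (simp add: c_def Nr_def field_simps)
 qed
 show ?thesis
 proof (rule exI[of _ "2*K"], rule exI[of _ "4^m"], rule exI[of _ c], rule exI[of _ de], intro conjI allI impI, goal_cases)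
  case 2
  show ?case using m1 by (intro one_less_power) auto
 next
  case (5 S phi g A y r T u p H F z)
  show ?case by (rule main[of S phi g A y r T u p H F z]) (use 5 in blast)+
 qed (use K dc in auto)
qed

section \<open>Weak Harnack inequality and oscillation decay for C^2 functions\<close>

lemma finite_vitali_selection:
 fixes r :: "'i => real"
 assumes "finite I" "!!i. i \<in> I ==> B i ~= {}"
 shows "\<exists>J\<subseteq>I. disjoint_family_on B J & (ALL i:I. EX j:J. r i <= r j & B i \<inter> B j ~= {})" using assms
proof (induction "card I" arbitrary: I rule: less_induct)
 case less
 show ?case
 proof (cases "I = {}")
  case False
  have "Max (r ` I) \<in> r ` I" using less.prems(1) False by (intro Max_in) auto
  then obtain m where m: "m \<in> I" "r m = Max (r ` I)" by auto
  have mx: "r i <= r m" if "i \<in> I" for i using that less.prems(1) by (simp add: m(2))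
  \<comment> \<open>Greedy choice: the index with largest \<open>r\<close> is kept, everything
    meeting its set is discarded, and the induction continues with the rest.\<close>
  define I' where "I' = {i \<in> I. B i \<inter> B m = {}}"
  have "I' \<subset> I" using m less.prems(2)[OF m(1)] by (auto simp: I'_def)
  hence "card I' < card I" using less.prems(1) by (simp add: psubset_card_mono)
  moreover have "finite I'" using less.prems(1) by (simp add: I'_def)
  ultimately obtain J where J: "J \<subseteq> I'" "disjoint_family_on B J"
   "ALL i:I'. EX j:J. r i <= r j & B i \<inter> B j ~= {}" using less.hyps[of I'] less.prems(2) by (auto simp: I'_def)
  have "disjoint_family_on B (insert m J)" using J(1,2) by (auto simp: disjoint_family_on_def I'_def)
  moreover have "EX j:insert m J. r i <= r j & B i \<inter> B j ~= {}" if "i \<in> I" for i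
   using J(3) mx[OF that] that by (cases "i \<in> I'") (auto simp: I'_def)
  moreover have "insert m J \<subseteq> I" using J(1) m by (auto simp: I'_def)
  ultimately show ?thesis by blast
 qed (auto simp: disjoint_family_on_def)
qed

text \<open>Twice differentiability is asked on an open set around \<open>D\<close>, and
  \<open>F\<close> is continuous so that its powers are integrable on compact sections.\<close>

definition supersolution ::
 "(real^'n::finite => real^'n^'n) => (real^'n) set => (real^'n => real) => (real^'n => real) => bool" where
 "supersolution A D u F \<longleftrightarrow> continuous_on D F & (ALL x:D. 0 <= F x) &
  (EX T p H. c2_on T u p H & D \<subseteq> T & (ALL x:D. 0 <= u x & mdot (cofac (A x)) (H x) <= F x))"

lemma supersolution_continuous: "supersolution A D u F ==> continuous_on D u"
 unfolding supersolution_def by (meson c2_on_continuous(1) continuous_on_subset)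

lemma supersolution_integrable:
 assumes "supersolution A D u F" "compact D" "D' \<in> sets lebesgue" "D' \<subseteq> D"
 shows "(%x. F x^k) integrable_on D'"
proof (rule integrable_on_compact_subset(2)[OF assms(2) _ assms(3,4)])
 show "continuous_on D (%x. F x^k)" using assms(1) unfolding supersolution_def by (intro continuous_intros) auto
qed

text \<open>The operator is linear, so \<open>u/t\<close> has source \<open>F/t\<close> and the
  smallness condition acquires the factor \<open>t^n\<close>. The source is integrated over a fixed
  larger set \<open>D\<close>, which makes the condition uniform over all sections of a
  covering.\<close>

lemma critical_density_scaled:
 fixes l L :: real
 assumes l: "0 < l" "l <= L"
 shows "EX K Q c de. 4 <= K & 1 < Q & 0 < c & 0 < de &
  (ALL (S :: (real^'n::finite) set) phi g A y r u F D t z.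
   msec l L S phi g A y (K*r) & 0 < r & 0 < t & compact D & csec S phi g y (K*r) \<subseteq> D &
   supersolution A D u F & sqrt r^CARD('n)*integral D (%x. F x^CARD('n)) <= de*t^CARD('n) &
   z \<in> csec S phi g y (2*r) & u z <= t -->
   c * sqrt r^CARD('n) <= vol {x \<in> csec S phi g y r. u x <= Q*t})"
proof -
 let ?N = "CARD('n)"
 show ?thesis using critical_density[OF l, where 'n='n]
 proof (elim exE conjE, goal_cases)
  case (1 K Q c de)
  note k = 1(1-4) and V = 1(5)[rule_format]
 have "c * sqrt r^?N <= vol {x \<in> csec S phi g y r. u x <= Q*t}"
  if M: "msec l L S phi g A y (K*r)" and r: "0 < r" and t: "0 < t" and D: "compact D" "csec S phi g y (K*r) \<subseteq> D"
   and s: "supersolution A D u F" and F: "sqrt r^?N*integral D (%x. F x^?N) <= de*t^?N"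
   and z: "z \<in> csec S phi g y (2*r)" "u z <= t" for S :: "(real^'n) set" and phi g A y r u F D t z
 proof -
  let ?D = "csec S phi g y (K*r)"
  obtain T p H where T: "c2_on T u p H" "D \<subseteq> T" "!!x. x \<in> D ==> 0 <= u x & mdot (cofac (A x)) (H x) <= F x"
   using s unfolding supersolution_def by blast
  have F0: "continuous_on D F" "!!x. x \<in> D ==> 0 <= F x" using s unfolding supersolution_def by blast+
  have cD: "compact ?D" by (rule msecD(4)[OF M])
  have mD: "?D \<in> sets lebesgue" "D \<in> sets lebesgue" using cD D(1) by (auto intro: fmeasurableD lmeasurable_compact)
  have le: "integral ?D (%x. F x^?N) <= integral D (%x. F x^?N)"
   using F0(2) by (intro integral_subset_le D(2) supersolution_integrable[OF s D(1)] mD) auto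
  have "r^?N*integral ?D (%x. ((1/t)*F x)^?N) = sqrt r^?N*(1/t)^?N*(sqrt r^?N*integral ?D (%x. F x^?N))"
  proof -
   have rr: "r^?N = sqrt r^?N * sqrt r^?N" using r by (simp flip: power_mult_distrib)
   show ?thesis unfolding power_mult_distrib[of "1/t"] integral_mult_right rr by (simp only: mult_ac)
  qed
  also have "... <= sqrt r^?N*(1/t)^?N*(de*t^?N)" using r t by (intro mult_left_mono order_trans[OF mult_left_mono[OF le] F]) auto
  also have "... = de * sqrt r^?N" using t by (simp add: power_divide)
  finally have small: "r^?N*integral ?D (%x. ((1/t)*F x)^?N) <= de * sqrt r^?N" .
  have "c * sqrt r^?N <= vol {x \<in> csec S phi g y r. (1/t)*u x <= Q}"
  proof (rule V[of S phi g A y r T _ _ _ "%x. (1/t)*F x" z], intro conjI ballI)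
   show "c2_on T (%x. (1/t)*u x) (%x. (1/t) *\<^sub>R p x) (%x. (1/t) *\<^sub>R H x)" by (rule c2_on_scale[OF T(1)])
   show "?D \<subseteq> T" using D T by blast
   show "continuous_on ?D (%x. (1/t)*F x)" using continuous_on_subset[OF F0(1) D(2)] by (intro continuous_intros)
   fix x assume "x \<in> ?D"
   hence xD: "x \<in> D" using D by blast
   show "0 <= 1/t*u x" "mdot (cofac (A x)) ((1/t) *\<^sub>R H x) <= 1/t*F x" "0 <= 1/t*F x"
    using T(3)[OF xD] F0(2)[OF xD] t by (auto simp: mdot_scale divide_right_mono)
  qed (use M r z t small in auto)
  thus ?thesis using t by (simp add: pos_divide_le_eq)
 qed
 note main = this
 show ?thesis
 proof (rule exI[of _ K], rule exI[of _ Q], rule exI[of _ c], rule exI[of _ de], intro conjI allI impI, goal_cases)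
  case (5 S phi g A y r u F D t z)
  show ?case by (rule main[where A=A and D=D and F=F and z=z]) (use 5 in blast)+
 qed (use k in auto)
 qed
qed

text \<open>The common point \<open>w\<close> serves as intermediate centre: the gradient bound
  moves the centre from \<open>x\<close> to \<open>w\<close> and then from \<open>w\<close> to
  \<open>y\<close>, each time at the cost of a factor, hence the square. This is the enlargement in
  Vitali's lemma.\<close>

lemma csec_engulf_meeting:
 fixes l L :: real
 assumes l: "0 < l" "l <= L"
 shows "EX C>=2. ALL (S :: (real^'n::finite) set) phi g A x y w r s.
  msec l L S phi g A x (2*r) & msec l L S phi g A y (2 * s) & msec l L S phi g A w (C * s) & r <= s &
  w \<in> csec S phi g x r & w \<in> csec S phi g y s --> csec S phi g x r \<subseteq> csec S phi g y (C * s)"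
proof -
 obtain C1 where C1: "2 <= C1" and GB: "!!(S :: (real^'n) set) phi g A y h x z.
  msec l L S phi g A y (2*h) & x \<in> csec S phi g y h & z \<in> csec S phi g y (2*h) ==>
  \<bar>(g x - g y) \<bullet> (z - x)\<bar> <= C1*h & excess phi g x z <= C1*h" using csec_gradient_bound[OF l, where 'n='n] by blast
 have CC: "2*C1 <= C1*C1" "2 <= C1*C1"
 proof -
  show "2*C1 <= C1*C1" using C1 by (intro mult_right_mono) auto
  thus "2 <= C1*C1" using C1 by linarith
 qed
 have "csec S phi g x r \<subseteq> csec S phi g y (C1*C1 * s)"
  if M: "msec l L S phi g A x (2*r)" "msec l L S phi g A y (2 * s)" "msec l L S phi g A w (C1*C1 * s)"
   and rs: "r <= s" and w: "w \<in> csec S phi g x r" "w \<in> csec S phi g y s" for S :: "(real^'n) set" and phi g A x y w r s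
 proof
  fix v assume v: "v \<in> csec S phi g x r"
  have r0: "0 < r" and s0: "0 < s" using msecD(3)[OF M(1)] msecD(3)[OF M(2)] by auto
  have vS: "v \<in> S" using v by (simp add: csec_def)
  have "v \<in> csec S phi g x (2*r)" using v r0 by (auto simp: csec_def)
  hence "excess phi g w v <= C1*r" using GB[of S phi g A x r w v] M(1) w(1) by blast
  also have "... <= C1 * s" using rs C1 by (intro mult_left_mono) auto
  finally have 1: "excess phi g w v <= C1 * s" .
  have yS: "y \<in> S" by (rule msecD(2)[OF M(2)])
  have "y \<in> csec S phi g y (2 * s)" using yS s0 by (simp add: csec_def)
  hence 2: "excess phi g w y <= C1 * s" using GB[of S phi g A y s w y] M(2) w(2) by blast
  have Cs: "0 < C1 * s" using C1 s0 by simp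
  have "msec l L S phi g A w (2*(C1 * s))" using CC s0 C1 mult_right_mono[OF CC(1), of s] by (intro msec_smaller[OF M(3)]) (auto simp: mult.assoc)
  hence "excess phi g y v <= C1*(C1 * s)" using GB[of S phi g A w "C1 * s" y v] 1 2 vS yS Cs by (auto simp: csec_def)
  thus "v \<in> csec S phi g y (C1*C1 * s)" using vS by (simp add: csec_def mult.assoc)
 qed
 thus ?thesis using CC by (intro exI[of _ "C1*C1"]) blast
qed

lemma compact_subset_measure:
 fixes A :: "'a::euclidean_space set"
 assumes A: "A \<in> sets lebesgue" "bounded A" "0 < vol A"
 obtains K where "compact K" "K \<subseteq> A" "vol A/2 <= vol K"
proof -
 have AL: "A \<in> lmeasurable" by (rule bounded_set_imp_lmeasurable[OF A(2,1)])
 obtain C where C: "closed C" "C \<subseteq> A" "A - C \<in> lmeasurable" "emeasure lebesgue (A - C) < ennreal (vol A/2)"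
  using sets_lebesgue_inner_closed[OF A(1), of "vol A/2"] A(3) by auto
 have cC: "compact C" using C(1,2) A(2) bounded_subset by (auto simp: compact_eq_bounded_closed)
 have "vol (A - C) < vol A/2" using C(4) A(3) by (simp add: emeasure_eq_measure2[OF C(3)] ennreal_less_iff)
 moreover have "vol (A - C) = vol A - vol C" using C(2) by (intro measurable_measure_Diff AL fmeasurableD lmeasurable_compact cC)
 ultimately show thesis using cC C(2) by (intro that[of C]) auto
qed

lemma csec_interior_open:
 assumes "MA l L S phi g A"
 shows "open {z \<in> S. excess phi g y z < h}" using sublev_interior[OF assms, of "phi y - g y \<bullet> y + h" "g y"]
 by (rule back_subst[of "open"]) (auto simp: excess_def inner_diff_right)

text \<open>Strictness comes from the midpoint, where the gradient has already strictly increased in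
  direction \<open>z - x\<close>.\<close>

lemma excess_pos:
 assumes M: "MA l L S phi g A" and x: "x \<in> S" and z: "z \<in> S" and ne: "z ~= x"
 shows "0 < excess phi g x z"
proof -
 define m where "m = x + (1/2) *\<^sub>R (z - x)"
 have m: "m \<in> S" unfolding m_def by (rule segment_scale_mem[OF MA_D(2)[OF M] x z]) auto
 have mx: "m - x = (1/2) *\<^sub>R (z - x)" by (simp add: m_def)
 have "z - m = (z - x) - (m - x)" by simp
 also have "... = (1 - 1/2) *\<^sub>R (z - x)" unfolding mx scaleR_diff_left by simp
 finally have "z - m = m - x" using mx by simp
 moreover have "0 < (g m - g x) \<bullet> (m - x)" using ne mx by (intro MA_grad_mono[OF M m x]) auto
 moreover have "0 <= excess phi g x m" "0 <= excess phi g m z" using MA_D(10)[OF M] m x z by auto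
 ultimately show ?thesis using excess_three_points[of phi g x z m] by simp
qed

text \<open>Krylov and Safonov's covering argument: on sections in which a superlevel set has density
 close to one the function is bounded from below on the doubled section; by Vitali's covering
 argument the superlevel sets otherwise grow by a fixed factor.\<close>

lemma weak_harnack:
 fixes l L :: real
 assumes l: "0 < l" "l <= L"
 shows "EX K ga de. 2 <= K & 0 < ga & ga < 1 & 0 < de &
  (ALL (S :: (real^'n::finite) set) phi g A y h u F.
   msec l L S phi g A y (K*h) & 0 < h & supersolution A (csec S phi g y (K*h)) u F &
   sqrt h^CARD('n)*integral (csec S phi g y (K*h)) (%x. F x^CARD('n)) <= de &
   vol (csec S phi g y h)/2 <= vol {x \<in> csec S phi g y h. 1 <= u x} -->
   (ALL x:csec S phi g y h. ga <= u x))"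
proof -
 let ?n = "real CARD('n)" and ?N = "CARD('n)"
 show ?thesis using critical_density_scaled[OF l, where 'n='n]
 proof (elim exE conjE, goal_cases)
  case (1 K Q c de)
  note k = 1(1-4) and CD = 1(5)[rule_format]
 obtain C1 where C1: "2 <= C1" and GB: "!!(S :: (real^'n) set) phi g A y h x z.
  msec l L S phi g A y (2*h) & x \<in> csec S phi g y h & z \<in> csec S phi g y (2*h) ==>
  \<bar>(g x - g y) \<bullet> (z - x)\<bar> <= C1*h & excess phi g x z <= C1*h" using csec_gradient_bound[OF l, where 'n='n] by blast
 obtain eps where eps: "0 < eps" "eps <= 1" and EN: "!!(S :: (real^'n) set) phi g A y h x.
  msec l L S phi g A y (2*h) & x \<in> csec S phi g y h ==>
  msec l L S phi g A x (eps*h) & csec S phi g x (eps*h) \<subseteq> {z \<in> S. excess phi g y z < 2*h}" using csec_engulf[OF l, where 'n='n] by blast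
 obtain cV CV where V: "0 < cV" "0 < CV" and VO: "!!(S :: (real^'n) set) phi g A y h.
  MA l L S phi g A & compact (csec S phi g y h) & y \<in> S & 0 < h ==>
  cV * sqrt h^?N <= vol (csec S phi g y h) &
  vol (csec S phi g y h) <= CV * sqrt h^?N" using csec_volume[OF l, where 'n='n] by blast
 obtain C where C: "2 <= C" and EM: "!!(S :: (real^'n) set) phi g A x y w r s.
  msec l L S phi g A x (2*r) & msec l L S phi g A y (2 * s) & msec l L S phi g A w (C * s) & r <= s &
  w \<in> csec S phi g x r & w \<in> csec S phi g y s ==> csec S phi g x r \<subseteq> csec S phi g y (C * s)"
  using csec_engulf_meeting[OF l, where 'n='n] by blast
 \<comment> \<open>Bound for the volume of an enlarged section of the covering relative to the part
   of the original one where \<open>u\<close> is below the level; the growth rate \<open>tau\<close>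
   is half of its inverse.\<close>
 define vit where "vit = CV * sqrt C^?N/c"
 have vit: "0 < vit" using V C k by (simp add: vit_def)
 define tau where "tau = 1/(2 * vit)"
 have tau: "0 < tau" using vit by (simp add: tau_def)
 \<comment> \<open>After \<open>k1\<close> growth steps the superlevel set would be larger than the
   section of height \<open>4*h\<close> that contains it. The heights \<open>a i\<close> of the
   growing sections increase by \<open>th = 1/(k1 + 1)\<close> per step and so stay at most
   2.\<close>
 obtain k1 where k1: "2*(CV*2^?N)/cV < (1 + tau)^k1" using real_arch_pow[of "1 + tau"] tau by auto
 define th where "th = 1/(real k1 + 1)"
 have th: "0 < th" "th <= 1" "real k1*th + th = 1" by (auto simp: th_def add_divide_distrib[symmetric])
 define eta where "eta = th/2"
 have eta: "0 < eta" "eta <= 1" using th by (auto simp: eta_def)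
 obtain eps1 where eps1: "0 < eps1" "eps1 <= 1" and SI: "!!(S :: (real^'n) set) phi g A y h x z.
  msec l L S phi g A y ((1 + eta)*h) & x \<in> csec S phi g y h & z \<in> csec S phi g x (eps1*h) ==>
  excess phi g y z < (1 + eta)*h" using csec_strict_interior[OF l eta, where 'n='n] by blast
 \<comment> \<open>The number of doublings that lead from a section of height \<open>eps1*h\<close>
   to one containing the whole section of height \<open>h\<close>.\<close>
 obtain p where p: "2*C1/eps1 < 2^p" using real_arch_pow[of 2] by auto
 define P where "P = 2^p*eps1"
 have P: "2*C1 < P" "eps1 <= P"
 proof -
  show "2*C1 < P" using p eps1 by (simp add: P_def field_simps)
  show "eps1 <= P" using eps1 by (simp add: P_def)
 qed
 \<comment> \<open>All sections that occur are centred in the section of height \<open>H*h\<close>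
   and have height at most \<open>P*h\<close>, up to the factors \<open>K\<close> and
   \<open>C\<close>; engulfing with this \<open>H\<close> keeps them compactly inside.\<close>
 define H where "H = 4 + (K + C)*P/eps"
 have P0: "0 < P" using P eps1 by linarith
 have H: "4 <= H" "K*P <= eps*H" "C*P <= eps*H"
 proof -
  show "4 <= H" using k C P0 eps by (simp add: H_def)
  have e: "eps*H = 4*eps + K*P + C*P" using eps by (simp add: H_def field_simps)
  have "0 <= K*P" "0 <= C*P" using k C P0 by auto
  thus "K*P <= eps*H" "C*P <= eps*H" unfolding e using eps by linarith+
 qed
 \<comment> \<open>Levels at which superlevel sets are measured: each use of the critical density
   estimate loses a factor \<open>Q\<close>.\<close>
 define lam where "lam i = (1/Q)^i/2" for i :: nat
 have lam: "0 < lam i" "lam i = Q*lam (Suc i)" "lam (Suc i) <= lam i" for i using k by (auto simp: lam_def field_simps)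
 have lam_mono: "lam j <= lam i" if "i <= j" for i j using k that by (auto simp: lam_def intro!: power_decreasing)
 define ga where "ga = lam (k1 + p)"
 define de0 where "de0 = de*ga^?N/sqrt P^?N"
 have ga0: "0 < ga" using lam(1) by (simp add: ga_def)
 have ga1: "ga < 1" using lam_mono[of 0 "k1 + p"] by (simp add: ga_def lam_def)
 have de0: "0 < de0" using k ga0 P0 by (simp add: de0_def)
 have main: "ga <= u v" if Ms: "msec l L S phi g A y (2*H*h)" and h: "0 < h" and su: "supersolution A (csec S phi g y (2*H*h)) u F"
   and Fs: "sqrt h^?N*integral (csec S phi g y (2*H*h)) (%x. F x^?N) <= de0"
   and half: "vol (csec S phi g y h)/2 <= vol {x \<in> csec S phi g y h. 1 <= u x}"
   and v: "v \<in> csec S phi g y h" for S :: "(real^'n) set" and phi g A y h u F v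
 proof -
  let ?ms = "msec l L S phi g A" and ?cs = "csec S phi g" and ?ex = "excess phi g"
  note MM = msecD[OF Ms]
  note M = MM(1)
  define D where "D = ?cs y (2*H*h)"
  have cD: "compact D" using MM(4) by (simp add: D_def)
  have cu: "continuous_on D u" unfolding D_def by (rule supersolution_continuous[OF su])
  have sm: "?ms y (t*h)" if "0 < t" "t <= 2*H" for t using that h by (intro msec_smaller[OF Ms]) auto
  have ms2: "?ms y (2*(H*h))" using Ms by (simp add: mult.assoc)
  have big: "?ms x (eps*H*h)" "?cs x (eps*H*h) \<subseteq> D" if "x \<in> ?cs y (H*h)" for x
   using EN[of S phi g A y "H*h" x] ms2 that by (auto simp: D_def csec_def mult.assoc)
  have sub: "?ms x (a*r)" "?cs x (a*r) \<subseteq> D" if x: "x \<in> ?cs y (H*h)" and r: "0 < r" "r <= P*h" and a: "0 < a" "a*P <= eps*H" for x a r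
  proof -
   have "a*r <= a*(P*h)" using r a by (intro mult_left_mono) auto
   also have "... <= eps*H*h" using a h mult_right_mono[OF a(2), of h] by (simp add: mult.assoc)
   finally have le: "a*r <= eps*H*h" .
   show "?ms x (a*r)" using le r a by (intro msec_smaller[OF big(1)[OF x]]) auto
   show "?cs x (a*r) \<subseteq> D" using csec_mono[OF le] big(2)[OF x] by blast
  qed
  have KP: "0 < K" "0 < C" using k C by auto
  have tP: "2*P <= eps*H" using H(3) C P0 mult_right_mono[OF C, of P] by linarith
  have tP1: "1*P <= eps*H" using tP P0 by linarith
  have sub1: "?ms x r" "?cs x r \<subseteq> D" if "x \<in> ?cs y (H*h)" "0 < r" "r <= P*h" for x r using sub[OF that _ tP1] by auto
  \<comment> \<open>Contrapositive of the critical density estimate: if the set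
    \<open>u <= Q*t\<close> has small measure in a section, then \<open>u\<close> exceeds
    \<open>t\<close> on the doubled section.\<close>
  have good: "t < u z" if x: "x \<in> ?cs y (H*h)" and r: "0 < r" "r <= P*h" and t: "ga <= t"
    and m: "vol {z \<in> ?cs x r. u z <= Q*t} < c * sqrt r^?N" and z: "z \<in> ?cs x (2*r)" for x r t z
  proof (rule ccontr)
   assume "~ t < u z"
   hence uz: "u z <= t" by simp
   have t0: "0 < t" using t ga0 by linarith
   have I0: "0 <= integral D (%x. F x^?N)" using su unfolding supersolution_def D_def by (intro integral_nonneg supersolution_integrable[OF su MM(4)])
     (auto intro: fmeasurableD lmeasurable_compact MM(4))
   have "sqrt r^?N*integral D (%x. F x^?N) <= sqrt (P*h)^?N*integral D (%x. F x^?N)" using r I0 by (intro mult_right_mono power_mono) auto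
   also have "... = sqrt P^?N*(sqrt h^?N*integral D (%x. F x^?N))" by (simp add: real_sqrt_mult power_mult_distrib)
   also have "... <= sqrt P^?N*de0" using Fs P0 by (intro mult_left_mono) (auto simp: D_def)
   also have "... = de*ga^?N" using P0 by (simp add: de0_def)
   also have "... <= de*t^?N" using t ga0 k by (intro mult_left_mono power_mono) auto
   finally have "sqrt r^?N*integral D (%x. F x^?N) <= de*t^?N" .
   hence "c * sqrt r^?N <= vol {w \<in> ?cs x r. u w <= Q*t}"
    using sub[OF x r KP(1) H(2)] r t0 cD su z uz by (intro CD[where A=A and D=D and F=F and z=z]) (auto simp: D_def)
   thus False using m by linarith
  qed
  define a where "a i = 1 + (real i + 1)*th" for i
  have a: "1 <= a i" "a (Suc i) = a i + th" for i using th by (auto simp: a_def algebra_simps)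
  have a2: "a i <= 2" if "i <= k1" for i
  proof -
   have "(real i + 1)*th <= (real k1 + 1)*th" using that th by (intro mult_right_mono) auto
   thus ?thesis using th(3) by (simp add: a_def algebra_simps)
  qed
  define X where "X i = {x \<in> S. ?ex y x < a i*h} \<inter> {x \<in> D. lam i < u x}" for i
  have XH: "X i \<subseteq> ?cs y (H*h)" if "i <= k1" for i
  proof
   fix x assume "x \<in> X i"
   hence x: "x \<in> S" "?ex y x < a i*h" by (auto simp: X_def)
   have "a i*h <= H*h" using a2[OF that] H h by (intro mult_right_mono) auto
   thus "x \<in> ?cs y (H*h)" using x by (simp add: csec_def)
  qed
  have iD: "{x \<in> S. ?ex y x < 2*H*h} \<subseteq> D" by (auto simp: D_def csec_def)
  have oX: "open (X i)" if "i <= k1" for i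
  proof -
   let ?O = "{x \<in> S. ?ex y x < a i*h}"
   have "a i*h <= 2*H*h" using a2[OF that] H h by (intro mult_right_mono) auto
   hence OD: "?O \<subseteq> D" using iD by fastforce
   have oO: "open ?O" by (rule csec_interior_open[OF M])
   have "open (?O \<inter> u -` {lam i<..})" by (rule continuous_open_preimage[OF continuous_on_subset[OF cu OD] oO]) auto
   moreover have "X i = ?O \<inter> u -` {lam i<..}" using OD by (auto simp: X_def)
   ultimately show ?thesis by simp
  qed
  have XD: "X i \<subseteq> D" for i by (auto simp: X_def)
  have bX: "bounded (X i)" for i using bounded_subset[OF compact_imp_bounded[OF cD] XD] .
  have mX: "X i \<in> lmeasurable" if "i <= k1" for i using oX[OF that] bX by (intro bounded_set_imp_lmeasurable) auto
  have XS: "X i \<subseteq> X (Suc i)" for i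
  proof
   fix x assume x: "x \<in> X i"
   have "a i*h <= a (Suc i)*h" using a(2)[of i] th h by (intro mult_right_mono) auto
   thus "x \<in> X (Suc i)" using x lam(3)[of i] by (auto simp: X_def)
  qed
  define R where "R j = eps1*h/2^j" for j :: nat
  have R: "0 < R j" "R j <= eps1*h" "R j = 2*R (Suc j)" for j using eps1 h by (auto simp: R_def field_simps)
  have RP: "R j <= P*h" for j using R(2)[of j] mult_right_mono[OF P(2), of h] h by linarith
  have grow: "(1 + tau) * vol (X i) <= vol (X (Suc i))"
   if i: "i < k1" and no: "!!x. x \<in> X i ==> c * sqrt (R 0)^?N <= vol {z \<in> ?cs x (R 0). u z <= lam i}" for i
  proof (cases "vol (X i) = 0")
   case True thus ?thesis by simp
  next
   case False
   define bad where "bad x r = {z \<in> ?cs x r. u z <= lam i}" for x r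
   have xH: "x \<in> ?cs y (H*h)" if "x \<in> X i" for x using XH[of i] i that by auto
   have cbad: "compact (bad x (R j))" if x: "x \<in> X i" for x j unfolding bad_def
    using msecD(4)[OF sub1(1)[OF xH[OF x] R(1) RP]] continuous_on_subset[OF cu sub1(2)[OF xH[OF x] R(1) RP]] by (intro compact_sublevel)
   \<comment> \<open>At small scales the low set is empty, since \<open>u x > lam i\<close> and
     strict convexity gives all points of the low set an excess bounded away from zero.\<close>
   have ex: "EX j. vol (bad x (R j)) < c * sqrt (R j)^?N" if x: "x \<in> X i" for x
   proof -
    have xS: "x \<in> S" and ux: "lam i < u x" using x by (auto simp: X_def)
    show ?thesis
    proof (cases "bad x (R 0) = {}")
     case True
     thus ?thesis using R(1)[of 0] k by (intro exI[of _ 0]) auto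
    next
     case False
     have "continuous_on (bad x (R 0)) (?ex x)" by (rule continuous_on_subset[OF excess_continuous[OF M]]) (auto simp: bad_def csec_def)
     then obtain w where w: "w \<in> bad x (R 0)" "!!z. z \<in> bad x (R 0) ==> ?ex x w <= ?ex x z"
      using continuous_attains_inf[OF cbad[OF x] False] by blast
     have "w ~= x" "w \<in> S" using w(1) ux by (auto simp: bad_def csec_def)
     hence e0: "0 < ?ex x w" using excess_pos[OF M xS] by blast
     obtain j where "eps1*h/?ex x w < 2^j" using real_arch_pow[of 2] by auto
     hence Rj: "R j < ?ex x w" using e0 by (simp add: R_def field_simps)
     have "bad x (R j) = {}"
     proof (rule ccontr)
      assume "bad x (R j) ~= {}"
      then obtain z where z: "z \<in> bad x (R j)" by blast
      have "R j <= R 0" using R(2)[of j] by (simp add: R_def)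
      hence "z \<in> bad x (R 0)" using z by (auto simp: bad_def csec_def)
      hence "?ex x w <= ?ex x z" by (rule w(2))
      thus False using z Rj by (auto simp: bad_def csec_def)
     qed
     thus ?thesis using R(1)[of j] k by (intro exI[of _ j]) auto
    qed
   qed
   have "EX j. vol (bad x (R (Suc j))) < c * sqrt (R (Suc j))^?N & c * sqrt (R j)^?N <= vol (bad x (R j))" if x: "x \<in> X i" for x
   proof -
    define j where "j = (LEAST j. vol (bad x (R j)) < c * sqrt (R j)^?N)"
    have j1: "vol (bad x (R j)) < c * sqrt (R j)^?N" unfolding j_def by (rule LeastI_ex[OF ex[OF x]])
    have "j ~= 0"
    proof
     assume "j = 0"
     hence "vol (bad x (R 0)) < c * sqrt (R 0)^?N" using j1 by simp
     thus False using no[OF x] by (simp add: bad_def)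
    qed
    then obtain j' where j': "j = Suc j'" by (cases j) auto
    have "~ vol (bad x (R j')) < c * sqrt (R j')^?N" using not_less_Least[of j' "%j. vol (bad x (R j)) < c * sqrt (R j)^?N"] j' by (simp add: j_def)
    thus ?thesis using j1 j' by (intro exI[of _ j']) auto
   qed
   \<comment> \<open>\<open>R (J x)\<close> is the scale just before the low set first loses its
     density. Halving it makes \<open>good\<close> applicable, so \<open>u\<close> exceeds the next
     level on the section of height \<open>R (J x)\<close>; yet a fixed fraction of that section
     lies outside \<open>X i\<close>.\<close>
   then obtain J where J: "!!x. x \<in> X i ==> vol (bad x (R (Suc (J x)))) < c * sqrt (R (Suc (J x)))^?N"
    "!!x. x \<in> X i ==> c * sqrt (R (J x))^?N <= vol (bad x (R (J x)))" by metis
   define r where "r x = R (J x)" for x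
   have r: "0 < r x" "r x <= eps1*h" "r x <= P*h" for x using R(1,2) RP by (auto simp: r_def)
   have new: "?cs x (r x) \<subseteq> X (Suc i)" if x: "x \<in> X i" for x
   proof
    fix z assume z: "z \<in> ?cs x (r x)"
    have "lam (Suc i) < u z"
    proof (rule good[OF xH[OF x] R(1)[of "Suc (J x)"] RP])
     show "ga <= lam (Suc i)" unfolding ga_def using i by (intro lam_mono) auto
     show "vol {z \<in> ?cs x (R (Suc (J x))). u z <= Q*lam (Suc i)} < c * sqrt (R (Suc (J x)))^?N"
      using J(1)[OF x] by (simp add: bad_def lam(2)[of i])
     show "z \<in> ?cs x (2*R (Suc (J x)))" using z by (simp add: r_def R(3)[of "J x"])
    qed
    moreover have "?ex y z < (1 + eta)*(a i*h)"
    proof (rule SI[of S phi g A y "a i*h" x z], intro conjI)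
     have ai: "a i <= 2" using a2 i by simp
     have "(1 + eta)*a i <= 2*2" using ai a(1)[of i] eta by (intro mult_mono) auto
     hence "(1 + eta)*a i <= 2*H" using H by linarith
     moreover have "0 < (1 + eta)*a i" using a(1)[of i] eta by (intro mult_pos_pos) auto
     ultimately show "?ms y ((1 + eta)*(a i*h))" using sm[of "(1 + eta)*a i"] by (simp add: mult.assoc)
     show "x \<in> ?cs y (a i*h)" using x by (auto simp: X_def csec_def)
     have "eps1*(1*h) <= eps1*(a i*h)" using a(1)[of i] eps1 h by (intro mult_left_mono mult_right_mono) auto
     thus "z \<in> ?cs x (eps1*(a i*h))" using z r(2)[of x] by (auto simp: csec_def)
    qed
    moreover have "(1 + eta)*(a i*h) <= a (Suc i)*h"
    proof -
     have "eta*a i <= eta*2" using a2[of i] i eta by (intro mult_left_mono) auto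
     hence "(1 + eta)*a i <= a (Suc i)" by (simp add: a(2) eta_def algebra_simps)
     thus ?thesis using h mult_right_mono[of "(1 + eta)*a i" "a (Suc i)" h] by (simp add: mult.assoc)
    qed
    moreover have "z \<in> D" using sub1(2)[OF xH[OF x] r(1,3)] z by blast
    ultimately show "z \<in> X (Suc i)" using z by (auto simp: X_def csec_def)
   qed
   have pX: "0 < vol (X i)" using False by (simp add: less_le)
   \<comment> \<open>A compact part carrying half of the measure reduces the covering to finitely
     many sections.\<close>
   obtain Kc where Kc: "compact Kc" "Kc \<subseteq> X i" "vol (X i)/2 <= vol Kc" using compact_subset_measure[OF fmeasurableD[OF mX] bX pX] i by auto
   have sK: "Kc \<subseteq> (\<Union>x\<in>Kc. {z \<in> S. ?ex x z < r x})" using Kc(2) r(1) by (force simp: X_def)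
   obtain I where I: "I \<subseteq> Kc" "finite I" "Kc \<subseteq> (\<Union>x\<in>I. {z \<in> S. ?ex x z < r x})"
    by (rule compactE_image[OF Kc(1) csec_interior_open[OF M] sK]) (rule that)
   have IX: "x \<in> X i" if "x \<in> I" for x using that I(1) Kc(2) by blast
   have "?cs x (r x) ~= {}" if "x \<in> I" for x using IX[OF that] r(1)[of x] by (auto simp: X_def csec_def intro!: exI[of _ x])
   from finite_vitali_selection[OF I(2) this, of "%x. x" r] obtain I' where
    I': "I' \<subseteq> I" "disjoint_family_on (%x. ?cs x (r x)) I'"
    "!!x. x \<in> I ==> EX j:I'. r x <= r j & ?cs x (r x) \<inter> ?cs j (r j) ~= {}" by auto
   have fI': "finite I'" using I'(1) I(2) finite_subset by blast
   have I'X: "x \<in> X i" if "x \<in> I'" for x using IX that I'(1) by blast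
   have cov: "Kc \<subseteq> (\<Union>j\<in>I'. ?cs j (C*r j))"
   proof
    fix z assume "z \<in> Kc"
    then obtain x where x: "x \<in> I" "z \<in> ?cs x (r x)" using I(3) by (force simp: csec_def)
    obtain j w where j: "j \<in> I'" "r x <= r j" and w: "w \<in> ?cs x (r x)" "w \<in> ?cs j (r j)" using I'(3)[OF x(1)] by blast
    have wX: "w \<in> X (Suc i)" using new[OF IX[OF x(1)]] w(1) by blast
    have wH: "w \<in> ?cs y (H*h)" using XH[of "Suc i"] i wX by auto
    have "?cs x (r x) \<subseteq> ?cs j (C*r j)"
    proof (rule EM[of S phi g A x "r x" j "r j" w], intro conjI)
     show "?ms x (2*r x)" by (rule sub(1)[OF xH[OF IX[OF x(1)]] r(1,3) _ tP]) simp
     show "?ms j (2*r j)" by (rule sub(1)[OF xH[OF I'X[OF j(1)]] r(1,3) _ tP]) simp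
     show "?ms w (C*r j)" by (rule sub(1)[OF wH r(1,3) KP(2) H(3)])
    qed (use j w in auto)
    thus "z \<in> (\<Union>j\<in>I'. ?cs j (C*r j))" using x j by blast
   qed
   have mC: "?cs j (C*r j) \<in> lmeasurable" "vol (?cs j (C*r j)) <= vit * vol (bad j (r j))" if j: "j \<in> I'" for j
   proof -
    have ms: "?ms j (C*r j)" by (rule sub(1)[OF xH[OF I'X[OF j]] r(1,3) KP(2) H(3)])
    show "?cs j (C*r j) \<in> lmeasurable" by (rule lmeasurable_compact[OF msecD(4)[OF ms]])
    have "vol (?cs j (C*r j)) <= CV * sqrt (C*r j)^?N" using VO[of S phi g A j "C*r j"] msecD[OF ms] by blast
    also have "... = vit*(c * sqrt (r j)^?N)" using k by (simp add: vit_def real_sqrt_mult power_mult_distrib)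
    also have "... <= vit * vol (bad j (r j))" using J(2)[OF I'X[OF j]] vit by (intro mult_left_mono) (auto simp: r_def)
    finally show "vol (?cs j (C*r j)) <= vit * vol (bad j (r j))" .
   qed
   have mb: "bad j (r j) \<in> lmeasurable" if "j \<in> I'" for j unfolding r_def by (rule lmeasurable_compact[OF cbad[OF I'X[OF that]]])
   have mXS: "X (Suc i) \<in> lmeasurable" "X i \<in> lmeasurable" using mX i by auto
   have "vol Kc <= vol (\<Union>j\<in>I'. ?cs j (C*r j))"
    using mC(1) fI' Kc(1) by (intro measure_mono_fmeasurable[OF cov] fmeasurableD[OF lmeasurable_compact] fmeasurable.finite_UN) auto
   also have "... <= (\<Sum>j\<in>I'. vol (?cs j (C*r j)))" using mC(1) fI' by (intro measure_UNION_le fmeasurableD)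
   also have "... <= (\<Sum>j\<in>I'. vit * vol (bad j (r j)))" using mC(2) by (intro sum_mono)
   also have "... = vit*(\<Sum>j\<in>I'. vol (bad j (r j)))" by (simp add: sum_distrib_left)
   also have "(\<Sum>j\<in>I'. vol (bad j (r j))) = vol (\<Union>j\<in>I'. bad j (r j))"
   proof -
    have "disjoint_family_on (%j. bad j (r j)) I'" using I'(2) by (fastforce simp: disjoint_family_on_def bad_def)
    note dj = this
    have s: "(%j. bad j (r j)) ` I' \<subseteq> sets lebesgue" using mb fmeasurableD by blast
    have f: "emeasure lebesgue (bad j (r j)) ~= \<infinity>" if "j \<in> I'" for j
     unfolding infinity_ennreal_def by (rule fmeasurableD2[OF mb[OF that]])
    show ?thesis by (rule measure_finite_Union[OF fI' s dj f, symmetric])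
   qed
   also have "vol (\<Union>j\<in>I'. bad j (r j)) <= vol (X (Suc i) - X i)"
   proof (rule measure_mono_fmeasurable)
    show "(\<Union>j\<in>I'. bad j (r j)) \<subseteq> X (Suc i) - X i" using new I'X by (fastforce simp: bad_def X_def)
    show "(\<Union>j\<in>I'. bad j (r j)) \<in> sets lebesgue" using mb fI' by (intro fmeasurableD fmeasurable.finite_UN)
    show "X (Suc i) - X i \<in> lmeasurable" using mXS by (intro fmeasurable_Diff fmeasurableD)
   qed
   also have "vol (X (Suc i) - X i) = vol (X (Suc i)) - vol (X i)" using mXS XS by (intro measurable_measure_Diff fmeasurableD) auto
   finally have "vol (X i)/2 <= vit*(vol (X (Suc i)) - vol (X i))" using Kc(3) vit by (simp add: mult_left_mono)
   hence "tau * vol (X i) <= vol (X (Suc i)) - vol (X i)" using vit by (simp add: tau_def field_simps)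
   thus ?thesis by (simp add: algebra_simps)
  qed
  \<comment> \<open>Otherwise the volumes would outgrow the surrounding section. The failure of
    growth provides a section of the top scale in which the low set has small density.\<close>
  have "EX i<k1. EX x:X i. vol {z \<in> ?cs x (R 0). u z <= lam i} < c * sqrt (R 0)^?N"
  proof (rule ccontr)
   assume no: "~ ?thesis"
   have it: "(1 + tau)^i * vol (X 0) <= vol (X i)" if "i <= k1" for i using that
   proof (induction i)
    case (Suc i)
    have "(1 + tau) * vol (X i) <= vol (X (Suc i))" using no Suc.prems by (intro grow) (simp, meson Suc_le_eq not_less)
    moreover have "(1 + tau)*((1 + tau)^i * vol (X 0)) <= (1 + tau) * vol (X i)" using Suc tau by (intro mult_left_mono) auto
    ultimately show ?case by simp
   qed simp
   have ms1: "?ms y h" "?ms y (4*h)" using H sm[of 1] sm[of 4] by auto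
   have "cV * sqrt h^?N/2 <= vol (X 0)"
   proof -
    have hD: "?cs y h \<subseteq> D" unfolding D_def using H h by (intro csec_mono) auto
    have "cV * sqrt h^?N/2 <= vol {x \<in> ?cs y h. 1 <= u x}" using VO[of S phi g A y h] msecD[OF ms1(1)] half by auto
    also have "... <= vol (X 0)"
    proof (rule measure_mono_fmeasurable)
     have "h < a 0*h" using th h by (simp add: a_def)
     thus "{x \<in> ?cs y h. 1 <= u x} \<subseteq> X 0" using hD by (auto simp: X_def csec_def lam_def)
     have "compact {x \<in> ?cs y h. 1 <= u x}" using msecD(4)[OF ms1(1)] continuous_on_subset[OF cu hD] by (intro compact_superlevel) auto
     thus "{x \<in> ?cs y h. 1 <= u x} \<in> sets lebesgue" by (intro fmeasurableD lmeasurable_compact)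
    qed (use mX in auto)
    finally show ?thesis .
   qed
   hence "(1 + tau)^k1*(cV * sqrt h^?N/2) <= (1 + tau)^k1 * vol (X 0)" using tau by (intro mult_left_mono) auto
   also have "... <= vol (X k1)" by (rule it) simp
   also have "... <= vol (?cs y (4*h))"
   proof (rule measure_mono_fmeasurable)
    have "a k1*h <= 4*h" using a2[of k1] h by (intro mult_right_mono) auto
    thus "X k1 \<subseteq> ?cs y (4*h)" by (auto simp: X_def csec_def)
   qed (use mX msecD(4)[OF ms1(2)] in \<open>auto intro: lmeasurable_compact fmeasurableD\<close>)
   also have "... <= CV * sqrt (4*h)^?N" using VO[of S phi g A y "4*h"] msecD[OF ms1(2)] by auto
   also have "... = CV*2^?N * sqrt h^?N" by (simp add: real_sqrt_mult power_mult_distrib)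
   finally have "(1 + tau)^k1 * cV * sqrt h^?N <= 2*(CV*2^?N) * sqrt h^?N" by simp
   hence "(1 + tau)^k1 * cV <= 2*(CV*2^?N)" using h by simp
   thus False using k1 V by (simp add: field_simps)
  qed
  then obtain i x where i: "i < k1" and x: "x \<in> X i"
   and m: "vol {z \<in> ?cs x (R 0). u z <= lam i} < c * sqrt (R 0)^?N" by blast
  have xH: "x \<in> ?cs y (H*h)" using XH[of i] i x by auto
  have start: "lam (Suc i) < u z" if "z \<in> ?cs x (2*R 0)" for z
   by (rule good[OF xH R(1) RP _ _ that]) (use m lam(2)[of i] i lam_mono in \<open>auto simp: ga_def\<close>)
  \<comment> \<open>On a section where \<open>u\<close> exceeds a level the low set is empty, so
    \<open>good\<close> doubles the section at the cost of one factor \<open>Q\<close>.\<close>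
  have spread: "ALL z:?cs x (2^j*(eps1*h)). lam (k1 + j) < u z" if "j <= p" for j using that
  proof (induction j)
   case 0
   show ?case
   proof
    fix z assume "z \<in> ?cs x (2^0*(eps1*h))"
    hence "z \<in> ?cs x (eps1*h)" by simp
    moreover have "R 0 = eps1*h" by (simp add: R_def)
    hence "eps1*h <= 2*R 0" using mult_pos_pos[OF eps1(1) h] by linarith
    ultimately have "z \<in> ?cs x (2*R 0)" by (rule rev_subsetD[OF _ csec_mono])
    thus "lam (k1 + 0) < u z" using start[of z] lam_mono[of "Suc i" k1] i by fastforce
   qed
  next
   case (Suc j)
   show ?case
   proof
    fix z assume z: "z \<in> ?cs x (2^Suc j*(eps1*h))"
    have r0: "0 < 2^j*(eps1*h)" using eps1 h by simp
    have "2^j*(eps1*h) <= 2^p*(eps1*h)" using Suc.prems eps1 h by (intro mult_right_mono power_increasing) auto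
    hence rP: "2^j*(eps1*h) <= P*h" by (simp add: P_def)
    show "lam (k1 + Suc j) < u z"
    proof (rule good[OF xH r0 rP])
     show "ga <= lam (k1 + Suc j)" unfolding ga_def using Suc.prems by (intro lam_mono) auto
     have e: "{z \<in> ?cs x (2^j*(eps1*h)). u z <= Q*lam (k1 + Suc j)} = {}" using Suc lam(2)[of "k1 + j"] by (auto simp: not_le)
     show "vol {z \<in> ?cs x (2^j*(eps1*h)). u z <= Q*lam (k1 + Suc j)}
       < c * sqrt (2^j*(eps1*h))^?N" unfolding e measure_empty using k r0 by (intro mult_pos_pos zero_less_power) auto
     show "z \<in> ?cs x (2*(2^j*(eps1*h)))" using z by (simp add: mult.assoc)
    qed
   qed
  qed
  have "?ms y (2*(2*h))" using sm[of 4] H by simp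
  moreover have "x \<in> ?cs y (2*h)"
  proof -
   have "a i*h <= 2*h" using a2[of i] i h by (intro mult_right_mono) auto
   thus ?thesis using x by (auto simp: X_def csec_def)
  qed
  moreover have "v \<in> ?cs y (2*(2*h))" by (rule subsetD[OF csec_mono v]) (use h in auto)
  ultimately have "?ex x v <= C1*(2*h)" using GB[of S phi g A y "2*h" x v] by blast
  also have "... <= 2^p*(eps1*h)" using mult_right_mono[OF less_imp_le[OF P(1)], of h] h by (simp add: P_def)
  finally have "v \<in> ?cs x (2^p*(eps1*h))" using v by (simp add: csec_def)
  thus ?thesis using spread[of p] by (auto simp: ga_def)
 qed
 show ?thesis
 proof (rule exI[of _ "2*H"], rule exI[of _ ga], rule exI[of _ de0], intro conjI allI impI ballI, goal_cases)
  case (5 S phi g A y h u F x)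
  show ?case by (rule main[where A=A and F=F and y=y]) (use 5 in blast)+
 qed (use H ga0 ga1 de0 in auto)
 qed
qed

text \<open>The normalized distances \<open>2*(u - a)/om\<close> and
  \<open>2*(a + om - u)/om\<close> to the two bounds add up to 2, so one of them is at least 1 on
  half of the section, and the weak Harnack inequality improves the corresponding bound.\<close>

lemma oscillation_step:
 fixes l L :: real
 assumes l: "0 < l" "l <= L"
 shows "EX K ga de. 2 <= K & 0 < ga & ga < 1 & 0 < de &
  (ALL (S :: (real^'n::finite) set) phi g A y h T u p H F a om.
   msec l L S phi g A y (K*h) & 0 < h & 0 < om & c2_on T u p H & csec S phi g y (K*h) \<subseteq> T &
   continuous_on (csec S phi g y (K*h)) F &
   (ALL x:csec S phi g y (K*h). a <= u x & u x <= a + om & \<bar>mdot (cofac (A x)) (H x)\<bar> <= F x) &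
   sqrt h^CARD('n)*integral (csec S phi g y (K*h)) (%x. F x^CARD('n)) <= de * om^CARD('n) -->
   (EX b. ALL x:csec S phi g y h. b <= u x & u x <= b + (1 - ga) * om))"
proof -
 let ?N = "CARD('n)"
 show ?thesis using weak_harnack[OF l, where 'n='n]
 proof (elim exE conjE, goal_cases)
  case (1 K ga de)
  note k = 1(1-4) and W0 = 1(5)
 have main: "EX b. ALL x:csec S phi g y h. b <= u x & u x <= b + (1 - ga/2) * om"
  if M: "msec l L S phi g A y (K*h)" and h: "0 < h" and om: "0 < om" and c: "c2_on T u p H" and DT: "csec S phi g y (K*h) \<subseteq> T"
   and cF: "continuous_on (csec S phi g y (K*h)) F"
   and u: "!!x. x \<in> csec S phi g y (K*h) ==> a <= u x & u x <= a + om & \<bar>mdot (cofac (A x)) (H x)\<bar> <= F x"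
   and sm: "sqrt h^?N*integral (csec S phi g y (K*h)) (%x. F x^?N) <= de/2^?N * om^?N" for S :: "(real^'n) set" and phi g A y h T u p H F a om
 proof -
  let ?cs = "csec S phi g"
  let ?D = "?cs y (K*h)" and ?F = "%x. 2/om*F x"
  have F0: "0 <= F x" if "x \<in> ?D" for x using u[OF that] by (meson abs_ge_zero order_trans)
  have sub: "supersolution A ?D (%x. s*(2/om)*u x + (k + 0 \<bullet> x)) ?F"
   if s: "s = 1 | s = -1" and pos: "!!x. x \<in> ?D ==> 0 <= s*(2/om)*u x + k" for s k :: real unfolding supersolution_def
  proof (intro conjI ballI exI)
   show "continuous_on ?D ?F" using cF by (intro continuous_intros)
   show "0 <= ?F x" if "x \<in> ?D" for x using F0[OF that] om by simp
   show "c2_on T (%x. s*(2/om)*u x + (k + 0 \<bullet> x)) (%x. (s*(2/om)) *\<^sub>R p x + 0) (%x. (s*(2/om)) *\<^sub>R H x + 0)"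
    by (intro c2_on_add c2_on_scale c c2_on_affine c2_onD(1)[OF c])
   show "?D \<subseteq> T" by (rule DT)
   fix x assume x: "x \<in> ?D"
   show "0 <= s*(2/om)*u x + (k + 0 \<bullet> x)" using pos[OF x] by simp
   have "s*mdot (cofac (A x)) (H x) <= F x" using u[OF x] s by auto
   hence "2/om*(s*mdot (cofac (A x)) (H x)) <= 2/om*F x" using om by (intro mult_left_mono) auto
   thus "mdot (cofac (A x)) ((s*(2/om)) *\<^sub>R H x + 0) <= ?F x" by (simp add: mdot_scale mult_ac)
  qed
  have small: "sqrt h^?N*integral ?D (%x. ?F x^?N) <= de"
  proof -
   have "sqrt h^?N*integral ?D (%x. ?F x^?N) = (2/om)^?N*(sqrt h^?N*integral ?D (%x. F x^?N))"
    unfolding power_mult_distrib integral_mult_right by (simp only: mult_ac)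
   also have "... <= (2/om)^?N*(de/2^?N * om^?N)" using sm om by (intro mult_left_mono) auto
   also have "... = de" using om by (simp add: power_divide)
   finally show ?thesis .
  qed
  define w where "w x = 1*(2/om)*u x + (- (2/om*a) + 0 \<bullet> x)" for x
  define w' where "w' x = (-1)*(2/om)*u x + (2/om*(a + om) + 0 \<bullet> x)" for x
  have sw: "supersolution A ?D w ?F" unfolding w_def
  proof (rule sub)
   fix x assume "x \<in> ?D"
   hence "2/om*a <= 2/om*u x" using u om by (intro mult_left_mono) auto
   thus "0 <= 1*(2/om)*u x + - (2/om*a)" by simp
  qed simp
  have sw': "supersolution A ?D w' ?F" unfolding w'_def
  proof (rule sub)
   fix x assume "x \<in> ?D"
   hence "2/om*u x <= 2/om*(a + om)" using u om by (intro mult_left_mono) auto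
   thus "0 <= -1*(2/om)*u x + 2/om*(a + om)" by simp
  qed simp
  have hD: "?cs y h \<subseteq> ?D" using k h by (intro csec_mono) auto
  have ch: "compact (?cs y h)" using msecD(4)[OF msec_smaller[OF M h]] k h by simp
  have cw: "continuous_on (?cs y h) w" "continuous_on (?cs y h) w'"
   using supersolution_continuous[OF sw] supersolution_continuous[OF sw'] hD continuous_on_subset by blast+
  have ww: "w x + w' x = 2" for x using om by (simp add: w_def w'_def field_simps)
  have m: "{x \<in> ?cs y h. 1 <= w x} \<in> lmeasurable" "{x \<in> ?cs y h. 1 <= w' x} \<in> lmeasurable"
   by (intro lmeasurable_compact compact_superlevel ch cw)+
  have "?cs y h = {x \<in> ?cs y h. 1 <= w x} \<union> {x \<in> ?cs y h. 1 <= w' x}"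
  proof -
   have "1 <= w x | 1 <= w' x" for x using ww[of x] by linarith
   thus ?thesis by blast
  qed
  hence "vol (?cs y h) <=
    vol {x \<in> ?cs y h. 1 <= w x} + vol {x \<in> ?cs y h. 1 <= w' x}" using measure_Un_le[OF fmeasurableD[OF m(1)] fmeasurableD[OF m(2)]] by simp
  then consider "vol (?cs y h)/2 <= vol {x \<in> ?cs y h. 1 <= w x}"
   | "vol (?cs y h)/2 <= vol {x \<in> ?cs y h. 1 <= w' x}" by linarith
  thus ?thesis
  proof cases
   case 1
   have g: "ga <= w x" if "x \<in> ?cs y h" for x by (rule W0[rule_format, of S phi g A y h w ?F x]) (use M h sw small 1 that in auto)
   show ?thesis
   proof (intro exI[of _ "a + ga/2 * om"] ballI conjI)
    fix x assume x: "x \<in> ?cs y h"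
    have "ga*(om/2) <= w x*(om/2)" using g x om by (intro mult_right_mono) auto
    also have "w x*(om/2) = u x - a" using om by (simp add: w_def field_simps)
    finally show "a + ga/2 * om <= u x" by simp
    show "u x <= a + ga/2 * om + (1 - ga/2) * om" using u[of x] x hD by (auto simp: algebra_simps)
   qed
  next
   case 2
   have g: "ga <= w' x" if "x \<in> ?cs y h" for x by (rule W0[rule_format, of S phi g A y h w' ?F x]) (use M h sw' small 2 that in auto)
   show ?thesis
   proof (intro exI[of _ a] ballI conjI)
    fix x assume x: "x \<in> ?cs y h"
    have "ga*(om/2) <= w' x*(om/2)" using g x om by (intro mult_right_mono) auto
    also have "w' x*(om/2) = a + om - u x" using om by (simp add: w'_def field_simps)
    finally show "u x <= a + (1 - ga/2) * om" by (simp add: algebra_simps)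
    show "a <= u x" using u[of x] x hD by auto
   qed
  qed
 qed
 show ?thesis
 proof (rule exI[of _ K], rule exI[of _ "ga/2"], rule exI[of _ "de/2^?N"], intro conjI allI impI, goal_cases)
  case (5 S phi g A y h T u p H F a om)
  show ?case by (rule main[where A=A and F=F and y=y and T=T and p=p and H=H and a=a]) (use 5 in blast)+
 qed (use k in auto)
 qed
qed

lemma interior_oscillation_decay:
 fixes l L :: real
 assumes l: "0 < l" "l <= L"
 shows "EX K th C. 1 < K & 0 < th & th < 1 & 0 < C &
  (ALL (S :: (real^'n::finite) set) phi g A y h T u p H F B j x x'.
   msec l L S phi g A y h & 0 < B & c2_on T u p H & csec S phi g y h \<subseteq> T & continuous_on (csec S phi g y h) F &
   (ALL x:csec S phi g y h. \<bar>u x\<bar> <= B & \<bar>mdot (cofac (A x)) (H x)\<bar> <= F x) &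
   sqrt h^CARD('n)*integral (csec S phi g y h) (%x. F x^CARD('n)) <= B^CARD('n) &
   x \<in> csec S phi g y (h/K^j) & x' \<in> csec S phi g y (h/K^j) -->
   \<bar>u x - u x'\<bar> <= C*B*th^j)"
proof -
 let ?N = "CARD('n)"
 show ?thesis using oscillation_step[OF l, where 'n='n]
 proof (elim exE conjE, goal_cases)
  case (1 K ga de)
  note k = 1(1-4) and W0 = 1(5)
 \<comment> \<open>The rate is limited by the improvement of the oscillation and by the scaling of
   the source term: one step divides \<open>sqrt h\<close> by \<open>sqrt K\<close>.\<close>
 define th where "th = max (1 - ga) (1/sqrt K)"
 have sK: "1 < sqrt K" using k by simp
 have th: "0 < th" "th < 1" "1 - ga <= th" "1/sqrt K <= th" using k sK by (auto simp: th_def)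
 \<comment> \<open>The second property of \<open>C\<close> makes the source small against the
   oscillation bound \<open>C*B*th^j\<close> at every scale, so the induction needs no case
   distinction.\<close>
 define C where "C = 2 + 1/de"
 have C: "2 <= C" "1 <= de*C^?N"
 proof -
  show C2: "2 <= C" using k by (simp add: C_def)
  have "1 <= de*C" using k by (simp add: C_def algebra_simps)
  also have "... <= de*C^?N" using C2 k self_le_power[of C ?N] by (intro mult_left_mono) auto
  finally show "1 <= de*C^?N" .
 qed
 have main: "EX b. ALL x:csec S phi g y (h/K^j). b <= u x & u x <= b + C*B*th^j"
  if M: "msec l L S phi g A y h" and B: "0 < B" and c: "c2_on T u p H" and DT: "csec S phi g y h \<subseteq> T"
   and cF: "continuous_on (csec S phi g y h) F"
   and u: "!!x. x \<in> csec S phi g y h ==> \<bar>u x\<bar> <= B & \<bar>mdot (cofac (A x)) (H x)\<bar> <= F x"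
   and sm: "sqrt h^?N*integral (csec S phi g y h) (%x. F x^?N) <= B^?N" for S :: "(real^'n) set" and phi g A y h T u p H F B j
 proof (induction j)
  case 0
  show ?case
  proof (intro exI[of _ "- B"] ballI)
   fix x assume "x \<in> csec S phi g y (h/K^0)"
   hence "\<bar>u x\<bar> <= B" using u by simp
   moreover have "2*B <= C*B" using C B by (intro mult_right_mono) auto
   ultimately show "- B <= u x & u x <= - B + C*B*th^0" by (simp add: abs_le_iff)
  qed
 next
  case (Suc j)
  then obtain b where b: "!!x. x \<in> csec S phi g y (h/K^j) ==> b <= u x & u x <= b + C*B*th^j" by blast
  have h: "0 < h" using msecD(3)[OF M] .
  define h' where "h' = h/K^Suc j"
  have hj: "K*h' = h/K^j" "0 < h'" using k h by (auto simp: h'_def)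
  have Kj: "1 <= K^j" using k by simp
  have hh: "h/K^j <= h" using Kj h k by (simp add: field_simps)
  have msj: "msec l L S phi g A y (K*h')" unfolding hj(1) using hh h k by (intro msec_smaller[OF M]) auto
  have sub: "csec S phi g y (K*h') \<subseteq> csec S phi g y h" unfolding hj(1) by (rule csec_mono[OF hh])
  let ?D = "csec S phi g y (K*h')"
  have F0: "0 <= F x" if "x \<in> csec S phi g y h" for x using u[OF that] by (meson abs_ge_zero order_trans)
  have int: "(%x. F x^?N) integrable_on D" if "D = csec S phi g y h | D = ?D" for D
  proof (rule integrable_on_compact_subset(2)[OF msecD(4)[OF M]])
   show "continuous_on (csec S phi g y h) (%x. F x^?N)" using cF by (intro continuous_intros)
   show "D \<in> sets lebesgue" "D \<subseteq> csec S phi g y h"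
    using that sub msecD(4)[OF M] msecD(4)[OF msj] by (auto intro: fmeasurableD[OF lmeasurable_compact])
  qed
  have I0: "0 <= integral ?D (%x. F x^?N)" using sub F0 by (intro integral_nonneg int) auto
  have Ile: "integral ?D (%x. F x^?N) <= integral (csec S phi g y h) (%x. F x^?N)" using F0 by (intro integral_subset_le sub int) auto
  have "sqrt h'^?N*integral ?D (%x. F x^?N) <= sqrt (h/K^j)^?N*integral (csec S phi g y h) (%x. F x^?N)"
  proof (intro mult_mono power_mono Ile I0)
   have "1*h' <= K*h'" using k hj(2) by (intro mult_right_mono) auto
   thus "sqrt h' <= sqrt (h/K^j)" using hj(1) by simp
  qed (use hj(2) h k in auto)
  also have "... = ((1/sqrt K)^j)^?N*(sqrt h^?N*integral (csec S phi g y h) (%x. F x^?N))"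
   by (simp add: real_sqrt_divide real_sqrt_power power_divide)
  also have "... <= ((1/sqrt K)^j)^?N*B^?N" using sm k by (intro mult_left_mono) auto
  also have "... <= (th^j)^?N*B^?N" using th B k by (intro mult_right_mono power_mono) auto
  also have "... <= (de*C^?N)*((th^j)^?N*B^?N)" using C(2) th B mult_right_mono[OF C(2), of "(th^j)^?N*B^?N"] by simp
  also have "... = de*(C*B*th^j)^?N" by (simp add: power_mult_distrib)
  finally have small: "sqrt h'^?N*integral ?D (%x. F x^?N) <= de*(C*B*th^j)^?N" .
  have om: "0 < C*B*th^j" using C B th by simp
  have "EX b. ALL x:csec S phi g y h'. b <= u x & u x <= b + (1 - ga)*(C*B*th^j)"
  proof (rule W0[rule_format, of S phi g A y h' "C*B*th^j" T u p H F b], intro conjI ballI)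
   show "continuous_on ?D F" using cF sub continuous_on_subset by blast
   fix x assume x: "x \<in> ?D"
   show "b <= u x" "u x <= b + C*B*th^j" using b[of x] x hj(1) by auto
   show "\<bar>mdot (cofac (A x)) (H x)\<bar> <= F x" using u x sub by blast
  qed (use msj hj(2) om c DT sub small in auto)
  then obtain b' where b': "!!x. x \<in> csec S phi g y h' ==> b' <= u x & u x <= b' + (1 - ga)*(C*B*th^j)" by blast
  have "(1 - ga)*(C*B*th^j) <= th*(C*B*th^j)" using th om by (intro mult_right_mono) auto
  moreover have "th*(C*B*th^j) = C*B*th^Suc j" by simp
  ultimately have "u x <= b' + C*B*th^Suc j" if "x \<in> csec S phi g y h'" for x using b'[OF that] by linarith
  thus ?case using b' by (intro exI[of _ b']) (auto simp: h'_def)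
 qed
 have fin: "\<bar>u x - u x'\<bar> <= C*B*th^j"
  if "EX b. ALL x:D. b <= u x & u x <= b + C*B*th^j" "x \<in> D" "x' \<in> D" for u :: "real^'n => real" and D x x' B j
 proof -
  from that(1) obtain b where b: "!!x. x \<in> D ==> b <= u x & u x <= b + C*B*th^j" by blast
  show ?thesis using b[OF that(2)] b[OF that(3)] by (simp add: abs_le_iff)
 qed
 show ?thesis
 proof (rule exI[of _ K], rule exI[of _ th], rule exI[of _ C], intro conjI allI impI, goal_cases)
  case (5 S phi g A y h T u p H F B j x x')
  show ?case by (rule fin[OF main[where A=A and F=F and y=y and T=T and p=p and H=H and B=B and h=h and S=S and phi=phi and g=g]]) (use 5 in blast)+
 qed (use k C th in auto)
 qed
qed

section \<open>Smooth test functions and mollification of strong solutions\<close>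

primrec diffn :: "nat => (real => real) => bool" where
 "diffn 0 f \<longleftrightarrow> True"
| "diffn (Suc n) f \<longleftrightarrow> (EX f'. (ALL t. (f has_real_derivative f' t) (at t)) & diffn n f')"

lemma diffn_Suc_imp: "diffn (Suc n) f ==> diffn n f"
proof (induction n arbitrary: f)
 case (Suc n)
 then obtain f' where "ALL t. (f has_real_derivative f' t) (at t)" "diffn (Suc n) f'" by auto
 thus ?case using Suc.IH[of f'] by auto
qed simp

lemma diffn_add: "diffn n f ==> diffn n g ==> diffn n (%t. f t + g t)"
proof (induction n arbitrary: f g)
 case (Suc n)
 then obtain f' g' where "!!t. (f has_real_derivative f' t) (at t)" "diffn n f'"
  "!!t. (g has_real_derivative g' t) (at t)" "diffn n g'" by auto
 thus ?case using Suc.IH[of f' g'] by (auto intro!: exI[of _ "%t. f' t + g' t"] derivative_intros)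
qed simp

lemma diffn_mult: "diffn n f ==> diffn n g ==> diffn n (%t. f t*g t)"
proof (induction n arbitrary: f g)
 case (Suc n)
 then obtain f' g' where d: "!!t. (f has_real_derivative f' t) (at t)" "diffn n f'"
  "!!t. (g has_real_derivative g' t) (at t)" "diffn n g'" by auto
 have "diffn n (%t. f' t*g t + g' t*f t)" using Suc.prems[THEN diffn_Suc_imp] d by (intro diffn_add Suc.IH)
 thus ?case using d by (auto intro!: exI[of _ "%t. f' t*g t + g' t*f t"] DERIV_mult)
qed simp

lemma diffn_affine: "diffn n f ==> diffn n (%t. c*f (a*t + b))"
proof (induction n arbitrary: f c)
 case (Suc n)
 then obtain f' where d: "!!t. (f has_real_derivative f' t) (at t)" "diffn n f'" by auto
 have "((%t. c*f (a*t + b)) has_real_derivative ((c*a)*f' (a*t + b))) (at t)" for t by (auto intro!: derivative_eq_intros DERIV_chain2[OF d(1)])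
 thus ?case using Suc.IH[OF d(2), of "c*a"] by (auto intro!: exI[of _ "%t. c*a*f' (a*t + b)"])
qed simp

lemma diffn_deriv: "ALL n. diffn n f ==> diffn n ((deriv ^^ k) f)"
proof (induction k arbitrary: n)
 case (Suc k)
 have "diffn (Suc n) ((deriv ^^ k) f)" by (rule Suc.IH[OF Suc.prems])
 then obtain f' where d: "!!t. ((deriv ^^ k) f has_real_derivative f' t) (at t)" "diffn n f'" by auto
 have "(deriv ^^ Suc k) f = f'" using DERIV_imp_deriv[OF d(1)] by auto
 thus ?case using d(2) by simp
qed simp

lemma DERIV_deriv_iterate:
 assumes "ALL n. diffn n f"
 shows "((deriv ^^ k) f has_real_derivative (deriv ^^ Suc k) f t) (at t)"
proof -
 have "diffn (Suc 0) ((deriv ^^ k) f)" by (rule diffn_deriv[OF assms])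
 then obtain f' where d: "!!t. ((deriv ^^ k) f has_real_derivative f' t) (at t)" by auto
 thus ?thesis using DERIV_imp_deriv[OF d] by simp
qed

text \<open>The functions \<open>P(1/t) * exp (-1/t)\<close>, extended by zero, form a family closed
  under differentiation: \<open>P\<close> is replaced by \<open>X^2*(P - P')\<close>. This is why
  \<open>exp (-1/t)\<close> is smooth at 0.\<close>

definition flat :: "real poly => real => real" where
 "flat P t = (if 0 < t then poly P (1/t)*exp (- (1/t)) else 0)"

lemma DERIV_flat: "(flat P has_real_derivative flat ([:0, 0, 1:]*(P - pderiv P)) t) (at t)"
proof -
 consider "0 < t" | "t < 0" | "t = 0" by linarith
 thus ?thesis
 proof cases
  case 1
  have "((%t. poly P (1/t)*exp (- (1/t))) has_real_derivative flat ([:0, 0, 1:]*(P - pderiv P)) t) (at t)"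
   using 1 by (auto intro!: derivative_eq_intros DERIV_chain2[OF poly_DERIV] simp: flat_def field_simps power2_eq_square)
  thus ?thesis by (rule has_field_derivative_transform_within_open[of _ _ _ "{0<..}"]) (use 1 in \<open>auto simp: flat_def\<close>)
 next
  case 2
  have "((%t. 0) has_real_derivative flat ([:0, 0, 1:]*(P - pderiv P)) t) (at t)" using 2 by (simp add: flat_def)
  thus ?thesis by (rule has_field_derivative_transform_within_open[of _ _ _ "{..<0}"]) (use 2 in \<open>auto simp: flat_def\<close>)
 next
  case 3
  have lim: "((%s. poly Q s*exp (- s)) \<longlongrightarrow> 0) at_top" for Q :: "real poly"
  proof -
   have "((%s. \<Sum>i\<le>degree Q. coeff Q i*(s^i/exp s)) \<longlongrightarrow> (\<Sum>i\<le>degree Q. coeff Q i*0)) at_top"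
    by (intro tendsto_sum tendsto_mult tendsto_const tendsto_power_div_exp_0)
   moreover have "(\<Sum>i\<le>degree Q. coeff Q i*(s^i/exp s)) = poly Q s*exp (- s)" for s
    by (simp add: poly_altdef sum_distrib_right exp_minus divide_inverse mult.assoc)
   ultimately show ?thesis by simp
  qed
  have "((%h. flat P h/h) \<longlongrightarrow> 0) (at 0)"
  proof (rule filterlim_split_at_real)
   have "((%h. flat P h/h) \<longlongrightarrow> 0) (at_left 0) \<longleftrightarrow> ((%h :: real. 0 :: real) \<longlongrightarrow> 0) (at_left 0)"
    by (intro filterlim_cong refl) (auto simp: flat_def eventually_at_filter)
   thus "((%h. flat P h/h) \<longlongrightarrow> 0) (at_left 0)" by simp
   have "((%h. poly (pCons 0 P) (inverse h)*exp (- inverse h)) \<longlongrightarrow> 0) (at_right 0)"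
    by (rule filterlim_compose[OF lim filterlim_inverse_at_top_right])
   also have "((%h. poly (pCons 0 P) (inverse h)*exp (- inverse h)) \<longlongrightarrow> 0) (at_right 0) \<longleftrightarrow> ((%h. flat P h/h) \<longlongrightarrow> 0) (at_right 0)"
    by (intro filterlim_cong refl) (auto simp: flat_def eventually_at_filter field_simps)
   finally show "((%h. flat P h/h) \<longlongrightarrow> 0) (at_right 0)" .
  qed
  thus ?thesis using 3 by (simp add: DERIV_def flat_def)
 qed
qed

lemma diffn_flat: "diffn n (flat P)" using DERIV_flat by (induction n arbitrary: P) auto

text \<open>For positive \<open>k\<close> a smooth function that is positive exactly between
  \<open>a\<close> and \<open>b\<close>. Increasing \<open>k\<close> moves it towards the indicator
  function, as \<open>weak_derivative_unique\<close> requires.\<close>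

definition bump :: "real => real => real => real => real" where
 "bump k a b t = flat 1 (k*(t - a))*flat 1 (k*(b - t))"

lemma diffn_bump: "diffn n (bump k a b)"
proof -
 have "diffn n (%t. (1*flat 1 (k*t + - k*a))*(1*flat 1 (- k*t + k*b)))" by (intro diffn_mult diffn_affine diffn_flat)
 thus ?thesis by (rule back_subst[of "diffn n"]) (auto simp: bump_def fun_eq_iff algebra_simps)
qed

lemma bump_bounds:
 assumes "0 < k"
 shows "0 <= bump k a b t" "bump k a b t <= 1" "a < t ==> t < b ==> 0 < bump k a b t"
  "t <= a | b <= t ==> bump k a b t = 0"
proof -
 have f: "0 <= flat 1 s" "flat 1 s <= 1" for s by (auto simp: flat_def)
 show "0 <= bump k a b t" "bump k a b t <= 1" unfolding bump_def using f by (auto intro: mult_le_one)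
 show "a < t ==> t < b ==> 0 < bump k a b t" using assms by (simp add: bump_def flat_def)
 show "t <= a | b <= t ==> bump k a b t = 0" using assms by (auto simp: bump_def flat_def mult_le_0_iff zero_less_mult_iff)
qed

text \<open>The exponents \<open>m\<close> count derivatives in each coordinate, so a partial
  derivative raises one entry and the family is closed under \<open>pderiv_dir\<close>.\<close>

definition prodfun :: "('n => real => real) => ('n => nat) => real^'n::finite => real" where
 "prodfun d m x = (\<Prod>i\<in>UNIV. (deriv ^^ m i) (d i) (x $ i))"

definition prodgrad :: "('n => real => real) => ('n => nat) => real^'n::finite => real^'n" where
 "prodgrad d m x = (\<chi> j. prodfun d (m(j := Suc (m j))) x)"

lemma prodfun_has_derivative:
 fixes d :: "'n::finite => real => real"
 assumes d: "ALL i n. diffn n (d i)"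
 shows "(prodfun d m has_derivative (%h. prodgrad d m x \<bullet> h)) (at x)"
proof -
 have 1: "((%x. (deriv ^^ m i) (d i) (x $ i)) has_derivative (%h. (deriv ^^ Suc (m i)) (d i) (x $ i)*h $ i)) (at x)" for i
 proof -
  have a: "((%x. x $ i) has_derivative (%h. h $ i)) (at x)" by (rule bounded_linear_imp_has_derivative[OF bounded_linear_vec_nth])
  show ?thesis using has_derivative_compose[OF a DERIV_deriv_iterate[OF spec[OF d, of i], unfolded has_field_derivative_def]] .
 qed
 show ?thesis unfolding prodfun_def[abs_def]
 proof (rule has_derivative_eq_rhs[OF has_derivative_prod[OF 1]], rule ext)
  fix h :: "real^'n"
  have e: "(\<Prod>i\<in>UNIV. (deriv ^^ (m(j := Suc (m j))) i) (d i) (x $ i))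
    = (deriv ^^ Suc (m j)) (d j) (x $ j)*(\<Prod>i\<in>UNIV - {j}. (deriv ^^ m i) (d i) (x $ i))" for j
   by (subst prod.remove[of _ j]) (auto intro!: arg_cong2[of _ _ _ _ "(*)"] prod.cong)
  show "(\<Sum>i\<in>UNIV. (deriv ^^ Suc (m i)) (d i) (x $ i)*h $ i*(\<Prod>j\<in>UNIV - {i}. (deriv ^^ m j) (d j) (x $ j))) = prodgrad d m x \<bullet> h"
   unfolding prodgrad_def prodfun_def inner_vec_def
  proof (rule sum.cong[OF refl], unfold vec_lambda_beta inner_real_def e)
   fix i
   show "(deriv ^^ Suc (m i)) (d i) (x $ i)*h $ i*(\<Prod>j\<in>UNIV - {i}. (deriv ^^ m j) (d j) (x $ j)) =
    (deriv ^^ Suc (m i)) (d i) (x $ i)*(\<Prod>i\<in>UNIV - {i}. (deriv ^^ m i) (d i) (x $ i))*h $ i"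
    by (simp only: mult.assoc mult.commute[of "h $ i"])
  qed
 qed
qed

lemma prodfun_continuous: "ALL i n. diffn n (d i) ==> continuous_on A (prodfun d m)"
 by (rule continuous_at_imp_continuous_on) (blast intro: has_derivative_continuous[OF prodfun_has_derivative])

lemma pderiv_dir_prodfun:
 assumes d: "ALL i n. diffn n (d i)"
 shows "pderiv_dir j (prodfun d m) = prodfun d (m(j := Suc (m j)))"
proof
 fix x
 show "pderiv_dir j (prodfun d m) x = prodfun d (m(j := Suc (m j))) x"
  unfolding pderiv_dir_def frechet_derivative_at[OF prodfun_has_derivative[OF d], symmetric] by (simp add: prodgrad_def inner_axis)
qed

lemma Ck_on_prodfun: "ALL i n. diffn n (d i) ==> Ck_on k UNIV (prodfun d m)"
proof (induction k arbitrary: m)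
 case 0 thus ?case by (simp add: prodfun_continuous)
next
 case (Suc k)
 have "prodfun d m differentiable (at x)" for x using prodfun_has_derivative[OF Suc.prems] by (auto simp: differentiable_def)
 thus ?case using Suc by (simp add: pderiv_dir_prodfun)
qed

lemma test_function_prodfun:
 fixes d :: "'n::finite => real => real"
 assumes d: "ALL i n. diffn n (d i)" and z: "!!i t. t \<notin> {a $ i..b $ i} ==> d i t = 0" and sub: "cbox a b \<subseteq> Om"
 shows "test_function Om (prodfun d (%_. 0))" "!!x. x \<notin> cbox a b ==> prodfun d (%_. 0) x = 0"
proof -
 show 1: "prodfun d (%_. 0) x = 0" if "x \<notin> cbox a b" for x using that z by (auto simp: prodfun_def mem_box_cart)
 have "closure {x. prodfun d (%_. 0) x ~= 0} \<subseteq> cbox a b" using 1 by (intro closure_minimal) auto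
 moreover from this have "compact (closure {x. prodfun d (%_. 0) x ~= 0})"
  using compact_closure bounded_cbox bounded_subset closure_subset by (metis (no_types, lifting))
 ultimately show "test_function Om (prodfun d (%_. 0))" using Ck_on_prodfun[OF d] sub unfolding test_function_def by (meson subset_trans)
qed

lemma deriv_iterate_support:
 assumes d: "ALL n. diffn n f" and z: "ALL t. t \<notin> {a..b} --> f t = 0"
 shows "t \<notin> {a..b} ==> (deriv ^^ k) f t = 0"
proof (induction k arbitrary: t)
 case (Suc k)
 have "((%t. 0) has_real_derivative (deriv ^^ Suc k) f t) (at t)"
  by (rule has_field_derivative_transform_within_open[OF DERIV_deriv_iterate[OF d], where S="- {a..b}"])
   (use Suc in \<open>auto intro!: Suc.IH\<close>)
 thus ?case using DERIV_unique[OF _ DERIV_const] by blast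
qed (use z in simp)

lemma deriv_iterate_bounded:
 assumes d: "ALL n. diffn n f" and z: "ALL t. t \<notin> {a..b} --> f t = 0"
 shows "EX B>0. ALL t. \<bar>(deriv ^^ k) f t\<bar> <= B"
proof -
 have "continuous_on {a..b} ((deriv ^^ k) f)" by (rule continuous_at_imp_continuous_on, rule ballI, rule DERIV_isCont[OF DERIV_deriv_iterate[OF d]])
 hence "bounded ((deriv ^^ k) f ` {a..b})" by (intro compact_imp_bounded compact_continuous_image) auto
 then obtain B where B: "0 < B" "!!t. t \<in> {a..b} ==> \<bar>(deriv ^^ k) f t\<bar> <= B" unfolding bounded_pos by (metis imageI real_norm_def)
 have "\<bar>(deriv ^^ k) f t\<bar> <= B" for t
 proof (cases "t \<in> {a..b}")
  case False
  from deriv_iterate_support[OF d z this] show ?thesis using B(1) by simp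
 qed (rule B(2))
 thus ?thesis using B by blast
qed

lemma prodfun_bounded:
 fixes d :: "'n::finite => real => real"
 assumes d: "ALL i n. diffn n (d i)" and z: "ALL i t. t \<notin> {a..b} --> d i t = 0"
 shows "EX B>0. ALL x. \<bar>prodfun d m x\<bar> <= B"
proof -
 have "ALL i. EX B>0. ALL t. \<bar>(deriv ^^ m i) (d i) t\<bar> <= B" using d z by (intro allI deriv_iterate_bounded) auto
 then obtain B where B: "!!i. 0 < B i" "!!i t. \<bar>(deriv ^^ m i) (d i) t\<bar> <= B i" by metis
 have "\<bar>prodfun d m x\<bar> <= (\<Prod>i\<in>UNIV. B i)" for x unfolding prodfun_def abs_prod using B by (intro prod_mono) auto
 thus ?thesis using B(1) by (intro exI[of _ "\<Prod>i\<in>UNIV. B i"]) (auto intro: prod_pos)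
qed

text \<open>Bounded second derivatives make the gradient Lipschitz. A remainder uniform in
  \<open>x\<close> is what permits differentiation under the integral sign.\<close>

lemma prodfun_taylor:
 fixes d :: "'n::finite => real => real"
 assumes d: "ALL i n. diffn n (d i)" and z: "ALL i t. t \<notin> {a..b} --> d i t = 0"
 shows "EX C>0. (ALL x. norm (prodgrad d m x) <= C) &
  (ALL x h. \<bar>prodfun d m (x + h) - prodfun d m x - prodgrad d m x \<bullet> h\<bar> <= C*(norm h)^2)"
proof -
 have gb: "EX B>0. ALL x. norm (prodgrad d m x) <= B" for m
 proof -
  have "ALL j. EX B>0. ALL x. \<bar>prodfun d (m(j := Suc (m j))) x\<bar> <= B" using prodfun_bounded[OF d z] by blast
  then obtain B where B: "!!j. 0 < B j" "!!j x. \<bar>prodfun d (m(j := Suc (m j))) x\<bar> <= B j" by metis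
  have "norm (prodgrad d m x) <= (\<Sum>j\<in>UNIV. B j)" for x
   using norm_le_l1_cart[of "prodgrad d m x"] sum_mono[of UNIV "%j. \<bar>prodgrad d m x $ j\<bar>" B] B(2) by (simp add: prodgrad_def)
  thus ?thesis using B(1) by (intro exI[of _ "\<Sum>j\<in>UNIV. B j"]) (auto intro: sum_pos)
 qed
 have mv: "EX t>0. t < 1 & prodfun d m (x + h) - prodfun d m x = prodgrad d m (x + t *\<^sub>R h) \<bullet> h" for m x h
 proof -
  have "((%t. prodfun d m (x + t *\<^sub>R h)) has_real_derivative (prodgrad d m (x + t *\<^sub>R h) \<bullet> h)) (at t)" for t
  proof -
   have a: "((%s. x + s *\<^sub>R h) has_derivative (%r. r *\<^sub>R h)) (at t)" by (auto intro!: derivative_eq_intros)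
   show ?thesis unfolding has_field_derivative_def by (rule has_derivative_eq_rhs[OF has_derivative_compose[OF a prodfun_has_derivative[OF d]]])
     (simp add: fun_eq_iff mult.commute)
  qed
  thus ?thesis using MVT2[of 0 1 "%t. prodfun d m (x + t *\<^sub>R h)" "%t. prodgrad d m (x + t *\<^sub>R h) \<bullet> h"] by auto
 qed
 obtain B0 where B0: "0 < B0" "!!x. norm (prodgrad d m x) <= B0" using gb by blast
 have "ALL j. EX B>0. ALL x. norm (prodgrad d (m(j := Suc (m j))) x) <= B" using gb by blast
 then obtain B where B: "!!j. 0 < B j" "!!j x. norm (prodgrad d (m(j := Suc (m j))) x) <= B j" by metis
 define C where "C = B0 + (\<Sum>j\<in>UNIV. B j)"
 have S0: "0 <= (\<Sum>j\<in>UNIV. B j)" using B(1) by (intro sum_nonneg less_imp_le)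
 have lip: "norm (prodgrad d m (x + h) - prodgrad d m x) <= (\<Sum>j\<in>UNIV. B j)*norm h" for x h
 proof -
  have "\<bar>(prodgrad d m (x + h) - prodgrad d m x) $ j\<bar> <= B j*norm h" for j
  proof -
   obtain t where "prodfun d (m(j := Suc (m j))) (x + h) - prodfun d (m(j := Suc (m j))) x
     = prodgrad d (m(j := Suc (m j))) (x + t *\<^sub>R h) \<bullet> h" using mv by blast
   hence "\<bar>(prodgrad d m (x + h) - prodgrad d m x) $ j\<bar> <= norm (prodgrad d (m(j := Suc (m j))) (x + t *\<^sub>R h))*norm h"
    by (simp add: prodgrad_def[of d m] Cauchy_Schwarz_ineq2)
   also have "... <= B j*norm h" using B(2) by (intro mult_right_mono) auto
   finally show ?thesis .
  qed
  hence "(\<Sum>j\<in>UNIV. \<bar>(prodgrad d m (x + h) - prodgrad d m x) $ j\<bar>) <= (\<Sum>j\<in>UNIV. B j*norm h)" by (intro sum_mono)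
  from order_trans[OF norm_le_l1_cart this] show ?thesis unfolding sum_distrib_right .
 qed
 have "\<bar>prodfun d m (x + h) - prodfun d m x - prodgrad d m x \<bullet> h\<bar> <= C*(norm h)^2" for x h
 proof -
  obtain t where t: "0 < t" "t < 1" "prodfun d m (x + h) - prodfun d m x = prodgrad d m (x + t *\<^sub>R h) \<bullet> h" using mv by blast
  have "\<bar>prodfun d m (x + h) - prodfun d m x - prodgrad d m x \<bullet> h\<bar> = \<bar>(prodgrad d m (x + t *\<^sub>R h) - prodgrad d m x) \<bullet> h\<bar>"
   by (simp add: t(3) inner_diff_left)
  also have "... <= norm (prodgrad d m (x + t *\<^sub>R h) - prodgrad d m x)*norm h" by (rule Cauchy_Schwarz_ineq2)
  also have "... <= ((\<Sum>j\<in>UNIV. B j)*norm (t *\<^sub>R h))*norm h" by (intro mult_right_mono lip) auto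
  also have "... <= ((\<Sum>j\<in>UNIV. B j)*norm h)*norm h" using t S0 by (intro mult_right_mono mult_left_mono) (auto simp: mult_left_le_one_le)
  also have "... <= C*norm h*norm h" using B0 by (intro mult_right_mono) (auto simp: C_def)
  finally show ?thesis by (simp add: power2_eq_square mult.assoc)
 qed
 moreover have "norm (prodgrad d m x) <= C" for x using B0(2)[of x] S0 by (simp add: C_def)
 ultimately show ?thesis using B0 S0 by (intro exI[of _ C]) (auto simp: C_def)
qed

text \<open>The uniform Taylor remainder of the kernel is integrated against the absolute value of
  \<open>U\<close>, which gives a quadratic remainder for the convolution.\<close>

lemma convolution_has_derivative:
 fixes d :: "'n::finite => real => real" and U :: "real^'n => real"
 assumes d: "ALL i n. diffn n (d i)" and z: "ALL i t. t \<notin> {a..b} --> d i t = 0" and U: "integrable lborel U"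
 shows "((%x. LINT y|lborel. U y*prodfun d m (x - y)) has_derivative
   (%h. (\<chi> j. LINT y|lborel. U y*prodfun d (m(j := Suc (m j))) (x - y)) \<bullet> h)) (at x)"
proof -
 obtain C where C: "0 < C" "!!x h. \<bar>prodfun d m (x + h) - prodfun d m x - prodgrad d m x \<bullet> h\<bar> <= C*(norm h)^2"
  using prodfun_taylor[OF d z, of m] by blast
 have int: "integrable lborel (%y. U y*prodfun d m (x - y))" for m x
 proof -
  obtain B where B: "!!x. \<bar>prodfun d m x\<bar> <= B" using prodfun_bounded[OF d z, of m] by blast
  have "prodfun d m \<in> borel_measurable borel" by (intro borel_measurable_continuous_onI prodfun_continuous d)
  hence m: "(%y. U y*prodfun d m (x - y)) \<in> borel_measurable lborel" using borel_measurable_integrable[OF U] by measurable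
  show ?thesis
  proof (rule Bochner_Integration.integrable_bound[OF integrable_mult_right[OF integrable_abs[OF U], of B] m])
   show "AE y in lborel. norm (U y*prodfun d m (x - y)) <= norm (B*\<bar>U y\<bar>)"
    using B by (intro always_eventually) (auto simp: abs_mult mult.commute[of B] intro!: mult_left_mono order_trans[OF B abs_ge_self])
  qed
 qed
 define V where "V x = (LINT y|lborel. U y*prodfun d m (x - y))" for x
 define G where "G = (\<chi> j. LINT y|lborel. U y*prodfun d (m(j := Suc (m j))) (x - y))"
 define I where "I = (LINT y|lborel. \<bar>U y\<bar>)"
 have I0: "0 <= I" unfolding I_def by (intro integral_nonneg_AE) auto
 have est: "\<bar>V (x + h) - V x - G \<bullet> h\<bar> <= C*I*(norm h)^2" for h
 proof -
  have Gh: "G \<bullet> h = (LINT y|lborel. U y*(prodgrad d m (x - y) \<bullet> h))" unfolding G_def inner_vec_def prodgrad_def using int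
   by (simp add: sum_distrib_left Bochner_Integration.integral_sum flip: mult.assoc)
  have iG: "integrable lborel (%y. U y*(prodgrad d m (x - y) \<bullet> h))"
   unfolding inner_vec_def prodgrad_def sum_distrib_left using int by (auto simp flip: mult.assoc)
  have "V (x + h) - V x - G \<bullet> h = (LINT y|lborel. U y*prodfun d m (x + h - y) - U y*prodfun d m (x - y) - U y*(prodgrad d m (x - y) \<bullet> h))"
   unfolding V_def Gh by (simp add: Bochner_Integration.integral_diff int iG)
  also have "\<bar>...\<bar> <= (LINT y|lborel. (C*(norm h)^2)*\<bar>U y\<bar>)"
  proof (rule integral_abs_bound[THEN order_trans], rule integral_mono)
   show "integrable lborel (%y. \<bar>U y*prodfun d m (x + h - y) - U y*prodfun d m (x - y) - U y*(prodgrad d m (x - y) \<bullet> h)\<bar>)"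
    by (intro integrable_abs Bochner_Integration.integrable_diff int iG)
   show "integrable lborel (%y. (C*(norm h)^2)*\<bar>U y\<bar>)" by (intro integrable_mult_right integrable_abs U)
   fix y
   have "\<bar>U y*prodfun d m (x + h - y) - U y*prodfun d m (x - y) - U y*(prodgrad d m (x - y) \<bullet> h)\<bar>
     = \<bar>U y\<bar>*\<bar>prodfun d m ((x - y) + h) - prodfun d m (x - y) - prodgrad d m (x - y) \<bullet> h\<bar>"
    by (simp add: abs_mult[symmetric] algebra_simps)
   also have "... <= \<bar>U y\<bar>*(C*(norm h)^2)" by (intro mult_left_mono C(2)) auto
   finally show "\<bar>U y*prodfun d m (x + h - y) - U y*prodfun d m (x - y) - U y*(prodgrad d m (x - y) \<bullet> h)\<bar> <= C*(norm h)^2*\<bar>U y\<bar>"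
    by (simp add: mult_ac)
  qed
  also have "... = C*I*(norm h)^2" by (simp add: I_def)
  finally show ?thesis .
 qed
 have "(V has_derivative (%h. G \<bullet> h)) (at x)" unfolding has_derivative_at
 proof (intro conjI bounded_linear_inner_right)
  show "(%h. norm (V (x + h) - V x - G \<bullet> h)/norm h) \<midarrow>0\<rightarrow> 0"
  proof (rule tendsto_0_le[where K=1])
   show "((%h. C*I*norm h) \<longlongrightarrow> 0) (at 0)" by (auto intro!: tendsto_eq_intros)
   show "\<forall>\<^sub>F h in at 0. norm (norm (V (x + h) - V x - G \<bullet> h)/norm h) <= norm (C*I*norm h)*1"
   proof (intro always_eventually allI)
    fix h
    show "norm (norm (V (x + h) - V x - G \<bullet> h)/norm h) <= norm (C*I*norm h)*1"
     using est[of h] C(1) I0 by (cases "h = 0") (auto simp: power2_eq_square pos_divide_le_eq abs_mult mult.assoc)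
   qed
  qed
 qed
 thus ?thesis by (simp add: V_def[abs_def] G_def)
qed

lemma Lp_loc_integrable:
 assumes v: "Lp_loc 1 Om v" and K: "compact K" "K \<subseteq> Om"
 shows "integrable lebesgue (%x. indicat_real K x * v x)"
proof -
 have "Lp_space 1 K v" using assms by (auto simp: Lp_loc_def)
 hence "integrable (lebesgue_on K) v" unfolding Lp_space_def using integrable_abs_cancel by auto
 thus ?thesis using K(1) by (subst (asm) integrable_restrict_space) (auto intro: fmeasurableD[OF lmeasurable_compact])
qed

lemma integral_lebesgue_on_supported:
 assumes S: "Om \<in> sets lebesgue" "K \<subseteq> Om" and z: "!!x. x \<notin> K ==> psi x = 0"
 shows "integral\<^sup>L (lebesgue_on Om) (%x. v x*psi x) = (LINT x|lebesgue. (indicat_real K x * v x)*psi x)"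
proof -
 have "integral\<^sup>L (lebesgue_on Om) (%x. v x*psi x) = (LINT x|lebesgue. indicator Om x *\<^sub>R (v x*psi x))"
  using S by (intro integral_restrict_space) auto
 also have "... = (LINT x|lebesgue. (indicat_real K x * v x)*psi x)"
  using S(2) z by (intro Bochner_Integration.integral_cong refl) (auto simp: indicator_def)
 finally show ?thesis .
qed

lemma bump_tendsto_indicator:
 "(%k. bump (real (Suc k)) a b t) \<longlonglongrightarrow> indicat_real {a<..<b} t"
proof (cases "a < t & t < b")
 case True
 have f: "(%k. flat 1 (real (Suc k) * s)) \<longlonglongrightarrow> 1" if "0 < s" for s
 proof -
  have "(%k. exp (- (inverse (real (Suc k))*inverse s))) \<longlonglongrightarrow> exp (- (0*inverse s))"
   by (intro tendsto_intros LIMSEQ_inverse_real_of_nat)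
  moreover have "flat 1 (real (Suc k) * s) = exp (- (inverse (real (Suc k))*inverse s))" for k using that by (simp add: flat_def divide_inverse)
  ultimately show ?thesis by simp
 qed
 have "(%k. bump (real (Suc k)) a b t) \<longlonglongrightarrow> 1*1" unfolding bump_def using True by (intro tendsto_mult f) auto
 thus ?thesis using True by simp
next
 case False
 hence "bump (real (Suc k)) a b t = 0" for k by (intro bump_bounds(4)) auto
 thus ?thesis using False by simp
qed

text \<open>Bumps converging to indicators of boxes show that \<open>v - w\<close> has zero integral
  over boxes, and Lebesgue's differentiation theorem yields equality almost everywhere. The result
  identifies the matrix \<open>H\<close> of the equation with the \<open>L^n\<close> derivatives
  given by the Sobolev condition.\<close>

lemma weak_derivative_unique:
 fixes Om :: "(real^'n::finite) set"
 assumes Om: "open Om" and v: "Lp_loc 1 Om v" and w: "Lp_loc 1 Om w" and K: "compact K" "K \<subseteq> Om"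
  and eq: "!!psi. test_function Om psi ==> integral\<^sup>L (lebesgue_on Om) (%x. v x*psi x) = integral\<^sup>L (lebesgue_on Om) (%x. w x*psi x)"
 shows "negligible {x \<in> K. v x ~= w x}"
proof -
 have OmL: "Om \<in> sets lebesgue" using Om by auto
 define q where "q C x = indicat_real C x * v x - indicat_real C x*w x" for C x
 have q: "integrable lebesgue (q C)" if "compact C" "C \<subseteq> Om" for C
  unfolding q_def using that by (intro Bochner_Integration.integrable_diff Lp_loc_integrable[OF v] Lp_loc_integrable[OF w])
 have box: "(LINT x|lebesgue. q (cbox a b) x) = 0" if ab: "cbox a b \<subseteq> Om" for a b
 proof -
  define d where "d k i = bump (real (Suc k)) (a $ i) (b $ i)" for k i
  define psi where "psi k = prodfun (d k) (%_. 0)" for k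
  have d1: "ALL i n. diffn n (d k i)" for k by (simp add: d_def diffn_bump)
  have d0: "d k i t = 0" if "t \<notin> {a $ i..b $ i}" for k i t unfolding d_def using that by (intro bump_bounds(4)) auto
  have t: "test_function Om (psi k)" "!!x. x \<notin> cbox a b ==> psi k x = 0" for k
   unfolding psi_def using test_function_prodfun[OF d1 d0 ab] by blast+
  note qi = q[OF compact_cbox ab]
  have lim: "(%k. psi k x) \<longlonglongrightarrow> indicat_real (box a b) x" for x
  proof -
   have "(%k. \<Prod>i\<in>UNIV. d k i (x $ i)) \<longlonglongrightarrow> (\<Prod>i\<in>UNIV. indicat_real {a $ i<..<b $ i} (x $ i))"
    unfolding d_def by (intro tendsto_prod bump_tendsto_indicator)
   moreover have "(\<Prod>i\<in>UNIV. indicat_real {a $ i<..<b $ i} (x $ i)) = indicat_real (box a b) x" by (auto simp: indicator_def mem_box_cart)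
   ultimately show ?thesis by (simp add: psi_def prodfun_def)
  qed
  have bd: "\<bar>psi k x\<bar> <= 1" for k x unfolding psi_def prodfun_def d_def abs_prod using bump_bounds(1,2)[of "real (Suc k)"]
   by (intro prod_le_1) auto
  have mB: "(%x. q (cbox a b) x*indicat_real (box a b) x) \<in> borel_measurable lebesgue"
   by (rule borel_measurable_times[OF borel_measurable_integrable[OF qi] borel_measurable_indicator]) simp
  have L: "(%k. LINT x|lebesgue. q (cbox a b) x*psi k x) \<longlonglongrightarrow> (LINT x|lebesgue. q (cbox a b) x*indicat_real (box a b) x)"
  proof (rule integral_dominated_convergence[where w="%x. \<bar>q (cbox a b) x\<bar>"])
   have m: "psi k \<in> borel_measurable lebesgue" for k unfolding psi_def
    by (rule measurable_completion) (simp add: borel_measurable_continuous_onI prodfun_continuous d1)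
   show "(%x. q (cbox a b) x*psi k x) \<in> borel_measurable lebesgue" for k by (rule borel_measurable_times[OF borel_measurable_integrable[OF qi] m])
   show "(%x. q (cbox a b) x*indicat_real (box a b) x) \<in> borel_measurable lebesgue" by (rule mB)
   show "AE x in lebesgue. (%k. q (cbox a b) x*psi k x) \<longlonglongrightarrow> q (cbox a b) x*indicat_real (box a b) x"
    by (intro always_eventually allI tendsto_mult tendsto_const lim)
   show "AE x in lebesgue. norm (q (cbox a b) x*psi k x) <= \<bar>q (cbox a b) x\<bar>" for k
    using bd by (intro always_eventually allI) (simp add: abs_mult mult_left_le)
  qed (use qi in auto)
  have "(LINT x|lebesgue. q (cbox a b) x*psi k x) = 0" for k
  proof -
   have i: "integrable lebesgue (%x. (indicat_real (cbox a b) x*z x)*psi k x)" if z: "Lp_loc 1 Om z" for z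
   proof (rule Bochner_Integration.integrable_bound[OF Lp_loc_integrable[OF z compact_cbox ab]])
    have "psi k \<in> borel_measurable lebesgue" unfolding psi_def
     by (rule measurable_completion) (simp add: borel_measurable_continuous_onI prodfun_continuous d1)
    thus "(%x. (indicat_real (cbox a b) x*z x)*psi k x) \<in> borel_measurable lebesgue"
     using borel_measurable_integrable[OF Lp_loc_integrable[OF z compact_cbox ab]] by measurable
    show "AE x in lebesgue. norm ((indicat_real (cbox a b) x*z x)*psi k x) <= norm (indicat_real (cbox a b) x*z x)"
     using bd by (intro always_eventually allI) (simp add: abs_mult mult_left_le)
   qed
   have "(LINT x|lebesgue. q (cbox a b) x*psi k x) = (LINT x|lebesgue. (indicat_real (cbox a b) x * v x)*psi k x) - (LINT x|lebesgue. (indicat_real (cbox a b) x*w x)*psi k x)"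
    unfolding q_def left_diff_distrib by (rule Bochner_Integration.integral_diff[OF i[OF v] i[OF w]])
   thus ?thesis using eq[OF t(1)[of k]] integral_lebesgue_on_supported[where psi="psi k" and v=v, OF OmL ab t(2)]
     integral_lebesgue_on_supported[where psi="psi k" and v=w, OF OmL ab t(2)] by simp
  qed
  with L have "(%k. 0) \<longlonglongrightarrow> (LINT x|lebesgue. q (cbox a b) x*indicat_real (box a b) x)" by simp
  from LIMSEQ_unique[OF this tendsto_const] have 0: "(LINT x|lebesgue. q (cbox a b) x*indicat_real (box a b) x) = 0" .
  have "negligible (cbox a b - box a b)" by (rule negligible_frontier_interval)
  hence "AE x in lebesgue. x \<notin> cbox a b - box a b" by (intro AE_not_in) (simp add: negligible_iff_null_sets)
  hence "AE x in lebesgue. q (cbox a b) x*indicat_real (box a b) x = q (cbox a b) x" by eventually_elim (auto simp: q_def indicator_def)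
  hence "(LINT x|lebesgue. q (cbox a b) x*indicat_real (box a b) x) = (LINT x|lebesgue. q (cbox a b) x)"
   by (rule integral_cong_AE[OF mB borel_measurable_integrable[OF qi]])
  thus ?thesis using 0 by simp
 qed
 have loc: "negligible {x \<in> cbox a b. v x ~= w x}" if ab: "cbox a b \<subseteq> Om" for a b
 proof -
  note qi = q[OF compact_cbox ab]
  have ii: "q (cbox a b) integrable_on cbox c d" for c d using integrable_on_lebesgue[OF qi] integrable_on_subcbox by blast
  have i0: "integral (cbox c d) (q (cbox a b)) = 0" for c d
  proof -
   obtain e f where ef: "cbox c d \<inter> cbox a b = cbox e f" using Int_interval[of c d a b] by blast
   have "integral (cbox c d) (q (cbox a b)) = integral UNIV (q (cbox e f))" unfolding integral_restrict_UNIV[of "cbox c d", symmetric]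
    by (rule integral_cong) (use ef in \<open>auto simp: q_def indicator_def\<close>)
   also have "... = (LINT x|lebesgue. q (cbox e f) x)" using q[OF compact_cbox, of e f] ef ab by (intro integral_lebesgue) auto
   finally show ?thesis using box[of e f] ef ab by auto
  qed
  obtain N where N: "negligible N" "!!x e. x \<notin> N ==> 0 < e ==> EX d>0. ALL h. 0 < h & h < d -->
    norm (integral (cbox x (x + h *\<^sub>R One)) (q (cbox a b)) /\<^sub>R h^DIM(real^'n) - q (cbox a b) x) < e"
   by (rule integrable_ccontinuous_explicit[OF ii]) (rule that)
  have "q (cbox a b) x = 0" if xN: "x \<notin> N" for x
  proof (rule ccontr)
   assume "q (cbox a b) x ~= 0"
   then obtain d where "0 < d" "!!h. 0 < h ==> h < d ==>
    norm (integral (cbox x (x + h *\<^sub>R One)) (q (cbox a b)) /\<^sub>R h^DIM(real^'n) - q (cbox a b) x) < \<bar>q (cbox a b) x\<bar>"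
    using N(2)[OF xN, of "\<bar>q (cbox a b) x\<bar>"] by auto
   from this(2)[of "d/2"] this(1) show False unfolding i0 by simp
  qed
  hence "{x \<in> cbox a b. v x ~= w x} \<subseteq> N" by (force simp: q_def)
  thus ?thesis using N(1) negligible_subset by blast
 qed
 have "EX a b. x \<in> box a b & cbox a b \<subseteq> Om" if "x \<in> K" for x using open_contains_cbox[OF Om, of x] that K by (metis subsetD)
 then obtain a b where ab: "!!x. x \<in> K ==> x \<in> box (a x) (b x)" "!!x. x \<in> K ==> cbox (a x) (b x) \<subseteq> Om" by metis
 have "K \<subseteq> (\<Union>x\<in>K. box (a x) (b x))" using ab by blast
 from compactE_image[OF K(1) open_box this] obtain I where I: "I \<subseteq> K" "finite I" "K \<subseteq> (\<Union>x\<in>I. box (a x) (b x))" by metis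
 have "negligible (\<Union>x\<in>I. {y \<in> cbox (a x) (b x). v y ~= w y})"
 proof (rule negligible_Union)
  show "finite ((%x. {y \<in> cbox (a x) (b x). v y ~= w y}) ` I)" using I(2) by simp
  fix t assume "t \<in> (%x. {y \<in> cbox (a x) (b x). v y ~= w y}) ` I"
  thus "negligible t" using loc ab(2) I(1) by blast
 qed
 moreover have "{x \<in> K. v x ~= w x} \<subseteq> (\<Union>x\<in>I. {y \<in> cbox (a x) (b x). v y ~= w y})" using I(3) box_subset_cbox by fastforce
 ultimately show ?thesis by (rule negligible_subset)
qed

text \<open>Bernoulli's inequality, rescaled; it is the pointwise convexity behind Jensen's
  inequality in \<open>convolution_power_bound\<close>.\<close>

lemma power_ge_tangent: "a^n + real n*a^(n - 1)*(x - a) <= x^n" if "0 <= a" "0 <= x" for a x :: real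
proof (cases "a = 0")
 case True thus ?thesis using that by (cases n) (auto simp: power_0_left)
next
 case False
 hence a: "0 < a" using that by simp
 have "1 + real n*(x/a - 1) <= (1 + (x/a - 1))^n" using a that by (intro Bernoulli_inequality) simp
 hence "a^n*(1 + real n*(x/a - 1)) <= a^n*(x/a)^n" using a by (intro mult_left_mono) auto
 also have "a^n*(x/a)^n = x^n" using a by (simp add: power_divide)
 also have "a^n*(1 + real n*(x/a - 1)) = a^n + real n*a^(n - 1)*(x - a)" using a by (cases n) (auto simp: field_simps)
 finally show ?thesis .
qed

lemma integral_reflected_shift:
 fixes psi :: "real^'n::finite => real"
 assumes ev: "!!x. psi (- x) = psi x" and psi: "integrable lborel psi"
 shows "integrable lborel (%y. psi (x - y))" "(LINT y|lborel. psi (x - y)) = (LINT y|lborel. psi y)"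
proof -
 have m[measurable]: "psi \<in> borel_measurable borel" using borel_measurable_integrable[OF psi] by simp
 have e: "psi (x - y) = psi ((- x) + y)" for y using ev[of "x - y"] by (simp add: algebra_simps)
 have "(LINT y|lborel. psi ((- x) + y)) = (LINT y|distr lborel borel ((+) (- x)). psi y)" by (subst integral_distr) auto
 thus "(LINT y|lborel. psi (x - y)) = (LINT y|lborel. psi y)" unfolding lborel_distr_plus e by simp
 have "integrable (distr lborel borel ((+) (- x))) psi" unfolding lborel_distr_plus by (rule psi)
 thus "integrable lborel (%y. psi (x - y))" unfolding e by (subst (asm) integrable_distr_eq) auto
qed

text \<open>Young's inequality for convolutions with a probability density, in the form of Jensen's
 inequality integrated by Fubini's theorem.\<close>

lemma convolution_power_bound:
 fixes q psi F :: "real^'n::finite => real"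
 assumes q: "!!x. 0 <= q x" "integrable lborel q" "integrable lborel (%x. q x^n)"
  and psi: "!!x. 0 <= psi x" "!!x. psi x <= 1" "!!x. psi (- x) = psi x" "integrable lborel psi" "continuous_on UNIV psi"
  and J: "J = (LINT x|lborel. psi x)" "0 < J"
  and K: "compact K" "continuous_on K F" "!!x. x \<in> K ==> 0 <= F x & J*F x <= (LINT y|lborel. q y*psi (x - y))"
 shows "integral K (%x. F x^n) <= (LINT y|lborel. q y^n)"
proof -
 have m[measurable]: "psi \<in> borel_measurable borel" "q \<in> borel_measurable borel"
  using psi(5) q(2) by (auto intro: borel_measurable_continuous_onI dest: borel_measurable_integrable)
 have ip: "integrable lborel (%y. p y*psi (x - y))" if p: "integrable lborel p" for p x
 proof (rule Bochner_Integration.integrable_bound[OF p])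
  show "(%y. p y*psi (x - y)) \<in> borel_measurable lborel" using borel_measurable_integrable[OF p] by measurable
  show "AE y in lborel. norm (p y*psi (x - y)) <= norm (p y)" using psi(1,2) by (intro always_eventually allI) (simp add: abs_mult mult_left_le)
 qed
 have shift: "integrable lborel (%y. psi (x - y))" "(LINT y|lborel. psi (x - y)) = J" for x
  unfolding J using integral_reflected_shift[OF psi(3,4)] by auto
 have jensen: "J*F x^n <= (LINT y|lborel. q y^n*psi (x - y))" if x: "x \<in> K" for x
 proof -
  \<comment> \<open>The mean of \<open>q\<close> under the kernel; integrating the tangent line of
    the power at \<open>a\<close> gives Jensen's inequality.\<close>
  define a where "a = (LINT y|lborel. q y*psi (x - y))/J"
  have Fa: "0 <= F x" "F x <= a" using K(3)[OF x] J(2) by (auto simp: a_def field_simps)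
  have "J*a^n = (LINT y|lborel. (a^n - real n*a^(n - 1)*a)*psi (x - y) + real n*a^(n - 1)*(q y*psi (x - y)))"
  proof -
   have "(LINT y|lborel. q y*psi (x - y)) = J*a" using J(2) by (simp add: a_def)
   hence "(LINT y|lborel. (a^n - real n*a^(n - 1)*a)*psi (x - y) + real n*a^(n - 1)*(q y*psi (x - y)))
     = (a^n - real n*a^(n - 1)*a)*J + real n*a^(n - 1)*(J*a)" by (simp add: shift ip[OF q(2)])
   thus ?thesis by (simp add: algebra_simps)
  qed
  also have "... <= (LINT y|lborel. q y^n*psi (x - y))"
  proof (rule integral_mono)
   show "integrable lborel (%y. (a^n - real n*a^(n - 1)*a)*psi (x - y) + real n*a^(n - 1)*(q y*psi (x - y)))"
    by (intro Bochner_Integration.integrable_add integrable_mult_right shift ip q)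
   show "integrable lborel (%y. q y^n*psi (x - y))" by (rule ip[OF q(3)])
   fix y
   have "(a^n + real n*a^(n - 1)*(q y - a))*psi (x - y) <= q y^n*psi (x - y)" using Fa q(1) psi(1) by (intro mult_right_mono power_ge_tangent) auto
   thus "(a^n - real n*a^(n - 1)*a)*psi (x - y) + real n*a^(n - 1)*(q y*psi (x - y)) <= q y^n*psi (x - y)" by (simp add: algebra_simps)
  qed
  finally have "J*a^n <= (LINT y|lborel. q y^n*psi (x - y))" .
  moreover have "J*F x^n <= J*a^n" using Fa J by (intro mult_left_mono power_mono) auto
  ultimately show ?thesis by linarith
 qed
 have iK: "integrable lborel (%x. indicat_real K x *\<^sub>R F x^n)" using K(2) by (intro borel_integrable_compact K(1) continuous_intros)
 have mK[measurable]: "K \<in> sets borel" using K(1) by (simp add: compact_imp_closed)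
 have qn0: "0 <= q y^n" for y using q(1) by simp
 have "ennreal J*(\<integral>\<^sup>+x. ennreal (indicat_real K x *\<^sub>R F x^n) \<partial>lborel)
   = (\<integral>\<^sup>+x. ennreal (J*(indicat_real K x *\<^sub>R F x^n)) \<partial>lborel)"
  using J(2) borel_measurable_integrable[OF iK] by (subst nn_integral_cmult[symmetric]) (auto simp: ennreal_mult'[symmetric])
 also have "... <= (\<integral>\<^sup>+x. (\<integral>\<^sup>+y. ennreal (q y^n*psi (x - y)) \<partial>lborel) \<partial>lborel)"
 proof (rule nn_integral_mono)
  fix x
  have "(\<integral>\<^sup>+y. ennreal (q y^n*psi (x - y)) \<partial>lborel) = ennreal (LINT y|lborel. q y^n*psi (x - y))"
   using qn0 psi(1) by (intro nn_integral_eq_integral ip q(3)) auto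
  thus "ennreal (J*(indicat_real K x *\<^sub>R F x^n)) <= (\<integral>\<^sup>+y. ennreal (q y^n*psi (x - y)) \<partial>lborel)"
   using jensen[of x] by (cases "x \<in> K") (auto intro: ennreal_leI)
 qed
 also have "... = (\<integral>\<^sup>+y. (\<integral>\<^sup>+x. ennreal (q y^n*psi (x - y)) \<partial>lborel) \<partial>lborel)"
  by (rule lborel_pair.Fubini'[symmetric, of "%x y. ennreal (q y^n*psi (x - y))"]) measurable
 also have "... = (\<integral>\<^sup>+y. ennreal (q y^n)*ennreal J \<partial>lborel)"
 proof (rule nn_integral_cong)
  fix y
  have e: "psi (x - y) = psi (y - x)" for x using psi(3)[of "y - x"] by simp
  have "(\<integral>\<^sup>+x. ennreal (q y^n*psi (x - y)) \<partial>lborel) = ennreal (q y^n)*(\<integral>\<^sup>+x. ennreal (psi (y - x)) \<partial>lborel)"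
   unfolding e using qn0 psi(1) by (subst nn_integral_cmult[symmetric]) (auto simp: ennreal_mult')
  also have "(\<integral>\<^sup>+x. ennreal (psi (y - x)) \<partial>lborel) = ennreal J"
   unfolding shift(2)[of y, symmetric] using psi(1) by (intro nn_integral_eq_integral shift) auto
  finally show "(\<integral>\<^sup>+x. ennreal (q y^n*psi (x - y)) \<partial>lborel) = ennreal (q y^n)*ennreal J" .
 qed
 also have "... = (\<integral>\<^sup>+y. ennreal (q y^n) \<partial>lborel)*ennreal J" by (rule nn_integral_multc) measurable
 also have "(\<integral>\<^sup>+y. ennreal (q y^n) \<partial>lborel) = ennreal (LINT y|lborel. q y^n)"
  using qn0 by (intro nn_integral_eq_integral q(3)) auto
 also have "(\<integral>\<^sup>+x. ennreal (indicat_real K x *\<^sub>R F x^n) \<partial>lborel) = ennreal (LINT x|lborel. indicat_real K x *\<^sub>R F x^n)"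
  using K(3) by (intro nn_integral_eq_integral iK) (auto simp: indicator_def)
 finally have "ennreal (J*(LINT x|lborel. indicat_real K x *\<^sub>R F x^n)) <= ennreal ((LINT y|lborel. q y^n)*J)"
  using J(2) qn0 by (simp add: ennreal_mult' ennreal_mult'')
 moreover have "0 <= (LINT y|lborel. q y^n)*J" using J(2) qn0 by (intro mult_nonneg_nonneg integral_nonneg_AE) auto
 ultimately have "J*(LINT x|lborel. indicat_real K x *\<^sub>R F x^n) <= J*(LINT y|lborel. q y^n)" by (simp add: ennreal_le_iff mult.commute)
 hence "(LINT x|lborel. indicat_real K x *\<^sub>R F x^n) <= (LINT y|lborel. q y^n)" using J(2) by simp
 moreover have "integral K (%x. F x^n) = (LINT x|lborel. indicat_real K x *\<^sub>R F x^n)"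
  using set_borel_integral_eq_integral(2)[of K "%x. F x^n"] iK by (simp add: set_integrable_def set_lebesgue_integral_def)
 ultimately show ?thesis by simp
qed

lemma prodfun_reflected_support:
 fixes d :: "'n::finite => real => real"
 assumes d: "ALL i n. diffn n (d i)" and z: "ALL i t. t \<notin> {-r..r} --> d i t = 0" and ne: "prodfun d m x ~= 0"
 shows "norm x <= real CARD('n)*r"
proof -
 have "\<bar>x $ i\<bar> <= r" for i
 proof (rule ccontr)
  assume "~ ?thesis"
  hence "x $ i \<notin> {-r..r}" by auto
  from deriv_iterate_support[OF spec[OF d, of i] spec[OF z, of i] this] have "(deriv ^^ m i) (d i) (x $ i) = 0" .
  thus False using ne by (auto simp: prodfun_def)
 qed
 hence "(\<Sum>i\<in>UNIV. \<bar>x $ i\<bar>) <= (\<Sum>i\<in>(UNIV::'n set). r)" by (intro sum_mono) blast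
 thus ?thesis using norm_le_l1_cart[of x] by simp
qed

lemma pderiv_dir_prodfun_reflected:
 assumes d: "ALL i n. diffn n (d i)"
 shows "pderiv_dir j (%y. c*prodfun d m (x - y)) = (%y. (- c)*prodfun d (m(j := Suc (m j))) (x - y))"
proof
 fix y
 have a: "((%y. x - y) has_derivative (%h. - h)) (at y)" by (auto intro!: derivative_eq_intros)
 have "((%y. c*prodfun d m (x - y)) has_derivative (%h. c*(prodgrad d m (x - y) \<bullet> (- h)))) (at y)"
  by (intro has_derivative_mult_right has_derivative_compose[OF a prodfun_has_derivative[OF d]])
 from frechet_derivative_at[OF this, symmetric]
 have "frechet_derivative (%y. c*prodfun d m (x - y)) (at y) (axis j 1) = c*(prodgrad d m (x - y) \<bullet> (- axis j 1))" by simp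
 thus "pderiv_dir j (%y. c*prodfun d m (x - y)) y = (- c)*prodfun d (m(j := Suc (m j))) (x - y)" by (simp add: pderiv_dir_def prodgrad_def inner_axis)
qed

text \<open>The mollifier is left unnormalized: it is bounded by one and has integral
  \<open>J\<close>, by which averages are divided. Evenness allows integration in either variable of
  \<open>x - y\<close>.\<close>

lemma mollifier_exists:
 fixes si :: real
 assumes "0 < si"
 obtains d :: "'n::finite => real => real" and r J where
  "ALL i n. diffn n (d i)" "0 < r" "ALL i t. t \<notin> {-r..r} --> d i t = 0"
  "!!m x. prodfun d m x ~= 0 ==> norm x < si"
  "!!x. 0 <= prodfun d (%_. 0) x" "!!x. prodfun d (%_. 0) x <= 1" "!!x. prodfun d (%_. 0) (- x) = prodfun d (%_. 0) x"
  "integrable lborel (prodfun d (%_. 0))" "(LINT x|lborel. prodfun d (%_. 0) x) = J" "0 < J"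
  "!!x. test_function (ball x si) (%y. prodfun d (%_. 0) (x - y))"
proof -
 define r where "r = si/(2*real CARD('n))"
 have r: "0 < r" "real CARD('n)*r < si" using assms by (auto simp: r_def)
 define d :: "'n => real => real" where "d i = bump 1 (- r) r" for i
 have d: "ALL i n. diffn n (d i)" by (simp add: d_def diffn_bump)
 have z: "ALL i t. t \<notin> {-r..r} --> d i t = 0" unfolding d_def using bump_bounds(4)[of 1 _ "- r" r] by auto
 let ?psi = "prodfun d (%_. 0)"
 have sup: "norm x < si" if "prodfun d m x ~= 0" for m x using prodfun_reflected_support[OF d z that] r by linarith
 have p0: "0 <= ?psi x" "?psi x <= 1" for x unfolding prodfun_def d_def using bump_bounds(1,2)[of 1] by (auto intro!: prod_nonneg prod_le_1)
 have ev: "?psi (- x) = ?psi x" for x by (simp add: prodfun_def d_def bump_def mult.commute add.commute)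
 have "integrable lborel (%x. indicat_real (cball 0 si) x *\<^sub>R ?psi x)" by (intro borel_integrable_compact compact_cball prodfun_continuous d)
 hence int: "integrable lborel ?psi"
  by (rule back_subst[of "integrable lborel"]) (use sup[of "%_. 0"] in \<open>force simp: fun_eq_iff indicator_def\<close>)
 have "(LINT x|lborel. ?psi x) ~= 0"
 proof
  assume "(LINT x|lborel. ?psi x) = 0"
  hence ae0: "AE x in lborel. ?psi x = 0" using integral_nonneg_eq_0_iff_AE[OF int] p0 by simp
  have pos: "0 < ?psi x" if "x \<in> box (\<chi> i. - r) (\<chi> i. r)" for x
   unfolding prodfun_def d_def using that by (auto simp: mem_box_cart intro!: prod_pos bump_bounds(3))
  from ae0 have "AE x in lborel. x \<notin> box (\<chi> i. - r) ((\<chi> i. r) :: real^'n)" by eventually_elim (use pos in force)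
  hence "box (\<chi> i. - r) ((\<chi> i. r) :: real^'n) \<in> null_sets lborel" by (subst AE_iff_null_sets) auto
  hence "negligible (box (\<chi> i. - r) ((\<chi> i. r) :: real^'n))" unfolding negligible_iff_null_sets by (rule null_sets_completionI)
  moreover have "box (\<chi> i. - r) ((\<chi> i. r) :: real^'n) ~= {}" using r by (auto simp: box_ne_empty Basis_vec_def inner_axis)
  ultimately show False using open_not_negligible[OF open_box] by blast
 qed
 moreover have "0 <= (LINT x|lborel. ?psi x)" using p0 by (intro integral_nonneg_AE) auto
 ultimately have J: "0 < (LINT x|lborel. ?psi x)" by simp
 have test: "test_function (ball x si) (%y. ?psi (x - y))" for x
 proof -
  define dx where "dx i = bump 1 (x $ i - r) (x $ i + r)" for i
  have e: "(%y. ?psi (x - y)) = prodfun dx (%_. 0)" by (auto simp: fun_eq_iff prodfun_def d_def dx_def bump_def algebra_simps intro!: prod.cong)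
  have dx: "ALL i n. diffn n (dx i)" by (simp add: dx_def diffn_bump)
  have "cbox (\<chi> i. x $ i - r) (\<chi> i. x $ i + r) \<subseteq> ball x si"
  proof
   fix y assume "y \<in> cbox (\<chi> i. x $ i - r) (\<chi> i. x $ i + r)"
   hence "\<bar>(x - y) $ i\<bar> <= r" for i by (auto simp: mem_box_cart abs_le_iff algebra_simps)
   hence "(\<Sum>i\<in>UNIV. \<bar>(x - y) $ i\<bar>) <= (\<Sum>i\<in>(UNIV::'n set). r)" by (intro sum_mono)
   hence "norm (x - y) <= real CARD('n)*r" using norm_le_l1_cart[of "x - y"] by simp
   thus "y \<in> ball x si" using r by (simp add: dist_norm)
  qed
  thus ?thesis unfolding e by (intro test_function_prodfun(1)[OF dx]) (auto simp: dx_def intro!: bump_bounds(4))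
 qed
 show thesis by (rule that[OF d r(1) z sup p0 ev int refl J test])
qed

lemma sum_power_le:
 fixes a :: "'i => real"
 assumes "finite I" "!!i. i \<in> I ==> 0 <= a i" "I ~= {}"
 shows "(\<Sum>i\<in>I. a i)^n <= real (card I)^n*(\<Sum>i\<in>I. a i^n)"
proof -
 define m where "m = Max (a ` I)"
 have "m \<in> a ` I" unfolding m_def using assms by (intro Max_in) auto
 then obtain j where j: "j \<in> I" "m = a j" by blast
 have "(\<Sum>i\<in>I. a i) <= real (card I)*m" using sum_bounded_above[of I a m] assms by (auto simp: m_def)
 hence "(\<Sum>i\<in>I. a i)^n <= (real (card I)*m)^n" using assms by (intro power_mono sum_nonneg) auto
 also have "... = real (card I)^n*a j^n" by (simp add: power_mult_distrib j(2))
 also have "... <= real (card I)^n*(\<Sum>i\<in>I. a i^n)" using assms j by (intro mult_left_mono member_le_sum) auto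
 finally show ?thesis .
qed

text \<open>Only continuity of the coefficients is used: freezing them at the centre of the mollifier
 costs a multiple of the modulus of continuity times the \<open>L\<^sup>n\<close> norm of the second derivatives.\<close>

lemma strong_solution_approximation:
 fixes Om :: "(real^'n::finite) set" and B :: "real^'n => real^'n^'n"
 assumes Om: "open Om" and cB: "continuous_on Om B" and cu: "continuous_on Om u"
  and wd: "!!i j. weak_deriv Om [i, j] u (%x. H x $ i $ j)" and sob: "sobolev_loc 2 CARD('n) Om u"
  and ae: "AE x in lebesgue_on Om. mdot (B x) (H x) = f x" and f: "Lp_space CARD('n) Om f"
  and K: "compact K" "K \<subseteq> Om" and e: "0 < e"
 shows "EX v p M. c2_on UNIV v p M & (ALL x:K. \<bar>v x - u x\<bar> <= e) &
  integral K (%x. \<bar>mdot (B x) (M x)\<bar>^CARD('n)) <= 2^CARD('n)*(LINT x|lebesgue_on Om. \<bar>f x\<bar>^CARD('n)) + e"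
proof -
 let ?N = "CARD('n)"
 obtain rho1 where rho1: "0 < rho1" "(\<Union>x\<in>K. cball x rho1) \<subseteq> Om"
  using compact_subset_open_imp_cball_epsilon_subset[OF K(1) Om K(2)] by blast
 \<comment> \<open>Mollification at points of \<open>K\<close> sees only values in this compact
   neighbourhood, where local integrability becomes integrability.\<close>
 define K' where "K' = {x + y |x y. x \<in> K & y \<in> cball 0 rho1}"
 have cK': "compact K'" unfolding K'_def by (intro compact_sums K(1) compact_cball)
 have near: "y \<in> K'" if "x \<in> K" "dist x y <= rho1" for x y
  unfolding K'_def using that by (intro CollectI exI[of _ x] exI[of _ "y - x"]) (auto simp: dist_norm norm_minus_commute)
 have K'Om: "K' \<subseteq> Om"
 proof
  fix z assume "z \<in> K'"
  then obtain x y where "z = x + y" "x \<in> K" "norm y <= rho1" by (auto simp: K'_def)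
  hence "x \<in> K" "z \<in> cball x rho1" by (auto simp: dist_norm)
  thus "z \<in> Om" using rho1(2) by blast
 qed
 have KK': "K \<subseteq> K'" using near rho1(1) by auto
 have mK': "K' \<in> sets lebesgue" "K' \<in> sets borel" using cK' by (auto intro: fmeasurableD[OF lmeasurable_compact] simp: compact_imp_closed)
 have OmL: "Om \<in> sets lebesgue" using Om by auto
 have HL: "Lp_loc 1 Om (%x. H x $ i $ j)" for i j using wd by (auto simp: weak_deriv_def)
 note iHK = Lp_loc_integrable[OF HL cK' K'Om]
 have ex: "EX G. G \<in> borel_measurable lborel & (AE x in lborel. indicat_real K' x*H x $ i $ j = G x)" for i j
  using completion_ex_borel_measurable_real[OF borel_measurable_integrable[OF iHK[of i j]]] by blast
 \<comment> \<open>Borel representatives of the entries of \<open>H\<close>, so that Fubini's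
   theorem on \<open>lborel\<close> is applicable.\<close>
 define G where "G i j = (SOME G. G \<in> borel_measurable lborel & (AE x in lborel. indicat_real K' x*H x $ i $ j = G x))" for i j
 have G: "G i j \<in> borel_measurable lborel" "AE x in lborel. indicat_real K' x*H x $ i $ j = G i j x" for i j
  unfolding G_def using someI_ex[OF ex[of i j]] by blast+
 define Hb where "Hb x = (\<chi> i j. indicat_real K' x*G i j x)" for x
 have mHb[measurable]: "(%x. Hb x $ i $ j) \<in> borel_measurable borel" for i j using G(1)[of i j] mK'(2) by (simp add: Hb_def) measurable
 have aeH: "AE x in lebesgue. indicat_real K' x*H x $ i $ j = Hb x $ i $ j" for i j
  using AE_completion[OF G(2)[of i j]] by eventually_elim (auto simp: Hb_def indicator_def)
 have out: "Hb x $ i $ j = 0" if "x \<notin> K'" for x i j using that by (simp add: Hb_def)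
 have iH: "integrable lborel (%x. Hb x $ i $ j)" for i j
 proof -
  have "integrable lebesgue (%x. Hb x $ i $ j)"
   using iHK[of i j] by (rule integrable_cong_AE_imp) (use aeH[of i j] mHb[of i j] in \<open>auto intro: measurable_completion\<close>)
  thus ?thesis by (subst (asm) integrable_completion) auto
 qed
 \<comment> \<open>The equation provides \<open>H\<close> only as a locally integrable weak
   derivative; its \<open>L^n\<close> bound comes from uniqueness and the Sobolev condition.\<close>
 have iHN: "integrable lborel (%x. \<bar>Hb x $ i $ j\<bar>^?N)" for i j
 proof -
  obtain w where w: "weak_deriv Om [i, j] u w" "Lp_loc ?N Om w" using sob[unfolded sobolev_loc_def, rule_format, of "[i, j]"] by auto
  have "negligible {x \<in> K'. H x $ i $ j ~= w x}"
  proof (rule weak_derivative_unique[OF Om HL _ cK' K'Om])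
   show "Lp_loc 1 Om w" using w(1) by (simp add: weak_deriv_def)
   fix psi assume "test_function Om psi"
   thus "integral\<^sup>L (lebesgue_on Om) (%x. H x $ i $ j*psi x) = integral\<^sup>L (lebesgue_on Om) (%x. w x*psi x)"
    using wd[of i j] w(1) by (simp add: weak_deriv_def)
  qed
  hence ne: "AE x in lebesgue. x \<notin> {x \<in> K'. H x $ i $ j ~= w x}" by (intro AE_not_in) (simp add: negligible_iff_null_sets)
  have "integrable (lebesgue_on K') (%x. \<bar>w x\<bar>^?N)" using w(2) cK' K'Om by (auto simp: Lp_loc_def Lp_space_def)
  hence "integrable lebesgue (%x. indicat_real K' x *\<^sub>R \<bar>w x\<bar>^?N)" using mK' by (subst (asm) integrable_restrict_space) auto
  hence "integrable lebesgue (%x. \<bar>Hb x $ i $ j\<bar>^?N)"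
  proof (rule integrable_cong_AE_imp)
   show "(%x. \<bar>Hb x $ i $ j\<bar>^?N) \<in> borel_measurable lebesgue" by (rule measurable_completion) measurable
   show "AE x in lebesgue. indicat_real K' x *\<^sub>R \<bar>w x\<bar>^?N = \<bar>Hb x $ i $ j\<bar>^?N" using ne aeH[of i j]
   proof eventually_elim
    case (elim x)
    thus ?case using out[of x i j] by (cases "x \<in> K'") auto
   qed
  qed
  thus ?thesis by (subst (asm) integrable_completion) measurable
 qed
 define S where "S x = (\<Sum>k\<in>UNIV. \<bar>Hb x $ fst k $ snd k\<bar>)" for x
 have S0: "0 <= S x" for x by (simp add: S_def sum_nonneg)
 have mS[measurable]: "S \<in> borel_measurable borel" unfolding S_def by measurable
 have iS: "integrable lborel S" unfolding S_def by (intro Bochner_Integration.integrable_sum integrable_abs iH)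
 have iZ: "integrable lborel (%x. real (card (UNIV :: ('n \<times> 'n) set))^?N*(\<Sum>k\<in>UNIV. \<bar>Hb x $ fst (k :: 'n \<times> 'n) $ snd k\<bar>^?N))"
  by (intro integrable_mult_right Bochner_Integration.integrable_sum iHN)
 have iSN: "integrable lborel (%x. S x^?N)"
 proof (rule Bochner_Integration.integrable_bound[OF iZ])
  show "AE x in lborel. norm (S x^?N) <= norm (real (card (UNIV :: ('n \<times> 'n) set))^?N*(\<Sum>k\<in>UNIV. \<bar>Hb x $ fst (k :: 'n \<times> 'n) $ snd k\<bar>^?N))"
  proof (intro always_eventually allI)
   fix x
   have "S x^?N <= real (card (UNIV :: ('n \<times> 'n) set))^?N*(\<Sum>k\<in>UNIV. \<bar>Hb x $ fst (k :: 'n \<times> 'n) $ snd k\<bar>^?N)"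
    unfolding S_def by (rule sum_power_le) auto
   thus "norm (S x^?N) <= norm (real (card (UNIV :: ('n \<times> 'n) set))^?N*(\<Sum>k\<in>UNIV. \<bar>Hb x $ fst (k :: 'n \<times> 'n) $ snd k\<bar>^?N))"
    using S0[of x] by simp
  qed
 qed measurable
 define IS where "IS = (LINT x|lborel. S x^?N)"
 have IS0: "0 <= IS" unfolding IS_def using S0 by (intro integral_nonneg_AE) auto
 \<comment> \<open>Admissible oscillation of the coefficients on the scale of the mollifier, small
   enough that the freezing error \<open>2^n*tau^n*IS\<close> is at most \<open>e\<close>.\<close>
 define tau where "tau = min 1 (e/(2^?N*(IS + 1)))"
 have tau: "0 < tau" "tau <= 1" using e IS0 by (auto simp: tau_def)
 have tauN: "2^?N*(tau^?N*IS) <= e"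
 proof -
  have "tau^?N <= tau^1" using tau by (intro power_decreasing) auto
  hence "tau^?N*IS <= tau*(IS + 1)" using tau IS0 by (intro mult_mono) auto
  also have "... <= e/(2^?N*(IS + 1))*(IS + 1)" using IS0 by (intro mult_right_mono) (auto simp: tau_def)
  finally have "2^?N*(tau^?N*IS) <= 2^?N*(e/(2^?N*(IS + 1))*(IS + 1))" by (rule mult_left_mono) simp
  moreover have "a*(e/(a*b)*b) = e" if "a ~= 0" "b ~= 0" for a b :: real using that by simp
  ultimately show ?thesis using IS0 by (metis add_nonneg_pos less_irrefl zero_less_numeral zero_less_one zero_less_power)
 qed
 have mdif: "\<bar>mdot (B x) (Hb y)\<bar> <= \<bar>mdot (B y) (Hb y)\<bar> + norm (B y - B x)*S y" for x y
 proof -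
  have "\<bar>mdot (B x) (Hb y) - mdot (B y) (Hb y)\<bar> = \<bar>\<Sum>k\<in>UNIV. (B x - B y) $ fst k $ snd k*Hb y $ fst k $ snd k\<bar>"
   unfolding mdot_def sum_subtractf[symmetric] UNIV_Times_UNIV[symmetric] sum.cartesian_product by (simp add: left_diff_distrib case_prod_beta)
  also have "... <= (\<Sum>k\<in>UNIV. norm (B y - B x)*\<bar>Hb y $ fst k $ snd k\<bar>)"
  proof (intro sum_abs[THEN order_trans] sum_mono)
   fix k :: "'n \<times> 'n"
   have "\<bar>(B x - B y) $ fst k $ snd k\<bar> <= norm ((B x - B y) $ fst k)" by (rule component_le_norm_cart)
   also have "... <= norm (B x - B y)" by (rule Finite_Cartesian_Product.norm_nth_le)
   finally show "\<bar>(B x - B y) $ fst k $ snd k*Hb y $ fst k $ snd k\<bar> <= norm (B y - B x)*\<bar>Hb y $ fst k $ snd k\<bar>"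
    unfolding abs_mult norm_minus_commute[of "B y"] by (intro mult_right_mono) auto
  qed
  finally show ?thesis by (simp add: S_def sum_distrib_left)
 qed
 have uc: "uniformly_continuous_on K' u" "uniformly_continuous_on K' B"
  using continuous_on_subset[OF cu K'Om] continuous_on_subset[OF cB K'Om] by (auto intro: compact_uniformly_continuous cK')
 obtain r1 where r1: "0 < r1" "!!x y. x \<in> K' ==> y \<in> K' ==> dist y x < r1 ==> dist (u y) (u x) < e"
  using uc(1)[unfolded uniformly_continuous_on_def, rule_format, OF e] by blast
 obtain r2 where r2: "0 < r2" "!!x y. x \<in> K' ==> y \<in> K' ==> dist y x < r2 ==> dist (B y) (B x) < tau"
  using uc(2)[unfolded uniformly_continuous_on_def, rule_format, OF tau(1)] by blast
 note r12 = r1(1) r2(1) r1(2) r2(2)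
 define si where "si = min rho1 (min r1 r2)"
 have si: "0 < si" "si <= rho1" "si <= r1" "si <= r2" using r12 rho1 by (auto simp: si_def)
 obtain d :: "'n => real => real" and r J where d: "ALL i n. diffn n (d i)" "0 < r" "ALL i t. t \<notin> {-r..r} --> d i t = 0"
  and sup: "!!m x. prodfun d m x ~= 0 ==> norm x < si"
  and p0: "!!x. 0 <= prodfun d (%_. 0) x" "!!x. prodfun d (%_. 0) x <= 1" "!!x. prodfun d (%_. 0) (- x) = prodfun d (%_. 0) x"
   "integrable lborel (prodfun d (%_. 0))" and J: "(LINT x|lborel. prodfun d (%_. 0) x) = J" "0 < J"
  and test: "!!x. test_function (ball x si) (%y. prodfun d (%_. 0) (x - y))" by (rule mollifier_exists[OF si(1), where 'n='n]) (rule that; assumption)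
 let ?psi = "prodfun d (%_. 0)"
 have mpsi[measurable]: "prodfun d m \<in> borel_measurable borel" for m by (intro borel_measurable_continuous_onI prodfun_continuous d(1))
 have ip: "integrable lborel (%y. p y*?psi (x - y))" if p: "integrable lborel p" for p x
 proof (rule Bochner_Integration.integrable_bound[OF p])
  show "(%y. p y*?psi (x - y)) \<in> borel_measurable lborel" using borel_measurable_integrable[OF p] by measurable
  show "AE y in lborel. norm (p y*?psi (x - y)) <= norm (p y)" using p0(1,2) by (intro always_eventually allI) (simp add: abs_mult mult_left_le)
 qed
 note shift = integral_reflected_shift[OF p0(3,4), unfolded J(1)]
 define U where "U x = indicat_real K' x *\<^sub>R u x" for x
 have iU: "integrable lborel U" unfolding U_def by (intro borel_integrable_compact cK' continuous_on_subset[OF cu K'Om])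
 have mU[measurable]: "U \<in> borel_measurable borel" using borel_measurable_integrable[OF iU] by simp
 define W where "W m x = (LINT y|lborel. U y*prodfun d m (x - y))" for m x
 have dW: "(W m has_derivative (%h. (\<chi> j. W (m(j := Suc (m j))) x) \<bullet> h)) (at x)" for m x
  unfolding W_def[abs_def] by (rule convolution_has_derivative[OF d(1,3) iU])
 define o1 :: "'n => 'n => nat" where "o1 j = (%_. 0)(j := Suc 0)" for j
 define v where "v x = (1/J)*W (%_. 0) x" for x
 define p where "p x = (\<chi> j. (1/J)*W (o1 j) x)" for x
 define M where "M x = (\<chi> i j. (1/J)*W ((o1 i)(j := Suc (o1 i j))) x)" for x
 have comm: "(o1 i)(j := Suc (o1 i j)) = (o1 j)(i := Suc (o1 j i))" for i j by (auto simp: o1_def fun_eq_iff)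
 have c2: "c2_on UNIV v p M" unfolding c2_on_def
 proof (intro conjI ballI open_UNIV)
  fix x
  show "(v has_derivative (%h. p x \<bullet> h)) (at x)" unfolding v_def[abs_def] by (rule has_derivative_eq_rhs[OF has_derivative_mult_right[OF dW]])
    (simp add: fun_eq_iff p_def o1_def inner_vec_def sum_distrib_left mult.assoc)
  show "transpose (M x) = M x" by (simp add: vec_eq_iff transpose_def M_def comm)
  show "(p has_derivative (%h. M x *v h)) (at x)" unfolding has_derivative_componentwise_within[of p]
  proof
   fix b :: "real^'n" assume "b \<in> Basis"
   then obtain i where b: "b = axis i 1" by (auto simp: Basis_vec_def)
   have "((%x. (1/J)*W (o1 i) x) has_derivative (%h. (1/J)*((\<chi> j. W ((o1 i)(j := Suc (o1 i j))) x) \<bullet> h))) (at x)"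
    by (intro has_derivative_mult_right dW)
   moreover have "(%x. p x \<bullet> b) = (%x. (1/J)*W (o1 i) x)" by (simp add: b inner_axis p_def)
   moreover have "(%h. (M x *v h) \<bullet> b) = (%h. (1/J)*((\<chi> j. W ((o1 i)(j := Suc (o1 i j))) x) \<bullet> h))"
    by (rule ext) (unfold b inner_axis, simp add: M_def matrix_vector_mult_def inner_vec_def sum_distrib_left sum_divide_distrib)
   ultimately show "((%x. p x \<bullet> b) has_derivative (%h. (M x *v h) \<bullet> b)) (at x)" by (simp only:)
  qed
 next
  have "continuous_on UNIV (W m)" for m by (rule continuous_at_imp_continuous_on) (blast intro: has_derivative_continuous[OF dW])
  thus "continuous_on UNIV M" unfolding M_def[abs_def] by (intro continuous_intros)
 qed
 have close: "\<bar>v x - u x\<bar> <= e" if x: "x \<in> K" for x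
 proof -
  have "J*(v x - u x) = W (%_. 0) x - u x*J" using J(2) by (simp add: v_def algebra_simps)
  also have "... = (LINT y|lborel. U y*?psi (x - y) - u x*?psi (x - y))" by (simp add: W_def Bochner_Integration.integral_diff ip[OF iU] shift)
  finally have "J*\<bar>v x - u x\<bar> = \<bar>LINT y|lborel. U y*?psi (x - y) - u x*?psi (x - y)\<bar>" using J(2) by (metis abs_mult abs_of_pos)
  also have "... <= (LINT y|lborel. e*?psi (x - y))"
  proof (rule integral_abs_bound[THEN order_trans], rule integral_mono)
   show "integrable lborel (%y. \<bar>U y*?psi (x - y) - u x*?psi (x - y)\<bar>)"
    by (intro integrable_abs Bochner_Integration.integrable_diff ip[OF iU] integrable_mult_right shift)
   show "integrable lborel (%y. e*?psi (x - y))" by (intro integrable_mult_right shift)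
   fix y
   show "\<bar>U y*?psi (x - y) - u x*?psi (x - y)\<bar> <= e*?psi (x - y)"
   proof (cases "?psi (x - y) = 0")
    case False
    hence "dist x y < si" using sup[of "%_. 0" "x - y"] by (simp add: dist_norm)
    hence "y \<in> K'" "\<bar>u y - u x\<bar> < e" using near[OF x, of y] si r12(3)[of x y] x KK' by (auto simp: dist_commute dist_real_def)
    hence "\<bar>U y - u x\<bar>*?psi (x - y) <= e*?psi (x - y)" using p0(1) by (intro mult_right_mono) (auto simp: U_def)
    thus ?thesis using p0(1)[of "x - y"] by (simp add: abs_mult left_diff_distrib[symmetric])
   qed simp
  qed
  also have "... = J*e" by (simp add: shift)
  finally show ?thesis using J(2) by simp
 qed
 \<comment> \<open>The reflected mollifier is a test function, so the weak derivative moves both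
   derivatives from the mollifier to \<open>u\<close>; the two signs of the reflection
   cancel.\<close>
 have MH: "J*M x $ i $ j = (LINT y|lborel. Hb y $ i $ j*?psi (x - y))" if x: "x \<in> K" for x i j
 proof -
  let ?m = "(o1 i)(j := Suc (o1 i j))"
  have ball: "ball x si \<subseteq> K'" using near[OF x] si by auto
  have t: "test_function Om (%y. ?psi (x - y))" using test[of x] ball K'Om unfolding test_function_def by blast
  have z: "prodfun d m (x - y) = 0" if "y \<notin> K'" for m y using that ball sup[of m "x - y"] unfolding subset_iff mem_ball dist_norm by blast
  have ip2: "iter_pderiv [i, j] (%y. ?psi (x - y)) = (%y. prodfun d ?m (x - y))"
   using pderiv_dir_prodfun_reflected[OF d(1), of j 1 "%_. 0" x] pderiv_dir_prodfun_reflected[OF d(1), of i "-1" "o1 j" x]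
   unfolding comm by (simp add: iter_pderiv_def o1_def)
  have "integral\<^sup>L (lebesgue_on Om) (%y. u y*prodfun d ?m (x - y)) = integral\<^sup>L (lebesgue_on Om) (%y. H y $ i $ j*?psi (x - y))"
  proof -
   have "integral\<^sup>L (lebesgue_on Om) (%y. u y*iter_pderiv [i, j] (%y. ?psi (x - y)) y) =
    (-1)^length [i, j]*integral\<^sup>L (lebesgue_on Om) (%y. H y $ i $ j*?psi (x - y))" using wd[of i j] t unfolding weak_deriv_def by blast
   thus ?thesis unfolding ip2 by simp
  qed
  also have "integral\<^sup>L (lebesgue_on Om) (%y. u y*prodfun d ?m (x - y)) = (LINT y|lebesgue. (indicat_real K' y*u y)*prodfun d ?m (x - y))"
   by (rule integral_lebesgue_on_supported[OF OmL K'Om z])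
  also have "... = (LINT y|lebesgue. U y*prodfun d ?m (x - y))" by (simp add: U_def)
  also have "... = W ?m x" unfolding W_def by (rule integral_completion) measurable
  also have "integral\<^sup>L (lebesgue_on Om) (%y. H y $ i $ j*?psi (x - y)) = (LINT y|lebesgue. (indicat_real K' y*H y $ i $ j)*?psi (x - y))"
   by (rule integral_lebesgue_on_supported[OF OmL K'Om z])
  also have "... = (LINT y|lebesgue. Hb y $ i $ j*?psi (x - y))"
  proof (rule integral_cong_AE)
   have 1: "(%y. ?psi (x - y)) \<in> borel_measurable lebesgue" by (rule measurable_completion) measurable
   show "(%y. (indicat_real K' y*H y $ i $ j)*?psi (x - y)) \<in> borel_measurable lebesgue"
    by (rule borel_measurable_times[OF borel_measurable_integrable[OF iHK] 1])
   show "(%y. Hb y $ i $ j*?psi (x - y)) \<in> borel_measurable lebesgue" by (rule measurable_completion) measurable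
   show "AE y in lebesgue. (indicat_real K' y*H y $ i $ j)*?psi (x - y) = Hb y $ i $ j*?psi (x - y)" using aeH[of i j] by eventually_elim simp
  qed
  also have "... = (LINT y|lborel. Hb y $ i $ j*?psi (x - y))" by (rule integral_completion) measurable
  finally show ?thesis using J(2) by (simp add: M_def)
 qed
 define fb where "fb y = \<bar>mdot (B y) (Hb y)\<bar>" for y
 have fbe: "fb y = \<bar>\<Sum>i\<in>UNIV. \<Sum>j\<in>UNIV. (indicat_real K' y *\<^sub>R B y $ i $ j)*Hb y $ i $ j\<bar>" for y
  unfolding fb_def mdot_def using out[of y] by (cases "y \<in> K'") auto
 have mB: "(%y. indicat_real K' y *\<^sub>R B y $ i $ j) \<in> borel_measurable borel" for i j using continuous_on_subset[OF cB K'Om] mK'(2)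
  by (intro borel_measurable_continuous_on_indicator) (auto intro!: continuous_intros)
 have mfb[measurable]: "fb \<in> borel_measurable borel" unfolding fbe[abs_def] using mB by measurable
 have aef: "AE y in lebesgue. fb y^?N = indicat_real K' y *\<^sub>R \<bar>f y\<bar>^?N"
 proof -
  have 1: "AE y in lebesgue. y \<in> Om --> mdot (B y) (H y) = f y" using ae OmL by (subst (asm) AE_restrict_space_iff) auto
  have "AE y in lebesgue. ALL i j. indicat_real K' y*H y $ i $ j = Hb y $ i $ j" using aeH by (simp add: AE_all_countable)
  with 1 show ?thesis
  proof eventually_elim
   case (elim y)
   show ?case
   proof (cases "y \<in> K'")
    case True
    hence "Hb y = H y" using elim(2) by (simp add: vec_eq_iff)
    thus ?thesis using elim(1) True K'Om by (auto simp: fb_def)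
   next
    case False
    hence "fb y = 0" by (simp add: fbe)
    thus ?thesis using False by simp
   qed
  qed
 qed
 have ifOm: "integrable lebesgue (%x. indicat_real Om x *\<^sub>R \<bar>f x\<bar>^?N)"
  using f OmL unfolding Lp_space_def by (subst (asm) integrable_restrict_space) auto
 have ifK: "integrable lebesgue (%x. indicat_real K' x *\<^sub>R \<bar>f x\<bar>^?N)"
 proof -
  have "integrable lebesgue (%x. indicat_real K' x *\<^sub>R (indicat_real Om x *\<^sub>R \<bar>f x\<bar>^?N))"
   by (rule integrable_mult_indicator[OF mK'(1) ifOm])
  thus ?thesis by (rule back_subst[of "integrable lebesgue"]) (use K'Om in \<open>auto simp: fun_eq_iff indicator_def\<close>)
 qed
 have fbl: "integrable lebesgue (%y. fb y^?N)"
  by (rule integrable_cong_AE_imp[OF ifK]) (rule measurable_completion, measurable, use aef in eventually_elim, simp)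
 hence ifb: "integrable lborel (%y. fb y^?N)" by (subst (asm) integrable_completion) measurable
 have fble: "(LINT y|lborel. fb y^?N) <= (LINT x|lebesgue_on Om. \<bar>f x\<bar>^?N)"
 proof -
  have "(LINT y|lborel. fb y^?N) = (LINT y|lebesgue. fb y^?N)" by (rule integral_completion[symmetric]) measurable
  also have "... = (LINT y|lebesgue. indicat_real K' y *\<^sub>R \<bar>f y\<bar>^?N)" by (rule integral_cong_AE) (use fbl ifK aef in auto)
  also have "... <= (LINT y|lebesgue. indicat_real Om y *\<^sub>R \<bar>f y\<bar>^?N)"
   using K'Om by (intro integral_mono ifK ifOm) (auto simp: indicator_def)
  also have "... = (LINT x|lebesgue_on Om. \<bar>f x\<bar>^?N)" using OmL by (intro integral_restrict_space[symmetric]) auto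
  finally show ?thesis .
 qed
 obtain CB where CB: "!!y. y \<in> K' ==> norm (B y) <= CB"
  using compact_imp_bounded[OF compact_continuous_image[OF continuous_on_subset[OF cB K'Om] cK']] by (auto simp: bounded_iff)
 have fbS: "fb y <= CB*S y" for y
 proof (cases "y \<in> K'")
  case True
  have "fb y <= norm (B y)*S y"
  proof -
   have "\<bar>mdot (B y) (Hb y)\<bar> <= (\<Sum>i\<in>UNIV. \<Sum>j\<in>UNIV. norm (B y)*\<bar>Hb y $ i $ j\<bar>)" unfolding mdot_def
   proof (intro sum_abs[THEN order_trans] sum_mono)
    fix i j
    have "\<bar>B y $ i $ j\<bar> <= norm (B y)" by (rule order_trans[OF component_le_norm_cart Finite_Cartesian_Product.norm_nth_le])
    thus "\<bar>B y $ i $ j*Hb y $ i $ j\<bar> <= norm (B y)*\<bar>Hb y $ i $ j\<bar>" unfolding abs_mult by (intro mult_right_mono) auto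
   qed
   thus ?thesis unfolding fb_def S_def UNIV_Times_UNIV[symmetric] by (simp add: sum.cartesian_product case_prod_beta sum_distrib_left)
  qed
  also have "... <= CB*S y" using CB[OF True] S0 by (intro mult_right_mono) auto
  finally show ?thesis .
 qed (simp add: fbe S_def out)
 have ifb1: "integrable lborel fb"
 proof (rule Bochner_Integration.integrable_bound[OF integrable_mult_right[OF iS, of CB]])
  show "AE y in lborel. norm (fb y) <= norm (CB*S y)" using fbS by (intro always_eventually allI) (auto simp: fb_def intro: order_trans abs_ge_self)
 qed measurable
 \<comment> \<open>Bound for the operator with frozen coefficients: the true source plus the
   freezing error. Splitting its power costs \<open>2^n\<close>, the factor in the
   conclusion.\<close>
 define q where "q y = fb y + tau*S y" for y
 have q0: "0 <= q y" for y using S0[of y] tau by (simp add: q_def fb_def)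
 have qN: "q y^?N <= 2^?N*(fb y^?N + tau^?N*S y^?N)" for y
  using sum_power_le[of "{0 :: nat, 1}" "%k. if k = 0 then fb y else tau*S y" ?N] S0[of y] tau by (simp add: q_def fb_def power_mult_distrib)
 have iq: "integrable lborel q" unfolding q_def by (intro Bochner_Integration.integrable_add integrable_mult_right ifb1 iS)
 have iqb: "integrable lborel (%y. 2^?N*(fb y^?N + tau^?N*S y^?N))" by (intro Bochner_Integration.integrable_add integrable_mult_right ifb iSN)
 have iqN: "integrable lborel (%y. q y^?N)"
 proof (rule Bochner_Integration.integrable_bound[OF iqb])
  show "(%y. q y^?N) \<in> borel_measurable lborel" unfolding q_def by measurable
  show "AE y in lborel. norm (q y^?N) <= norm (2^?N*(fb y^?N + tau^?N*S y^?N))"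
  proof (intro always_eventually allI)
   fix y
   have "norm (q y^?N) = q y^?N" using q0[of y] by simp
   thus "norm (q y^?N) <= norm (2^?N*(fb y^?N + tau^?N*S y^?N))" using qN[of y] by (simp only: real_norm_def)
  qed
 qed
 have cF: "continuous_on K (%x. \<bar>mdot (B x) (M x)\<bar>)"
  unfolding mdot_def using continuous_on_subset[OF cB K(2)] continuous_on_subset[OF c2_onD(2)[OF c2], of K] by (intro continuous_intros) auto
 have "integral K (%x. \<bar>mdot (B x) (M x)\<bar>^?N) <= (LINT y|lborel. q y^?N)"
 proof (rule convolution_power_bound[OF q0 iq iqN p0 prodfun_continuous[OF d(1)] J(1)[symmetric] J(2) K(1) cF], intro conjI)
  fix x assume x: "x \<in> K"
  have "J*mdot (B x) (M x) = (LINT y|lborel. mdot (B x) (Hb y)*?psi (x - y))"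
  proof -
   have "J*mdot (B x) (M x) = (\<Sum>i\<in>UNIV. \<Sum>j\<in>UNIV. B x $ i $ j*(J*M x $ i $ j))" by (simp add: mdot_def sum_distrib_left mult_ac)
   also have "... = (LINT y|lborel. (\<Sum>i\<in>UNIV. \<Sum>j\<in>UNIV. B x $ i $ j*(Hb y $ i $ j*?psi (x - y))))"
    by (simp add: MH[OF x] Bochner_Integration.integral_sum Bochner_Integration.integrable_sum ip[OF iH])
   finally show ?thesis by (simp add: mdot_def sum_distrib_right mult.assoc)
  qed
  hence "J*\<bar>mdot (B x) (M x)\<bar> = \<bar>LINT y|lborel. mdot (B x) (Hb y)*?psi (x - y)\<bar>" using J(2) by (metis abs_mult abs_of_pos)
  also have "... <= (LINT y|lborel. q y*?psi (x - y))"
  proof (rule integral_abs_bound[THEN order_trans], rule integral_mono)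
   have "integrable lborel (%y. mdot (B x) (Hb y)*?psi (x - y))"
    unfolding mdot_def by (intro ip Bochner_Integration.integrable_sum integrable_mult_right iH)
   thus "integrable lborel (%y. \<bar>mdot (B x) (Hb y)*?psi (x - y)\<bar>)" by (rule integrable_abs)
   show "integrable lborel (%y. q y*?psi (x - y))" by (rule ip[OF iq])
   fix y
   show "\<bar>mdot (B x) (Hb y)*?psi (x - y)\<bar> <= q y*?psi (x - y)"
   proof (cases "?psi (x - y) = 0")
    case False
    hence ds: "dist x y < si" using sup[of "%_. 0" "x - y"] by (simp add: dist_norm)
    hence "y \<in> K'" using near[OF x, of y] si by auto
    hence "norm (B y - B x) <= tau" using r12(4)[of x y] x KK' ds si by (auto simp: dist_norm norm_minus_commute)
    hence "norm (B y - B x)*S y <= tau*S y" using S0 by (intro mult_right_mono) auto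
    hence "\<bar>mdot (B x) (Hb y)\<bar> <= q y" using mdif[of x y] by (simp add: q_def fb_def)
    hence "\<bar>mdot (B x) (Hb y)\<bar>*?psi (x - y) <= q y*?psi (x - y)" using p0(1) by (intro mult_right_mono) auto
    thus ?thesis using p0(1)[of "x - y"] by (simp add: abs_mult)
   qed simp
  qed
  finally show "J*\<bar>mdot (B x) (M x)\<bar> <= (LINT y|lborel. q y*?psi (x - y))" .
 qed simp
 also have "... <= (LINT y|lborel. 2^?N*(fb y^?N + tau^?N*S y^?N))" by (intro integral_mono iqN iqb qN)
 also have "... = 2^?N*(LINT y|lborel. fb y^?N) + 2^?N*(tau^?N*IS)" by (simp add: ifb iSN IS_def Bochner_Integration.integral_add algebra_simps)
 also have "... <= 2^?N*(LINT x|lebesgue_on Om. \<bar>f x\<bar>^?N) + e" using fble tauN by (intro add_mono mult_left_mono) auto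
 finally show ?thesis using c2 close by blast
qed

section \<open>Barriers and slopes at a boundary point\<close>

lemma quadratic_comparison:
 fixes S :: "(real^'n::finite) set"
 assumes M: "MA l L S phi g A" and T: "compact T" "continuous_on T phi" and U: "open U" "U \<subseteq> S" "U \<subseteq> T"
  and Q: "psd Q" "L < det (2 *\<^sub>R Q)"
  and b: "!!y. y \<in> T ==> y \<notin> U ==> a + b \<bullet> y + (y - c) \<bullet> (Q *v (y - c)) <= phi y" and y: "y \<in> T"
 shows "a + b \<bullet> y + (y - c) \<bullet> (Q *v (y - c)) <= phi y"
proof (rule ccontr)
 let ?q = "%y. a + b \<bullet> y + (y - c) \<bullet> (Q *v (y - c))"
 assume n: "~ ?thesis"
 have cQ: "c2_on UNIV ?q (%y. b + 2 *\<^sub>R (Q *v (y - c))) (%y. 0 + 2 *\<^sub>R Q)"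
  using Q(1) by (intro c2_on_add c2_on_affine c2_on_quadratic) (auto simp: psd_def)
 have cT: "continuous_on T (%y. ?q y - phi y)" by (intro continuous_on_diff T continuous_on_subset[OF c2_on_continuous(1)[OF cQ]]) auto
 have "T ~= {}" using y by auto
 from continuous_attains_sup[OF T(1) this cT]
 obtain z where z: "z \<in> T" "!!y. y \<in> T ==> ?q y - phi y <= ?q z - phi z" by blast
 \<comment> \<open>A positive maximum of polynomial minus potential can only lie in
   \<open>U\<close>, where it orders the Hessians, against
   \<open>det (2 Q) > L >= det A\<close>.\<close>
 have zU: "z \<in> U" using b[OF z(1)] n z(2)[OF y] by force
 hence zS: "z \<in> S" using U by auto
 have c: "c2_on S (%y. ?q y - phi y) (%y. b + 2 *\<^sub>R (Q *v (y - c)) - g y) (%y. 0 + 2 *\<^sub>R Q - A y)"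
  using MA_D(1,4)[OF M] by (intro c2_on_diff c2_on_subset[OF cQ]) auto
 have mx: "!!y. y \<in> U \<inter> S ==> ?q y - phi y <= ?q z - phi z" using z(2) U(3) by blast
 have "x \<bullet> ((2 *\<^sub>R Q) *v x) <= x \<bullet> (A z *v x)" for x
  using local_max_test(2)[OF c zS U(1) zU mx, of x] by (simp add: matrix_vector_mult_diff_rdistrib inner_diff_right)
 moreover have sA: "psd (A z)" "0 < det (A z)" using MA_D(8,9)[OF M zS] by auto
 moreover have Q2: "psd (2 *\<^sub>R Q)" using Q(1) by (auto simp: psd_def transpose_scalar scaleR_matrix_vector_assoc[symmetric])
 ultimately have "psd (A z - 2 *\<^sub>R Q)"
  unfolding psd_def by (auto simp: matrix_vector_mult_diff_rdistrib inner_diff_right transpose_def vec_eq_iff)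
 from psd_det_mono[OF sA Q2 this] show False using MA_D(7)[OF M zS] Q(2) by linarith
qed

text \<open>Everything refers to one frontier point \<open>x1\<close>; \<open>nu\<close> is the axis
  of the interior touching ball, and convexity puts the domain on its positive side.\<close>

locale boundary_point =
 fixes rho l L :: real and S :: "(real^'n::finite) set" and phi g A x1 nu p
 assumes rho: "0 < rho" and MA: "MA l L S phi g A" and cphi: "continuous_on (closure S) phi" "convex_on (closure S) phi"
  and S: "S \<subseteq> ball 0 (1/rho)" and x1: "x1 \<in> frontier S"
  and nu: "norm nu = 1" "ball (x1 + rho *\<^sub>R nu) rho \<subseteq> S" "!!x. x \<in> S ==> 0 <= nu \<bullet> (x - x1)"
  and p: "boundary_gradient S phi x1 p"
  and quad: "!!x. x \<in> frontier S ==> rho*(norm (x - x1))^2 <= phi x - phi x1 - p \<bullet> (x - x1)"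
   "!!x. x \<in> frontier S ==> phi x - phi x1 - p \<bullet> (x - x1) <= inverse rho*(norm (x - x1))^2"
begin

text \<open>\<open>s\<close> is the distance to the tangent hyperplane at \<open>x1\<close>, \<open>v\<close> the height of the potential above
 its tangent plane there.\<close>

definition "s y = nu \<bullet> (y - x1)"
definition "v y = phi y - phi x1 - p \<bullet> (y - x1)"

lemma basics:
 shows "open S" "convex S" "0 < l" "l <= L" "S \<subseteq> closure S" "compact (closure S)" "x1 \<in> closure S" "S ~= {}"
  "!!x. x \<in> closure S ==> norm x <= 1/rho" "nu \<bullet> nu = 1"
proof -
 show o: "open S" "convex S" "0 < l" using MA_D[OF MA] by auto
 show "S \<subseteq> closure S" by (rule closure_subset)
 have "bounded S" using S bounded_ball bounded_subset by blast
 thus "compact (closure S)" by simp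
 show "x1 \<in> closure S" using x1 by (simp add: frontier_def)
 have "x1 + rho *\<^sub>R nu \<in> S" using nu(2) rho by (auto simp: subset_iff)
 thus "S ~= {}" "l <= L" using MA_D(6,7)[OF MA] order_trans by blast+
 show "norm x <= 1/rho" if "x \<in> closure S" for x using closure_mono[OF order_trans[OF S ball_subset_cball]] that by (auto simp: subset_iff)
 show "nu \<bullet> nu = 1" using nu(1) by (simp add: norm_eq_1)
qed

lemma norm_le: "x \<in> closure S ==> y \<in> closure S ==> norm (x - y) <= 2/rho"
 using basics(9)[of x] basics(9)[of y] norm_triangle_ineq4[of x y] by simp

lemma s_bounds:
 shows "!!x. x \<in> closure S ==> 0 <= s x" "!!x. x \<in> S ==> 0 < s x" "\<bar>s x\<bar> <= norm (x - x1)"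
  "!!x. x \<in> frontier S ==> 2*rho * s x <= (norm (x - x1))^2"
  "!!x d. x \<in> S ==> ball x d \<subseteq> S ==> d <= s x"
proof -
 show cl: "0 <= s x" if "x \<in> closure S" for x
 proof (rule continuous_ge_on_closure[OF _ that])
  show "continuous_on (closure S) s" unfolding s_def by (intro continuous_intros)
 qed (auto simp: s_def nu(3))
 show "\<bar>s x\<bar> <= norm (x - x1)" using Cauchy_Schwarz_ineq2[of nu "x - x1"] nu(1) by (simp add: s_def)
 show bl: "d <= s x" if x: "x \<in> S" "ball x d \<subseteq> S" for x d
 proof (rule dense_ge)
  fix e assume "s x < e"
  hence "~ e < d"
  proof (intro notI)
   assume "s x < e" "e < d"
   hence "x - e *\<^sub>R nu \<in> S" using x cl[of x] basics(5) nu(1) by (auto simp: subset_iff dist_norm)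
   hence "0 <= s (x - e *\<^sub>R nu)" using nu(3) by (simp add: s_def)
   thus False using \<open>s x < e\<close> basics(10) by (simp add: s_def inner_diff_right)
  qed
  thus "d <= e" by simp
 qed
 show "0 < s x" if "x \<in> S" for x using bl[OF that] open_contains_ball[of S] basics(1) that by (meson less_le_trans)
 \<comment> \<open>A frontier point lies outside the touching ball; expanding its squared distance
   from the centre gives the inequality.\<close>
 show "2*rho * s x <= (norm (x - x1))^2" if "x \<in> frontier S" for x
 proof -
  have "x \<notin> ball (x1 + rho *\<^sub>R nu) rho" using that nu(2) basics(1) by (auto simp: frontier_def interior_open)
  hence "rho^2 <= (norm ((x - x1) - rho *\<^sub>R nu))^2" using rho by (intro power_mono) (auto simp: dist_norm norm_minus_commute algebra_simps)
  moreover have "(norm ((x - x1) - rho *\<^sub>R nu))^2 = (norm (x - x1))^2 - 2*rho * s x + rho^2"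
   unfolding power2_norm_eq_inner s_def inner_diff_left[of "x - x1"] inner_diff_right[of _ "x - x1"]
   using basics(10) by (simp add: inner_commute power2_eq_square)
  ultimately show ?thesis by simp
 qed
qed

lemma v_bounds:
 shows "!!x. x \<in> closure S ==> 0 <= v x" "!!x. x \<in> closure S ==> v x <= 4/rho^3"
  "convex_on (closure S) v" "continuous_on (closure S) v" "v x1 = 0"
  "!!x. x \<in> frontier S ==> rho*(norm (x - x1))^2 <= v x" "!!x. x \<in> frontier S ==> v x <= (norm (x - x1))^2/rho"
proof -
 show "0 <= v x" if "x \<in> closure S" for x using p that unfolding boundary_gradient_def supporting_slope_def v_def by force
 have "convex_on (closure S) (%x. phi x + (- phi x1 - p \<bullet> (x - x1)))" by (intro convex_on_add cphi convex_onI)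
   (use convex_closure[OF basics(2)] in \<open>auto simp: inner_diff_right inner_add_right algebra_simps\<close>)
 thus cv: "convex_on (closure S) v" unfolding v_def by (simp add: algebra_simps)
 show "continuous_on (closure S) v" unfolding v_def by (intro continuous_intros cphi)
 show "v x1 = 0" by (simp add: v_def)
 show q: "v x <= (norm (x - x1))^2/rho" "rho*(norm (x - x1))^2 <= v x" if "x \<in> frontier S" for x
  using quad[OF that] by (auto simp: v_def field_simps)
 have "v x <= 4/rho^3" if "x \<in> frontier S" for x
 proof -
  have "(norm (x - x1))^2 <= (2/rho)^2" using that x1 by (intro power_mono norm_le) (auto simp: frontier_def)
  hence "v x <= (2/rho)^2/rho" using q(1)[OF that] rho by (meson divide_right_mono less_imp_le order_trans)
  thus ?thesis by (simp add: power2_eq_square power3_eq_cube)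
 qed
 hence f: "v x <= 4/rho^3" if "x \<in> frontier (closure S)" for x using that interior_mono[OF closure_subset[of S]] by (intro \<open>!!x. x \<in> frontier S ==> v x <= 4 / rho ^ 3\<close>) (auto simp: frontier_def)
 \<comment> \<open>The closed domain is the convex hull of its frontier, so the bound on the
   frontier extends to it by convexity of \<open>v\<close>.\<close>
 have h: "closure S = convex hull frontier (closure S)" by (rule Krein_Milman_frontier[OF convex_closure[OF basics(2)] basics(6)])
 show "v x <= 4/rho^3" if "x \<in> closure S" for x using convex_on_convex_hull_bound[of "frontier (closure S)" v "4/rho^3"] cv f that h by auto
qed

lemma frontier_below:
 assumes y: "y \<in> S"
 obtains k where "0 <= k" "k <= s y" "y - k *\<^sub>R nu \<in> frontier S"
proof -
 have "y - s y *\<^sub>R nu \<notin> S" using s_bounds(2)[of "y - s y *\<^sub>R nu"] basics(10) by (auto simp: s_def inner_diff_right)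
 hence "closed_segment y (y - s y *\<^sub>R nu) \<inter> frontier S ~= {}" using y by (intro connected_Int_frontier) auto
 then obtain u where "0 <= u" "u <= 1" "(1 - u) *\<^sub>R y + u *\<^sub>R (y - s y *\<^sub>R nu) \<in> frontier S" by (auto simp: closed_segment_def)
 moreover have "(1 - u) *\<^sub>R y + u *\<^sub>R (y - s y *\<^sub>R nu) = y - (u * s y) *\<^sub>R nu" by (simp add: algebra_simps)
 ultimately show thesis using s_bounds(2)[OF y] by (intro that[of "u * s y"]) (auto simp: mult_left_le_one_le)
qed

lemma tangential_norm:
 assumes "f \<bullet> nu = 0"
 shows "(norm (f + k *\<^sub>R nu))^2 = (norm f)^2 + k^2" unfolding power2_norm_eq_inner using assms basics(10)
 by (simp add: inner_add_left inner_add_right inner_commute) (simp add: power2_eq_square)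

lemma tangential_decomposition:
 obtains f where "f \<bullet> nu = 0" "y - x1 = f + s y *\<^sub>R nu" "norm f <= norm (y - x1)"
proof -
 define f where "f = y - x1 - s y *\<^sub>R nu"
 have e: "f + s y *\<^sub>R nu = y - x1" by (simp add: f_def)
 have o: "f \<bullet> nu = 0" unfolding f_def by (subst inner_commute, subst inner_diff_right) (simp add: s_def basics(10))
 have "(norm f)^2 <= (norm (y - x1))^2" using tangential_norm[OF o, of "s y"] unfolding e by simp
 hence "norm f <= norm (y - x1)" by (rule power2_le_imp_le) simp
 thus thesis using that[OF o e[symmetric]] by blast
qed

text \<open>\<open>N\<close> is chosen so that the determinant of the doubled matrix is
  \<open>(2*de)^n + 2*L\<close>. A small tangential curvature \<open>de\<close> thus has to be paid
  for by a large curvature \<open>N\<close> in the normal direction.\<close>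

lemma barrier_matrix:
 assumes "0 < de" "N = L/(2*de)^(CARD('n) - 1)"
 shows "psd (de *\<^sub>R mat 1 + N *\<^sub>R outer nu nu)" "L < det (2 *\<^sub>R (de *\<^sub>R mat 1 + N *\<^sub>R outer nu nu))"
  "(y - x1) \<bullet> ((de *\<^sub>R mat 1 + N *\<^sub>R outer nu nu) *v (y - x1)) = de*(norm (y - x1))^2 + N*(s y)^2"
proof -
 let ?Q = "de *\<^sub>R mat 1 + N *\<^sub>R outer nu nu"
 have "0 < N" using assms basics(3,4) by simp
 thus "psd ?Q" using assms by (intro psd_id_outer) auto
 have "2 *\<^sub>R ?Q = (2*de) *\<^sub>R mat 1 + outer ((2*N) *\<^sub>R nu) nu" by (simp add: scaleR_add_right vec_eq_iff outer_def)
 hence "det (2 *\<^sub>R ?Q) = (2*de)^(CARD('n) - 1)*(2*de) + 2*((2*de)^(CARD('n) - 1)*N)"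
  using det_id_plus_outer[of "2*de" "(2*N) *\<^sub>R nu" nu] assms(1) basics(10) by (simp add: distrib_left)
 moreover have "(2*de)^(CARD('n) - 1)*N = L" using assms by simp
 moreover have "0 < (2*de)^(CARD('n) - 1)*(2*de)" using assms by simp
 ultimately show "L < det (2 *\<^sub>R ?Q)" using basics(3,4) by linarith
 show "(y - x1) \<bullet> (?Q *v (y - x1)) = de*(norm (y - x1))^2 + N*(s y)^2" unfolding quad_id_outer by (simp add: s_def power2_norm_eq_inner)
qed

text \<open>Comparison with a quadratic barrier tilted by a multiple of \<open>s\<close>: on the
  frontier \<open>s <= 2/rho\<close> makes the tilt outweigh \<open>N*s^2\<close>, and the quadratic
  separation dominates the remaining term.\<close>

lemma quadratic_lower_bound: "x \<in> closure S ==> rho/2*(norm (x - x1))^2 + L/rho^(CARD('n) - 1)*(s x)^2 - 2*(L/rho^(CARD('n) - 1))/rho * s x <= v x"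
proof -
 assume x: "x \<in> closure S"
 define N where "N = L/rho^(CARD('n) - 1)"
 have N: "0 < N" using basics(3,4) rho by (simp add: N_def)
 let ?Q = "(rho/2) *\<^sub>R mat 1 + N *\<^sub>R outer nu nu"
 have q: "psd ?Q" "L < det (2 *\<^sub>R ?Q)" "(y - x1) \<bullet> (?Q *v (y - x1)) = rho/2*(norm (y - x1))^2 + N*(s y)^2" for y
  using barrier_matrix[of "rho/2" N] rho by (auto simp: N_def)
 have "(phi x1 - p \<bullet> x1 + 2*N/rho*(nu \<bullet> x1)) + (p - (2*N/rho) *\<^sub>R nu) \<bullet> x + (x - x1) \<bullet> (?Q *v (x - x1)) <= phi x"
 proof (rule quadratic_comparison[OF MA basics(6) cphi(1) basics(1) order_refl basics(5) q(1,2) _ x])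
  fix y assume y: "y \<in> closure S" "y \<notin> S"
  hence f: "y \<in> frontier S" using basics(1) by (simp add: frontier_def interior_open)
  have s0: "0 <= s y" "s y <= 2/rho" using s_bounds(1,3)[of y] y norm_le[OF y(1) basics(7)] by auto
  have "N*(s y)^2 <= N*(2/rho * s y)" using mult_right_mono[OF s0(2,1)] N by (intro mult_left_mono) (auto simp: power2_eq_square)
  moreover have "rho/2*(norm (y - x1))^2 <= rho*(norm (y - x1))^2" using rho by (intro mult_right_mono) auto
  ultimately show "(phi x1 - p \<bullet> x1 + 2*N/rho*(nu \<bullet> x1)) + (p - (2*N/rho) *\<^sub>R nu) \<bullet> y + (y - x1) \<bullet> (?Q *v (y - x1)) <= phi y"
   using v_bounds(6)[OF f] unfolding q(3) by (simp add: v_def s_def algebra_simps)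
 qed
 thus ?thesis unfolding q(3) unfolding N_def[symmetric] by (simp add: v_def s_def algebra_simps diff_divide_distrib)
qed

text \<open>On the normal line through \<open>y\<close>, convexity interpolates between the frontier
  point below \<open>y\<close>, where \<open>v\<close> is at most quadratic, and a point at height
  \<open>rho\<close> of the closed touching ball, where \<open>v\<close> is bounded.\<close>

lemma linear_upper_bound:
 assumes y: "y \<in> S" and sy: "s y <= rho/2" "norm (y - x1) <= rho"
 shows "v y <= (norm (y - x1))^2/rho + 4/rho^4 * s y"
proof -
 obtain f where f: "f \<bullet> nu = 0" "y - x1 = f + s y *\<^sub>R nu" "norm f <= norm (y - x1)" by (rule tangential_decomposition)
 obtain k where k: "0 <= k" "k <= s y" "y - k *\<^sub>R nu \<in> frontier S" using frontier_below[OF y] by blast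
 have f2: "y = x1 + f + s y *\<^sub>R nu" unfolding add.assoc f(2)[symmetric] by simp
 have a: "y - k *\<^sub>R nu = x1 + f + (s y - k) *\<^sub>R nu" by (subst f2) (simp add: scaleR_left_diff_distrib)
 have a2: "y - k *\<^sub>R nu - x1 = f + (s y - k) *\<^sub>R nu" unfolding a by simp
 have "(norm (y - k *\<^sub>R nu - x1))^2 <= (norm (y - x1))^2"
  unfolding a2 f(2) tangential_norm[OF f(1)] using k by (intro add_left_mono power_mono) auto
 hence va: "v (y - k *\<^sub>R nu) <= (norm (y - x1))^2/rho" using v_bounds(7)[OF k(3)] rho by (meson divide_right_mono less_imp_le order_trans)
 let ?t = "x1 + f + rho *\<^sub>R nu"
 have "?t \<in> cball (x1 + rho *\<^sub>R nu) rho" using f(3) sy(2) by (simp add: dist_norm)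
 hence t: "?t \<in> closure S" using closure_mono[OF nu(2)] rho by auto
 define \<mu> where "\<mu> = k/(rho - s y + k)"
 have den: "0 < rho - s y + k" using k sy(1) rho by linarith
 have \<mu>: "0 <= \<mu>" "\<mu> <= 1" using k den sy rho by (auto simp: \<mu>_def)
 have mu: "\<mu> <= s y/rho"
 proof -
  have "(s y - k)*(rho - s y) >= 0" using k sy rho by (intro mult_nonneg_nonneg) auto
  hence "k*rho <= s y*(rho - s y + k)" by (simp add: algebra_simps)
  thus ?thesis using den rho by (simp add: \<mu>_def divide_simps mult.commute)
 qed
 have "(s y - k) + \<mu>*(rho - s y + k) = s y" using den by (simp add: \<mu>_def)
 hence "(1 - \<mu>)*(s y - k) + \<mu>*rho = s y" by (simp add: algebra_simps)
 hence "(1 - \<mu>) *\<^sub>R ((s y - k) *\<^sub>R nu) + \<mu> *\<^sub>R (rho *\<^sub>R nu) = s y *\<^sub>R nu" by (simp flip: scaleR_add_left)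
 moreover have "(1 - \<mu>) *\<^sub>R (x1 + f + z) + \<mu> *\<^sub>R (x1 + f + w) = x1 + f + ((1 - \<mu>) *\<^sub>R z + \<mu> *\<^sub>R w)" for z w by (simp add: algebra_simps)
 ultimately have e: "(1 - \<mu>) *\<^sub>R (y - k *\<^sub>R nu) + \<mu> *\<^sub>R ?t = y" unfolding a using f2 by (simp only:)
 have "v y <= (1 - \<mu>) * v (y - k *\<^sub>R nu) + \<mu> * v ?t"
  using convex_onD[OF v_bounds(3) \<mu>, of "y - k *\<^sub>R nu" ?t] k(3) t unfolding e by (auto simp: frontier_def)
 also have "... <= 1*((norm (y - x1))^2/rho) + s y/rho*(4/rho^3)"
  using \<mu> mu va v_bounds(1,2) t k(3) rho by (intro add_mono mult_mono) (auto simp: frontier_def)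
 finally show ?thesis by (simp add: power_def numeral_eq_Suc mult.commute)
qed

lemma tangent_below:
 assumes x: "x \<in> S" and y: "y \<in> closure S"
 shows "v x + (g x - p) \<bullet> (y - x) <= v y"
proof -
 have "0 <= excess phi g x y"
 proof (rule continuous_ge_on_closure[OF _ y])
  show "continuous_on (closure S) (excess phi g x)" unfolding excess_def by (intro continuous_intros cphi)
 qed (use MA_D(10)[OF MA _ x] in auto)
 thus ?thesis by (simp add: excess_def v_def inner_diff_right inner_diff_left)
qed

lemma gradient_bound:
 assumes x: "x \<in> S" and d: "0 < d" "ball x d \<subseteq> S"
 shows "d*norm (g x - p) <= 4/rho^3"
proof -
 let ?b = "g x - p"
 have "cball x d \<subseteq> closure S" using closure_mono[OF d(2)] d(1) by simp
 hence c: "x + d *\<^sub>R sgn ?b \<in> closure S" using d(1) by (auto simp: subset_iff dist_norm norm_sgn)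
 have "?b \<bullet> sgn ?b = norm ?b" by (cases "?b = 0") (auto simp: sgn_div_norm dot_square_norm power2_eq_square)
 thus ?thesis using tangent_below[OF x c] v_bounds(1)[of x] v_bounds(2)[OF c] x basics(5) by auto
qed

text \<open>A cone with vertex \<open>x\<close> over a small disc near \<open>x1\<close> parallel to the tangent hyperplane contains a
 large simplex on which \<open>v\<close> does not exceed \<open>v x\<close>.\<close>

lemma distance_lower_bound:
 assumes x: "x \<in> S" and C: "C2 = 8/rho + 32/rho^5"
 shows "(s x)^2*C2 <= (16 + 16/l*(16*(real CARD('n))^2*C2)^CARD('n)) * v x"
proof -
 let ?n = "CARD('n)"
 let ?Y = "(16*(real ?n)^2*C2)^?n" let ?K = "16 + 16/l*?Y"
 have C2: "0 < C2" using rho by (simp add: C add_pos_pos)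
 have Y: "0 < ?Y" "0 < ?K" using C2 basics(3) by (auto intro: add_pos_pos)
 \<comment> \<open>Levels \<open>H\<close> have to be positive, which is not known of
   \<open>v x\<close>; at the end \<open>H\<close> is chosen between \<open>v x\<close> and the
   bound to be refuted.\<close>
 have main: "(s x)^2*C2 <= ?K*H" if H: "0 < H" "v x <= H" "H <= 4/rho^3" for H
 proof -
  \<comment> \<open>Chosen so that \<open>C2*t^2 = H\<close>: by \<open>linear_upper_bound\<close>
    then \<open>v <= H\<close> on the disc of radius \<open>2*t\<close> at height
    \<open>eta\<close>. The height \<open>eta = 4*t^2/rho\<close> is what places this disc in the
    touching ball.\<close>
  define t where "t = sqrt (H/C2)"
  have t2: "t^2 = H/C2" and t: "0 < t" using H C2 by (auto simp: t_def)
  have "8*H <= rho^2*(32/rho^5)" using H(3) rho by (simp add: power_def numeral_eq_Suc field_simps)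
  also have "... <= rho^2*C2" using rho by (intro mult_left_mono) (auto simp: C)
  finally have t8: "8*t^2 <= rho^2" unfolding t2 using C2 by (simp add: field_simps)
  have "4*t^2 < rho^2" using t8 zero_less_power[OF t, of 2] by linarith
  hence "(2*t)^2 < rho^2" by (simp add: power_mult_distrib)
  hence trho: "2*t < rho" by (rule power2_less_imp_less) (use rho in simp)
  define eta where "eta = 4*t^2/rho"
  have etarho: "eta*rho = 4*t^2" using rho by (simp add: eta_def)
  have "eta*rho < 2*t*rho" unfolding etarho using mult_strict_left_mono[OF trho, of "2*t"] t by (simp add: power2_eq_square)
  moreover have "eta*rho <= rho/2*rho" unfolding etarho using t8 by (simp add: power2_eq_square)
  moreover have "0 < eta" using t rho by (simp add: eta_def)
  ultimately have eta: "0 < eta" "eta < 2*t" "eta <= rho/2" using rho by auto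
  have near: "x1 + f + eta *\<^sub>R nu \<in> S & v (x1 + f + eta *\<^sub>R nu) <= H" if f: "f \<bullet> nu = 0" "norm f <= 2*t" for f
  proof -
   let ?y = "x1 + f + eta *\<^sub>R nu"
   have f2: "(norm f)^2 <= 4*t^2" using power_mono[OF f(2), of 2] by (simp add: power_mult_distrib)
   have eta2: "eta^2 < 4*t^2" using power_strict_mono[OF eta(2), of 2] eta by (simp add: power_mult_distrib)
   have "(norm (f + (eta - rho) *\<^sub>R nu))^2 < rho^2" unfolding tangential_norm[OF f(1)] using f2 eta2 rho by (simp add: power2_diff eta_def)
   hence "norm (f + (eta - rho) *\<^sub>R nu) < rho" by (rule power2_less_imp_less) (use rho in simp)
   moreover have "?y - (x1 + rho *\<^sub>R nu) = f + (eta - rho) *\<^sub>R nu" by (simp add: scaleR_left_diff_distrib)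
   ultimately have "?y \<in> ball (x1 + rho *\<^sub>R nu) rho" by (simp only: mem_ball dist_norm norm_minus_commute[of "x1 + rho *\<^sub>R nu"])
   hence yS: "?y \<in> S" using nu(2) by auto
   have sy: "s ?y = eta" using f(1) basics(10) by (simp add: s_def inner_add_right inner_commute)
   have r2: "(norm (?y - x1))^2 <= 8*t^2" using tangential_norm[OF f(1), of eta] f2 eta2 by (simp add: add.assoc)
   hence "norm (?y - x1) <= rho" by (rule power2_le_imp_le[OF order_trans[OF _ t8]]) (use rho in simp)
   from linear_upper_bound[OF yS _ this] sy eta have "v ?y <= (norm (?y - x1))^2/rho + 4/rho^4*eta" by simp
   also have "... <= 8*t^2/rho + 4/rho^4*eta" using r2 rho by (simp add: divide_right_mono)
   also have "... <= t^2*C2" using rho by (simp add: C eta_def power_def numeral_eq_Suc field_simps)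
   also have "... = H" using C2 by (simp add: t2)
   finally show ?thesis using yS by simp
  qed
  let ?v0 = "x1 + eta *\<^sub>R nu"
  define w where "w = (1/2) *\<^sub>R (x - ?v0)"
  have vw: "nu \<bullet> w = (s x - eta)/2" using basics(10) by (simp add: w_def s_def inner_diff_right inner_add_right)
  show ?thesis
  proof (cases "s x <= 2*eta")
   case True
   hence "(s x)^2 <= (4*t)^2" using eta s_bounds(2)[OF x] by (intro power_mono) auto
   hence "(s x)^2*C2 <= 16*H" using t2 C2 by (simp add: power_mult_distrib field_simps)
   also have "... <= ?K*H" using Y H basics(3) by (intro mult_right_mono) auto
   finally show ?thesis .
  next
   case False
   \<comment> \<open>Column \<open>i\<close> of \<open>E\<close> is a tangential vector of length at
     most \<open>t\<close> plus a multiple of \<open>w\<close>, half the step from the centre of the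
     disc to \<open>x\<close>. The signs make these multiples nonnegative, so each vertex is a
     convex combination of \<open>x\<close> and a point of the disc.\<close>
   define sg where "sg i = (if nu $ i < 0 then -1 else 1 :: real)" for i
   define M where "M = t *\<^sub>R mat 1 + outer (w - t *\<^sub>R nu) nu"
   define E where "E = transpose (\<chi> i. sg i *s (transpose M $ i))"
   have dM: "det M = t^(?n - 1)*((s x - eta)/2)"
    unfolding M_def using det_id_plus_outer[of t "w - t *\<^sub>R nu" nu] t vw basics(10) by (simp add: inner_diff_right)
   have "det E = (\<Prod>i\<in>UNIV. sg i)*det M"
    unfolding E_def det_transpose using det_rows_mul[of sg "%i. transpose M $ i"] by (simp add: vec_nth_inverse det_transpose)
   moreover have "\<bar>\<Prod>i\<in>UNIV. sg i\<bar> = 1" unfolding abs_prod by (intro prod.neutral) (auto simp: sg_def)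
   moreover have "0 <= det M" unfolding dM using t False eta by simp
   ultimately have dE: "\<bar>det E\<bar> = t^(?n - 1)*((s x - eta)/2)" unfolding dM[symmetric] by (simp add: abs_mult)
   have dE2: "(det E)^2 = (t^2)^(?n - 1)*((s x - eta)/2)^2"
    unfolding power2_abs[of "det E", symmetric] dE power_mult_distrib by (simp add: power_mult[symmetric] mult.commute)
   hence E0: "det E ~= 0" using t False eta by auto
   have col: "column i E = (sg i*t) *\<^sub>R (axis i 1 - nu $ i *\<^sub>R nu) + \<bar>nu $ i\<bar> *\<^sub>R w" for i
   proof -
    have "\<bar>nu $ i\<bar> = sg i*nu $ i" by (simp add: sg_def)
    thus ?thesis by (simp add: vec_eq_iff column_def E_def M_def transpose_def outer_def mat_def axis_def algebra_simps)
   qed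
   define D where "D = {y \<in> S. v y <= H}"
   have "D = sublev S phi (phi x1 - p \<bullet> x1 + H) p" by (auto simp: D_def sublev_def v_def inner_diff_right)
   hence cD: "convex D" using sublev_convex[OF MA_D(2,3)[OF MA]] by simp
   have v0: "?v0 \<in> D" using near[of 0] t by (simp add: D_def)
   have xD: "x \<in> D" using x H(2) by (simp add: D_def)
   have cE: "?v0 + column i E \<in> D" for i
   proof -
    have ni: "\<bar>nu $ i\<bar> <= 1" using component_le_norm_cart[of nu i] nu(1) by simp
    define a where "a = \<bar>nu $ i\<bar>/2"
    have a: "0 <= a" "a <= 1/2" using ni by (auto simp: a_def)
    define f where "f = (sg i*t/(1 - a)) *\<^sub>R (axis i 1 - nu $ i *\<^sub>R nu)"
    have o: "(axis i 1 - nu $ i *\<^sub>R nu) \<bullet> nu = 0" using basics(10) by (simp add: inner_diff_left inner_axis')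
    have "(norm (axis i 1 - nu $ i *\<^sub>R nu))^2 + (nu $ i)^2 = 1" using tangential_norm[OF o, of "nu $ i"] by (simp add: norm_axis_1)
    hence "(norm (axis i 1 - nu $ i *\<^sub>R nu))^2 <= 1" using zero_le_power2[of "nu $ i"] by linarith
    hence n1: "norm (axis i 1 - nu $ i *\<^sub>R nu) <= 1" by (simp add: abs_square_le_1)
    have "\<bar>sg i*t/(1 - a)\<bar> <= 2*t" using t a by (auto simp: sg_def abs_mult field_simps)
    hence "norm f <= 2*t*1" unfolding f_def norm_scaleR using n1 t by (intro mult_mono) auto
    hence "?v0 + f \<in> D" using near[of f] o by (simp add: D_def f_def algebra_simps)
    hence "(1 - a) *\<^sub>R (?v0 + f) + a *\<^sub>R x \<in> D" using cD xD a by (intro convexD) auto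
    moreover have "(1 - a) *\<^sub>R f = (sg i*t) *\<^sub>R (axis i 1 - nu $ i *\<^sub>R nu)" using a by (simp add: f_def)
    moreover have "\<bar>nu $ i\<bar> *\<^sub>R w = a *\<^sub>R (x - ?v0)" by (simp add: a_def w_def)
    moreover have "(1 - a) *\<^sub>R (?v0 + f) + a *\<^sub>R x = ?v0 + ((1 - a) *\<^sub>R f + a *\<^sub>R (x - ?v0))" by (simp add: algebra_simps)
    ultimately show ?thesis unfolding col by (simp only:)
   qed
   have "l*(det E)^2 <= (16*(real ?n)^2*H)^?n"
   proof (rule simplex_volume_upper[OF MA E0 cD _ v0 cE H(1)])
    fix y assume "y \<in> D"
    thus "0 <= phi y - (phi x1 - p \<bullet> x1 + p \<bullet> y) & phi y - (phi x1 - p \<bullet> x1 + p \<bullet> y) <= H"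
     using v_bounds(1)[of y] basics(5) by (auto simp: D_def v_def inner_diff_right)
   qed (auto simp: D_def)
   also have "16*(real ?n)^2*H = 16*(real ?n)^2*C2*t^2" using C2 by (simp add: t2)
   also have "(...)^?n = ?Y*(t^2)^(?n - 1)*t^2" by (simp add: power_mult_distrib flip: power_Suc2 power_Suc)
   finally have "(t^2)^(?n - 1)*(l*((s x - eta)/2)^2) <= (t^2)^(?n - 1)*(?Y*t^2)" unfolding dE2 by (simp only: mult_ac)
   moreover have "0 < (t^2)^(?n - 1)" using t by simp
   ultimately have "l*((s x - eta)/2)^2 <= ?Y*t^2" by (rule mult_le_cancel_left_pos[THEN iffD1, rotated])
   moreover have "(s x/4)^2 <= ((s x - eta)/2)^2" using False eta by (intro power_mono) auto
   ultimately have "l*(s x/4)^2 <= ?Y*t^2" using basics(3) by (meson less_imp_le mult_left_mono order_trans)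
   hence "(s x)^2 <= 16/l*?Y*t^2" using basics(3) by (simp add: power_divide field_simps)
   hence "(s x)^2*C2 <= 16/l*?Y*t^2*C2" using C2 by (intro mult_right_mono) auto
   also have "... = 16/l*?Y*H" using C2 by (simp add: t2)
   also have "... <= ?K*H" using H by (intro mult_right_mono) auto
   finally show ?thesis .
  qed
 qed
 show ?thesis
 proof (rule ccontr)
  assume n: "~ ?thesis"
  define c where "c = (s x)^2*C2/?K"
  have vc: "v x < c" using n Y(2) by (simp add: c_def pos_less_divide_eq mult.commute)
  define H where "H = min (4/rho^3) ((v x + c)/2)"
  have v: "0 <= v x" "v x <= 4/rho^3" using v_bounds(1,2)[of x] x basics(5) by auto
  have "(v x + c)/2 < c" using vc by simp
  hence "H < c" by (simp add: H_def min_less_iff_disj)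
  moreover have "0 < H" "v x <= H" "H <= 4/rho^3" using v vc rho by (auto simp: H_def)
  moreover from main[OF this] have "c <= H" using Y(2) unfolding c_def by (simp add: pos_divide_le_eq mult.commute)
  ultimately show False by simp
 qed
qed

end

context boundary_point begin

text \<open>The tangent plane at \<open>x\<close>, which almost passes through \<open>x1\<close>, is
  tested at a frontier point at tangential distance \<open>om\<close>, where \<open>v\<close> is of
  order \<open>om^2\<close>. The normal part of the slope is only bounded by a multiple of
  \<open>1/d\<close>, hence the division.\<close>

lemma tangential_slope:
 assumes x: "x \<in> S" "0 < d" "ball x d \<subseteq> S" and d: "d <= 1/rho" and om: "0 < om" "om < rho" and h: "excess phi g x x1 < om^2"
 shows "norm (g x - p - ((g x - p) \<bullet> nu) *\<^sub>R nu) <= om*((1 + 2/rho)/rho + 4/rho^4)/d"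
proof -
 define b where "b = g x - p"
 define b' where "b' = b - (b \<bullet> nu) *\<^sub>R nu"
 have o: "b' \<bullet> nu = 0" unfolding b'_def inner_diff_left by (simp add: basics(10))
 show ?thesis unfolding b_def[symmetric] unfolding b'_def[symmetric]
 proof (cases "b' = 0")
  case False
  define e where "e = sgn b'"
  have e: "e \<bullet> nu = 0" "norm e = 1" using o False by (auto simp: e_def sgn_div_norm)
  have be: "b \<bullet> e = norm b'"
  proof -
   have "b \<bullet> e = b' \<bullet> e + (b \<bullet> nu)*(nu \<bullet> e)" by (simp add: b'_def inner_diff_left)
   also have "... = b' \<bullet> e" using e(1) by (simp add: inner_commute)
   also have "... = norm b'" using False by (simp add: e_def sgn_div_norm dot_square_norm power2_eq_square)
   finally show ?thesis .
  qed
  \<comment> \<open>A height at which a tangential displacement by \<open>om\<close> lands in the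
    touching ball.\<close>
  define k where "k = om^2/rho"
  have k: "0 < k" "k <= om" using om rho by (auto simp: k_def power2_eq_square field_simps)
  have krho: "k*rho = om^2" using rho by (simp add: k_def)
  let ?y = "x1 + om *\<^sub>R e + k *\<^sub>R nu"
  have oe: "(om *\<^sub>R e) \<bullet> nu = 0" using e by simp
  have "k*k < om^2" using mult_strict_left_mono[OF om(2) k(1)] mult_left_mono[OF k(2), of k] k(1) krho by linarith
  hence "(norm (om *\<^sub>R e + (k - rho) *\<^sub>R nu))^2 < rho^2"
   unfolding tangential_norm[OF oe] using e krho by (simp add: power2_eq_square algebra_simps)
  hence "norm (om *\<^sub>R e + (k - rho) *\<^sub>R nu) < rho" by (rule power2_less_imp_less) (use rho in simp)
  moreover have "?y - (x1 + rho *\<^sub>R nu) = om *\<^sub>R e + (k - rho) *\<^sub>R nu" by (simp add: scaleR_left_diff_distrib)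
  ultimately have "?y \<in> ball (x1 + rho *\<^sub>R nu) rho" by (simp only: mem_ball dist_norm norm_minus_commute[of "x1 + rho *\<^sub>R nu"])
  hence yS: "?y \<in> S" using nu(2) by auto
  have sy: "s ?y = k" using e(1) basics(10) by (simp add: s_def inner_add_right inner_commute)
  obtain j where j: "0 <= j" "j <= k" "?y - j *\<^sub>R nu \<in> frontier S" using frontier_below[OF yS] unfolding sy by blast
  let ?a = "?y - j *\<^sub>R nu"
  have a: "?a - x1 = om *\<^sub>R e + (k - j) *\<^sub>R nu" by (simp add: scaleR_left_diff_distrib)
  have ac: "?a \<in> closure S" using j(3) by (simp add: frontier_def)
  have "(norm (?a - x1))^2 <= om^2 + om^2" unfolding a tangential_norm[OF oe] using e j k om by (intro add_mono power_mono) auto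
  hence va: "v ?a <= (om^2 + om^2)/rho" using v_bounds(7)[OF j(3)] rho by (meson divide_right_mono less_imp_le order_trans)
  have bn: "\<bar>b \<bullet> nu\<bar> <= 4/rho^3/d"
  proof -
   have "d*\<bar>b \<bullet> nu\<bar> <= d*norm b" using Cauchy_Schwarz_ineq2[of b nu] nu(1) x(2) by (intro mult_left_mono) auto
   also have "... <= 4/rho^3" using gradient_bound[OF x] unfolding b_def .
   finally show ?thesis unfolding pos_le_divide_eq[OF x(2)] by (simp only: mult.commute)
  qed
  have "v x + b \<bullet> (y - x) = - excess phi g x x1 + b \<bullet> (y - x1)" for y
   by (simp add: v_def excess_def b_def inner_diff_right inner_diff_left)
  hence "b \<bullet> (?a - x1) <= om^2 + (om^2 + om^2)/rho" using tangent_below[OF x(1) ac] va h unfolding b_def[symmetric] by (smt (verit))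
  hence "om*norm b' + (k - j)*(b \<bullet> nu) <= om^2 + (om^2 + om^2)/rho" unfolding a by (simp add: inner_add_right be)
  moreover have "(k - j) * - (b \<bullet> nu) <= k*(4/rho^3/d)"
  proof -
   have "(k - j) * - (b \<bullet> nu) <= (k - j)*(4/rho^3/d)" using j bn by (intro mult_left_mono) auto
   also have "... <= k*(4/rho^3/d)" using j rho x(2) by (intro mult_right_mono) auto
   finally show ?thesis .
  qed
  ultimately have "om*norm b' <= om^2*(1 + 2/rho + 4/rho^4/d)" using rho by (simp add: k_def power_def numeral_eq_Suc algebra_simps)
  hence "norm b' <= om*(1 + 2/rho + 4/rho^4/d)" using om(1) by (simp add: power2_eq_square)
  also have "... <= om*(((1 + 2/rho)/rho + 4/rho^4)/d)"
  proof -
   have "(1 + 2/rho)*d <= (1 + 2/rho)*(1/rho)" using d rho by (intro mult_left_mono) auto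
   hence "1 + 2/rho <= (1 + 2/rho)/rho/d" by (subst pos_le_divide_eq[OF x(2)]) simp
   thus ?thesis using om by (intro mult_left_mono) (auto simp: add_divide_distrib)
  qed
  finally show "norm b' <= om*((1 + 2/rho)/rho + 4/rho^4)/d" by simp
 qed (use om rho x(2) in auto)
qed

text \<open>A quadratic barrier near \<open>x1\<close> improves the plane to \<open>(si / 8) * s <= v\<close>, against the maximality of
 the boundary gradient.\<close>

lemma steep_plane_contradiction:
 assumes si: "0 < si" "si <= 4*rho^2" "si <= 4*(C1 + 1)" and C1: "C1 = 2*(L/rho^(CARD('n) - 1))/rho"
  and de: "de = rho * si/(16*(C1 + 1))" and N: "N = L/(2*de)^(CARD('n) - 1)" and tau: "tau = si/(8*N)"
  and m: "!!y. y \<in> closure S ==> si * s y - si*tau/4 <= v y"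
 shows False
proof -
 have C10: "0 < C1" using basics(3,4) rho by (simp add: C1)
 have "rho * si <= rho*(4*(C1 + 1))" using si(3) rho by (intro mult_left_mono) auto
 hence de0: "0 < de" "de <= rho/4" using si C10 rho by (simp_all add: de pos_divide_le_eq algebra_simps)
 have N0: "0 < N" using basics(3,4) de0 by (simp add: N)
 have tau0: "0 < tau" using si N0 by (simp add: tau)
 have Ntau: "N*tau = si/8" using N0 by (simp add: tau)
 let ?Q = "de *\<^sub>R mat 1 + N *\<^sub>R outer nu nu"
 note q = barrier_matrix[OF de0(1) N]
 \<comment> \<open>The barrier lives in the slab \<open>s <= tau\<close>. On the upper face the
   hypothesis \<open>m\<close> controls it, thanks to \<open>N*tau = si/8\<close>; on the rest of
   the boundary the quadratic separation does.\<close>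
 let ?T = "{y \<in> closure S. s y <= tau}" let ?U = "S \<inter> {y. nu \<bullet> y < tau + nu \<bullet> x1}"
 have "continuous_on (closure S) s" unfolding s_def by (intro continuous_intros)
 hence T: "compact ?T" by (rule compact_sublevel[OF basics(6)])
 have U: "open ?U" by (intro open_Int basics(1) open_halfspace_lt)
 have near: "si/8 * s y <= v y" if y: "y \<in> ?T" for y
 proof -
  have "(phi x1 - p \<bullet> x1 - si/8*(nu \<bullet> x1)) + (p + (si/8) *\<^sub>R nu) \<bullet> y + (y - x1) \<bullet> (?Q *v (y - x1)) <= phi y"
  proof (rule quadratic_comparison[OF MA T _ U _ _ q(1,2) _ y])
   fix y assume y: "y \<in> ?T" "y \<notin> ?U"
   have "de*(norm (y - x1))^2 + N*(s y)^2 + si/8 * s y <= v y"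
   proof (cases "s y = tau")
    case True
    \<comment> \<open>The lower bounds from \<open>quadratic_lower_bound\<close> and from
      \<open>m\<close> are mixed; the weight \<open>th\<close> turns the first into exactly the term
      with coefficient \<open>de\<close>.\<close>
    define th where "th = 2*de/rho"
    have th: "0 <= th" "th <= 1/2" using de0 rho by (auto simp: th_def field_simps)
    have N0': "0 <= L/rho^(CARD('n) - 1)*(s y)^2" using basics(3,4) rho by simp
    have "rho/2*(norm (y - x1))^2 - C1*tau <= v y" using quadratic_lower_bound[of y] y N0' unfolding C1[symmetric] True by auto
    from mult_left_mono[OF this th(1)] have 1: "de*(norm (y - x1))^2 - th*(C1*tau) <= th * v y" using rho by (simp add: th_def algebra_simps)
    have "th*(C1*tau) = si*tau/8*(C1/(C1 + 1))" using rho C10 by (simp add: th_def de divide_simps)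
    also have "... <= si*tau/8*1" using si tau0 C10 by (intro mult_left_mono) auto
    finally have 2: "th*(C1*tau) <= si*tau/8" by simp
    have "(1 - th) * v y >= 1/2*(3/4*(si*tau))" using m[of y] y True th si tau0 by (intro mult_mono) auto
    moreover have "N*(s y)^2 = si/8*tau" using Ntau True by (simp add: power2_eq_square)
    moreover have "(1 - th) * v y = v y - th * v y" "si/8 * s y = si*tau/8" using True by (auto simp: algebra_simps)
    ultimately show ?thesis using 1 2 by linarith
   next
    case False
    hence f: "y \<in> frontier S" using y basics(1) by (auto simp: frontier_def interior_open s_def inner_diff_right)
    have s0: "0 <= s y" "s y <= tau" using s_bounds(1) y by auto
    have "N*(s y)^2 <= N*tau * s y" using mult_right_mono[OF s0(2,1)] N0 by (simp add: power2_eq_square)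
    moreover have "si/4 * s y <= rho*(2*rho * s y)/2" using mult_right_mono[OF si(2) s0(1)] by (simp add: power2_eq_square)
    moreover have "rho*(2*rho * s y) <= rho*(norm (y - x1))^2" using s_bounds(4)[OF f] rho by (intro mult_left_mono) auto
    moreover have "de*(norm (y - x1))^2 <= rho/4*(norm (y - x1))^2" using de0 by (intro mult_right_mono) auto
    moreover have "0 <= rho*(norm (y - x1))^2" using rho by simp
    ultimately show ?thesis using v_bounds(6)[OF f] unfolding Ntau by linarith
   qed
   thus "(phi x1 - p \<bullet> x1 - si/8*(nu \<bullet> x1)) + (p + (si/8) *\<^sub>R nu) \<bullet> y + (y - x1) \<bullet> (?Q *v (y - x1)) <= phi y"
    unfolding q(3) by (simp add: v_def s_def algebra_simps diff_divide_distrib)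
  qed (use de0 N0 basics(5) continuous_on_subset[OF cphi(1), of ?T] in \<open>auto simp: s_def inner_diff_right\<close>)
  moreover have "0 <= de*(norm (y - x1))^2 + N*(s y)^2" using de0 N0 by simp
  ultimately show ?thesis unfolding q(3) by (simp add: v_def s_def algebra_simps diff_divide_distrib)
 qed
 have "si/8 * s y <= v y" if y: "y \<in> closure S" for y
 proof (cases "s y <= tau")
  case False
  hence "si*tau <= si * s y" "0 <= si * s y" using si tau0 by (auto intro: mult_left_mono)
  thus ?thesis using m[OF y] by linarith
 qed (use near y in auto)
 hence "supporting_slope S phi x1 (p + (si/8) *\<^sub>R nu)"
  unfolding supporting_slope_def by (intro ballI) (force simp: v_def s_def algebra_simps diff_divide_distrib)
 moreover have "inner_unit_normal S x1 nu" using nu(1,3) by (simp add: inner_unit_normal_def)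
 ultimately show False using p si(1) unfolding boundary_gradient_def by (meson half_gt_zero divide_pos_pos zero_less_numeral)
qed

text \<open>If the excess were below \<open>om^2\<close>, the tangential slope at \<open>x\<close>
  would be negligible, and \<open>v x >= c*(s x)^2\<close> would force the normal slope to be at
  least \<open>si\<close>. The tangent plane at \<open>x\<close> would then be the steep plane that
  \<open>steep_plane_contradiction\<close> excludes.\<close>

lemma excess_at_boundary_point:
 assumes x: "x \<in> S" "0 < d" "ball x d \<subseteq> S" and d: "d <= 1/rho" and om: "0 < om" "om < rho"
  and c: "0 < c" "c*(s x)^2 <= v x"
  and si: "si = c/2*d" "si <= 4*rho^2" "si <= 4*(C1 + 1)" and C1: "C1 = 2*(L/rho^(CARD('n) - 1))/rho"
  and de: "de = rho * si/(16*(C1 + 1))" and N: "N = L/(2*de)^(CARD('n) - 1)" and tau: "tau = si/(8*N)"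
  and K: "K = 2/rho*(om*((1 + 2/rho)/rho + 4/rho^4)/d)" "K <= si*tau/8" "K <= c/2*d^2" "om^2 <= si*tau/8"
 shows "om^2 <= excess phi g x x1"
proof (rule ccontr)
 assume "~ ?thesis"
 hence h: "excess phi g x x1 < om^2" by simp
 define b where "b = g x - p"
 define b' where "b' = b - (b \<bullet> nu) *\<^sub>R nu"
 have m: "v x + b \<bullet> (y - x) = - excess phi g x x1 + (b \<bullet> nu) * s y + b' \<bullet> (y - x1)" for y
  by (simp add: v_def excess_def b_def b'_def s_def inner_diff_right inner_diff_left algebra_simps)
 have b': "norm b' <= om*((1 + 2/rho)/rho + 4/rho^4)/d" using tangential_slope[OF x d om h] unfolding b'_def b_def .
 have bK: "\<bar>b' \<bullet> (y - x1)\<bar> <= K" if "y \<in> closure S" for y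
 proof -
  have "\<bar>b' \<bullet> (y - x1)\<bar> <= norm b'*norm (y - x1)" by (rule Cauchy_Schwarz_ineq2)
  also have "... <= (om*((1 + 2/rho)/rho + 4/rho^4)/d)*(2/rho)"
   using norm_le[OF that basics(7)] b' by (intro mult_mono) (auto intro: order_trans[OF norm_ge_zero])
  finally show ?thesis by (simp add: K(1) mult.commute)
 qed
 have h0: "0 <= excess phi g x x1" using tangent_below[OF x(1) basics(7)] v_bounds(5) m[of x1] by (simp add: b_def s_def)
 have xc: "x \<in> closure S" using x(1) basics(5) by auto
 have sx: "0 < s x" "d <= s x" using s_bounds(2,5) x by auto
 have "d^2 <= (s x)^2" using sx x(2) by (intro power_mono) auto
 hence "c/2*d^2 <= c/2*(s x)^2" using c by (intro mult_left_mono) auto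
 moreover have "c*(s x)^2 <= (b \<bullet> nu) * s x + K" using m[of x] h0 c(2) bK[OF xc] by simp
 ultimately have "c/2*(s x)^2 <= (b \<bullet> nu) * s x" using K(3) by linarith
 hence "(c/2 * s x) * s x <= (b \<bullet> nu) * s x" by (simp add: power2_eq_square)
 hence "c/2 * s x <= b \<bullet> nu" using sx(1) by simp
 moreover have "si <= c/2 * s x" unfolding si(1) using sx c by (intro mult_left_mono) auto
 ultimately have bn: "si <= b \<bullet> nu" by simp
 have "si * s y - si*tau/4 <= v y" if y: "y \<in> closure S" for y
 proof -
  have "si * s y <= (b \<bullet> nu) * s y" using bn s_bounds(1)[OF y] by (rule mult_right_mono)
  thus ?thesis using tangent_below[OF x(1) y] m[of y] bK[OF y] K(2,4) h unfolding b_def[symmetric] by linarith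
 qed
 thus False using c(1) x(2) by (intro steep_plane_contradiction[OF _ si(2,3) C1 de N tau]) (auto simp: si(1))
qed

end

text \<open>The exponent collects the losses: \<open>si\<close> is of order \<open>d\<close> and
  \<open>N\<close> of order \<open>d^(1-n)\<close>, so \<open>si*tau\<close> is of order
  \<open>d^(n+1)\<close>. The tangential slope, of order \<open>om/d\<close>, has to stay below
  this, which requires \<open>om\<close> of order \<open>d^(n+2)\<close>.\<close>

lemma excess_at_boundary:
 fixes rho l L :: real
 assumes rho: "0 < rho" and l: "0 < l" "l <= L"
 shows "EX q>0. ALL (S :: (real^'n::finite) set) phi g A x1 nu p x d.
  boundary_point rho l L S phi g A x1 nu p & x \<in> S & 0 < d & d <= 1/rho & ball x d \<subseteq> S -->
  q*d^(CARD('n) + 2) <= 1 & (q*d^(CARD('n) + 2))^2 <= excess phi g x x1"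
proof -
 let ?n = "CARD('n)"
 define C2 where "C2 = 8/rho + 32/rho^5"
 define C3 where "C3 = 16 + 16/l*(16*(real ?n)^2*C2)^?n"
 define C1 where "C1 = 2*(L/rho^(?n - 1))/rho"
 define c where "c = min (C2/C3) (min (8*rho^3) (8*rho*(C1 + 1)))"
 define a where "a = rho/(16*(C1 + 1))"
 define ka where "ka = (c/2)^2*(a * c)^(?n - 1)/(64*L)"
 define C5 where "C5 = 2/rho*((1 + 2/rho)/rho + 4/rho^4)"
 \<comment> \<open>Bounds for powers of \<open>d\<close>, which is at most \<open>1/rho\<close>;
   they absorb surplus powers into the single constant \<open>q\<close>.\<close>
 define R where "R k = (1/rho)^k" for k
 define X where "X = 1 + C5 + C5*R (?n - 1) + R (?n + 3) + R (?n + 2)"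
 define Y where "Y = min (min ka (c/2)) (min (rho/2) 1)"
 have L0: "0 < L" using l by simp
 have C: "0 < C2" "0 < C3" "0 < C1" using rho l L0 by (auto simp: C2_def C3_def C1_def intro!: add_pos_nonneg)
 have c: "0 < c" "c*C3 <= C2" "c <= 8*rho^3" "c <= 8*rho*(C1 + 1)" using C rho pos_le_divide_eq[OF C(2), of c C2] by (auto simp: c_def)
 have pos: "0 < a" "0 < ka" "0 < C5" "0 < R k" for k
  using C rho c(1) L0 by (auto simp: a_def ka_def C5_def R_def intro!: add_pos_pos divide_pos_pos mult_pos_pos)
 have XY: "0 < X" "0 < Y" "Y <= ka" "Y <= c/2" "Y <= rho/2" "Y <= 1" using pos c(1) rho by (auto simp: X_def Y_def intro!: add_pos_pos)
 define q where "q = Y/X"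
 have q: "0 < q" "q*Z <= Y" if "Z <= X" for Z using XY mult_left_mono[OF that, of q] by (auto simp: q_def)
 have CR: "0 < C5*R (?n - 1)" using pos by simp
 have le: "1 <= X" "C5 <= X" "C5*R (?n - 1) <= X" "R (?n + 3) <= X" "R (?n + 2) <= X"
  using CR pos(3) pos(4)[of "?n + 3"] pos(4)[of "?n + 2"] by (simp_all add: X_def)
 have main: "(q*d^(?n + 2))^2 <= excess phi g x x1 & q*d^(?n + 2) <= 1"
  if b: "boundary_point rho l L S phi g A x1 nu p" and x: "x \<in> S" "0 < d" "ball x d \<subseteq> S" and d: "d <= 1/rho"
  for S :: "(real^'n) set" and phi g A x1 nu p x d
 proof -
  interpret boundary_point rho l L S phi g A x1 nu p by (rule b)
  have dR: "d^k <= R k" for k unfolding R_def using d x(2) by (intro power_mono) auto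
  have qd: "q*(Z*d^k) <= Y" if "Z*R k <= X" "0 <= Z" for Z k
  proof -
   have "q*(Z*d^k) <= q*(Z*R k)" using q(1)[OF le(1)] that dR by (intro mult_left_mono) auto
   thus ?thesis using q(2)[OF that(1)] by linarith
  qed
  define om where "om = q*d^(?n + 2)"
  define si where "si = c/2*d"
  have sid: "si <= c/2*(1/rho)" unfolding si_def using d c(1) by (intro mult_left_mono) auto
  also have "... <= 4*rho^2" using c(3) rho by (simp add: power2_eq_square power3_eq_cube field_simps)
  finally have si1: "si <= 4*rho^2" .
  have "c/2*(1/rho) <= 4*(C1 + 1)" using c(4) rho by (simp add: field_simps)
  hence si2: "si <= 4*(C1 + 1)" using sid by simp
  define de where "de = rho * si/(16*(C1 + 1))"
  define N where "N = L/(2*de)^(?n - 1)"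
  define tau where "tau = si/(8*N)"
  have de: "2*de = a * c*d" using C(3) by (simp add: de_def a_def si_def divide_simps)
  have dd: "d^(?n + 1) = d*(d*d^(?n - 1))" by (simp flip: power_Suc)
  have st: "si*tau/8 = ka*d^(?n + 1)" unfolding tau_def N_def de si_def ka_def dd by (simp add: power_mult_distrib power2_eq_square)
  have w1: "om <= rho/2" "om <= 1" using qd[of 1 "?n + 2"] le XY by (auto simp: om_def)
  have w0: "0 < om" using q(1)[OF le(1)] x(2) by (simp add: om_def)
  have wK: "2/rho*(om*((1 + 2/rho)/rho + 4/rho^4)/d) = q*C5*d^(?n + 1)" using x(2) by (simp add: om_def C5_def)
  have k1: "q*C5*d^(?n + 1) <= ka*d^(?n + 1)" using q(2)[OF le(2)] XY x(2) by (intro mult_right_mono) auto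
  have "q*(C5*d^(?n - 1))*d^2 <= c/2*d^2" using qd[OF le(3)] pos(3) XY by (intro mult_right_mono) auto
  hence k2: "q*C5*d^(?n + 1) <= c/2*d^2" unfolding dd by (simp add: power2_eq_square mult_ac)
  have "q*d^(?n + 3) <= ka" using qd[of 1 "?n + 3"] le XY by auto
  moreover have "q*(q*d^(?n + 3)) <= 1*(q*d^(?n + 3))" using q(1,2)[OF le(1)] XY x(2) by (intro mult_right_mono) auto
  ultimately have "q*(q*d^(?n + 3))*d^(?n + 1) <= ka*d^(?n + 1)" using x(2) by (intro mult_right_mono) auto
  moreover have "q*(q*d^(?n + 3))*d^(?n + 1) = om^2"
  proof -
   have "(d^(?n + 2))^2 = d^(?n + 3)*d^(?n + 1)" unfolding power_mult[symmetric] power_add[symmetric] by (rule arg_cong[where f="%k. d^k"]) simp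
   thus ?thesis unfolding om_def power_mult_distrib by (simp only: power2_eq_square[of q] mult_ac)
  qed
  ultimately have k3: "om^2 <= ka*d^(?n + 1)" by simp
  have "c*((s x)^2*C3) <= (s x)^2*C2" using mult_left_mono[OF c(2), of "(s x)^2"] by (simp add: mult_ac)
  also have "... <= C3 * v x" using distance_lower_bound[OF x(1) C2_def] unfolding C3_def .
  finally have "c*(s x)^2 <= v x" using C(2) by (simp add: mult_ac)
  from excess_at_boundary_point[OF x d w0 _ c(1) this si_def si1 si2 C1_def de_def N_def tau_def wK[symmetric]]
  show ?thesis using k1 k2 k3 w1 rho unfolding st by (simp add: om_def)
 qed
 show ?thesis
 proof (rule exI[of _ q], intro conjI allI impI, goal_cases)
  case (2 S phi g A x1 nu p x d)
  thus ?case by (intro main[THEN conjunct2, of S phi g A x1 nu p x d]) auto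
 next
  case (3 S phi g A x1 nu p x d)
  thus ?case by (intro main[THEN conjunct1, of S phi g A x1 nu p x d]) auto
 qed (use q(1)[OF le(1)] in auto)
qed

section \<open>Boundary and interior estimates for solutions\<close>

lemma continuous_on_cofac:
 fixes A :: "'a::topological_space => real^'n^'n::finite"
 assumes c: "continuous_on S A" and d: "!!x. x \<in> S ==> det (A x) ~= 0"
 shows "continuous_on S (%x. cofac (A x))"
proof -
 let ?D = "%M m k. det (\<chi> i j. if j = k then axis m 1 $ i else M $ i $ j) :: real"
 \<comment> \<open>By Cramer's rule the entries of the cofactor matrix are determinants, hence
   polynomials in the entries of \<open>M\<close>.\<close>
 have e: "cofac M = (\<chi> k m. ?D M m k)" if d: "det M ~= 0" for M :: "real^'n^'n"
 proof -
  have "M *v (matrix_inv M *v axis m 1) = axis m 1" for m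
   using someI_ex[OF d[folded invertible_det_nz, unfolded invertible_def]] by (simp add: matrix_inv_def matrix_vector_mul_assoc)
  hence "matrix_inv M *v axis m 1 = (\<chi> k. ?D M m k/det M)" for m using cramer[OF d] by blast
  hence "(matrix_inv M *v axis m 1) $ k = ?D M m k/det M" for m k by simp
  thus ?thesis using d by (simp add: cofac_def vec_eq_iff matrix_vector_mult_basis column_def)
 qed
 have "continuous_on S (%x. \<chi> k m. ?D (A x) m k)"
 proof -
  have "continuous_on S (%x. if j = k then axis m 1 $ i else A x $ i $ j)" for i j k m using c by (cases "j = k") (auto intro!: continuous_intros)
  thus ?thesis unfolding det_def by (intro continuous_intros) auto
 qed
 thus ?thesis by (rule continuous_on_eq) (use e d in simp)
qed

text \<open>All that is retained of a strong solution: approximation, uniform on compact sets, by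
  C^2 functions whose linearized operator is bounded in \<open>L^n\<close>. Only the bound
  \<open>G\<close> on the source survives, and it is the same for all \<open>K\<close>.\<close>

definition approximable :: "(real^'n::finite => real^'n^'n) => (real^'n) set => (real^'n => real) => real => bool" where
 "approximable A S u G \<longleftrightarrow> (ALL K e. compact K & K \<subseteq> S & 0 < e -->
  (EX v p M. c2_on UNIV v p M & (ALL x:K. \<bar>v x - u x\<bar> <= e) &
   integral K (%x. \<bar>mdot (cofac (A x)) (M x)\<bar>^CARD('n)) <= G + e))"

lemma approximable_uminus:
 fixes S :: "(real^'n::finite) set"
 assumes "approximable A S u G"
 shows "approximable A S (%x. - u x) G" unfolding approximable_def
proof (intro allI impI)
 fix K and e :: real assume k: "compact K & K \<subseteq> S & 0 < e"
 from assms[unfolded approximable_def, THEN spec, THEN spec, THEN mp, OF k]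
 obtain v p M where v: "c2_on UNIV v p M" "ALL x:K. \<bar>v x - u x\<bar> <= e"
  "integral K (%x. \<bar>mdot (cofac (A x)) (M x)\<bar>^CARD('n)) <= G + e" by blast
 have "c2_on UNIV (%x. - v x) (%x. - p x) (%x. - M x)" using c2_on_scale[OF v(1), of "-1"] by simp
 moreover have "ALL x:K. \<bar>- v x - - u x\<bar> <= e" using v(2) by (auto simp: abs_minus_commute)
 moreover have "mdot (cofac (A x)) (- M x) = - mdot (cofac (A x)) (M x)" for x using mdot_scale[of "cofac (A x)" "-1" "M x"] by simp
 ultimately show "EX v p M. c2_on UNIV v p M & (ALL x:K. \<bar>v x - - u x\<bar> <= e) &
   integral K (%x. \<bar>mdot (cofac (A x)) (M x)\<bar>^CARD('n)) <= G + e"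
  using v(3) by (intro exI[of _ "%x. - v x"] exI[of _ "%x. - p x"] exI[of _ "%x. - M x"]) simp
qed

lemma compact_psd_set:
 assumes D: "compact (D :: (real^'n::finite) set)" and M: "continuous_on D M" "!!x. x \<in> D ==> transpose (M x) = M x"
 shows "compact {x \<in> D. psd (M x)}"
proof -
 have "compact {x \<in> D. 0 <= h \<bullet> (M x *v h)}" for h
  using M(1) by (intro compact_superlevel[OF D]) (auto simp: matrix_vector_mult_def inner_vec_def intro!: continuous_intros)
 hence "closed (\<Inter>h. {x \<in> D. 0 <= h \<bullet> (M x *v h)})" by (intro closed_INT ballI compact_imp_closed)
 from compact_Int_closed[OF D this] show ?thesis by (rule back_subst[of compact]) (use M(2) in \<open>auto simp: psd_def\<close>)
qed

text \<open>The factor \<open>s x\<close> is gained because the contact set lies on one side of a hyperplane at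
 distance \<open>s x\<close> from \<open>x\<close>: this admits large slopes in the normal direction.\<close>

lemma (in boundary_point) slab_maximum_principle:
 assumes u: "continuous_on (closure S) u" "approximable A S u G" "0 < G"
  and w: "continuous_on (closure S) w" "c2_on S w pw Hw" "!!x. x \<in> S ==> mdot (cofac (A x)) (Hw x) <= 0"
  and b: "!!y. y \<in> frontier S ==> u y <= w y" and x: "x \<in> S" "w x < u x"
 shows "(u x - w x)^CARD('n) <= (8*real CARD('n))^CARD('n)/(rho*l)^(CARD('n) - 1) * s x*G"
proof -
 let ?n = "CARD('n)"
 define z where "z y = u y - w y" for y
 have cz: "continuous_on (closure S) z" unfolding z_def by (intro continuous_intros u w)
 have zx: "0 < z x" using x(2) by (simp add: z_def)
 \<comment> \<open>This superlevel set is compact in \<open>S\<close>, so approximation is available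
   on it; the level \<open>z x/4\<close> leaves room for the errors \<open>z x/8\<close> at two
   points.\<close>
 define K where "K = {y \<in> closure S. z x/4 <= z y}"
 have K: "compact K" unfolding K_def by (rule compact_superlevel[OF basics(6) cz])
 have KS: "K \<subseteq> S"
 proof
  fix y assume y: "y \<in> K"
  hence "y \<notin> frontier S" using b[of y] zx by (auto simp: K_def z_def)
  thus "y \<in> S" using y basics(1) by (auto simp: K_def frontier_def interior_open)
 qed
 have xK: "x \<in> K" using x(1) zx basics(5) by (auto simp: K_def)
 have "compact K & K \<subseteq> S & 0 < min (z x/8) G" using K KS zx u(3) by auto
 from u(2)[unfolded approximable_def, THEN spec, THEN spec, THEN mp, OF this]
 obtain v p' M where v: "c2_on UNIV v p' M" "ALL y:K. \<bar>v y - u y\<bar> <= min (z x/8) G"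
  and vi: "integral K (%x. \<bar>mdot (cofac (A x)) (M x)\<bar>^?n) <= G + min (z x/8) G" by blast
 define H where "H y = Hw y - M y" for y
 have c: "c2_on S (%y. w y - v y) (%y. pw y - p' y) H" unfolding H_def by (intro c2_on_diff w c2_on_subset[OF v(1)]) (auto simp: basics)
 let ?B = "{y \<in> K. psd (H y)}"
 define F where "F y = \<bar>mdot (cofac (A y)) (M y)\<bar>^?n/l^(?n - 1)" for y
 have cA: "continuous_on K A" "continuous_on K M"
  using continuous_on_subset[OF c2_onD(2)[OF MA_D(4)[OF MA]] KS] continuous_on_subset[OF c2_onD(2)[OF v(1)]] by auto
 have "continuous_on K (%y. cofac (A y))" by (rule continuous_on_cofac[OF cA(1)]) (use MA_D(8)[OF MA] KS in force)
 hence cF: "continuous_on K F" unfolding F_def mdot_def using cA(2) basics(3) by (intro continuous_intros) auto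
 have cB: "compact ?B" using continuous_on_subset[OF c2_onD(2)[OF c] KS] c2_onD(5)[OF c] KS by (intro compact_psd_set[OF K]) auto
 have sx: "0 < s x" by (rule s_bounds(2)[OF x(1)])
 \<comment> \<open>Some component of the unit vector \<open>nu\<close> has size at least
   \<open>1/n\<close>; it enters the volume of the slope set.\<close>
 obtain k where k: "1 <= real ?n*\<bar>nu $ k\<bar>"
 proof (rule ccontr)
  assume "~ thesis"
  hence "real ?n*\<bar>nu $ k\<bar> < 1" for k using that not_le by blast
  hence "\<bar>nu $ k\<bar> < 1/real ?n" for k by (simp add: pos_less_divide_eq mult.commute)
  hence "(\<Sum>k\<in>UNIV. \<bar>nu $ k\<bar>) < (\<Sum>k\<in>(UNIV::'n set). 1/real ?n)" by (intro sum_strict_mono) auto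
  thus False using norm_le_l1_cart[of nu] nu(1) by simp
 qed
 let ?E = "(1/rho) *\<^sub>R mat 1 :: real^'n^'n"
 have dE: "det ?E = (1/rho)^?n" by (simp add: det_scaleR)
 have tE: "transpose ?E *v y = (1/rho) *\<^sub>R y" "?E *v y = (1/rho) *\<^sub>R y" for y
  by (simp_all add: transpose_scalar transpose_mat flip: scaleR_matrix_vector_assoc)
 have kE: "(transpose ?E *v nu) $ k ~= 0" unfolding tE using k rho by auto
 have box: "EX e. y - x = ?E *v e & (ALL i. \<bar>e $ i\<bar> <= 2)" if "y \<in> K" for y
 proof (intro exI conjI allI)
  show "y - x = ?E *v (rho *\<^sub>R (y - x))" unfolding tE using rho by simp
  fix i
  have "\<bar>(y - x) $ i\<bar> <= 2/rho" using norm_le[of y x] that xK component_le_norm_cart[of "y - x" i] by (auto simp: K_def)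
  hence "rho*\<bar>(y - x) $ i\<bar> <= 2" unfolding pos_le_divide_eq[OF rho] by (simp only: mult.commute)
  thus "\<bar>(rho *\<^sub>R (y - x)) $ i\<bar> <= 2" by (simp only: vector_scaleR_component real_scaleR_def abs_mult abs_of_pos[OF rho])
 qed
 have slab: "nu \<bullet> x - nu \<bullet> y <= s x" if "y \<in> K" for y using nu(3)[of y] that KS by (auto simp: s_def inner_diff_right)
 obtain P where P: "P \<in> lmeasurable" "!!\<pi> y. \<pi> \<in> P ==> y \<in> K ==> \<pi> \<bullet> (y - x) < z x/2"
  and mP: "vol P = \<bar>(transpose ?E *v nu) $ k\<bar>*(z x/(4 * s x))*(z x/2/(4*real ?n))^(?n - 1)/\<bar>det ?E\<bar>"
  by (rule slope_set_measure[where E = ?E and D = K and p = x and xi = nu and r = "s x" and R = "z x/(4 * s x)" and m = "z x/2" and k = k, OF _ box _ slab _ _ _ kE]) (use rho sx zx dE in auto)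
 have PB: "P \<subseteq> (%y. pw y - p' y) ` ({} \<union> ?B)"
 proof
  fix \<pi> assume \<pi>: "\<pi> \<in> P"
  have cT: "c2_on S (%y. (0 + \<pi> \<bullet> y) - (w y - v y)) (%y. \<pi> - (pw y - p' y)) (%y. 0 - H y)"
   by (intro c2_on_diff[OF _ c] c2_on_affine basics)
  let ?T = "%y. (0 + \<pi> \<bullet> y) - (w y - v y)"
  from continuous_attains_sup[OF K _ continuous_on_subset[OF c2_on_continuous(1)[OF cT] KS]] xK
  obtain y where y: "y \<in> K" "!!y'. y' \<in> K ==> ?T y' <= ?T y" by auto
  have e: "\<bar>v y - u y\<bar> <= z x/8" "\<bar>v x - u x\<bar> <= z x/8" using v(2) y(1) xK by auto
  have "z x/4 < z y"
   using y(2)[OF xK] P(2)[OF \<pi> y(1)] e[unfolded abs_le_iff, THEN conjunct1] e[unfolded abs_le_iff, THEN conjunct2] unfolding z_def inner_diff_right by argo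
  define U where "U = S \<inter> z -` {z x/4<..}"
  have U: "open U" unfolding U_def using basics(1,5) continuous_on_subset[OF cz] by (intro continuous_open_preimage) auto
  have yU: "y \<in> U" "y \<in> S" using y(1) KS \<open>z x / 4 < z y\<close> by (auto simp: U_def)
  have mx: "!!y'. y' \<in> U \<inter> S ==> ?T y' <= ?T y" using y(2) basics(5) by (auto simp: U_def K_def)
  note lm = local_max_test[OF cT yU(2) U yU(1) mx]
  have "0 <= h \<bullet> (H y *v h)" for h using lm(2)[of h] unfolding matrix_vector_mult_diff_rdistrib by simp
  hence "psd (H y)" using c2_onD(5)[OF c yU(2)] by (simp add: psd_def)
  thus "\<pi> \<in> (%y. pw y - p' y) ` ({} \<union> ?B)" using lm(1) y(1) by (intro image_eqI[of _ _ y]) auto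
 qed
 have "vol P <= 0 * vol ({} :: (real^'n) set) + integral K F"
 proof (rule gradient_image_measure[OF c K KS _ _ _ _ P(1) PB _ _ cF])
  fix y assume y: "y \<in> ?B"
  hence yS: "y \<in> S" using KS by auto
  note A = MA_D(9,8,6)[OF MA yS]
  have H: "psd (H y)" using y by simp
  have "mdot (cofac (A y)) (H y) <= \<bar>mdot (cofac (A y)) (M y)\<bar>" using w(3)[OF yS] by (simp add: H_def mdot_diff)
  moreover have h0: "0 <= mdot (cofac (A y)) (H y)" by (rule psd_mdot(1)[OF cofac_props(1)[OF A(1,2)] H])
  ultimately have hn: "mdot (cofac (A y)) (H y)^?n <= \<bar>mdot (cofac (A y)) (M y)\<bar>^?n" by (intro power_mono)
  have "det (A y)^(?n - 1)*det (H y) <= (mdot (cofac (A y)) (H y)/?n)^?n"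
   using psd_mdot(2)[OF cofac_props(1)[OF A(1,2)] H] unfolding cofac_props(3)[OF A(1,2)] .
  also have "... <= mdot (cofac (A y)) (H y)^?n" using h0 divide_left_mono[OF _ h0, of 1 "real ?n"] by (intro power_mono) auto
  finally have "det (A y)^(?n - 1)*det (H y) <= \<bar>mdot (cofac (A y)) (M y)\<bar>^?n" using hn by simp
  moreover have "l^(?n - 1)*det (H y) <= det (A y)^(?n - 1)*det (H y)"
   using A(3) basics(3) psd_det_trace(1)[OF H] by (intro mult_right_mono power_mono) auto
  ultimately show "\<bar>det (H y)\<bar> <= F y" using psd_det_trace(1)[OF H] basics(3) by (simp add: F_def pos_le_divide_eq mult.commute)
 qed (use cB basics(3) in \<open>auto simp: F_def intro: fmeasurableD[OF lmeasurable_compact]\<close>)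
 also have "... = integral K (%x. \<bar>mdot (cofac (A x)) (M x)\<bar>^?n)/l^(?n - 1)" unfolding F_def[abs_def] by simp
 also have "... <= (2*G)/l^(?n - 1)" using vi basics(3) by (intro divide_right_mono) auto
 finally have mle: "vol P <= (2*G)/l^(?n - 1)" .
 have pw: "a^?n = a*a^(?n - 1)" for a :: real by (metis mult.commute power_minus_mult zero_less_card_finite)
 have "z x^?n*rho^(?n - 1) <= real ?n*\<bar>nu $ k\<bar>*(z x^?n*rho^(?n - 1))" using mult_right_mono[OF k, of "z x^?n*rho^(?n - 1)"] zx rho by simp
 also have "... = vol P*(4*real ?n * s x*(8*real ?n)^(?n - 1))"
 proof -
  have "\<bar>1/r*a\<bar>*(Z/(4*t))*(Z/(8*N))^m/\<bar>1/r*(1/r)^m\<bar>*(4*N*t*(8*N)^m) = N*\<bar>a\<bar>*(Z*Z^m*r^m)"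
   if "0 < r" "0 < t" "0 < N" for r t N Z a :: real and m using that by (simp add: abs_mult power_divide divide_simps)
  from this[OF rho sx, of "real ?n"] show ?thesis unfolding mP tE dE pw[of "z x"] pw[of "1/rho"] vector_scaleR_component real_scaleR_def by simp
 qed
 also have "... <= (2*G)/l^(?n - 1)*(4*real ?n * s x*(8*real ?n)^(?n - 1))" using mle sx by (intro mult_right_mono) auto
 also have "... = (8*real ?n)^?n/l^(?n - 1) * s x*G" unfolding pw[of "8*real ?n"] by simp
 finally show ?thesis using rho basics(3) unfolding z_def[symmetric] by (simp add: power_mult_distrib pos_le_divide_eq mult_ac)
qed

context boundary_point begin

text \<open>The barrier is \<open>c + k*w0\<close>, with \<open>w0\<close> the function
  \<open>v\<close> minus a polynomial of larger Hessian determinant. At \<open>t = sqrt r\<close>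
  the constant \<open>B*t^\<alpha>\<close> and the value of \<open>k*w0\<close> at \<open>x\<close>
  are both of order \<open>B*r^(\<alpha>/2)\<close>; the maximum principle adds a term of order
  \<open>(r*G)^(1/n)\<close>.\<close>

lemma boundary_upper:
 assumes u: "continuous_on (closure S) u" "approximable A S u G" "0 < G" "G <= (3*B)^CARD('n)" and B: "0 < B"
  and fr: "!!y. y \<in> frontier S ==> u y - u x1 <= B*norm (y - x1) powr \<alpha>" and \<alpha>: "0 < \<alpha>" "\<alpha> < 1"
  and x: "x \<in> S" "norm (x - x1) <= 1" "norm (x - x1) <= rho/2"
  and C6: "C6 = 1/rho + 4/rho^4 + 2*(L/rho^(CARD('n) - 1))/rho"
  and Ca: "Ca = (8*real CARD('n))^CARD('n)/(rho*l)^(CARD('n) - 1)"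
 shows "u x - u x1 <= (1 + 2*C6/rho + 3*(1 + Ca))*B*norm (x - x1) powr (\<alpha>/(2*CARD('n)))"
proof -
 let ?n = "CARD('n)"
 define r where "r = norm (x - x1)"
 define a where "a = \<alpha>/(2*?n)"
 have r: "0 < r" "r <= 1" "r <= rho/2" using x x1 basics(1) by (auto simp: r_def frontier_def interior_open)
 have sx: "0 < s x" "s x <= r" using s_bounds(2)[OF x(1)] s_bounds(3)[of x] by (auto simp: r_def)
 define N where "N = L/rho^(?n - 1)"
 define M where "M = 2*N/rho"
 have N: "0 < N" "0 < M" using basics(3,4) rho by (auto simp: N_def M_def)
 have C0: "0 < C6" "0 < Ca" using N rho basics(3) by (auto simp: C6 Ca M_def N_def intro!: add_pos_pos)
 define Q where "Q = (rho/2) *\<^sub>R mat 1 + N *\<^sub>R outer nu nu"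
 have Q: "psd Q" "L < det (2 *\<^sub>R Q)" "(y - x1) \<bullet> (Q *v (y - x1)) = rho/2*(norm (y - x1))^2 + N*(s y)^2" for y
  using barrier_matrix[of "rho/2" N] rho by (auto simp: N_def Q_def)
 define w0 where "w0 y = v y - (rho/2*(norm (y - x1))^2 + N*(s y)^2 - M * s y)" for y
 define t where "t = sqrt r"
 define k where "k = 2/rho*B*t powr (\<alpha> - 2)"
 have t: "0 < t" "t powr z = r powr (z/2)" for z using r by (auto simp: t_def powr_half_sqrt[symmetric] powr_powr)
 have k: "0 < k" using rho B r by (simp add: k_def t(2))
 define c where "c = u x1 + B*t powr \<alpha>"
 define w where "w y = ((c - k*(phi x1 - p \<bullet> x1 + M*(nu \<bullet> x1))) + (k *\<^sub>R (M *\<^sub>R nu - p)) \<bullet> y) + k*(phi y - (y - x1) \<bullet> (Q *v (y - x1)))" for y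
 have w: "w y = c + k*w0 y" for y unfolding w_def w0_def Q(3) v_def s_def by (simp add: inner_diff_left inner_diff_right algebra_simps)
 have cw: "continuous_on (closure S) w" unfolding w_def matrix_vector_mult_def by (intro continuous_intros cphi)
 have "c2_on S w (%y. k *\<^sub>R (M *\<^sub>R nu - p) + k *\<^sub>R (g y - 2 *\<^sub>R (Q *v (y - x1)))) (%y. 0 + k *\<^sub>R (A y - 2 *\<^sub>R Q))"
  unfolding w_def using Q(1) by (intro c2_on_add c2_on_affine c2_on_scale c2_on_diff c2_on_quadratic basics MA_D(4)[OF MA]) (simp add: psd_def)
 \<comment> \<open>By the arithmetic-geometric mean, \<open>det (2 Q) > L >= det A\<close> makes the
   operator applied to the polynomial at least \<open>n det A\<close>, its value at the
   potential.\<close>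
 moreover have "mdot (cofac (A y)) (0 + k *\<^sub>R (A y - 2 *\<^sub>R Q)) <= 0" if y: "y \<in> S" for y
 proof -
  note A = MA_D(9,8)[OF MA y] and cf = cofac_props[OF MA_D(9,8)[OF MA y]]
  have Q2: "psd (2 *\<^sub>R Q)" using Q(1) by (auto simp: psd_def transpose_scalar scaleR_matrix_vector_assoc[symmetric])
  have "det (A y)^?n = det (A y)^(?n - 1)*det (A y)" by (rule power_minus_mult[symmetric]) simp
  also have "... <= det (A y)^(?n - 1)*det (2 *\<^sub>R Q)" using MA_D(7)[OF MA y] Q(2) A(2) by (intro mult_left_mono) auto
  also have "... <= (mdot (cofac (A y)) (2 *\<^sub>R Q)/?n)^?n" using psd_mdot(2)[OF cf(1) Q2] unfolding cf(3) .
  finally have "det (A y) <= mdot (cofac (A y)) (2 *\<^sub>R Q)/?n" using psd_mdot(1)[OF cf(1) Q2] by (subst (asm) power_mono_iff) (use A(2) in auto)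
  hence "real ?n*det (A y) <= mdot (cofac (A y)) (2 *\<^sub>R Q)" by (simp add: pos_le_divide_eq mult.commute)
  hence "mdot (cofac (A y)) (A y - 2 *\<^sub>R Q) <= 0" unfolding mdot_diff cf(2) by simp
  thus ?thesis using k by (simp add: mdot_scale mult_le_0_iff)
 qed
 moreover have "u y <= w y" if y: "y \<in> frontier S" for y
 proof -
  let ?b = "norm (y - x1)"
  have yc: "y \<in> closure S" using y by (simp add: frontier_def)
  \<comment> \<open>The Hoelder modulus lies below a parabola: up to \<open>t\<close> the constant
    suffices, beyond \<open>t\<close> the quadratic term does.\<close>
  have "?b powr \<alpha> <= t powr \<alpha> + t powr (\<alpha> - 2)*?b^2"
  proof (cases "?b <= t")
   case True
   hence "?b powr \<alpha> <= t powr \<alpha>" using \<alpha> by (intro powr_mono2) auto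
   thus ?thesis by (simp add: add_increasing2)
  next
   case False
   have "?b powr \<alpha> = ?b powr (\<alpha> - 2)*?b powr 2" unfolding powr_add[symmetric] by simp
   also have "?b powr 2 = ?b^2" using False t by simp
   also have "?b powr (\<alpha> - 2)*?b^2 <= t powr (\<alpha> - 2)*?b^2" using False t \<alpha> by (intro mult_mono powr_mono2') auto
   finally show ?thesis by (simp add: add_increasing)
  qed
  from mult_left_mono[OF this, of B] have "u y <= c + B*t powr (\<alpha> - 2)*?b^2" using fr[OF y] B by (simp add: c_def algebra_simps)
  also have "B*t powr (\<alpha> - 2)*?b^2 = k*(rho/2*?b^2)" using rho by (simp add: k_def)
  also have "... <= k*w0 y"
  proof (intro mult_left_mono)
   have s0: "0 <= s y" "s y <= 2/rho" using s_bounds(1,3)[of y] yc norm_le[OF yc basics(7)] by auto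
   have "N*(s y)^2 <= M * s y" using mult_left_mono[OF mult_right_mono[OF s0(2,1)], of N] N by (simp add: M_def power2_eq_square mult_ac)
   thus "rho/2*?b^2 <= w0 y" using v_bounds(6)[OF y] by (simp add: w0_def)
  qed (use k in simp)
  finally show ?thesis by (simp add: w)
 qed
 ultimately have abp: "(u x - w x)^?n <= Ca * s x*G" if "w x < u x" unfolding Ca using that by (intro slab_maximum_principle[OF u(1-3) cw _ _ _ x(1)])
 have uw: "u x - w x <= (1 + Ca)*(3*B)*r powr (1/?n)"
 proof (cases "w x < u x")
  case True
  have "(u x - w x)^?n <= Ca*r*(3*B)^?n" using abp[OF True] sx C0 u(3,4) by (elim order_trans) (intro mult_mono, auto)
  also have "... <= (1 + Ca)^?n*r*(3*B)^?n"
  proof -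
   have "Ca <= (1 + Ca)^1" by simp
   also have "... <= (1 + Ca)^?n" using C0 by (intro power_increasing) auto
   finally show ?thesis using r B by (intro mult_right_mono) auto
  qed
  also have "... = ((1 + Ca)*(3*B)*r powr (1/?n))^?n" using r by (simp add: power_mult_distrib powr_realpow[symmetric] powr_powr)
  finally show ?thesis using True C0 B by (subst (asm) power_mono_iff) auto
 next
  case False
  thus ?thesis using C0 B by (simp add: add_nonneg_nonneg order_trans[of _ 0])
 qed
 have "0 <= rho/2*(norm (x - x1))^2 + N*(s x)^2" using N rho by simp
 hence "w0 x <= v x + M * s x" unfolding w0_def by linarith
 also have "... <= (r^2/rho + 4/rho^4 * s x) + M * s x" using linear_upper_bound[OF x(1)] sx r rho unfolding r_def by simp
 also have "... <= (r/rho + 4/rho^4*r) + M*r"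
  using sx r N rho mult_left_le[of r r] by (intro add_mono divide_right_mono mult_left_mono) (auto simp: power2_eq_square)
 also have "... = C6*r" by (simp add: C6 M_def N_def algebra_simps)
 finally have "k*w0 x <= k*(C6*r)" using k by simp
 also have "... = 2*C6/rho*B*r powr (\<alpha>/2)"
 proof -
  have "t powr (\<alpha> - 2)*r = r powr (\<alpha>/2)" unfolding t(2) using r powr_mult_base[of r "(\<alpha> - 2)/2"] by (simp add: diff_divide_distrib mult.commute)
  thus ?thesis by (simp add: k_def)
 qed
 finally have "u x - u x1 <= B*r powr (\<alpha>/2) + 2*C6/rho*B*r powr (\<alpha>/2) + (1 + Ca)*(3*B)*r powr (1/?n)"
  using uw unfolding w c_def t(2)[of \<alpha>] by linarith
 also have "... <= B*r powr a + 2*C6/rho*B*r powr a + (1 + Ca)*(3*B)*r powr a"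
 proof -
  have n: "1 <= real ?n" by simp
  have "\<alpha>/(2*real ?n) <= \<alpha>/2" using \<alpha> n by (intro divide_left_mono) auto
  hence "r powr (\<alpha>/2) <= r powr a" using r by (intro powr_mono') (auto simp: a_def)
  moreover have "r powr (1/?n) <= r powr a" using r \<alpha> by (intro powr_mono') (auto simp: a_def field_simps)
  ultimately show ?thesis using B C0 rho by (intro add_mono mult_left_mono) auto
 qed
 finally show ?thesis unfolding r_def a_def by (simp add: algebra_simps)
qed

lemma boundary_holder:
 assumes u: "continuous_on (closure S) u" "approximable A S u G" "0 < G" "G <= (3*B)^CARD('n)" and B: "0 < B"
  and uB: "!!y. y \<in> closure S ==> \<bar>u y\<bar> <= B"
  and fr: "!!y. y \<in> frontier S ==> \<bar>u y - u x1\<bar> <= B*norm (y - x1) powr \<alpha>" and \<alpha>: "0 < \<alpha>" "\<alpha> < 1"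
  and x: "x \<in> S" and C: "C = 1 + 2*(1/rho + 4/rho^4 + 2*(L/rho^(CARD('n) - 1))/rho)/rho
   + 3*(1 + (8*real CARD('n))^CARD('n)/(rho*l)^(CARD('n) - 1))"
 shows "\<bar>u x - u x1\<bar> <= (C + 2/min 1 (rho/2))*B*norm (x - x1) powr (\<alpha>/(2*CARD('n)))"
proof -
 define R where "R = min 1 (rho/2)"
 define a where "a = \<alpha>/(2*CARD('n))"
 have R: "0 < R" "R <= 1" "R <= rho/2" using rho by (auto simp: R_def)
 have "1 <= real CARD('n)" by simp
 hence "\<alpha> <= 2*real CARD('n)" using \<alpha> by linarith
 hence a: "0 < a" "a <= 1" using \<alpha> by (auto simp: a_def field_simps)
 have C0: "0 <= C" using basics(3,4) rho by (auto simp: C intro!: add_nonneg_nonneg divide_nonneg_nonneg)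
 show ?thesis
 proof (cases "norm (x - x1) <= R")
  case True
  have "u x - u x1 <= C*B*norm (x - x1) powr a"
   unfolding C a_def using fr True R by (intro boundary_upper[OF u B _ \<alpha> x]) (auto intro: order_trans[OF abs_ge_self])
  moreover have "- u x - - u x1 <= C*B*norm (x - x1) powr a"
  proof -
   have "- u y - - u x1 <= B*norm (y - x1) powr \<alpha>" if "y \<in> frontier S" for y using fr[OF that] by linarith
   thus ?thesis
    unfolding C a_def using True R u by (intro boundary_upper[OF _ approximable_uminus[OF u(2)] u(3,4) B _ \<alpha> x]) (auto intro: continuous_intros)
  qed
  moreover have "0 <= 2/R*B*norm (x - x1) powr a" using B R by simp
  ultimately show ?thesis unfolding R_def[symmetric] a_def[symmetric] by (simp add: distrib_right abs_le_iff)
 next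
  case False
  have "1 <= norm (x - x1) powr a/R powr a" using False R a by (simp add: pos_le_divide_eq powr_mono2)
  also have "... <= norm (x - x1) powr a/R" using R a powr_mono'[of a 1 R] by (intro divide_left_mono) auto
  finally have "2*B*1 <= 2*B*(norm (x - x1) powr a/R)" using B by (intro mult_left_mono) auto
  moreover have "\<bar>u x - u x1\<bar> <= 2*B" using uB[of x] uB[of x1] x basics(5,7) by auto
  moreover have "0 <= C*B*norm (x - x1) powr a" using B C0 by simp
  moreover have "(C + 2/R)*B*norm (x - x1) powr a = C*B*norm (x - x1) powr a + 2*B*(norm (x - x1) powr a/R)" by (simp add: algebra_simps)
  ultimately show ?thesis unfolding R_def[symmetric] a_def[symmetric] by linarith
 qed
qed

text \<open>Convexity along the ray through \<open>y\<close> gives a linear bound, because the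
  excess at distance \<open>d/2\<close> is controlled by the gradient bound.\<close>

lemma excess_upper:
 assumes x: "x \<in> S" "0 < d" "ball x d \<subseteq> S" and y: "norm (y - x) <= d/2"
 shows "y \<in> S" "excess phi g x y <= 16/rho^3*norm (y - x)/d"
proof -
 have b: "z \<in> S" if "norm (z - x) <= d/2" for z using x that by (auto simp: subset_iff dist_norm norm_minus_commute)
 show "y \<in> S" by (rule b[OF y])
 show "excess phi g x y <= 16/rho^3*norm (y - x)/d"
 proof (cases "y = x")
  case False
  define t where "t = 2*norm (y - x)/d"
  have t: "0 < t" "t <= 1" using False y x(2) by (auto simp: t_def)
  define z where "z = x + (1/t) *\<^sub>R (y - x)"
  have "norm (z - x) = d/2" using False x(2) by (simp add: z_def t_def)
  hence z: "z \<in> S" "norm (z - x) <= d" using b x(2) by auto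
  have "- ((g x - p) \<bullet> (z - x)) <= norm (g x - p)*norm (z - x)" using Cauchy_Schwarz_ineq2[of "g x - p" "z - x"] by linarith
  also have "... <= norm (g x - p)*d" using z by (intro mult_left_mono) auto
  finally have "- ((g x - p) \<bullet> (z - x)) <= 4/rho^3" using gradient_bound[OF x] by (simp add: mult.commute)
  moreover have "0 <= v x" "v z <= 4/rho^3" using v_bounds(1,2) x z basics(5) by auto
  moreover have "excess phi g x z = v z - v x - (g x - p) \<bullet> (z - x)" by (simp add: excess_def v_def inner_diff_right inner_diff_left)
  ultimately have "excess phi g x z <= 8/rho^3" by simp
  hence "t*excess phi g x z <= t*(8/rho^3)" using t by (intro mult_left_mono) auto
  moreover have "x + t *\<^sub>R (z - x) = y" using t by (simp add: z_def)
  hence "excess phi g x y <= t*excess phi g x z" using excess_segment[OF MA x(1) z(1), of t] t by simp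
  moreover have "t*(8/rho^3) = 16/rho^3*norm (y - x)/d" by (simp add: t_def)
  ultimately show ?thesis by linarith
 qed (use x(2) rho in \<open>simp add: excess_def\<close>)
qed

end

text \<open>Converts decay over geometric scales into a power: \<open>j\<close> is the integer part
  of the logarithm of \<open>X\<close> to base \<open>K\<close>, and rounding down costs the factor
  \<open>1/th\<close>.\<close>

lemma geometric_scale_exponent:
 fixes K th :: real
 assumes "1 < K" "0 < th" "th < 1"
 shows "EX ga>0. ALL X>=1. EX j::nat. K^j <= X & th^j <= X powr (- ga)/th"
proof (intro exI[of _ "- log K th"] conjI allI impI)
 show "0 < - log K th" using assms by simp
 fix X :: real assume X: "1 <= X"
 define j where "j = nat \<lfloor>log K X\<rfloor>"
 have "0 <= log K X" using assms X by simp
 hence j: "real j <= log K X" "log K X < real j + 1" by (auto simp: j_def)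
 have "K powr real j <= K powr log K X" using j assms by (intro powr_mono) auto
 hence 1: "K^j <= X" using assms X by (simp add: powr_realpow)
 have e: "X powr (log K th) = th powr (log K X)" using assms X by (simp add: powr_def log_def)
 have "th*th^j = th powr (real j + 1)" using assms by (simp add: powr_add powr_realpow)
 also have "... <= th powr (log K X)" using j assms by (intro powr_mono') auto
 finally have "th^j <= X powr (- (- log K th))/th" using assms e by (simp add: pos_le_divide_eq mult.commute)
 with 1 show "EX j::nat. K^j <= X & th^j <= X powr (- (- log K th))/th" by blast
qed

text \<open>The open ball reaching up to a nearest frontier point contains no frontier point, so
  connectedness keeps it in \<open>S\<close>.\<close>

lemma nearest_frontier_point:
 fixes S :: "(real^'n::finite) set"
 assumes S: "open S" "S \<subseteq> ball 0 R" "frontier S ~= {}" and x: "x \<in> S"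
 obtains z where "z \<in> frontier S" "0 < norm (x - z)" "ball x (norm (x - z)) \<subseteq> S" "norm (x - z) <= R"
proof -
 obtain z where z: "z \<in> frontier S" "infdist x (frontier S) = dist x z" using infdist_attains_inf[OF frontier_closed S(3)] by blast
 have b: "ball x (norm (x - z)) \<subseteq> S"
 proof (rule ccontr)
  assume "~ ?thesis"
  hence "ball x (norm (x - z)) \<inter> frontier S ~= {}" using x by (intro connected_Int_frontier) (auto simp: disjoint_iff intro!: exI[of _ x])
  then obtain y where y: "dist x y < norm (x - z)" "y \<in> frontier S" by auto
  thus False using infdist_le[OF y(2), of x] z(2) by (simp add: dist_norm)
 qed
 have p: "0 < norm (x - z)" using z(1) x S(1) by (auto simp: frontier_def interior_open)
 have "ball x (norm (x - z)) \<subseteq> ball 0 R" using b S(2) by blast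
 hence "norm x + norm (x - z) <= R" unfolding ball_subset_ball_iff using p by (auto simp: dist_norm)
 hence "norm (x - z) <= R" using norm_ge_zero[of x] by linarith
 thus thesis by (rule that[OF z(1) p b])
qed

lemma interior_estimate:
 fixes rho l L :: real
 assumes rho: "0 < rho" and l: "0 < l" "l <= L"
 shows "EX ga C. 0 < ga & 0 < C & (ALL (S :: (real^'n::finite) set) phi g A u B x y d.
  (ALL x1:frontier S. EX nu p. boundary_point rho l L S phi g A x1 nu p) & frontier S ~= {} & 0 < B &
  approximable A S u ((2*B)^CARD('n)) & (ALL y:closure S. \<bar>u y\<bar> <= B) &
  x \<in> S & y \<in> S & 0 < d & d <= 1/rho & ball x d \<subseteq> S & norm (y - x) <= d/2 -->
  \<bar>u x - u y\<bar> <= C*B*(norm (x - y)/d^(2*CARD('n) + 5)) powr ga)"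
proof -
 let ?n = "CARD('n)"
 obtain q where q0: "0 < q" and q: "ALL (S :: (real^'n::finite) set) phi g A x1 nu p x d.
  boundary_point rho l L S phi g A x1 nu p & x \<in> S & 0 < d & d <= 1/rho & ball x d \<subseteq> S -->
  q*d^(?n + 2) <= 1 & (q*d^(?n + 2))^2 <= excess phi g x x1" using excess_at_boundary[OF rho l, where 'n='n] by blast
 show ?thesis using interior_oscillation_decay[OF l, where 'n='n]
 proof (elim exE conjE, goal_cases)
  case (1 K th D)
  note K = 1(1-4) and I = 1(5)[rule_format]
 obtain ga where ga: "0 < ga" "ALL X>=1. EX j::nat. K^j <= X & th^j <= X powr (- ga)/th" using geometric_scale_exponent[OF K(1-3)] by blast
 define c where "c = q^2*rho^3/32"
 have c: "0 < c" using q0 rho by (simp add: c_def)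
 define C where "C = (2 + 3*D/th)*(1/c) powr ga"
 have C: "0 < C" using K c by (simp add: C_def add_pos_pos)
 have main: "\<bar>u x - u y\<bar> <= C*B*(norm (x - y)/d^(2*?n + 5)) powr ga"
  if bp: "!!x1. x1 \<in> frontier S ==> EX nu p. boundary_point rho l L S phi g A x1 nu p" and fr: "frontier S ~= {}" and B: "0 < B"
   and ap: "approximable A S u ((2*B)^?n)" and uB: "!!y. y \<in> closure S ==> \<bar>u y\<bar> <= B"
   and x: "x \<in> S" "y \<in> S" and d: "0 < d" "d <= 1/rho" "ball x d \<subseteq> S" and y: "norm (y - x) <= d/2"
  for S :: "(real^'n) set" and phi g A u B x y d
 proof (cases "x = y")
  case False
  obtain x1 nu p where b: "boundary_point rho l L S phi g A x1 nu p" using fr bp by blast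
  interpret boundary_point rho l L S phi g A x1 nu p by (rule b)
  define om where "om = q*d^(?n + 2)"
  \<comment> \<open>Half of the excess that \<open>excess_at_boundary\<close> guarantees at frontier
    points, so the section of height \<open>h\<close> is compact in \<open>S\<close>.\<close>
  define h where "h = om^2/2"
  have w: "0 < om" "om <= 1" using q[rule_format, of S phi g A x1 nu p x d] b x d q0 by (auto simp: om_def)
  have h: "0 < h" "h <= 1" using w power_le_one[of om 2] by (auto simp: h_def)
  have "csec S phi g x h = {y \<in> closure S. excess phi g x y <= h}"
  proof (intro equalityI subsetI)
   fix z assume z: "z \<in> {y \<in> closure S. excess phi g x y <= h}"
   have "z \<notin> frontier S"
   proof
    assume "z \<in> frontier S"
    then obtain nu p where "boundary_point rho l L S phi g A z nu p" using bp by blast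
    hence "om^2 <= excess phi g x z" using q[rule_format, of S phi g A z nu p x d] x d by (simp add: om_def)
    moreover have "h < om^2" using w by (simp add: h_def)
    ultimately show False using z by simp
   qed
   thus "z \<in> csec S phi g x h" using z basics(1) by (auto simp: csec_def frontier_def interior_open)
  qed (use basics(5) in \<open>auto simp: csec_def\<close>)
  moreover have "continuous_on (closure S) (excess phi g x)" unfolding excess_def by (intro continuous_intros cphi)
  ultimately have cK: "compact (csec S phi g x h)" using compact_sublevel[OF basics(6)] by simp
  have ms: "msec l L S phi g A x h" using MA x(1) h cK by (simp add: msec_def)
  have KS: "csec S phi g x h \<subseteq> S" by (auto simp: csec_def)
  have cA: "continuous_on (csec S phi g x h) A" by (rule continuous_on_subset[OF c2_onD(2)[OF MA_D(4)[OF MA]] KS])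
  have "continuous_on (csec S phi g x h) (%y. cofac (A y))" by (rule continuous_on_cofac[OF cA]) (use MA_D(8)[OF MA] KS in force)
  note ccf = this
  \<comment> \<open>Ratio of the height \<open>h\<close>, of order \<open>d^(2*n + 4)\<close>, to
    the excess bound at \<open>y\<close>, of order \<open>norm (x - y)/d\<close>; hence the exponent
    \<open>2*n + 5\<close>.\<close>
  define X where "X = c*d^(2*?n + 5)/norm (x - y)"
  have X: "0 < X" using c d False by (simp add: X_def)
  have Xg: "(norm (x - y)/d^(2*?n + 5)) powr ga*(1/c) powr ga = X powr (- ga)"
   using c d False by (simp add: X_def powr_minus_divide powr_divide powr_mult)
  have "\<bar>u x - u y\<bar> <= (2 + 3*D/th)*B*X powr (- ga)"
  proof (cases "1 <= X")
   case True
   then obtain j where j: "K^j <= X" "th^j <= X powr (- ga)/th" using ga(2) by blast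
   have Kj: "0 < K^j" using K by simp
   have "excess phi g x y <= 16/rho^3*norm (y - x)/d" by (rule excess_upper(2)[OF x(1) d(1,3) y])
   also have "... = h/X"
   proof -
    have "d^(2*?n + 5) = d*(d^(?n + 2))^2" unfolding power_mult[symmetric] power_Suc[symmetric] by (rule arg_cong[where f = "%k. d^k"]) simp
    thus ?thesis using d q0 rho False by (simp add: h_def om_def X_def c_def power_mult_distrib norm_minus_commute field_simps)
   qed
   also have "... <= h/K^j" using j(1) Kj h X by (intro divide_left_mono) auto
   finally have yK: "y \<in> csec S phi g x (h/K^j)" using x by (simp add: csec_def)
   have xK: "x \<in> csec S phi g x (h/K^j)" using x h Kj by (simp add: csec_def)
   have sub: "csec S phi g x (h/K^j) \<subseteq> csec S phi g x h"
    using K h by (intro csec_mono) (simp add: divide_le_eq mult_le_cancel_left1 one_le_power)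
   have "\<bar>u x - u y\<bar> <= D*(3*B)*th^j + eps" if eps: "0 < eps" for eps
   proof -
    \<comment> \<open>Keeps the approximation below \<open>3*B\<close> and its source below
      \<open>(3*B)^n\<close>; \<open>eps\<close> is removed afterwards.\<close>
    define e where "e = min (eps/2) (min B (B^?n))"
    have e: "0 < e" "e <= eps/2" "e <= B" "e <= B^?n" using eps B by (auto simp: e_def)
    obtain v' p' M where v': "c2_on UNIV v' p' M" "ALL y:csec S phi g x h. \<bar>v' y - u y\<bar> <= e"
     and vi: "integral (csec S phi g x h) (%x. \<bar>mdot (cofac (A x)) (M x)\<bar>^?n) <= (2*B)^?n + e"
     using ap[unfolded approximable_def, THEN spec, THEN spec, THEN mp, of "csec S phi g x h" e] cK KS e(1) by blast
    define F where "F y = \<bar>mdot (cofac (A y)) (M y)\<bar>" for y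
    have cF: "continuous_on (csec S phi g x h) F"
     unfolding F_def mdot_def using ccf continuous_on_subset[OF c2_onD(2)[OF v'(1)], of "csec S phi g x h"] by (intro continuous_intros) auto
    have "2^?n + 1 <= (3 :: real)^?n"
    proof -
     have "2^Suc m + 1 <= (3 :: real)^Suc m" for m
     proof (induction m)
      case (Suc m)
      moreover have "0 <= (3 :: real)^m" by simp
      ultimately show ?case unfolding power_Suc by linarith
     qed simp
     from this[of "?n - 1"] show ?thesis by simp
    qed
    hence "(2^?n + 1)*B^?n <= 3^?n*B^?n" using B by (intro mult_right_mono) auto
    hence "integral (csec S phi g x h) (%x. F x^?n) <= (3*B)^?n" using vi e(4) unfolding F_def by (simp add: power_mult_distrib distrib_right)
    moreover have "0 <= sqrt h^?n" "sqrt h^?n <= 1" using h by (auto intro!: power_le_one)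
    moreover have "0 <= (3*B)^?n" using B by simp
    ultimately have "sqrt h^?n*integral (csec S phi g x h) (%x. F x^?n) <= (3*B)^?n" by (meson mult_left_mono mult_left_le_one_le order_trans)
    moreover have "\<bar>v' z\<bar> <= 3*B" if "z \<in> csec S phi g x h" for z
     using bspec[OF v'(2) that] uB[of z] that KS basics(5) e(3) by fastforce
    ultimately have "\<bar>v' x - v' y\<bar> <= D*(3*B)*th^j"
     using ms B v'(1) cF xK yK by (intro I[of S phi g A x h "3*B" UNIV v' p' M F]) (auto simp: F_def)
    moreover have "\<bar>v' x - u x\<bar> <= e" "\<bar>v' y - u y\<bar> <= e" using v'(2) xK yK sub by auto
    ultimately show ?thesis using e(2) by linarith
   qed
   hence "\<bar>u x - u y\<bar> <= D*(3*B)*th^j" by (rule field_le_epsilon)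
   also have "... <= D*(3*B)*(X powr (- ga)/th)" using j(2) K B by (intro mult_left_mono) auto
   also have "... <= (2 + 3*D/th)*B*X powr (- ga)" using B by (simp add: algebra_simps)
   finally show ?thesis .
  next
   case False
   have "\<bar>u x - u y\<bar> <= 2*B" using uB[of x] uB[of y] x basics(5) by fastforce
   also have "... <= 2*B*X powr (- ga)" using False X ga(1) B powr_mono'[of "- ga" 0 X] by simp
   also have "... <= (2 + 3*D/th)*B*X powr (- ga)" using B K by (simp add: algebra_simps)
   finally show ?thesis .
  qed
  thus ?thesis unfolding Xg[symmetric] C_def by (simp add: mult_ac)
 qed simp
 show ?thesis
 proof (rule exI[of _ ga], rule exI[of _ C], intro conjI allI impI, goal_cases)
  case (3 S phi g A u B x y d)
  show ?case by (rule main[where phi = phi and g = g and A = A]) (use 3 in blast)+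
 qed (use ga C in auto)
 qed
qed

text \<open>The cases compare \<open>t = norm (x - y)\<close> with a power of the distance
  \<open>d\<close> to the frontier. If \<open>t <= d^(2*M)\<close>, the interior loss
  \<open>d^M\<close> costs only half of the exponent; otherwise \<open>d\<close> is bounded by a
  power of \<open>t\<close> and the nearest frontier point is close to both points.\<close>

lemma holder_estimate:
 fixes rho l L \<alpha> :: real
 assumes rho: "0 < rho" and l: "0 < l" "l <= L" and \<alpha>: "0 < \<alpha>" "\<alpha> < 1"
 shows "EX \<beta> C. 0 < \<beta> & 0 < C & (ALL (S :: (real^'n::finite) set) phi g A u B x y.
  (ALL x1:frontier S. EX nu p. boundary_point rho l L S phi g A x1 nu p) & frontier S ~= {} & 0 < B &
  continuous_on (closure S) u & approximable A S u ((2*B)^CARD('n)) & (ALL y:closure S. \<bar>u y\<bar> <= B) &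
  (ALL y:frontier S. ALL z:frontier S. \<bar>u y - u z\<bar> <= B*norm (y - z) powr \<alpha>) & x \<in> S & y \<in> S -->
  \<bar>u x - u y\<bar> <= C*B*norm (x - y) powr \<beta>)"
proof -
 let ?n = "CARD('n)"
 show ?thesis using interior_estimate[OF rho l, where 'n='n]
 proof (elim exE conjE, goal_cases)
  case (1 ga C1)
  note g = 1(1-2) and I = 1(3)
 define a where "a = \<alpha>/(2*?n)"
 define C where "C = 1 + 2*(1/rho + 4/rho^4 + 2*(L/rho^(?n - 1))/rho)/rho
   + 3*(1 + (8*real ?n)^?n/(rho*l)^(?n - 1))"
 define C2 where "C2 = C + 2/min 1 (rho/2)"
 define M where "M = 2*?n + 5"
 \<comment> \<open>\<open>ga/2\<close> comes from the interior case, \<open>a/(2*M)\<close> from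
   \<open>d <= 2*t^(1/(2*M))\<close> in the boundary case.\<close>
 define \<beta> where "\<beta> = min (ga/2) (a/(2*M))"
 have "1 <= real ?n" by simp
 hence "\<alpha> <= 2*real ?n" using \<alpha> by linarith
 hence a: "0 < a" "a <= 1" using \<alpha> by (auto simp: a_def field_simps)
 have M: "0 < M" by (simp add: M_def)
 have \<beta>: "0 < \<beta>" "\<beta> <= ga/2" "\<beta> <= a/(2*M)" using g a M by (auto simp: \<beta>_def)
 have "0 < C" using rho l by (auto simp: C_def intro!: add_pos_nonneg add_nonneg_nonneg divide_nonneg_nonneg)
 hence C2: "0 < C2" using rho by (auto simp: C2_def intro!: add_pos_pos)
 have main: "\<bar>u x - u y\<bar> <= (2 + C1 + 6*C2)*B*norm (x - y) powr \<beta>"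
  if bp: "ALL x1:frontier S. EX nu p. boundary_point rho l L S phi g A x1 nu p" and fr: "frontier S ~= {}" and B: "0 < B"
   and cu: "continuous_on (closure S) u" and ap: "approximable A S u ((2*B)^?n)" and uB: "ALL y:closure S. \<bar>u y\<bar> <= B"
   and uf: "ALL y:frontier S. ALL z:frontier S. \<bar>u y - u z\<bar> <= B*norm (y - z) powr \<alpha>" and x: "x \<in> S" "y \<in> S"
  for S :: "(real^'n) set" and phi g A u B x y
 proof -
  define t where "t = norm (x - y)"
  have le: "\<bar>u x - u y\<bar> <= (2 + C1 + 6*C2)*B*t powr \<beta>" if "\<bar>u x - u y\<bar> <= c*B*t powr \<beta>" "c <= 2 + C1 + 6*C2" for c
   by (rule order_trans[OF that(1)]) (use that(2) B in \<open>intro mult_right_mono, auto\<close>)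
  obtain x0 nu0 p0 where "boundary_point rho l L S phi g A x0 nu0 p0" using fr bp by blast
  then interpret b0: boundary_point rho l L S phi g A x0 nu0 p0 .
  obtain z where z: "z \<in> frontier S" "0 < norm (x - z)" "ball x (norm (x - z)) \<subseteq> S" "norm (x - z) <= 1/rho"
   using nearest_frontier_point[OF b0.basics(1) b0.S fr x(1)] by blast
  define d where "d = norm (x - z)"
  consider "t = 0" | "1 <= t" | "0 < t" "t <= 1" "t <= d/2" "t <= d^(2*M)" | "0 < t" "t <= 1" "d/2 < t | d^(2*M) < t"
   using norm_ge_zero[of "x - y", folded t_def] by (metis less_eq_real_def linorder_not_le)
  hence "\<bar>u x - u y\<bar> <= (2 + C1 + 6*C2)*B*t powr \<beta>"
  proof cases
   case 1
   thus ?thesis by (simp add: t_def)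
  next
   case 2
   have "\<bar>u x - u y\<bar> <= 2*B*1" using bspec[OF uB, of x] bspec[OF uB, of y] x b0.basics(5) by fastforce
   also have "... <= 2*B*t powr \<beta>" using 2 B \<beta>(1) by (intro mult_left_mono ge_one_powr_ge_zero) auto
   finally show ?thesis using g C2 by (intro le) auto
  next
   case 3
   have "sqrt t <= d^M" using 3 by (intro real_le_lsqrt) (auto simp: d_def power_mult[symmetric] mult.commute)
   hence "t/d^M <= t/sqrt t" using 3 z(2) by (intro divide_left_mono) (auto simp: d_def)
   also have "... = t powr (1/2)" using 3 by (simp add: powr_half_sqrt real_div_sqrt)
   finally have "(t/d^M) powr ga <= (t powr (1/2)) powr ga" using 3 g z(2) by (intro powr_mono2) (auto simp: d_def)
   also have "... <= t powr \<beta>" using 3 \<beta>(2) by (simp add: powr_powr powr_mono')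
   finally have "C1*B*(t/d^M) powr ga <= C1*B*t powr \<beta>" using g B by (intro mult_left_mono) auto
   moreover have "\<bar>u x - u y\<bar> <= C1*B*(t/d^M) powr ga" unfolding t_def M_def by (rule I[rule_format, of S phi g A B u x y d])
     (use bp fr B ap uB x z 3 in \<open>auto simp: d_def t_def norm_minus_commute\<close>)
   ultimately have "\<bar>u x - u y\<bar> <= C1*B*t powr \<beta>" by linarith
   thus ?thesis using g C2 by (intro le[of C1]) auto
  next
   case 4
   define eta where "eta = t powr (1/(2*M))"
   have teta: "t <= eta" using 4 M powr_mono'[of "1/(2*M)" 1 t] by (simp add: eta_def)
   have "d <= 2*eta" using 4(3)
   proof
    assume "d^(2*M) < t"
    hence "(d^(2*M)) powr (1/(2*M)) <= eta" unfolding eta_def by (intro powr_mono2) auto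
    moreover have "(d^(2*M)) powr (1/(2*M)) = d" using z(2) M by (simp add: d_def powr_powr flip: powr_realpow)
    ultimately show ?thesis using teta 4 by linarith
   qed (use teta in auto)
   moreover have "norm (y - z) <= t + d" using norm_triangle_ineq[of "y - x" "x - z"] by (simp add: d_def t_def norm_minus_commute)
   ultimately have dist: "norm (x - z) <= 3*eta" "norm (y - z) <= 3*eta" using teta 4(1) unfolding d_def by linarith+
   obtain nu p where "boundary_point rho l L S phi g A z nu p" using z(1) bp by blast
   then interpret boundary_point rho l L S phi g A z nu p .
   have near: "\<bar>u w - u z\<bar> <= 3*C2*B*t powr \<beta>" if w: "w \<in> S" "norm (w - z) <= 3*eta" for w
   proof -
    have "\<bar>u w - u z\<bar> <= C2*B*norm (w - z) powr a" unfolding C2_def a_def using uf uB z(1) B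
     by (intro boundary_holder[OF cu ap _ _ B _ _ \<alpha> w(1) C_def] power_mono) auto
    also have "... <= C2*B*(3*eta) powr a" using w a B C2 by (intro mult_left_mono powr_mono2) auto
    also have "(3*eta) powr a = 3 powr a*t powr (a/(2*M))" using 4 by (simp add: eta_def powr_mult powr_powr)
    also have "C2*B * ... <= C2*B*(3*t powr \<beta>)"
     using a B C2 4 \<beta>(3) powr_mono[of a 1 "3 :: real"] by (intro mult_left_mono mult_mono powr_mono') auto
    finally show ?thesis by simp
   qed
   have "\<bar>u x - u y\<bar> <= 6*C2*B*t powr \<beta>" using near[OF x(1) dist(1)] near[OF x(2) dist(2)] by linarith
   thus ?thesis using g C2 by (intro le[of "6*C2"]) auto
  qed
  thus ?thesis unfolding t_def .
 qed
 show ?thesis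
 proof (rule exI[of _ \<beta>], rule exI[of _ "2 + C1 + 6*C2"], intro conjI allI impI, goal_cases)
  case (3 S phi g A u B x y)
  show ?case by (rule main[where phi = phi and g = g and A = A and S = S]) (use 3 in blast)+
 qed (use \<beta> g C2 in auto)
 qed
qed

section \<open>Reduction of the stated hypotheses to the estimates\<close>

lemma has_derivative_pderiv_dir:
 fixes f :: "real^'n::finite => real"
 assumes "f differentiable (at x)"
 shows "(f has_derivative (%h. (\<chi> i. pderiv_dir i f x) \<bullet> h)) (at x)"
proof -
 let ?D = "frechet_derivative f (at x)"
 have d: "(f has_derivative ?D) (at x)" using assms by (simp add: frechet_derivative_works)
 then interpret linear ?D by (rule has_derivative_linear)
 have "?D h = (\<chi> i. pderiv_dir i f x) \<bullet> h" for h using arg_cong[OF basis_expansion[of h], of ?D, symmetric]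
  by (simp add: sum scale pderiv_dir_def inner_vec_def mult.commute scalar_mult_eq_scaleR)
 thus ?thesis by (intro has_derivative_eq_rhs[OF d] ext)
qed

lemma c2_on_hessian:
 fixes phi :: "real^'n::finite => real"
 assumes S: "open S" and phi: "Ck_on 2 S phi"
 shows "c2_on S phi (%x. \<chi> i. pderiv_dir i phi x) (hessian phi)"
proof -
 let ?g = "%x. \<chi> i. pderiv_dir i phi x"
 have D: "!!x. x \<in> S ==> phi differentiable (at x)" "!!x i. x \<in> S ==> pderiv_dir i phi differentiable (at x)"
  "!!i j. continuous_on S (pderiv_dir j (pderiv_dir i phi))" using phi by (auto simp: numeral_2_eq_2)
 \<comment> \<open>Entry \<open>i\<close>, \<open>j\<close> of \<open>hessian\<close> differentiates
   first in direction \<open>j\<close>, so the gradient has the transposed matrix as derivative;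
   symmetry then removes the difference.\<close>
 have dg: "(?g has_derivative (%h. transpose (hessian phi x) *v h)) (at x)" if "x \<in> S" for x unfolding has_derivative_componentwise_within[of ?g]
 proof
  fix b :: "real^'n" assume "b \<in> Basis"
  then obtain i where b: "b = axis i 1" by (auto simp: Basis_vec_def)
  have "(%x. ?g x \<bullet> b) = pderiv_dir i phi" by (simp add: b inner_axis)
  moreover have "(%h. (transpose (hessian phi x) *v h) \<bullet> b) = (%h. (\<chi> j. pderiv_dir j (pderiv_dir i phi) x) \<bullet> h)"
   by (rule ext) (unfold b inner_axis, simp add: matrix_vector_mult_def transpose_def hessian_def iter_pderiv_def inner_vec_def)
  ultimately show "((%x. ?g x \<bullet> b) has_derivative (%h. (transpose (hessian phi x) *v h) \<bullet> b)) (at x)"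
   using has_derivative_pderiv_dir[OF D(2)[OF that, of i]] by (simp only:)
 qed
 have cH: "continuous_on S (%x. transpose (hessian phi x))"
  unfolding transpose_def hessian_def iter_pderiv_def using D(3) by (simp, intro continuous_intros)
 have s: "transpose (hessian phi x) = hessian phi x" if "x \<in> S" for x
  using second_derivative_symmetric[OF S that has_derivative_pderiv_dir[OF D(1)] dg[OF that]] by simp
 show ?thesis unfolding c2_on_def using S D(1) has_derivative_pderiv_dir dg s continuous_on_eq[OF cH] by auto
qed

text \<open>A supporting hyperplane at \<open>y\<close> also supports the touching ball, which
  forces equality in the Cauchy-Schwarz inequality; its normal is therefore a positive multiple of
  \<open>z - y\<close>.\<close>

lemma interior_ball_normal:
 fixes S :: "(real^'n::finite) set"
 assumes S: "open S" "convex S" and z: "0 < rho" "ball z rho \<subseteq> S" "y \<in> sphere z rho" and y: "y \<notin> S" and x: "x \<in> S"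
 shows "0 <= ((1/rho) *\<^sub>R (z - y)) \<bullet> (x - y)"
proof -
 obtain a where a: "a ~= 0" "!!x. x \<in> S ==> a \<bullet> y <= a \<bullet> x" using separating_hyperplane_sets[of "{y}" S] S(2) x y by force
 have C: "cball z rho \<subseteq> {x. a \<bullet> y <= a \<bullet> x}"
  using closure_minimal[OF _ closed_halfspace_ge, of "ball z rho" "a \<bullet> y" a] a(2) z(1,2) by auto
 have "z - rho *\<^sub>R sgn a \<in> cball z rho" using z(1) a(1) by (simp add: dist_norm norm_sgn)
 from subsetD[OF C this] have "a \<bullet> y <= a \<bullet> z - rho*(a \<bullet> sgn a)" by (simp add: inner_diff_right)
 moreover have "a \<bullet> sgn a = norm a" using a(1) by (simp add: sgn_div_norm dot_square_norm power2_eq_square)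
 ultimately have "rho*norm a <= a \<bullet> (z - y)" by (simp add: inner_diff_right)
 moreover have "norm (z - y) = rho" using z(3) by (simp add: dist_norm)
 ultimately have "norm a*norm (z - y) = a \<bullet> (z - y)" using norm_cauchy_schwarz[of a "z - y"] by (simp add: mult.commute)
 hence "norm a *\<^sub>R (z - y) = norm (z - y) *\<^sub>R a" by (metis norm_cauchy_schwarz_eq)
 hence "z - y = (rho/norm a) *\<^sub>R a" using a(1) \<open>norm (z - y) = rho\<close>
  by (metis divide_inverse_commute eq_vector_fraction_iff norm_eq_zero scaleR_scaleR)
 hence "((1/rho) *\<^sub>R (z - y)) \<bullet> (x - y) = a \<bullet> (x - y)/norm a" using z(1) by simp
 also have "0 <= ..." using a(2)[OF x] by (simp add: inner_diff_right)
 finally show ?thesis .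
qed

text \<open>Continuity on an open set turns the almost everywhere bound into a pointwise one.
  Boundedness makes the essential supremum finite, so \<open>real_of_ereal\<close> does not return
  its default value 0.\<close>

lemma abs_le_Linf_norm:
 fixes S :: "(real^'n::finite) set"
 assumes S: "open S" and u: "continuous_on S u" "!!x. x \<in> S ==> \<bar>u x\<bar> <= b" and x: "x \<in> S"
 shows "\<bar>u x\<bar> <= Linf_norm S u"
proof -
 let ?m = "esssup (lebesgue_on S) (%x. ereal \<bar>u x\<bar>)"
 have SL: "S \<in> sets lebesgue" using S by auto
 have "u \<in> borel_measurable (lebesgue_on S)" by (rule continuous_imp_measurable_on_sets_lebesgue[OF u(1) SL])
 hence mu: "(%x. ereal \<bar>u x\<bar>) \<in> borel_measurable (lebesgue_on S)" by measurable
 have "?m <= ereal b" using u(2) by (intro esssup_I[OF mu] AE_I2) simp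
 moreover have le: "ereal \<bar>u x\<bar> <= ?m"
 proof (rule ccontr)
  assume "~ ?thesis"
  hence "?m < ereal \<bar>u x\<bar>" by simp
  from ereal_dense2[OF this] obtain r where r: "?m < ereal r" "r < \<bar>u x\<bar>" by auto
  let ?U = "S \<inter> (%x. \<bar>u x\<bar>) -` {r<..}"
  have U: "open ?U" by (intro continuous_open_preimage continuous_intros u S)
  have "AE y in lebesgue. y \<in> S --> ereal \<bar>u y\<bar> <= ?m"
   using esssup_AE[where M = "lebesgue_on S" and f = "%x. ereal \<bar>u x\<bar>"] SL by (subst (asm) AE_restrict_space_iff) auto
  hence "AE y in lebesgue. y \<notin> ?U"
  proof eventually_elim
   case (elim y)
   thus ?case using r(1) by (auto simp: not_less dest: order_le_less_trans)
  qed
  hence "?U \<in> null_sets lebesgue" using U by (subst AE_iff_null_sets) auto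
  hence "negligible ?U" by (simp add: negligible_iff_null_sets)
  thus False using open_not_negligible[OF U] x r by auto
 qed
 ultimately show ?thesis unfolding Linf_norm_def by (cases ?m) auto
qed

text \<open>Suprema of real sets are meaningful only for bounded nonempty sets:
  \<open>holder_on\<close> gives boundedness, and two distinct points of \<open>S\<close> give a
  difference quotient.\<close>

lemma holder_norm_bound:
 assumes h: "holder_on \<alpha> S g" and ne: "a \<in> S" "b \<in> S" "a ~= b"
 shows "0 <= holder_norm \<alpha> S g" "y \<in> S ==> z \<in> S ==> \<bar>g y - g z\<bar> <= holder_norm \<alpha> S g*dist y z powr \<alpha>"
proof -
 let ?P = "{(x, y). x \<in> S & y \<in> S & x ~= y}" and ?q = "%(x, y). \<bar>g x - g y\<bar>/dist x y powr \<alpha>"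
 obtain M where M: "!!x y. x \<in> S ==> y \<in> S ==> \<bar>g x - g y\<bar> <= M*dist x y powr \<alpha>" using h by (auto simp: holder_on_def)
 obtain c where c: "!!x. x \<in> S ==> \<bar>g x\<bar> <= c" using h by (auto simp: holder_on_def bounded_iff)
 have "bdd_above (?q ` ?P)" using M by (auto simp: bdd_above_def divide_le_eq intro!: exI[of _ M])
 hence q: "?q w <= (SUP w\<in>?P. ?q w)" if "w \<in> ?P" for w using that by (intro cSUP_upper)
 have "bdd_above ((%x. \<bar>g x\<bar>) ` S)" using c by (auto simp: bdd_above_def)
 hence s: "\<bar>g a\<bar> <= (SUP x\<in>S. \<bar>g x\<bar>)" using ne by (intro cSUP_upper)
 have q0: "0 <= ?q (a, b)" by simp
 show n0: "0 <= holder_norm \<alpha> S g" unfolding holder_norm_def using order_trans[OF q0 q] order_trans[OF abs_ge_zero s] ne by simp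
 show "\<bar>g y - g z\<bar> <= holder_norm \<alpha> S g*dist y z powr \<alpha>" if "y \<in> S" "z \<in> S"
 proof (cases "y = z")
  case False
  hence "\<bar>g y - g z\<bar>/dist y z powr \<alpha> <= holder_norm \<alpha> S g" unfolding holder_norm_def using q[of "(y, z)"] s that by auto
  thus ?thesis using False by (simp add: pos_divide_le_eq)
 qed simp
qed

theorem theorem4p2:
  fixes \<rho> l L \<alpha> :: real
  assumes "0 < \<rho>" and "0 < l" and "l \<le> L" and "0 < \<alpha>" and "\<alpha> < 1"
  shows "\<exists>\<beta> C :: real. 0 < \<beta> \<and> 0 < C \<and>
    (\<forall>(\<Omega> :: (real^'n::finite) set) \<phi> u f g.
       bounded_convex_domain \<Omega> \<and>
       domain_condition \<rho> \<Omega> \<and>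
       potential_condition l L \<Omega> \<phi> \<and>
       quadratic_separation \<rho> \<Omega> \<phi> \<and>
       Lp_space CARD('n) \<Omega> f \<and>
       holder_on \<alpha> (frontier \<Omega>) g \<and>
       continuous_on (closure \<Omega>) u \<and>
       sobolev_loc 2 CARD('n) \<Omega> u \<and>
       lma_solution \<Omega> \<phi> f u \<and>
       (\<forall>x\<in>frontier \<Omega>. u x = g x) \<longrightarrow>
       (\<forall>x\<in>\<Omega>. \<forall>y\<in>\<Omega>.
          \<bar>u x - u y\<bar> \<le> C * norm (x - y) powr \<beta> *
            (Linf_norm \<Omega> u + holder_norm \<alpha> (frontier \<Omega>) g + Lp_norm CARD('n) \<Omega> f)))"
proof -
 let ?n = "CARD('n)"
 show ?thesis using holder_estimate[OF assms, where 'n='n]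
 proof (elim exE conjE, goal_cases)
  case (1 \<beta> C)
  note \<beta> = 1(1-2) and est = 1(3)
 have main: "\<bar>u x - u y\<bar> <= C*norm (x - y) powr \<beta>*(Linf_norm \<Omega> u + holder_norm \<alpha> (frontier \<Omega>) g + Lp_norm ?n \<Omega> f)"
  if dom: "bounded_convex_domain \<Omega>" "domain_condition \<rho> \<Omega>" and pot: "potential_condition l L \<Omega> \<phi>"
   and quad: "quadratic_separation \<rho> \<Omega> \<phi>" and f: "Lp_space ?n \<Omega> f" and g: "holder_on \<alpha> (frontier \<Omega>) g"
   and u: "continuous_on (closure \<Omega>) u" "sobolev_loc 2 ?n \<Omega> u" "lma_solution \<Omega> \<phi> f u" "ALL x:frontier \<Omega>. u x = g x"
   and x: "x \<in> \<Omega>" "y \<in> \<Omega>"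
  for \<Omega> :: "(real^'n) set" and \<phi> u f g x y
 proof -
  have \<Omega>: "open \<Omega>" "convex \<Omega>" "bounded \<Omega>" "\<Omega> ~= {}" using dom(1) by (auto simp: bounded_convex_domain_def)
  have sub: "\<Omega> \<subseteq> closure \<Omega>" by (rule closure_subset)
  have out: "z \<notin> \<Omega>" if "z \<in> frontier \<Omega>" for z using that \<Omega>(1) by (simp add: frontier_def interior_open)
  have fr: "frontier \<Omega> ~= {}" using \<Omega>(3,4) not_bounded_UNIV by (auto simp: frontier_eq_empty)
  have c\<phi>: "continuous_on (closure \<Omega>) \<phi>" "convex_on (closure \<Omega>) \<phi>"
   using pot lipschitz_on_continuous_on by (auto simp: potential_condition_def)
  let ?G = "%x. \<chi> i. pderiv_dir i \<phi> x" and ?A = "hessian \<phi>"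
  have MA: "MA l L \<Omega> \<phi> ?G ?A"
   unfolding MA_def using \<Omega> c\<phi>(2) sub assms(2) pot c2_on_hessian[OF \<Omega>(1)] convex_on_subset[OF c\<phi>(2) sub]
   by (auto simp: potential_condition_def)
  have bp: "EX \<nu> p. boundary_point \<rho> l L \<Omega> \<phi> ?G ?A x1 \<nu> p" if x1: "x1 \<in> frontier \<Omega>" for x1
  proof -
   obtain z where z: "ball z \<rho> \<subseteq> \<Omega>" "x1 \<in> sphere z \<rho>" using dom(2) x1 unfolding domain_condition_def by blast
   obtain p where p: "boundary_gradient \<Omega> \<phi> x1 p" "ALL x:frontier \<Omega>.
     \<rho>*(norm (x - x1))^2 <= \<phi> x - \<phi> x1 - p \<bullet> (x - x1) & \<phi> x - \<phi> x1 - p \<bullet> (x - x1) <= inverse \<rho>*(norm (x - x1))^2"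
    using quad x1 unfolding quadratic_separation_def by blast
   have "boundary_point \<rho> l L \<Omega> \<phi> ?G ?A x1 ((1/\<rho>) *\<^sub>R (z - x1)) p"
   proof
    show "\<Omega> \<subseteq> ball 0 (1/\<rho>)" using dom(2) by (simp add: domain_condition_def)
    show "0 <= ((1/\<rho>) *\<^sub>R (z - x1)) \<bullet> (x - x1)" if "x \<in> \<Omega>" for x
     by (rule interior_ball_normal[OF \<Omega>(1,2) assms(1) z out[OF x1] that])
   qed (use assms z MA c\<phi> x1 p in \<open>auto simp: dist_norm\<close>)
   thus ?thesis by blast
  qed
  obtain x1 where x1: "x1 \<in> frontier \<Omega>" using fr by blast
  then obtain \<nu> p where "boundary_point \<rho> l L \<Omega> \<phi> ?G ?A x1 \<nu> p" using bp by blast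
  then interpret b: boundary_point \<rho> l L \<Omega> \<phi> ?G ?A x1 \<nu> p .
  \<comment> \<open>A second frontier point makes the set of difference quotients in
    \<open>holder_norm\<close> nonempty; it is found on the normal line at \<open>x1\<close>, which
    leaves the bounded domain.\<close>
  obtain x2 where x2: "x2 \<in> frontier \<Omega>" "x1 ~= x2"
  proof -
   have "x1 + \<rho> *\<^sub>R \<nu> \<in> \<Omega>" using b.nu(2) assms(1) by (auto simp: subset_iff)
   moreover have "x1 + (3/\<rho>) *\<^sub>R \<nu> \<notin> \<Omega>" using b.norm_le[of "x1 + (3/\<rho>) *\<^sub>R \<nu>" x1] b.basics(7) sub b.nu(1) assms(1) by (auto simp: divide_le_cancel)
   ultimately have "closed_segment (x1 + \<rho> *\<^sub>R \<nu>) (x1 + (3/\<rho>) *\<^sub>R \<nu>) \<inter> frontier \<Omega> ~= {}"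
    by (intro connected_Int_frontier) auto
   then obtain t where t: "0 <= t" "t <= 1" "(1 - t) *\<^sub>R (x1 + \<rho> *\<^sub>R \<nu>) + t *\<^sub>R (x1 + (3/\<rho>) *\<^sub>R \<nu>) \<in> frontier \<Omega>"
    by (auto simp: closed_segment_def)
   have e: "(1 - t) *\<^sub>R (x1 + \<rho> *\<^sub>R \<nu>) + t *\<^sub>R (x1 + (3/\<rho>) *\<^sub>R \<nu>) = x1 + ((1 - t)*\<rho> + t*(3/\<rho>)) *\<^sub>R \<nu>"
    by (simp add: algebra_simps)
   have "0 < (1 - t)*\<rho> + t*(3/\<rho>)"
    using t assms(1) by (cases "t = 0") (auto intro: add_nonneg_pos)
   thus thesis using t(3) b.nu(1) unfolding e by (intro that) auto
  qed
  let ?I = "Linf_norm \<Omega> u" and ?h = "holder_norm \<alpha> (frontier \<Omega>) g" and ?F = "Lp_norm ?n \<Omega> f"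
  note hol = holder_norm_bound[OF g x1 x2]
  obtain b where b: "!!x. x \<in> closure \<Omega> ==> \<bar>u x\<bar> <= b"
   using compact_imp_bounded[OF compact_continuous_image[OF u(1) b.basics(6)]] by (auto simp: bounded_iff)
  have I: "\<bar>u x\<bar> <= ?I" if "x \<in> \<Omega>" for x
   by (rule abs_le_Linf_norm[OF \<Omega>(1) continuous_on_subset[OF u(1) sub] b that]) (use sub in auto)
  have I0: "0 <= ?I" using I[OF x(1)] by linarith
  have LP: "0 <= (LINT x|lebesgue_on \<Omega>. \<bar>f x\<bar>^?n)" by simp
  hence F: "0 <= ?F" "?F^?n = (LINT x|lebesgue_on \<Omega>. \<bar>f x\<bar>^?n)" by (auto simp: Lp_norm_def)
  have ap: "approximable ?A \<Omega> u ((2*B)^?n)" if B: "?F <= B" for B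
   unfolding approximable_def
  proof (intro allI impI)
   fix K and e :: real assume K: "compact K & K \<subseteq> \<Omega> & 0 < e"
   obtain H where H: "!!i j. weak_deriv \<Omega> [i, j] u (%x. H x $ i $ j)"
    "AE x in lebesgue_on \<Omega>. mdot (cofac (?A x)) (H x) = f x"
    using u(3) unfolding lma_solution_def mdot_def cofac_def hessian_cofactor_def by blast
   have "continuous_on \<Omega> (%x. cofac (?A x))"
    by (rule continuous_on_cofac[OF c2_onD(2)[OF MA_D(4)[OF MA]]]) (use MA_D(8)[OF MA] in force)
   from strong_solution_approximation[OF \<Omega>(1) this continuous_on_subset[OF u(1) sub] H(1) u(2) H(2) f, of K e] K
   obtain v p M where v: "c2_on UNIV v p M" "ALL x:K. \<bar>v x - u x\<bar> <= e"
    "integral K (%x. \<bar>mdot (cofac (?A x)) (M x)\<bar>^?n) <= 2^?n*?F^?n + e" unfolding F(2) by blast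
   have "2^?n*?F^?n <= (2*B)^?n" unfolding power_mult_distrib using B F(1) by (intro mult_left_mono power_mono) auto
   with v(3) have "integral K (%x. \<bar>mdot (cofac (?A x)) (M x)\<bar>^?n) <= (2*B)^?n + e" by linarith
   with v(1,2) show "EX v p M. c2_on UNIV v p M & (ALL x:K. \<bar>v x - u x\<bar> <= e) &
     integral K (%x. \<bar>mdot (cofac (?A x)) (M x)\<bar>^?n) <= (2*B)^?n + e"
    by blast
  qed
  let ?t = "norm (x - y) powr \<beta>"
  have "\<bar>u x - u y\<bar> <= C*?t*(?I + ?h + ?F) + \<epsilon>" if \<epsilon>: "0 < \<epsilon>" for \<epsilon>
  proof -
   have Ct: "0 <= C*?t" using \<beta> by simp
   \<comment> \<open>The three norms may all vanish, while the estimate needs \<open>B > 0\<close>;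
     the surplus is scaled to contribute at most \<open>\<epsilon>\<close> after multiplication by
     \<open>C*?t\<close>.\<close>
   define B where "B = (?I + ?h + ?F) + \<epsilon>/(C*?t + 1)"
   have "0 < \<epsilon>/(C*?t + 1)" using \<epsilon> Ct by (intro divide_pos_pos add_nonneg_pos) auto
   hence B: "0 < B" "?I <= B" "?h <= B" "?F <= B" using I0 F(1) hol(1) unfolding B_def by linarith+
   have uB: "\<bar>u z\<bar> <= B" if "z \<in> closure \<Omega>" for z
   proof (rule continuous_le_on_closure[OF _ that])
    show "continuous_on (closure \<Omega>) (%z. \<bar>u z\<bar>)" by (intro continuous_intros u)
   qed (use I B(2) order_trans in blast)
   have "\<bar>u w - u z\<bar> <= B*norm (w - z) powr \<alpha>" if "w \<in> frontier \<Omega>" "z \<in> frontier \<Omega>" for w z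
    using hol(2)[OF that] mult_right_mono[OF B(3), of "dist w z powr \<alpha>"] u(4) that by (auto simp: dist_norm)
   hence "\<bar>u x - u y\<bar> <= C*B*?t"
    using est[rule_format, of \<Omega> \<phi> ?G ?A B u x y] bp fr B(1) u(1) ap[OF B(4)] uB x by blast
   also have "... = C*?t*(?I + ?h + ?F) + \<epsilon>*(C*?t/(C*?t + 1))" by (simp add: B_def algebra_simps)
   also have "... <= C*?t*(?I + ?h + ?F) + \<epsilon>*1" using \<epsilon> Ct by (intro add_left_mono mult_left_mono) auto
   finally show ?thesis by simp
  qed
  thus ?thesis by (rule field_le_epsilon)
 qed
 show ?thesis
 proof (rule exI[of _ \<beta>], rule exI[of _ C], intro conjI allI impI ballI, goal_cases)
  case (3 \<Omega> \<phi> u f g x y)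
  show ?case by (rule main[of \<Omega> \<phi>]) (use 3 in blast)+
 qed (use \<beta> in auto)
 qed
qed

end
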